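(* Let $k$ be a commutative ring of finite global dimension and let $G$ be a group of type $\Phi_k$. Then the Mazza–Symonds stable module category of $kG$ is equivalent to the proper stable module category $\mathrm{StMod}^{\mathrm{prop}}_{kG}$.
   Context: A group $G$ is of type $\Phi_k$ if for every $kG$-module $x$: $\mathrm{pd}_{kG}x<\infty$ if and only if $\mathrm{pd}_{kF}\,\mathrm{res}^G_Fx<\infty$ for all finite subgroups $F\leqslant G$. The Mazza–Symonds stable module category of $kG$ has as objects all $kG$-modules and as morphisms $x\to y$ the elements of the complete cohomology group $\widehat{\mathrm{Ext}}{}^0_{kG}(x,y)=\varinjlim_n\underline{\mathrm{Hom}}_{kG}(\Omega^nx,\Omega^ny)$, where $\underline{\mathrm{Hom}}_{kG}$ denotes homomorphisms modulo those factoring through a projective module and $\Omega$ is the syzygy (kernel of a surjection from a projective). For a class $\mathcal X$ of modules, $\mathcal X^\perp=\{y : \mathrm{Ext}^1(x,y)=0\ \forall x\in\mathcal X\}$ and ${}^\perp\mathcal X=\{x : \mathrm{Ext}^1(x,y)=0\ \forall y\in\mathcal X\}$. $B(G,k)$ is the $kG$-module of functions $f\colon G\to k$ taking only finitely many values, with $(gf)(x)=f(g^{-1}x)$. $\mathrm{Cof}(kG)$ is the class of $kG$-modules $x$ such that $B(G,k)\otimes_k x$ (diagonal action) is $kG$-projective. $\mathcal W_G$ is the class of $kG$-modules $x$ with $\mathrm{res}^G_F x\in\mathrm{Cof}(kF)^\perp$ for every finite subgroup $F\leqslant G$, and $\mathrm{PCof}(kG)={}^\perp\mathcal W_G$. The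 proper stable module category $\mathrm{StMod}^{\mathrm{prop}}_{kG}$ is the homotopy category of the abelian model structure on $\mathrm{Mod}(kG)$ with Hovey triple (cofibrant, trivial, fibrant objects) $(\mathrm{PCof}(kG),\mathcal W_G,\mathrm{Mod}(kG))$; equivalently, the stable category of the Frobenius exact category $\mathrm{PCof}(kG)$ (exact structure inherited from $\mathrm{Mod}(kG)$, projective-injective objects the projective $kG$-modules). *)

theory Defs
  imports "HOL-Algebra.Module" "HOL-Algebra.Elementary_Groups" "HOL-Library.Equipollence"
begin

section \<open>Categories and equivalences of categories\<close>

text \<open>Hom-sets are not required to be disjoint, so composition, identities and the action of a
  functor on morphisms carry the objects involved as arguments: \<open>Comp C x y z g f\<close> is the composite
  of \<open>f : x \<rightarrow> y\<close> and \<open>g : y \<rightarrow> z\<close>.\<close>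

record ('o, 'm) category_data =
  Ob :: "'o set"
  Hom :: "'o \<Rightarrow> 'o \<Rightarrow> 'm set"
  Comp :: "'o \<Rightarrow> 'o \<Rightarrow> 'o \<Rightarrow> 'm \<Rightarrow> 'm \<Rightarrow> 'm"
  Ident :: "'o \<Rightarrow> 'm"

locale category =
  fixes C :: "('o, 'm) category_data"
  assumes Ident_in_Hom: "x \<in> Ob C \<Longrightarrow> Ident C x \<in> Hom C x x"
    and Comp_in_Hom: "\<lbrakk>x \<in> Ob C; y \<in> Ob C; z \<in> Ob C; f \<in> Hom C x y; g \<in> Hom C y z\<rbrakk>
          \<Longrightarrow> Comp C x y z g f \<in> Hom C x z"
    and Comp_Ident: "\<lbrakk>x \<in> Ob C; y \<in> Ob C; f \<in> Hom C x y\<rbrakk> \<Longrightarrow> Comp C x x y f (Ident C x) = f"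
    and Ident_Comp: "\<lbrakk>x \<in> Ob C; y \<in> Ob C; f \<in> Hom C x y\<rbrakk> \<Longrightarrow> Comp C x y y (Ident C y) f = f"
    and Comp_assoc: "\<lbrakk>w \<in> Ob C; x \<in> Ob C; y \<in> Ob C; z \<in> Ob C;
          f \<in> Hom C w x; g \<in> Hom C x y; h \<in> Hom C y z\<rbrakk>
          \<Longrightarrow> Comp C w y z h (Comp C w x y g f) = Comp C w x z (Comp C x y z h g) f"

locale category_functor = source: category C + target: category D
  for C :: "('o1, 'm1) category_data" and D :: "('o2, 'm2) category_data" +
  fixes Fo :: "'o1 \<Rightarrow> 'o2" and Fm :: "'o1 \<Rightarrow> 'o1 \<Rightarrow> 'm1 \<Rightarrow> 'm2"
  assumes Fo_in_Ob: "x \<in> Ob C \<Longrightarrow> Fo x \<in> Ob D"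
    and Fm_in_Hom: "\<lbrakk>x \<in> Ob C; y \<in> Ob C; f \<in> Hom C x y\<rbrakk> \<Longrightarrow> Fm x y f \<in> Hom D (Fo x) (Fo y)"
    and Fm_Ident: "x \<in> Ob C \<Longrightarrow> Fm x x (Ident C x) = Ident D (Fo x)"
    and Fm_Comp: "\<lbrakk>x \<in> Ob C; y \<in> Ob C; z \<in> Ob C; f \<in> Hom C x y; g \<in> Hom C y z\<rbrakk>
          \<Longrightarrow> Fm x z (Comp C x y z g f) = Comp D (Fo x) (Fo y) (Fo z) (Fm y z g) (Fm x y f)"

definition isomorphism_in ::
  "('o, 'm) category_data \<Rightarrow> 'o \<Rightarrow> 'o \<Rightarrow> 'm \<Rightarrow> bool" where
  "isomorphism_in C x y f \<longleftrightarrow> f \<in> Hom C x y \<and>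
     (\<exists>g \<in> Hom C y x. Comp C x y x g f = Ident C x \<and> Comp C y x y f g = Ident C y)"

definition natural_isomorphism ::
  "('o1, 'm1) category_data \<Rightarrow> ('o2, 'm2) category_data \<Rightarrow>
   ('o1 \<Rightarrow> 'o2) \<Rightarrow> ('o1 \<Rightarrow> 'o1 \<Rightarrow> 'm1 \<Rightarrow> 'm2) \<Rightarrow>
   ('o1 \<Rightarrow> 'o2) \<Rightarrow> ('o1 \<Rightarrow> 'o1 \<Rightarrow> 'm1 \<Rightarrow> 'm2) \<Rightarrow> ('o1 \<Rightarrow> 'm2) \<Rightarrow> bool" where
  "natural_isomorphism C D Fo Fm Go Gm \<eta> \<longleftrightarrow>
     (\<forall>x \<in> Ob C. isomorphism_in D (Fo x) (Go x) (\<eta> x)) \<and>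
     (\<forall>x \<in> Ob C. \<forall>y \<in> Ob C. \<forall>f \<in> Hom C x y.
        Comp D (Fo x) (Fo y) (Go y) (\<eta> y) (Fm x y f) =
        Comp D (Fo x) (Go x) (Go y) (Gm x y f) (\<eta> x))"

definition equivalent_categories ::
  "('o1, 'm1) category_data \<Rightarrow> ('o2, 'm2) category_data \<Rightarrow> bool" where
  "equivalent_categories C D \<longleftrightarrow>
     (\<exists>Fo Fm Go Gm \<eta> \<epsilon>.
        category_functor C D Fo Fm \<and> category_functor D C Go Gm \<and>
        natural_isomorphism C C (\<lambda>x. x) (\<lambda>x y f. f)
          (\<lambda>x. Go (Fo x)) (\<lambda>x y f. Gm (Fo x) (Fo y) (Fm x y f)) \<eta> \<and>
        natural_isomorphism D D (\<lambda>x. Fo (Go x)) (\<lambda>x y f. Fm (Go x) (Go y) (Gm x y f))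
          (\<lambda>x. x) (\<lambda>x y f. f) \<epsilon>)"


section \<open>Modules over group rings\<close>

text \<open>A \<open>kG\<close>-module is a \<open>k\<close>-module together with an action of \<open>G\<close> by \<open>k\<close>-linear maps.
  A subgroup \<open>F\<close> of \<open>G\<close> is regarded as the group \<open>G\<lparr>carrier := F\<rparr>\<close>, so that restriction from \<open>kG\<close>
  to \<open>kF\<close> does not change the underlying record. (The ring multiplication and unit contained in the
  record of a library module are never used.)

  The category of all \<open>kG\<close>-modules is taken relative to a universe: it consists of the modules whose
  carrier is a subset of the type \<open>'u\<close>. Where \<open>'u\<close> occurs in a definition only through quantified
  modules, it is passed as a type argument.\<close>

record ('k, 'u, 'g) gmodule = "('k, 'u) module" +
  gact :: "'g \<Rightarrow> 'u \<Rightarrow> 'u"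

definition linear_maps :: "'k ring \<Rightarrow> ('k, 'u, 'a) module_scheme \<Rightarrow> ('k, 'v, 'b) module_scheme
    \<Rightarrow> ('u \<Rightarrow> 'v) set" where
  "linear_maps k x y = {f \<in> carrier x \<rightarrow>\<^sub>E carrier y.
     (\<forall>v \<in> carrier x. \<forall>w \<in> carrier x. f (v \<oplus>\<^bsub>x\<^esub> w) = f v \<oplus>\<^bsub>y\<^esub> f w) \<and>
     (\<forall>c \<in> carrier k. \<forall>v \<in> carrier x. f (c \<odot>\<^bsub>x\<^esub> v) = c \<odot>\<^bsub>y\<^esub> f v)}"

locale group_module = module k x + group G
  for k :: "'k ring" and G :: "'g monoid" and x :: "('k, 'u, 'g) gmodule" +
  assumes gact_linear: "g \<in> carrier G \<Longrightarrow> restrict (gact x g) (carrier x) \<in> linear_maps k x x"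
    and gact_one: "v \<in> carrier x \<Longrightarrow> gact x \<one>\<^bsub>G\<^esub> v = v"
    and gact_mult: "\<lbrakk>g \<in> carrier G; h \<in> carrier G; v \<in> carrier x\<rbrakk>
          \<Longrightarrow> gact x (g \<otimes>\<^bsub>G\<^esub> h) v = gact x g (gact x h v)"

definition gmaps :: "'k ring \<Rightarrow> 'g monoid \<Rightarrow> ('k, 'u, 'g) gmodule \<Rightarrow> ('k, 'v, 'g) gmodule
    \<Rightarrow> ('u \<Rightarrow> 'v) set" where
  "gmaps k G x y = {f \<in> linear_maps k x y.
     \<forall>g \<in> carrier G. \<forall>v \<in> carrier x. f (gact x g v) = gact y g (f v)}"

definition epis :: "'k ring \<Rightarrow> 'g monoid \<Rightarrow> ('k, 'u, 'g) gmodule \<Rightarrow> ('k, 'u, 'g) gmodule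
    \<Rightarrow> ('u \<Rightarrow> 'u) set" where
  "epis k G x y = {f \<in> gmaps k G x y. f ` carrier x = carrier y}"

definition ker_module :: "('k, 'u, 'g) gmodule \<Rightarrow> ('k, 'u, 'g) gmodule \<Rightarrow> ('u \<Rightarrow> 'u)
    \<Rightarrow> ('k, 'u, 'g) gmodule" where
  "ker_module x y f = x\<lparr>carrier := {v \<in> carrier x. f v = \<zero>\<^bsub>y\<^esub>}\<rparr>"

definition projective_module :: "'k ring \<Rightarrow> 'g monoid \<Rightarrow> ('k, 'u, 'g) gmodule \<Rightarrow> bool" where
  "projective_module k G p \<longleftrightarrow> group_module k G p \<and>
     (\<forall>(x :: ('k, 'u, 'g) gmodule) (y :: ('k, 'u, 'g) gmodule).
        group_module k G x \<longrightarrow> group_module k G y \<longrightarrow>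
        (\<forall>e \<in> epis k G x y. \<forall>f \<in> gmaps k G p y. \<exists>h \<in> gmaps k G p x.
           compose (carrier p) e h = f))"

inductive pd_le :: "'k ring \<Rightarrow> 'g monoid \<Rightarrow> nat \<Rightarrow> ('k, 'u, 'g) gmodule \<Rightarrow> bool"
  for k :: "'k ring" and G :: "'g monoid" where
  pd_le_0: "projective_module k G x \<Longrightarrow> pd_le k G 0 x"
| pd_le_Suc: "\<lbrakk>group_module k G x; projective_module k G p; e \<in> epis k G p x;
     pd_le k G n (ker_module p x e)\<rbrakk> \<Longrightarrow> pd_le k G (Suc n) x"

definition finite_pd :: "'k ring \<Rightarrow> 'g monoid \<Rightarrow> ('k, 'u, 'g) gmodule \<Rightarrow> bool" where
  "finite_pd k G x \<longleftrightarrow> (\<exists>n. pd_le k G n x)"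

text \<open>A \<open>k\<close>-module is the same as a module over the group ring of a one-element group.\<close>

definition finite_global_dimension :: "'u itself \<Rightarrow> 'k ring \<Rightarrow> bool" where
  "finite_global_dimension (_ :: 'u itself) k \<longleftrightarrow>
     (\<exists>n. \<forall>x :: ('k, 'u, unit) gmodule.
        group_module k (singleton_group ()) x \<longrightarrow> pd_le k (singleton_group ()) n x)"

definition type_Phi :: "'u itself \<Rightarrow> 'k ring \<Rightarrow> 'g monoid \<Rightarrow> bool" where
  "type_Phi (_ :: 'u itself) k G \<longleftrightarrow>
     (\<forall>x :: ('k, 'u, 'g) gmodule. group_module k G x \<longrightarrow>
        (finite_pd k G x \<longleftrightarrow>
         (\<forall>F. subgroup F G \<and> finite F \<longrightarrow> finite_pd k (G\<lparr>carrier := F\<rparr>) x)))"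


section \<open>Syzygies and Ext\<close>

definition proj_cover :: "'k ring \<Rightarrow> 'g monoid \<Rightarrow> ('k, 'u, 'g) gmodule
    \<Rightarrow> ('k, 'u, 'g) gmodule \<times> ('u \<Rightarrow> 'u)" where
  "proj_cover k G x = (SOME (p, e). projective_module k G p \<and> e \<in> epis k G p x)"

definition cover_mod :: "'k ring \<Rightarrow> 'g monoid \<Rightarrow> ('k, 'u, 'g) gmodule \<Rightarrow> ('k, 'u, 'g) gmodule" where
  "cover_mod k G x = fst (proj_cover k G x)"

definition cover_map :: "'k ring \<Rightarrow> 'g monoid \<Rightarrow> ('k, 'u, 'g) gmodule \<Rightarrow> 'u \<Rightarrow> 'u" where
  "cover_map k G x = snd (proj_cover k G x)"

definition syzygy :: "'k ring \<Rightarrow> 'g monoid \<Rightarrow> ('k, 'u, 'g) gmodule \<Rightarrow> ('k, 'u, 'g) gmodule" where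
  "syzygy k G x = ker_module (cover_mod k G x) x (cover_map k G x)"

abbreviation syzygies :: "'k ring \<Rightarrow> 'g monoid \<Rightarrow> nat \<Rightarrow> ('k, 'u, 'g) gmodule
    \<Rightarrow> ('k, 'u, 'g) gmodule" where
  "syzygies k G n \<equiv> (syzygy k G ^^ n)"

definition zero_map :: "('k, 'u, 'g) gmodule \<Rightarrow> ('k, 'u, 'g) gmodule \<Rightarrow> 'u \<Rightarrow> 'u" where
  "zero_map x y = (\<lambda>v \<in> carrier x. \<zero>\<^bsub>y\<^esub>)"

text \<open>The additive group of homomorphisms, in the multiplicative notation of \<^locale>\<open>group\<close>.\<close>

definition hom_group :: "'k ring \<Rightarrow> 'g monoid \<Rightarrow> ('k, 'u, 'g) gmodule \<Rightarrow> ('k, 'u, 'g) gmodule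
    \<Rightarrow> ('u \<Rightarrow> 'u) monoid" where
  "hom_group k G x y =
     \<lparr>carrier = gmaps k G x y,
      monoid.mult = (\<lambda>f g. \<lambda>v \<in> carrier x. f v \<oplus>\<^bsub>y\<^esub> g v),
      monoid.one = zero_map x y\<rparr>"

text \<open>Splicing the sequences \<open>0 \<rightarrow> \<Omega>\<^sup>n\<^sup>+\<^sup>1 x \<rightarrow> P\<^sub>n \<rightarrow> \<Omega>\<^sup>n x \<rightarrow> 0\<close> gives the projective resolution with
  terms \<open>res_mod k G x n\<close> whose differential from degree \<open>n + 1\<close> to degree \<open>n\<close> is the cover of
  \<open>\<Omega>\<^sup>n\<^sup>+\<^sup>1 x\<close>, a submodule of the term in degree \<open>n\<close>. Ext is the cohomology of the associated
  complex of homomorphisms.\<close>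

definition res_mod :: "'k ring \<Rightarrow> 'g monoid \<Rightarrow> ('k, 'u, 'g) gmodule \<Rightarrow> nat
    \<Rightarrow> ('k, 'u, 'g) gmodule" where
  "res_mod k G x n = cover_mod k G (syzygies k G n x)"

definition res_diff :: "'k ring \<Rightarrow> 'g monoid \<Rightarrow> ('k, 'u, 'g) gmodule \<Rightarrow> nat \<Rightarrow> 'u \<Rightarrow> 'u" where
  "res_diff k G x n = cover_map k G (syzygies k G (Suc n) x)"

definition Ext_cocycles :: "'k ring \<Rightarrow> 'g monoid \<Rightarrow> nat \<Rightarrow> ('k, 'u, 'g) gmodule
    \<Rightarrow> ('k, 'u, 'g) gmodule \<Rightarrow> ('u \<Rightarrow> 'u) set" where
  "Ext_cocycles k G n x y = {f \<in> gmaps k G (res_mod k G x n) y.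
     compose (carrier (res_mod k G x (Suc n))) f (res_diff k G x n) =
     zero_map (res_mod k G x (Suc n)) y}"

fun Ext_coboundaries :: "'k ring \<Rightarrow> 'g monoid \<Rightarrow> nat \<Rightarrow> ('k, 'u, 'g) gmodule
    \<Rightarrow> ('k, 'u, 'g) gmodule \<Rightarrow> ('u \<Rightarrow> 'u) set" where
  "Ext_coboundaries k G 0 x y = {zero_map (res_mod k G x 0) y}"
| "Ext_coboundaries k G (Suc n) x y =
     (\<lambda>f. compose (carrier (res_mod k G x (Suc n))) f (res_diff k G x n)) `
       gmaps k G (res_mod k G x n) y"

definition Ext :: "'k ring \<Rightarrow> 'g monoid \<Rightarrow> nat \<Rightarrow> ('k, 'u, 'g) gmodule
    \<Rightarrow> ('k, 'u, 'g) gmodule \<Rightarrow> ('u \<Rightarrow> 'u) set monoid" where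
  "Ext k G n x y =
     (hom_group k G (res_mod k G x n) y)\<lparr>carrier := Ext_cocycles k G n x y\<rparr>
       Mod Ext_coboundaries k G n x y"

definition right_perp :: "'k ring \<Rightarrow> 'g monoid \<Rightarrow> ('k, 'u, 'g) gmodule set
    \<Rightarrow> ('k, 'u, 'g) gmodule set" where
  "right_perp k G S = {y. group_module k G y \<and> (\<forall>x \<in> S. trivial_group (Ext k G 1 x y))}"

definition left_perp :: "'k ring \<Rightarrow> 'g monoid \<Rightarrow> ('k, 'u, 'g) gmodule set
    \<Rightarrow> ('k, 'u, 'g) gmodule set" where
  "left_perp k G S = {x. group_module k G x \<and> (\<forall>y \<in> S. trivial_group (Ext k G 1 x y))}"


section \<open>Benson cofibrant modules and the class PCof\<close>

definition bounded_functions :: "'k ring \<Rightarrow> 'g monoid \<Rightarrow> ('k, 'g \<Rightarrow> 'k, 'g) gmodule" where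
  "bounded_functions k G =
     \<lparr>carrier = {f \<in> carrier G \<rightarrow>\<^sub>E carrier k. finite (f ` carrier G)},
      monoid.mult = (\<lambda>f f'. \<lambda>a \<in> carrier G. f a \<otimes>\<^bsub>k\<^esub> f' a),
      monoid.one = (\<lambda>a \<in> carrier G. \<one>\<^bsub>k\<^esub>),
      zero = (\<lambda>a \<in> carrier G. \<zero>\<^bsub>k\<^esub>),
      add = (\<lambda>f f'. \<lambda>a \<in> carrier G. f a \<oplus>\<^bsub>k\<^esub> f' a),
      smult = (\<lambda>c f. \<lambda>a \<in> carrier G. c \<otimes>\<^bsub>k\<^esub> f a),
      gact = (\<lambda>g f. \<lambda>a \<in> carrier G. f (inv\<^bsub>G\<^esub> g \<otimes>\<^bsub>G\<^esub> a))\<rparr>"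

definition bilinear_map :: "'k ring \<Rightarrow> ('k, 'v, 'a) module_scheme \<Rightarrow> ('k, 'w, 'b) module_scheme
    \<Rightarrow> ('k, 'u, 'c) module_scheme \<Rightarrow> ('v \<Rightarrow> 'w \<Rightarrow> 'u) \<Rightarrow> bool" where
  "bilinear_map k x y z \<beta> \<longleftrightarrow>
     (\<forall>v \<in> carrier x. restrict (\<beta> v) (carrier y) \<in> linear_maps k y z) \<and>
     (\<forall>w \<in> carrier y. (\<lambda>v \<in> carrier x. \<beta> v w) \<in> linear_maps k x z)"

definition is_tensor_product :: "'k ring \<Rightarrow> ('k, 'v, 'a) module_scheme \<Rightarrow> ('k, 'w, 'b) module_scheme
    \<Rightarrow> ('k, 'u, 'c) module_scheme \<Rightarrow> ('v \<Rightarrow> 'w \<Rightarrow> 'u) \<Rightarrow> bool" where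
  "is_tensor_product k x y t \<tau> \<longleftrightarrow> module k t \<and> bilinear_map k x y t \<tau> \<and>
     (\<forall>(z :: ('k, 'u) module) \<beta>. module k z \<longrightarrow> bilinear_map k x y z \<beta> \<longrightarrow>
        (\<exists>!h. h \<in> linear_maps k t z \<and>
           (\<forall>v \<in> carrier x. \<forall>w \<in> carrier y. h (\<tau> v w) = \<beta> v w)))"

text \<open>The module \<open>t\<close> below is \<open>B(G,k) \<otimes> x\<close> with the diagonal action, realised inside the universe;
  it is determined up to isomorphism.\<close>

definition Cof :: "'k ring \<Rightarrow> 'g monoid \<Rightarrow> ('k, 'u, 'g) gmodule set" where
  "Cof k G = {x. group_module k G x \<and>
     (\<exists>(t :: ('k, 'u, 'g) gmodule) \<tau>. group_module k G t \<and>
        is_tensor_product k (bounded_functions k G) x t \<tau> \<and>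
        (\<forall>g \<in> carrier G. \<forall>b \<in> carrier (bounded_functions k G). \<forall>v \<in> carrier x.
           gact t g (\<tau> b v) = \<tau> (gact (bounded_functions k G) g b) (gact x g v)) \<and>
        projective_module k G t)}"

definition W_class :: "'k ring \<Rightarrow> 'g monoid \<Rightarrow> ('k, 'u, 'g) gmodule set" where
  "W_class k G = {x. group_module k G x \<and>
     (\<forall>F. subgroup F G \<and> finite F \<longrightarrow>
        x \<in> right_perp k (G\<lparr>carrier := F\<rparr>) (Cof k (G\<lparr>carrier := F\<rparr>)))}"

definition PCof :: "'k ring \<Rightarrow> 'g monoid \<Rightarrow> ('k, 'u, 'g) gmodule set" where
  "PCof k G = left_perp k G (W_class k G)"


section \<open>The two stable module categories\<close>

definition through_projective :: "'k ring \<Rightarrow> 'g monoid \<Rightarrow> ('k, 'u, 'g) gmodule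
    \<Rightarrow> ('k, 'u, 'g) gmodule \<Rightarrow> ('u \<Rightarrow> 'u) set" where
  "through_projective k G x y = {compose (carrier x) b a | (p :: ('k, 'u, 'g) gmodule) a b.
     projective_module k G p \<and> a \<in> gmaps k G x p \<and> b \<in> gmaps k G p y}"

definition stable_hom :: "'k ring \<Rightarrow> 'g monoid \<Rightarrow> ('k, 'u, 'g) gmodule \<Rightarrow> ('k, 'u, 'g) gmodule
    \<Rightarrow> ('u \<Rightarrow> 'u) set set" where
  "stable_hom k G x y = carrier (hom_group k G x y Mod through_projective k G x y)"

definition stable_class :: "'k ring \<Rightarrow> 'g monoid \<Rightarrow> ('k, 'u, 'g) gmodule \<Rightarrow> ('k, 'u, 'g) gmodule
    \<Rightarrow> ('u \<Rightarrow> 'u) \<Rightarrow> ('u \<Rightarrow> 'u) set" where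
  "stable_class k G x y f = through_projective k G x y #>\<^bsub>hom_group k G x y\<^esub> f"

text \<open>In the following definitions the union is over a family of equal classes: it expresses that
  the operation is computed on arbitrary representatives.\<close>

definition stable_comp :: "'k ring \<Rightarrow> 'g monoid \<Rightarrow> ('k, 'u, 'g) gmodule \<Rightarrow> ('k, 'u, 'g) gmodule
    \<Rightarrow> ('k, 'u, 'g) gmodule \<Rightarrow> ('u \<Rightarrow> 'u) set \<Rightarrow> ('u \<Rightarrow> 'u) set \<Rightarrow> ('u \<Rightarrow> 'u) set" where
  "stable_comp k G x y z \<psi> \<phi> =
     (\<Union>g \<in> \<psi>. \<Union>f \<in> \<phi>. stable_class k G x z (compose (carrier x) g f))"

definition stable_id :: "'k ring \<Rightarrow> 'g monoid \<Rightarrow> ('k, 'u, 'g) gmodule \<Rightarrow> ('u \<Rightarrow> 'u) set" where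
  "stable_id k G x = stable_class k G x x (\<lambda>v \<in> carrier x. v)"

text \<open>\<open>\<Omega>\<close> on stable maps: lift a representative to the projective covers and restrict to the kernels.\<close>

definition syzygy_map :: "'k ring \<Rightarrow> 'g monoid \<Rightarrow> ('k, 'u, 'g) gmodule \<Rightarrow> ('k, 'u, 'g) gmodule
    \<Rightarrow> ('u \<Rightarrow> 'u) set \<Rightarrow> ('u \<Rightarrow> 'u) set" where
  "syzygy_map k G x y \<phi> =
     \<Union> {stable_class k G (syzygy k G x) (syzygy k G y) (restrict h (carrier (syzygy k G x))) | f h.
          f \<in> \<phi> \<and> h \<in> gmaps k G (cover_mod k G x) (cover_mod k G y) \<and>
          compose (carrier (cover_mod k G x)) (cover_map k G y) h =
          compose (carrier (cover_mod k G x)) f (cover_map k G x)}"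

text \<open>The transition map from degree \<open>n\<close> to degree \<open>n + j\<close> of the direct system of the groups
  \<open>stable_hom k G (\<Omega>\<^sup>n x) (\<Omega>\<^sup>n y)\<close>.\<close>

fun syzygy_shift :: "'k ring \<Rightarrow> 'g monoid \<Rightarrow> ('k, 'u, 'g) gmodule \<Rightarrow> ('k, 'u, 'g) gmodule
    \<Rightarrow> nat \<Rightarrow> nat \<Rightarrow> ('u \<Rightarrow> 'u) set \<Rightarrow> ('u \<Rightarrow> 'u) set" where
  "syzygy_shift k G x y n 0 \<phi> = \<phi>"
| "syzygy_shift k G x y n (Suc j) \<phi> =
     syzygy_map k G (syzygies k G (n + j) x) (syzygies k G (n + j) y) (syzygy_shift k G x y n j \<phi>)"

definition complete_cochains :: "'k ring \<Rightarrow> 'g monoid \<Rightarrow> ('k, 'u, 'g) gmodule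
    \<Rightarrow> ('k, 'u, 'g) gmodule \<Rightarrow> (nat \<times> ('u \<Rightarrow> 'u) set) set" where
  "complete_cochains k G x y =
     (SIGMA n : UNIV. stable_hom k G (syzygies k G n x) (syzygies k G n y))"

definition complete_rel :: "'k ring \<Rightarrow> 'g monoid \<Rightarrow> ('k, 'u, 'g) gmodule \<Rightarrow> ('k, 'u, 'g) gmodule
    \<Rightarrow> (nat \<times> ('u \<Rightarrow> 'u) set) rel" where
  "complete_rel k G x y = {((n, \<phi>), (m, \<psi>)) | n \<phi> m \<psi>.
     (n, \<phi>) \<in> complete_cochains k G x y \<and> (m, \<psi>) \<in> complete_cochains k G x y \<and>
     (\<exists>i j. n + i = m + j \<and> syzygy_shift k G x y n i \<phi> = syzygy_shift k G x y m j \<psi>)}"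

text \<open>The direct limit, that is, complete cohomology in degree zero.\<close>

definition complete_Ext0 :: "'k ring \<Rightarrow> 'g monoid \<Rightarrow> ('k, 'u, 'g) gmodule \<Rightarrow> ('k, 'u, 'g) gmodule
    \<Rightarrow> (nat \<times> ('u \<Rightarrow> 'u) set) set set" where
  "complete_Ext0 k G x y = complete_cochains k G x y // complete_rel k G x y"

text \<open>Two elements of a direct limit over \<open>nat\<close> have representatives in a common degree.\<close>

definition complete_comp :: "'k ring \<Rightarrow> 'g monoid \<Rightarrow> ('k, 'u, 'g) gmodule \<Rightarrow> ('k, 'u, 'g) gmodule
    \<Rightarrow> ('k, 'u, 'g) gmodule \<Rightarrow> (nat \<times> ('u \<Rightarrow> 'u) set) set \<Rightarrow> (nat \<times> ('u \<Rightarrow> 'u) set) set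
    \<Rightarrow> (nat \<times> ('u \<Rightarrow> 'u) set) set" where
  "complete_comp k G x y z b a =
     \<Union> {complete_rel k G x z ``
          {(n, stable_comp k G (syzygies k G n x) (syzygies k G n y) (syzygies k G n z) \<psi> \<phi>)} |
          n \<phi> \<psi>. (n, \<phi>) \<in> a \<and> (n, \<psi>) \<in> b}"

definition Mazza_Symonds_StMod :: "'k ring \<Rightarrow> 'g monoid \<Rightarrow>
    (('k, 'u, 'g) gmodule, (nat \<times> ('u \<Rightarrow> 'u) set) set) category_data" where
  "Mazza_Symonds_StMod k G =
     \<lparr>Ob = {x. group_module k G x},
      Hom = complete_Ext0 k G,
      Comp = complete_comp k G,
      Ident = (\<lambda>x. complete_rel k G x x `` {(0, stable_id k G x)})\<rparr>"

text \<open>The proper stable module category, as the stable category of the Frobenius exact category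
  \<open>PCof\<close>, in which the projective-injective objects are the projective modules.\<close>

definition proper_StMod :: "'k ring \<Rightarrow> 'g monoid \<Rightarrow>
    (('k, 'u, 'g) gmodule, ('u \<Rightarrow> 'u) set) category_data" where
  "proper_StMod k G =
     \<lparr>Ob = PCof k G,
      Hom = stable_hom k G,
      Comp = stable_comp k G,
      Ident = stable_id k G\<rparr>"


section \<open>Size of the universe\<close>

text \<open>The conditions ensure that the modules with carrier in \<open>'u\<close> are closed under the
  constructions above: free modules on the elements of a module, subquotients, and
  \<open>B(G,k) \<otimes> x\<close>. For all \<open>k\<close> and \<open>G\<close> and every type \<open>'a\<close>, there is such a type \<open>'u\<close> that moreover
  contains a copy of \<open>'a\<close>; so modules of arbitrary size are covered.\<close>

definition admissible_universe :: "'u itself \<Rightarrow> 'k ring \<Rightarrow> 'g monoid \<Rightarrow> bool" where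
  "admissible_universe (_ :: 'u itself) k G \<longleftrightarrow>
     infinite (UNIV :: 'u set) \<and>
     carrier k \<lesssim> (UNIV :: 'u set) \<and>
     Pow (carrier G) \<lesssim> (UNIV :: 'u set)"

end

theory Submission
  imports Defs "HOL-Algebra.Free_Abelian_Groups"
begin

text \<open>Let \<open>B x\<close> be the module of functions \<open>G \<rightarrow> x\<close> with finitely many values. Call \<open>x\<close> cofibrant if the
  embedding of \<open>x\<close> into \<open>B x\<close> by constant functions factors through a projective module; this property
  passes to syzygies. On a free module with basis \<open>X\<close>, evaluation \<open>b \<mapsto> ((a, v) \<mapsto> b a (a, v))\<close> retracts
  \<open>B P\<close> onto \<open>P\<close>, so maps from \<open>\<Omega>x\<close> to a projective module extend to the projective cover of a
  cofibrant \<open>x\<close>, and dimension shifting gives \<open>Ext\<^sup>1(x, y) = 0\<close> whenever \<open>y\<close> has finite projective dimension.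

  Over a finite subgroup \<open>F\<close>, the module \<open>B x\<close> is a retract of a module coinduced from \<open>k\<close>, hence has
  finite projective dimension because \<open>k\<close> has finite global dimension; by type \<open>\<Phi>\<close> it then has
  finite projective dimension over \<open>G\<close>. Likewise \<open>\<W>\<^sub>G\<close> consists of the modules of finite projective dimension, and lifting
  the constant map along a projective cover of \<open>B x\<close> shows that \<open>PCof\<close> is the class of cofibrant modules.

  On stable maps out of a cofibrant module \<open>\<Omega>\<close> is bijective, which makes the inclusion of \<open>PCof\<close> fully
  faithful. If \<open>B x\<close> has projective dimension at most \<open>n\<close>, then \<open>\<Omega>\<^sup>n x\<close> is cofibrant. Embedding cofibrant
  modules into projective ones \<open>n\<close> times produces a cofibrant \<open>y\<close> with \<open>\<Omega>\<^sup>n y\<close> stably isomorphic to \<open>\<Omega>\<^sup>n x\<close>,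
  and such a \<open>y\<close> is isomorphic to \<open>x\<close> in the Mazza-Symonds category.\<close>

text \<open>Finitely many values are essential for the retraction of \<open>B P\<close> onto a free
  module \<open>P\<close>: for infinite \<open>G\<close>, the evaluation of an arbitrary function
  from \<open>G\<close> to \<open>P\<close> can have infinite support. Cofibrancy asks for less than
  projectivity of \<open>B x\<close>: each use of it comes down to extending or lifting one map, and
  no tensor product has to be formed over infinite \<open>G\<close>. \<open>Cof\<close> enters
  \<open>PCof\<close> only through \<open>W_class\<close>, that is, over finite subgroups. There
  every k-projective module lies in \<open>Cof\<close> and members of \<open>Cof\<close> are
  cofibrant, and these two facts determine the orthogonal class. Type Phi acts twice: it bounds the
  projective dimension of \<open>B x\<close>, and it identifies \<open>W_class\<close> over
  \<open>G\<close>. In both cases the bound over a finite subgroup comes from one observation: a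
  high syzygy is k-projective, so \<open>B\<close> of it is projective, and up to maps through
  projectives the syzygy is a retract of that. Projective dimension and stable Hom sets quantify
  over one universe of modules. Modules of functions or pairs have to be coded back into it, which
  accounts for \<open>push\<close>, \<open>benc\<close> and the cardinality lemmas.\<close>

section \<open>Group modules and equivariant maps\<close>

lemma
  assumes "group_module k G x"
  shows group_module_group: "group G" and group_module_abelian: "abelian_group x" and group_module_module: "module k x"
proof -
  interpret group_module k G x by fact
  show "group G" "abelian_group x" "module k x"
    by unfold_locales
qed

lemma
  assumes "group_module k G x" and "g \<in> carrier G" "v \<in> carrier x"
  shows gact_closed: "gact x g v \<in> carrier x"
    and gact_add: "w \<in> carrier x \<Longrightarrow> gact x g (v \<oplus>\<^bsub>x\<^esub> w) = gact x g v \<oplus>\<^bsub>x\<^esub> gact x g w"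
    and gact_smult: "c \<in> carrier k \<Longrightarrow> gact x g (c \<odot>\<^bsub>x\<^esub> v) = c \<odot>\<^bsub>x\<^esub> gact x g v"
proof -
  interpret group_module k G x by fact
  have 1: "restrict (gact x g) (carrier x) \<in> linear_maps k x x"
    using assms(2) by (rule gact_linear)
  show "gact x g v \<in> carrier x"
    using 1 assms(3) by (auto simp: linear_maps_def PiE_iff)
  show "gact x g (v \<oplus>\<^bsub>x\<^esub> w) = gact x g v \<oplus>\<^bsub>x\<^esub> gact x g w" if "w \<in> carrier x"
    using 1 assms(3) that by (auto simp: linear_maps_def)
  show "gact x g (c \<odot>\<^bsub>x\<^esub> v) = c \<odot>\<^bsub>x\<^esub> gact x g v" if "c \<in> carrier k"
    using 1 assms(3) that by (auto simp: linear_maps_def)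
qed

lemma group_moduleI:
  assumes "cring k" "group G"
    and "\<And>v w. \<lbrakk>v \<in> carrier x; w \<in> carrier x\<rbrakk> \<Longrightarrow> v \<oplus>\<^bsub>x\<^esub> w \<in> carrier x"
    and "\<zero>\<^bsub>x\<^esub> \<in> carrier x"
    and "\<And>u v w. \<lbrakk>u \<in> carrier x; v \<in> carrier x; w \<in> carrier x\<rbrakk>
           \<Longrightarrow> (u \<oplus>\<^bsub>x\<^esub> v) \<oplus>\<^bsub>x\<^esub> w = u \<oplus>\<^bsub>x\<^esub> (v \<oplus>\<^bsub>x\<^esub> w)"
    and "\<And>v w. \<lbrakk>v \<in> carrier x; w \<in> carrier x\<rbrakk> \<Longrightarrow> v \<oplus>\<^bsub>x\<^esub> w = w \<oplus>\<^bsub>x\<^esub> v"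
    and "\<And>v. v \<in> carrier x \<Longrightarrow> \<zero>\<^bsub>x\<^esub> \<oplus>\<^bsub>x\<^esub> v = v"
    and "\<And>v. v \<in> carrier x \<Longrightarrow> \<exists>w \<in> carrier x. w \<oplus>\<^bsub>x\<^esub> v = \<zero>\<^bsub>x\<^esub>"
    and "\<And>a v. \<lbrakk>a \<in> carrier k; v \<in> carrier x\<rbrakk> \<Longrightarrow> a \<odot>\<^bsub>x\<^esub> v \<in> carrier x"
    and "\<And>a b v. \<lbrakk>a \<in> carrier k; b \<in> carrier k; v \<in> carrier x\<rbrakk>
           \<Longrightarrow> (a \<oplus>\<^bsub>k\<^esub> b) \<odot>\<^bsub>x\<^esub> v = a \<odot>\<^bsub>x\<^esub> v \<oplus>\<^bsub>x\<^esub> b \<odot>\<^bsub>x\<^esub> v"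
    and "\<And>a v w. \<lbrakk>a \<in> carrier k; v \<in> carrier x; w \<in> carrier x\<rbrakk>
           \<Longrightarrow> a \<odot>\<^bsub>x\<^esub> (v \<oplus>\<^bsub>x\<^esub> w) = a \<odot>\<^bsub>x\<^esub> v \<oplus>\<^bsub>x\<^esub> a \<odot>\<^bsub>x\<^esub> w"
    and "\<And>a b v. \<lbrakk>a \<in> carrier k; b \<in> carrier k; v \<in> carrier x\<rbrakk>
           \<Longrightarrow> (a \<otimes>\<^bsub>k\<^esub> b) \<odot>\<^bsub>x\<^esub> v = a \<odot>\<^bsub>x\<^esub> (b \<odot>\<^bsub>x\<^esub> v)"
    and "\<And>v. v \<in> carrier x \<Longrightarrow> \<one>\<^bsub>k\<^esub> \<odot>\<^bsub>x\<^esub> v = v"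
    and "\<And>g v. \<lbrakk>g \<in> carrier G; v \<in> carrier x\<rbrakk> \<Longrightarrow> gact x g v \<in> carrier x"
    and "\<And>g v w. \<lbrakk>g \<in> carrier G; v \<in> carrier x; w \<in> carrier x\<rbrakk>
           \<Longrightarrow> gact x g (v \<oplus>\<^bsub>x\<^esub> w) = gact x g v \<oplus>\<^bsub>x\<^esub> gact x g w"
    and "\<And>g c v. \<lbrakk>g \<in> carrier G; c \<in> carrier k; v \<in> carrier x\<rbrakk>
           \<Longrightarrow> gact x g (c \<odot>\<^bsub>x\<^esub> v) = c \<odot>\<^bsub>x\<^esub> gact x g v"
    and "\<And>v. v \<in> carrier x \<Longrightarrow> gact x \<one>\<^bsub>G\<^esub> v = v"
    and "\<And>g h v. \<lbrakk>g \<in> carrier G; h \<in> carrier G; v \<in> carrier x\<rbrakk>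
           \<Longrightarrow> gact x (g \<otimes>\<^bsub>G\<^esub> h) v = gact x g (gact x h v)"
  shows "group_module k G x"
proof -
  have ag: "abelian_group x"
    by (rule abelian_groupI) (use assms in auto)
  have "module k x"
    by (rule moduleI) (use assms ag in auto)
  then show ?thesis
    using assms by (auto simp: group_module_def group_module_axioms_def linear_maps_def)
qed

lemma group_module_subgroup:
  assumes "group_module k G x" "subgroup F G"
  shows "group_module k (G\<lparr>carrier := F\<rparr>) x"
proof -
  interpret group_module k G x by fact
  have "group (G\<lparr>carrier := F\<rparr>)"
    using assms(2) by (simp add: group.subgroup_imp_group is_group)
  then show ?thesis
    using assms subgroup.subset[OF assms(2)] gact_linear gact_one gact_mult module_axioms
    by (auto simp: group_module_def group_module_axioms_def subset_iff)
qed

lemma gmaps_iff: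
  "f \<in> gmaps k G x y \<longleftrightarrow> f \<in> extensional (carrier x) \<and> (\<forall>v \<in> carrier x. f v \<in> carrier y) \<and>
     (\<forall>v \<in> carrier x. \<forall>w \<in> carrier x. f (v \<oplus>\<^bsub>x\<^esub> w) = f v \<oplus>\<^bsub>y\<^esub> f w) \<and>
     (\<forall>c \<in> carrier k. \<forall>v \<in> carrier x. f (c \<odot>\<^bsub>x\<^esub> v) = c \<odot>\<^bsub>y\<^esub> f v) \<and>
     (\<forall>g \<in> carrier G. \<forall>v \<in> carrier x. f (gact x g v) = gact y g (f v))"
  by (auto simp: gmaps_def linear_maps_def PiE_iff)

lemma
  assumes "f \<in> gmaps k G x y" "v \<in> carrier x"
  shows gmaps_closed: "f v \<in> carrier y"
    and gmaps_add: "w \<in> carrier x \<Longrightarrow> f (v \<oplus>\<^bsub>x\<^esub> w) = f v \<oplus>\<^bsub>y\<^esub> f w"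
    and gmaps_smult: "c \<in> carrier k \<Longrightarrow> f (c \<odot>\<^bsub>x\<^esub> v) = c \<odot>\<^bsub>y\<^esub> f v"
    and gmaps_act: "g \<in> carrier G \<Longrightarrow> f (gact x g v) = gact y g (f v)"
  using assms by (auto simp: gmaps_iff)

lemma gmaps_extensional: "f \<in> gmaps k G x y \<Longrightarrow> f \<in> extensional (carrier x)"
  by (simp add: gmaps_iff)

lemma gmaps_eqI:
  assumes "f \<in> gmaps k G x y" "f' \<in> gmaps k G x y'" "\<And>v. v \<in> carrier x \<Longrightarrow> f v = f' v"
  shows "f = f'"
  using assms extensionalityI gmaps_extensional by metis

lemma gmapsI:
  assumes "group_module k G x"
    and "\<And>v. v \<in> carrier x \<Longrightarrow> f v \<in> carrier y"
    and "\<And>v w. \<lbrakk>v \<in> carrier x; w \<in> carrier x\<rbrakk> \<Longrightarrow> f (v \<oplus>\<^bsub>x\<^esub> w) = f v \<oplus>\<^bsub>y\<^esub> f w"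
    and "\<And>c v. \<lbrakk>c \<in> carrier k; v \<in> carrier x\<rbrakk> \<Longrightarrow> f (c \<odot>\<^bsub>x\<^esub> v) = c \<odot>\<^bsub>y\<^esub> f v"
    and "\<And>g v. \<lbrakk>g \<in> carrier G; v \<in> carrier x\<rbrakk> \<Longrightarrow> f (gact x g v) = gact y g (f v)"
  shows "restrict f (carrier x) \<in> gmaps k G x y"
proof -
  interpret group_module k G x by fact
  show ?thesis
    using assms gact_closed[OF assms(1)] by (auto simp: gmaps_iff)
qed

lemma gmaps_zero:
  assumes "group_module k G x" "group_module k G y" "f \<in> gmaps k G x y"
  shows "f \<zero>\<^bsub>x\<^esub> = \<zero>\<^bsub>y\<^esub>"
proof -
  interpret x: group_module k G x by fact
  interpret y: group_module k G y by fact
  have "f \<zero>\<^bsub>x\<^esub> \<oplus>\<^bsub>y\<^esub> f \<zero>\<^bsub>x\<^esub> = f \<zero>\<^bsub>x\<^esub>"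
    using gmaps_add[OF assms(3), of "\<zero>\<^bsub>x\<^esub>" "\<zero>\<^bsub>x\<^esub>"] by simp
  then show ?thesis
    using gmaps_closed[OF assms(3) x.zero_closed] y.M.add.r_cancel_one' by metis
qed

lemma gmaps_minus:
  assumes "group_module k G x" "group_module k G y" "f \<in> gmaps k G x y"
    "v \<in> carrier x" "w \<in> carrier x"
  shows "f (v \<ominus>\<^bsub>x\<^esub> w) = f v \<ominus>\<^bsub>y\<^esub> f w"
proof -
  interpret x: group_module k G x by fact
  interpret y: group_module k G y by fact
  note c = gmaps_closed[OF assms(3)]
  have "f (v \<ominus>\<^bsub>x\<^esub> w) \<oplus>\<^bsub>y\<^esub> f w = f v"
    using gmaps_add[OF assms(3), of "v \<ominus>\<^bsub>x\<^esub> w" w] assms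
    by (simp add: x.minus_eq x.M.a_assoc x.M.l_neg)
  then show ?thesis
    using assms(4,5) c y.M.add.inv_solve_right[of "f (v \<ominus>\<^bsub>x\<^esub> w)" "f v" "f w"]
    by (simp add: y.minus_eq)
qed

lemma gmaps_comp:
  assumes "group_module k G x" "f \<in> gmaps k G x y" "g \<in> gmaps k G y z"
  shows "compose (carrier x) g f \<in> gmaps k G x z"
  unfolding compose_def
  by (rule gmapsI[OF assms(1)])
     (use assms in \<open>auto simp: gmaps_closed gmaps_add gmaps_smult gmaps_act\<close>)

lemma gmaps_id: "group_module k G x \<Longrightarrow> (\<lambda>v \<in> carrier x. v) \<in> gmaps k G x x"
  by (rule gmapsI) auto

lemma gmaps_zero_map:
  assumes "group_module k G x" "group_module k G y"
  shows "zero_map x y \<in> gmaps k G x y"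
proof -
  interpret y: group_module k G y by fact
  have "gact y g \<zero>\<^bsub>y\<^esub> = \<zero>\<^bsub>y\<^esub>" if "g \<in> carrier G" for g
    using gact_smult[OF assms(2) that, of "\<zero>\<^bsub>y\<^esub>" "\<zero>\<^bsub>k\<^esub>"] gact_closed[OF assms(2) that, of "\<zero>\<^bsub>y\<^esub>"]
    by simp
  then show ?thesis
    unfolding zero_map_def by (intro gmapsI) (use assms in auto)
qed

lemma gact_zero:
  assumes "group_module k G x" "g \<in> carrier G"
  shows "gact x g \<zero>\<^bsub>x\<^esub> = \<zero>\<^bsub>x\<^esub>"
proof -
  interpret group_module k G x by fact
  show ?thesis
    using gact_smult[OF assms, of "\<zero>\<^bsub>x\<^esub>" "\<zero>\<^bsub>k\<^esub>"] gact_closed[OF assms, of "\<zero>\<^bsub>x\<^esub>"]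
    by simp
qed

section \<open>Sums and differences of equivariant maps\<close>

definition diff_map :: "('k, 'u, 'g) gmodule \<Rightarrow> ('k, 'v, 'g) gmodule \<Rightarrow> ('u \<Rightarrow> 'v) \<Rightarrow> ('u \<Rightarrow> 'v)
    \<Rightarrow> 'u \<Rightarrow> 'v" where
  "diff_map x y f g = (\<lambda>v \<in> carrier x. f v \<ominus>\<^bsub>y\<^esub> g v)"

definition sum_map :: "('k, 'u, 'g) gmodule \<Rightarrow> ('k, 'v, 'g) gmodule \<Rightarrow> ('u \<Rightarrow> 'v) \<Rightarrow> ('u \<Rightarrow> 'v)
    \<Rightarrow> 'u \<Rightarrow> 'v" where
  "sum_map x y f g = (\<lambda>v \<in> carrier x. f v \<oplus>\<^bsub>y\<^esub> g v)"

lemma gmaps_sum: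
  assumes "group_module k G x" "group_module k G y" "f \<in> gmaps k G x y" "f' \<in> gmaps k G x y"
  shows "sum_map x y f f' \<in> gmaps k G x y"
proof -
  interpret y: group_module k G y by fact
  show ?thesis
    unfolding sum_map_def
    by (rule gmapsI[OF assms(1)])
       (use assms in \<open>auto simp: gmaps_closed gmaps_add gmaps_smult gmaps_act y.M.a_ac
          y.smult_r_distr gact_add gact_closed\<close>)
qed

lemma gact_neg:
  assumes "group_module k G x" "g \<in> carrier G" "v \<in> carrier x"
  shows "gact x g (\<ominus>\<^bsub>x\<^esub> v) = \<ominus>\<^bsub>x\<^esub> gact x g v"
proof -
  interpret group_module k G x by fact
  have "gact x g (\<ominus>\<^bsub>x\<^esub> v) \<oplus>\<^bsub>x\<^esub> gact x g v = \<zero>\<^bsub>x\<^esub>"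
    using gact_add[OF assms(1,2), of "\<ominus>\<^bsub>x\<^esub> v" v] assms gact_zero[OF assms(1,2)]
    by (simp add: M.l_neg)
  then show ?thesis
    using M.minus_equality gact_closed[OF assms(1,2)] assms(3) by (metis M.a_inv_closed)
qed

lemma gmaps_diff:
  assumes "group_module k G x" "group_module k G y" "f \<in> gmaps k G x y" "f' \<in> gmaps k G x y"
  shows "diff_map x y f f' \<in> gmaps k G x y"
proof -
  interpret y: group_module k G y by fact
  show ?thesis
    unfolding diff_map_def
    by (rule gmapsI[OF assms(1)])
       (use assms in \<open>auto simp: gmaps_closed gmaps_add gmaps_smult gmaps_act y.M.a_ac y.minus_eq
          y.smult_r_distr gact_add gact_closed gact_neg y.smult_r_minus y.M.minus_add\<close>)
qed

lemma gmaps_subgroup: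
  assumes "f \<in> gmaps k G x y" "F \<subseteq> carrier G"
  shows "f \<in> gmaps k (G\<lparr>carrier := F\<rparr>) x y"
  using assms by (auto simp: gmaps_iff subset_iff)

lemma epis_iff: "e \<in> epis k G x y \<longleftrightarrow> e \<in> gmaps k G x y \<and> (\<forall>w \<in> carrier y. \<exists>v \<in> carrier x. e v = w)"
  by (force simp: epis_def gmaps_closed image_def)

lemma epis_gmaps: "e \<in> epis k G x y \<Longrightarrow> e \<in> gmaps k G x y"
  by (simp add: epis_def)

lemma epis_surj:
  assumes "e \<in> epis k G x y" "w \<in> carrier y"
  obtains v where "v \<in> carrier x" "e v = w"
  using assms by (auto simp: epis_iff)

section \<open>Kernels and factorisations\<close>

lemma carrier_ker_module [simp]:
  "carrier (ker_module x y f) = {v \<in> carrier x. f v = \<zero>\<^bsub>y\<^esub>}"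
  by (simp add: ker_module_def)

lemma ker_module_ops [simp]:
  "add (ker_module x y f) = add x" "\<zero>\<^bsub>ker_module x y f\<^esub> = \<zero>\<^bsub>x\<^esub>"
  "smult (ker_module x y f) = smult x" "gact (ker_module x y f) = gact x"
  by (simp_all add: ker_module_def)

lemma group_module_ker:
  assumes "group_module k G x" "group_module k G y" "f \<in> gmaps k G x y"
  shows "group_module k G (ker_module x y f)"
proof -
  interpret x: group_module k G x by fact
  interpret y: group_module k G y by fact
  note [simp] = gmaps_add[OF assms(3)] gmaps_smult[OF assms(3)] gmaps_act[OF assms(3)]
    gmaps_zero[OF assms] gact_closed[OF assms(1)]
  have neg: "f (\<ominus>\<^bsub>x\<^esub> v) = \<zero>\<^bsub>y\<^esub>" if "v \<in> carrier x" "f v = \<zero>\<^bsub>y\<^esub>" for v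
    using gmaps_minus[OF assms, of "\<zero>\<^bsub>x\<^esub>" v] that by (simp add: x.minus_eq y.minus_eq)
  show ?thesis
  proof (rule group_moduleI)
    show "\<exists>w\<in>carrier (ker_module x y f). w \<oplus>\<^bsub>ker_module x y f\<^esub> v = \<zero>\<^bsub>ker_module x y f\<^esub>"
      if "v \<in> carrier (ker_module x y f)" for v
      using that neg by (intro bexI[of _ "\<ominus>\<^bsub>x\<^esub> v"]) (auto simp: x.M.l_neg)
  qed (use x.is_group x.R.is_cring gact_zero[OF assms(2)] in \<open>auto simp: x.M.a_assoc
      x.smult_l_distr x.smult_r_distr x.smult_assoc1 x.gact_one x.gact_mult
      gact_add[OF assms(1)] gact_smult[OF assms(1)] intro: x.M.a_comm\<close>)
qed

lemma diff_eq_zero: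
  assumes "group_module k G x" "v \<in> carrier x" "w \<in> carrier x"
  shows "v \<ominus>\<^bsub>x\<^esub> w = \<zero>\<^bsub>x\<^esub> \<longleftrightarrow> v = w"
proof -
  interpret group_module k G x by fact
  show ?thesis
    using assms(2,3) by (metis M.minus_closed M.r_neg M.minus_eq M.minus_equality M.a_inv_closed M.minus_minus M.a_comm)
qed

lemma diff_closed:
  assumes "group_module k G x" "v \<in> carrier x" "w \<in> carrier x"
  shows "v \<ominus>\<^bsub>x\<^esub> w \<in> carrier x"
proof -
  interpret group_module k G x by fact
  show ?thesis
    using assms(2,3) by simp
qed

lemma diff_add:
  assumes "group_module k G x" "v \<in> carrier x" "w \<in> carrier x"
  shows "(v \<ominus>\<^bsub>x\<^esub> w) \<oplus>\<^bsub>x\<^esub> w = v"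
proof -
  interpret group_module k G x by fact
  show ?thesis
    using assms(2,3) by (simp add: minus_eq M.a_assoc M.l_neg)
qed

lemma diff_self:
  assumes "group_module k G x" "v \<in> carrier x"
  shows "v \<ominus>\<^bsub>x\<^esub> v = \<zero>\<^bsub>x\<^esub>"
  using assms by (simp add: diff_eq_zero)

lemma diff_zero:
  assumes "group_module k G x" "v \<in> carrier x"
  shows "v \<ominus>\<^bsub>x\<^esub> \<zero>\<^bsub>x\<^esub> = v"
proof -
  interpret group_module k G x by fact
  show ?thesis using assms by (simp add: minus_eq)
qed

lemma neg_diff:
  assumes "group_module k G x" "v \<in> carrier x" "w \<in> carrier x"
  shows "\<ominus>\<^bsub>x\<^esub> (v \<ominus>\<^bsub>x\<^esub> w) = w \<ominus>\<^bsub>x\<^esub> v"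
proof -
  interpret group_module k G x by fact
  show ?thesis using assms by (simp add: minus_eq M.minus_add M.a_comm)
qed

lemma diff_triangle:
  assumes "group_module k G x" "v \<in> carrier x" "w \<in> carrier x" "u \<in> carrier x"
  shows "(v \<ominus>\<^bsub>x\<^esub> w) \<oplus>\<^bsub>x\<^esub> (w \<ominus>\<^bsub>x\<^esub> u) = v \<ominus>\<^bsub>x\<^esub> u"
proof -
  interpret group_module k G x by fact
  show ?thesis using assms by (simp add: minus_eq M.a_assoc M.r_neg1)
qed

lemma gmaps_into_ker:
  assumes "f \<in> gmaps k G z x" "\<And>v. v \<in> carrier z \<Longrightarrow> e (f v) = \<zero>\<^bsub>y\<^esub>"
  shows "f \<in> gmaps k G z (ker_module x y e)"
  using assms by (auto simp: gmaps_iff)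

lemma gmaps_from_ker:
  assumes "group_module k G (ker_module x y e)" "f \<in> gmaps k G x z"
  shows "restrict f (carrier (ker_module x y e)) \<in> gmaps k G (ker_module x y e) z"
  by (rule gmapsI) (use assms in \<open>auto simp: gmaps_closed gmaps_add gmaps_smult gmaps_act\<close>)

lemma gmaps_ker_ker:
  assumes "group_module k G (ker_module x y e)" "f \<in> gmaps k G x z"
    and "\<And>v. \<lbrakk>v \<in> carrier x; e v = \<zero>\<^bsub>y\<^esub>\<rbrakk> \<Longrightarrow> e' (f v) = \<zero>\<^bsub>y'\<^esub>"
  shows "restrict f (carrier (ker_module x y e))
           \<in> gmaps k G (ker_module x y e) (ker_module z y' e')"
  by (rule gmaps_into_ker[OF gmaps_from_ker]) (use assms in auto)

lemma gmaps_ker_incl: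
  assumes "f \<in> gmaps k G z (ker_module x y e)"
  shows "f \<in> gmaps k G z x"
  using assms by (auto simp: gmaps_iff)

lemma gmaps_ker_subset:
  assumes "group_module k G (ker_module x y e)"
  shows "(\<lambda>v \<in> carrier (ker_module x y e). v) \<in> gmaps k G (ker_module x y e) x"
  by (rule gmaps_ker_incl[OF gmaps_id[OF assms]])

text \<open>Addition in a kernel is that of the ambient module by definition, but negation is
  defined by a search in the carrier, so the two subtractions are different terms until this is
  proved.\<close>

lemma ker_minus:
  assumes "group_module k G x" "group_module k G (ker_module x y e)"
    and "v \<in> carrier (ker_module x y e)" "w \<in> carrier (ker_module x y e)"
  shows "v \<ominus>\<^bsub>ker_module x y e\<^esub> w = v \<ominus>\<^bsub>x\<^esub> w"
  using gmaps_minus[OF assms(2,1) gmaps_ker_subset[OF assms(2)] assms(3,4)] diff_closed[OF assms(2-4)] assms(3,4)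
  by simp

text \<open>The universal property of a quotient: values are read off at chosen preimages, and
  \<open>wd\<close> shows that the choice does not matter. Surjectivity is stated elementwise, since
  \<open>epis\<close> ties both modules to one type and the sum module of \<open>ext_vanishI\<close>
  lives on pairs.\<close>

lemma gmaps_descend:
  assumes "group_module k G q" "group_module k G z" "group_module k G m"
    and e': "e \<in> gmaps k G q z" and surj: "\<And>w. w \<in> carrier z \<Longrightarrow> \<exists>v \<in> carrier q. e v = w"
    and g: "g \<in> gmaps k G q m"
    and van: "\<And>v. \<lbrakk>v \<in> carrier q; e v = \<zero>\<^bsub>z\<^esub>\<rbrakk> \<Longrightarrow> g v = \<zero>\<^bsub>m\<^esub>"
  obtains h where "h \<in> gmaps k G z m" "\<And>v. v \<in> carrier q \<Longrightarrow> h (e v) = g v"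
proof -
  interpret q: group_module k G q by fact
  interpret z: group_module k G z by fact
  have wd: "g v = g w" if "v \<in> carrier q" "w \<in> carrier q" "e v = e w" for v w
  proof -
    have "e (v \<ominus>\<^bsub>q\<^esub> w) = \<zero>\<^bsub>z\<^esub>"
      using that gmaps_closed[OF e'] by (simp add: gmaps_minus[OF assms(1,2) e'] diff_eq_zero[OF assms(2)])
    then have "g (v \<ominus>\<^bsub>q\<^esub> w) = \<zero>\<^bsub>m\<^esub>"
      using van that by (simp add: diff_closed[OF assms(1)])
    then show ?thesis
      using that gmaps_closed[OF g] by (simp add: gmaps_minus[OF assms(1,3) g] diff_eq_zero[OF assms(3)])
  qed
  define s where "s w = (SOME v. v \<in> carrier q \<and> e v = w)" for w
  have s: "s w \<in> carrier q" "e (s w) = w" if "w \<in> carrier z" for w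
    using someI_ex[of "\<lambda>v. v \<in> carrier q \<and> e v = w"] surj[OF that] unfolding s_def by blast+
  have key: "g (s (e v)) = g v" if "v \<in> carrier q" for v
    using wd[of "s (e v)" v] s[of "e v"] gmaps_closed[OF e' that] that by simp
  have gs: "g (s w) = g v" if "v \<in> carrier q" "e v = w" for v w
    using key that by blast
  have "(\<lambda>w \<in> carrier z. g (s w)) \<in> gmaps k G z m"
  proof (rule gmapsI)
    fix v w assume vw: "v \<in> carrier z" "w \<in> carrier z"
    show "g (s (v \<oplus>\<^bsub>z\<^esub> w)) = g (s v) \<oplus>\<^bsub>m\<^esub> g (s w)"
      using gs[of "s v \<oplus>\<^bsub>q\<^esub> s w"] s vw by (simp add: gmaps_add[OF e'] gmaps_add[OF g])
  next
    fix c v assume v: "c \<in> carrier k" "v \<in> carrier z"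
    show "g (s (c \<odot>\<^bsub>z\<^esub> v)) = c \<odot>\<^bsub>m\<^esub> g (s v)"
      using gs[of "c \<odot>\<^bsub>q\<^esub> s v"] s v by (simp add: gmaps_smult[OF e'] gmaps_smult[OF g])
  next
    fix c v assume v: "c \<in> carrier G" "v \<in> carrier z"
    show "g (s (gact z c v)) = gact m c (g (s v))"
      using gs[of "gact q c (s v)"] s v gact_closed[OF assms(1)]
      by (simp add: gmaps_act[OF e'] gmaps_act[OF g])
  qed (use s assms g in \<open>auto simp: gmaps_closed\<close>)
  moreover have "(\<lambda>w \<in> carrier z. g (s w)) (e v) = g v" if "v \<in> carrier q" for v
    using that key gmaps_closed[OF e'] by simp
  ultimately show ?thesis
    using that by blast
qed

section \<open>Transport of module structures\<close>

text \<open>Transport of structure along \<open>\<phi>\<close>. The map \<open>\<psi>\<close> only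
  selects a preimage of each element of the image, and the operations are carried out on these
  representatives.\<close>

definition push :: "('v \<Rightarrow> 'u) \<Rightarrow> ('u \<Rightarrow> 'v) \<Rightarrow> ('k, 'v, 'g) gmodule \<Rightarrow> ('k, 'u, 'g) gmodule" where
  "push \<phi> \<psi> M = \<lparr>carrier = \<phi> ` carrier M,
     monoid.mult = (\<lambda>a b. \<phi> (\<psi> a \<otimes>\<^bsub>M\<^esub> \<psi> b)), monoid.one = \<phi> \<one>\<^bsub>M\<^esub>, ring.zero = \<phi> \<zero>\<^bsub>M\<^esub>,
     add = (\<lambda>a b. \<phi> (\<psi> a \<oplus>\<^bsub>M\<^esub> \<psi> b)), smult = (\<lambda>c a. \<phi> (c \<odot>\<^bsub>M\<^esub> \<psi> a)),
     gact = (\<lambda>g a. \<phi> (gact M g (\<psi> a)))\<rparr>"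

lemma push_simps [simp]:
  "carrier (push \<phi> \<psi> M) = \<phi> ` carrier M" "\<zero>\<^bsub>push \<phi> \<psi> M\<^esub> = \<phi> \<zero>\<^bsub>M\<^esub>"
  "add (push \<phi> \<psi> M) = (\<lambda>a b. \<phi> (\<psi> a \<oplus>\<^bsub>M\<^esub> \<psi> b))" "smult (push \<phi> \<psi> M) = (\<lambda>c a. \<phi> (c \<odot>\<^bsub>M\<^esub> \<psi> a))"
  "gact (push \<phi> \<psi> M) = (\<lambda>g a. \<phi> (gact M g (\<psi> a)))"
  by (simp_all add: push_def)

text \<open>The congruence conditions allow \<open>\<phi>\<close> to be the projection onto a quotient as well as an
  injective renaming of the elements.\<close>

lemma
  assumes M: "group_module k G M"
    and \<psi>: "\<And>v. v \<in> carrier M \<Longrightarrow> \<psi> (\<phi> v) \<in> carrier M" "\<And>v. v \<in> carrier M \<Longrightarrow> \<phi> (\<psi> (\<phi> v)) = \<phi> v"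
    and add: "\<And>v v' w. \<lbrakk>v \<in> carrier M; v' \<in> carrier M; w \<in> carrier M; \<phi> v = \<phi> v'\<rbrakk>
        \<Longrightarrow> \<phi> (v \<oplus>\<^bsub>M\<^esub> w) = \<phi> (v' \<oplus>\<^bsub>M\<^esub> w)"
    and smult: "\<And>c v v'. \<lbrakk>c \<in> carrier k; v \<in> carrier M; v' \<in> carrier M; \<phi> v = \<phi> v'\<rbrakk>
        \<Longrightarrow> \<phi> (c \<odot>\<^bsub>M\<^esub> v) = \<phi> (c \<odot>\<^bsub>M\<^esub> v')"
    and act: "\<And>g v v'. \<lbrakk>g \<in> carrier G; v \<in> carrier M; v' \<in> carrier M; \<phi> v = \<phi> v'\<rbrakk>
        \<Longrightarrow> \<phi> (gact M g v) = \<phi> (gact M g v')"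
  shows group_module_push: "group_module k G (push \<phi> \<psi> M)"
    and push_map: "restrict \<phi> (carrier M) \<in> gmaps k G M (push \<phi> \<psi> M)"
proof -
  interpret group_module k G M by fact
  note gc[simp] = gact_closed[OF M]
  have a: "\<phi> (\<psi> (\<phi> v) \<oplus>\<^bsub>M\<^esub> w) = \<phi> (v \<oplus>\<^bsub>M\<^esub> w)" "\<phi> (w \<oplus>\<^bsub>M\<^esub> \<psi> (\<phi> v)) = \<phi> (w \<oplus>\<^bsub>M\<^esub> v)"
    if "v \<in> carrier M" "w \<in> carrier M" for v w
    using add[of "\<psi> (\<phi> v)" v w] that \<psi> by (auto simp: M.a_comm)
  have s: "\<phi> (c \<odot>\<^bsub>M\<^esub> \<psi> (\<phi> v)) = \<phi> (c \<odot>\<^bsub>M\<^esub> v)" if "c \<in> carrier k" "v \<in> carrier M" for c v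
    using smult[of c "\<psi> (\<phi> v)" v] that \<psi> by auto
  have t: "\<phi> (gact M c (\<psi> (\<phi> v))) = \<phi> (gact M c v)" if "c \<in> carrier G" "v \<in> carrier M" for c v
    using act[of c "\<psi> (\<phi> v)" v] that \<psi> by auto
  have neg: "\<exists>w\<in>carrier M. \<phi> (\<psi> (\<phi> w) \<oplus>\<^bsub>M\<^esub> \<psi> (\<phi> v)) = \<phi> \<zero>\<^bsub>M\<^esub>" if "v \<in> carrier M" for v
    using that \<psi> by (intro bexI[of _ "\<ominus>\<^bsub>M\<^esub> v"]) (auto simp: a M.l_neg)
  have x1: "\<phi> (c \<odot>\<^bsub>M\<^esub> \<psi> (\<phi> v) \<oplus>\<^bsub>M\<^esub> d \<odot>\<^bsub>M\<^esub> \<psi> (\<phi> v)) = \<phi> (c \<odot>\<^bsub>M\<^esub> v \<oplus>\<^bsub>M\<^esub> d \<odot>\<^bsub>M\<^esub> v)"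
    "\<phi> (c \<odot>\<^bsub>M\<^esub> (d \<odot>\<^bsub>M\<^esub> \<psi> (\<phi> v))) = \<phi> (c \<odot>\<^bsub>M\<^esub> (d \<odot>\<^bsub>M\<^esub> v))"
    if "c \<in> carrier k" "d \<in> carrier k" "v \<in> carrier M" for c d v
    using s[of "c \<oplus>\<^bsub>k\<^esub> d" v] s[of "c \<otimes>\<^bsub>k\<^esub> d" v] that \<psi> by (simp_all add: smult_l_distr smult_assoc1)
  have x2: "\<phi> (gact M c (gact M d (\<psi> (\<phi> v)))) = \<phi> (gact M c (gact M d v))"
    if "c \<in> carrier G" "d \<in> carrier G" "v \<in> carrier M" for c d v
    using t[of "c \<otimes>\<^bsub>G\<^esub> d" v] that \<psi> by (simp add: gact_mult)
  show "group_module k G (push \<phi> \<psi> M)"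
    by (rule group_moduleI)
       (use R.is_cring is_group neg in \<open>auto simp: a s t x1 x2 \<psi> M.a_assoc gact_one gact_mult
           smult_l_distr smult_r_distr smult_assoc1 gact_add[OF M] gact_smult[OF M]\<close>,
         simp add: M.a_comm)
  show "restrict \<phi> (carrier M) \<in> gmaps k G M (push \<phi> \<psi> M)"
    by (rule gmapsI) (use M in \<open>auto simp: a s t \<psi>\<close>)
qed

lemma
  assumes M: "group_module k G M" and \<psi>: "\<And>v. v \<in> carrier M \<Longrightarrow> \<psi> (\<phi> v) = v"
  shows group_module_push_inj: "group_module k G (push \<phi> \<psi> M)"
    and push_inj_map: "restrict \<phi> (carrier M) \<in> gmaps k G M (push \<phi> \<psi> M)"
    and push_inj_inv: "restrict \<psi> (carrier (push \<phi> \<psi> M)) \<in> gmaps k G (push \<phi> \<psi> M) M"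
proof -
  interpret group_module k G M by fact
  have inj: "\<phi> v = \<phi> v' \<longleftrightarrow> v = v'" if "v \<in> carrier M" "v' \<in> carrier M" for v v'
    using that \<psi> by metis
  show 1: "group_module k G (push \<phi> \<psi> M)"
    by (rule group_module_push[OF M]) (simp_all add: \<psi> inj)
  show "restrict \<phi> (carrier M) \<in> gmaps k G M (push \<phi> \<psi> M)"
    by (rule push_map[OF M]) (simp_all add: \<psi> inj)
  show "restrict \<psi> (carrier (push \<phi> \<psi> M)) \<in> gmaps k G (push \<phi> \<psi> M) M"
    by (rule gmapsI[OF 1]) (auto simp: \<psi> gact_closed[OF M])
qed

text \<open>The quotient must again have its carrier in the type of \<open>x\<close>, so each coset
  is replaced by one representative.\<close>

lemma quotient_module:
  fixes x :: "('k, 'u, 'g) gmodule"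
  assumes x: "group_module k G x" and N: "N \<subseteq> carrier x" "\<zero>\<^bsub>x\<^esub> \<in> N"
    "\<And>v w. \<lbrakk>v \<in> N; w \<in> N\<rbrakk> \<Longrightarrow> v \<oplus>\<^bsub>x\<^esub> w \<in> N"
    "\<And>c v. \<lbrakk>c \<in> carrier k; v \<in> N\<rbrakk> \<Longrightarrow> c \<odot>\<^bsub>x\<^esub> v \<in> N"
    "\<And>g v. \<lbrakk>g \<in> carrier G; v \<in> N\<rbrakk> \<Longrightarrow> gact x g v \<in> N"
  obtains y :: "('k, 'u, 'g) gmodule" and e
  where "group_module k G y" "e \<in> epis k G x y" "{v \<in> carrier x. e v = \<zero>\<^bsub>y\<^esub>} = N"
proof -
  interpret group_module k G x by fact
  have neg: "\<ominus>\<^bsub>x\<^esub> v \<in> N" if "v \<in> N" for v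
    using N(4)[of "\<ominus>\<^bsub>k\<^esub> \<one>\<^bsub>k\<^esub>" v] N(1) that by (simp add: smult_l_minus subset_iff)
  define \<phi> where "\<phi> v = (SOME w. w \<in> carrier x \<and> v \<ominus>\<^bsub>x\<^esub> w \<in> N)" for v
  have \<phi>: "\<phi> v \<in> carrier x \<and> v \<ominus>\<^bsub>x\<^esub> \<phi> v \<in> N" if "v \<in> carrier x" for v
    unfolding \<phi>_def by (rule someI[of _ v]) (use that N in \<open>simp add: diff_self[OF x]\<close>)
  \<comment> \<open>Congruent elements satisfy the same condition under \<open>SOME\<close> and
    hence get the same representative.\<close>
  have eq: "\<phi> v = \<phi> w" if "v \<in> carrier x" "w \<in> carrier x" "v \<ominus>\<^bsub>x\<^esub> w \<in> N" for v w
  proof -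
    note d = diff_triangle[OF x] neg_diff[OF x]
    have "v \<ominus>\<^bsub>x\<^esub> u = (v \<ominus>\<^bsub>x\<^esub> w) \<oplus>\<^bsub>x\<^esub> (w \<ominus>\<^bsub>x\<^esub> u)" if "u \<in> carrier x" for u
      using that \<open>v \<in> carrier x\<close> \<open>w \<in> carrier x\<close> by (simp add: d)
    moreover have "w \<ominus>\<^bsub>x\<^esub> u = (\<ominus>\<^bsub>x\<^esub> (v \<ominus>\<^bsub>x\<^esub> w)) \<oplus>\<^bsub>x\<^esub> (v \<ominus>\<^bsub>x\<^esub> u)" if "u \<in> carrier x" for u
      using that \<open>v \<in> carrier x\<close> \<open>w \<in> carrier x\<close> by (simp add: d)
    ultimately have "v \<ominus>\<^bsub>x\<^esub> u \<in> N \<longleftrightarrow> w \<ominus>\<^bsub>x\<^esub> u \<in> N" if "u \<in> carrier x" for u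
      using N(3) neg that \<open>v \<ominus>\<^bsub>x\<^esub> w \<in> N\<close> by metis
    then show ?thesis
      unfolding \<phi>_def by metis
  qed
  have eq': "v \<ominus>\<^bsub>x\<^esub> w \<in> N" if "v \<in> carrier x" "w \<in> carrier x" "\<phi> v = \<phi> w" for v w
  proof -
    have "v \<ominus>\<^bsub>x\<^esub> w = (v \<ominus>\<^bsub>x\<^esub> \<phi> v) \<oplus>\<^bsub>x\<^esub> \<ominus>\<^bsub>x\<^esub> (w \<ominus>\<^bsub>x\<^esub> \<phi> v)"
      using diff_triangle[OF x, of v "\<phi> v" w] neg_diff[OF x, of w "\<phi> v"] that \<phi>[of v] by simp
    then show ?thesis
      using \<phi>[of v] \<phi>[of w] that neg N(3) by metis
  qed
  \<comment> \<open>A representative is its own preimage, so the identity serves as the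
    section.\<close>
  let ?y = "push \<phi> (\<lambda>v. v) x"
  have \<phi>\<phi>: "\<phi> (\<phi> v) = \<phi> v" if "v \<in> carrier x" for v
    using eq[of v "\<phi> v"] \<phi>[OF that] that by simp
  have c: "\<phi> (v \<oplus>\<^bsub>x\<^esub> w) = \<phi> (v' \<oplus>\<^bsub>x\<^esub> w)"
    if "v \<in> carrier x" "v' \<in> carrier x" "w \<in> carrier x" "\<phi> v = \<phi> v'" for v v' w
  proof (rule eq)
    have "(v \<oplus>\<^bsub>x\<^esub> w) \<ominus>\<^bsub>x\<^esub> (v' \<oplus>\<^bsub>x\<^esub> w) = v \<ominus>\<^bsub>x\<^esub> v'"
      using that by (simp add: minus_eq M.a_assoc M.minus_add M.a_lcomm[of w] M.r_neg)
    then show "(v \<oplus>\<^bsub>x\<^esub> w) \<ominus>\<^bsub>x\<^esub> (v' \<oplus>\<^bsub>x\<^esub> w) \<in> N"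
      using eq' that by simp
  qed (use that in auto)
  have d: "\<phi> (c \<odot>\<^bsub>x\<^esub> v) = \<phi> (c \<odot>\<^bsub>x\<^esub> v')"
    if "c \<in> carrier k" "v \<in> carrier x" "v' \<in> carrier x" "\<phi> v = \<phi> v'" for v v' c
  proof (rule eq)
    have "c \<odot>\<^bsub>x\<^esub> v \<ominus>\<^bsub>x\<^esub> c \<odot>\<^bsub>x\<^esub> v' = c \<odot>\<^bsub>x\<^esub> (v \<ominus>\<^bsub>x\<^esub> v')"
      using that by (simp add: minus_eq smult_r_distr smult_r_minus)
    then show "c \<odot>\<^bsub>x\<^esub> v \<ominus>\<^bsub>x\<^esub> c \<odot>\<^bsub>x\<^esub> v' \<in> N"
      using eq'[of v v'] N(4) that by simp
  qed (use that in auto)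
  have t: "\<phi> (gact x c v) = \<phi> (gact x c v')"
    if "c \<in> carrier G" "v \<in> carrier x" "v' \<in> carrier x" "\<phi> v = \<phi> v'" for v v' c
  proof (rule eq)
    have "gact x c v \<ominus>\<^bsub>x\<^esub> gact x c v' = gact x c (v \<ominus>\<^bsub>x\<^esub> v')"
      using that by (simp add: minus_eq gact_add[OF x] gact_neg[OF x])
    then show "gact x c v \<ominus>\<^bsub>x\<^esub> gact x c v' \<in> N"
      using eq'[of v v'] N(5) that by simp
  qed (use that gact_closed[OF x] in auto)
  have gm: "group_module k G ?y"
    by (rule group_module_push[OF x _ _ c d t]) (use \<phi> \<phi>\<phi> in auto)
  have "restrict \<phi> (carrier x) \<in> gmaps k G x ?y"
    by (rule push_map[OF x _ _ c d t]) (use \<phi> \<phi>\<phi> in auto)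
  then have e: "restrict \<phi> (carrier x) \<in> epis k G x ?y"
    by (auto simp: epis_iff)
  have "\<phi> v = \<phi> \<zero>\<^bsub>x\<^esub> \<longleftrightarrow> v \<in> N" if "v \<in> carrier x" for v
    using eq[of v "\<zero>\<^bsub>x\<^esub>"] eq'[of v "\<zero>\<^bsub>x\<^esub>"] that by (auto simp: diff_zero[OF x])
  then have "{v \<in> carrier x. restrict \<phi> (carrier x) v = \<zero>\<^bsub>?y\<^esub>} = N"
    using N(1) by auto
  then show ?thesis
    using that gm e by blast
qed

lemma cokernel_module:
  fixes x p :: "('k, 'u, 'g) gmodule"
  assumes x: "group_module k G x" and p: "group_module k G p" and f: "f \<in> gmaps k G x p"
  obtains c :: "('k, 'u, 'g) gmodule" and e
  where "group_module k G c" "e \<in> epis k G p c" "carrier (ker_module p c e) = f ` carrier x"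
proof -
  interpret x: group_module k G x by fact
  have closed: "\<zero>\<^bsub>p\<^esub> \<in> f ` carrier x"
    "\<And>v w. \<lbrakk>v \<in> f ` carrier x; w \<in> f ` carrier x\<rbrakk> \<Longrightarrow> v \<oplus>\<^bsub>p\<^esub> w \<in> f ` carrier x"
    "\<And>t v. \<lbrakk>t \<in> carrier k; v \<in> f ` carrier x\<rbrakk> \<Longrightarrow> t \<odot>\<^bsub>p\<^esub> v \<in> f ` carrier x"
    "\<And>g v. \<lbrakk>g \<in> carrier G; v \<in> f ` carrier x\<rbrakk> \<Longrightarrow> gact p g v \<in> f ` carrier x"
    using gmaps_zero[OF x p f] gact_closed[OF x]
    by (auto simp: gmaps_add[OF f, symmetric] gmaps_smult[OF f, symmetric] gmaps_act[OF f, symmetric]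
        intro: image_eqI[of _ _ "\<zero>\<^bsub>x\<^esub>"])
  obtain c :: "('k, 'u, 'g) gmodule" and e where "group_module k G c" "e \<in> epis k G p c"
    "{v \<in> carrier p. e v = \<zero>\<^bsub>c\<^esub>} = f ` carrier x"
    by (rule quotient_module[OF p _ closed]) (use gmaps_closed[OF f] in auto)
  then show ?thesis using that by simp
qed

lemma gmaps_inverse:
  assumes x: "group_module k G x" and K: "group_module k G K" and f: "f \<in> gmaps k G x K"
    and inj: "\<And>v w. \<lbrakk>v \<in> carrier x; w \<in> carrier x; f v = f w\<rbrakk> \<Longrightarrow> v = w"
    and surj: "carrier K \<subseteq> f ` carrier x"
  obtains b where "b \<in> gmaps k G K x" "\<And>v. v \<in> carrier x \<Longrightarrow> b (f v) = v" "\<And>w. w \<in> carrier K \<Longrightarrow> f (b w) = w"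
proof -
  interpret x: group_module k G x by fact
  let ?i = "inv_into (carrier x) f"
  have i: "?i (f v) = v" if "v \<in> carrier x" for v
    using that inj by (intro inv_into_f_f) (auto simp: inj_on_def)
  have "restrict ?i (carrier K) \<in> gmaps k G K x"
  proof (rule gmapsI[OF K])
    fix v assume "v \<in> carrier K"
    then obtain u where u: "u \<in> carrier x" "v = f u" using surj by auto
    show "?i v \<in> carrier x" using u i by simp
    show "?i (t \<odot>\<^bsub>K\<^esub> v) = t \<odot>\<^bsub>x\<^esub> ?i v" if "t \<in> carrier k" for t
      using u i that by (simp add: gmaps_smult[OF f, symmetric])
    show "?i (gact K t v) = gact x t (?i v)" if "t \<in> carrier G" for t
      using u i that gact_closed[OF x] by (simp add: gmaps_act[OF f, symmetric])
    fix w assume "w \<in> carrier K"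
    then obtain u' where u': "u' \<in> carrier x" "w = f u'" using surj by auto
    show "?i (v \<oplus>\<^bsub>K\<^esub> w) = ?i v \<oplus>\<^bsub>x\<^esub> ?i w"
      using u u' i by (simp add: gmaps_add[OF f, symmetric])
  qed
  moreover have "restrict ?i (carrier K) (f v) = v" if "v \<in> carrier x" for v
    using that i gmaps_closed[OF f that] by simp
  moreover have "f (restrict ?i (carrier K) w) = w" if "w \<in> carrier K" for w
    using that surj f_inv_into_f[of w f "carrier x"] by auto
  ultimately show ?thesis using that by blast
qed

section \<open>The universe\<close>

text \<open>An infinite type has as many finite subsets as elements. Functions of finite support or
  with finitely many values are coded below as finite sets.\<close>

lemma finite_set_encoding:
  assumes "infinite (UNIV :: 'u set)" "A \<lesssim> (UNIV :: 'u set)"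
  obtains enc :: "'a set \<Rightarrow> 'u" where "inj_on enc (Fpow A)"
proof -
  obtain f :: "'a \<Rightarrow> 'u" where f: "inj_on f A"
    using assms(2) by (auto simp: lepoll_def)
  have "Fpow (UNIV :: 'u set) \<lesssim> (UNIV :: 'u set)"
    using eqpoll_Fpow[OF assms(1)] eqpoll_imp_lepoll by blast
  then obtain h :: "'u set \<Rightarrow> 'u" where h: "inj_on h (Fpow UNIV)"
    by (auto simp: lepoll_def)
  have "inj_on (\<lambda>S. h (f ` S)) (Fpow A)"
  proof (rule inj_onI)
    fix S T assume ST: "S \<in> Fpow A" "T \<in> Fpow A" "h (f ` S) = h (f ` T)"
    then have "f ` S = f ` T"
      using inj_onD[OF h ST(3)] by (auto simp: Fpow_def)
    then show "S = T"
      using ST f by (auto simp: Fpow_def inj_on_image_eq_iff)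
  qed
  then show ?thesis using that by blast
qed

lemma times_UNIV_lepoll:
  assumes "infinite (UNIV :: 'u set)" "A \<lesssim> (UNIV :: 'u set)" "B \<lesssim> (UNIV :: 'u set)"
  shows "A \<times> B \<lesssim> (UNIV :: 'u set)"
proof -
  have "A \<times> B \<lesssim> (UNIV :: 'u set) \<times> (UNIV :: 'u set)"
    by (rule times_lepoll_mono[OF assms(2,3)])
  also have "\<dots> \<approx> (UNIV :: 'u set)"
    using card_of_Times_same_infinite[OF assms(1)] by (simp only: eqpoll_iff_card_of_ordIso)
  finally show ?thesis .
qed

locale group_universe =
  fixes k :: "'k ring" and G :: "'g monoid" and u :: "'u itself"
  assumes cring: "cring k" and group: "group G" and admissible: "admissible_universe u k G"
begin

sublocale G: group G by (rule group)
sublocale k: cring k by (rule cring)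

lemma infinite_UNIV: "infinite (UNIV :: 'u set)"
  and scalars_lepoll: "carrier k \<lesssim> (UNIV :: 'u set)"
  and Pow_lepoll: "Pow (carrier G) \<lesssim> (UNIV :: 'u set)"
  using admissible by (auto simp: admissible_universe_def)

lemma group_lepoll: "carrier G \<lesssim> (UNIV :: 'u set)"
proof -
  have "carrier G \<lesssim> Pow (carrier G)"
    unfolding lepoll_def by (rule exI[of _ "\<lambda>x. {x}"]) auto
  then show ?thesis using Pow_lepoll lepoll_trans by blast
qed

lemma group_universe_subgroup:
  assumes "subgroup F G"
  shows "group_universe k (G\<lparr>carrier := F\<rparr>) u"
proof -
  have "Pow F \<lesssim> Pow (carrier G)"
    by (rule subset_imp_lepoll) (use subgroup.subset[OF assms] in auto)
  then have "Pow F \<lesssim> (UNIV :: 'u set)"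
    using Pow_lepoll lepoll_trans by blast
  then show ?thesis
    using assms infinite_UNIV scalars_lepoll
    by (auto simp: group_universe_def admissible_universe_def cring G.subgroup_imp_group)
qed

end

section \<open>Bounded functions with values in a module\<close>

text \<open>\<open>bfun G x\<close> is \<open>B(G,k) \<otimes> x\<close>, realised as the module of functions \<open>G \<rightarrow> x\<close> with finitely many
  values; in this form it is evidently an exact functor of \<open>x\<close>.\<close>

definition bfun :: "'g monoid \<Rightarrow> ('k, 'u, 'g) gmodule \<Rightarrow> ('k, 'g \<Rightarrow> 'u, 'g) gmodule" where
  "bfun G x = \<lparr>carrier = {f \<in> carrier G \<rightarrow>\<^sub>E carrier x. finite (f ` carrier G)},
     monoid.mult = (\<lambda>f f'. \<lambda>a \<in> carrier G. f a \<otimes>\<^bsub>x\<^esub> f' a), monoid.one = (\<lambda>a \<in> carrier G. \<one>\<^bsub>x\<^esub>),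
     ring.zero = (\<lambda>a \<in> carrier G. \<zero>\<^bsub>x\<^esub>), add = (\<lambda>f f'. \<lambda>a \<in> carrier G. f a \<oplus>\<^bsub>x\<^esub> f' a),
     smult = (\<lambda>c f. \<lambda>a \<in> carrier G. c \<odot>\<^bsub>x\<^esub> f a),
     gact = (\<lambda>g f. \<lambda>a \<in> carrier G. gact x g (f (inv\<^bsub>G\<^esub> g \<otimes>\<^bsub>G\<^esub> a)))\<rparr>"

lemma bfun_simps [simp]:
  "carrier (bfun G x) = {f \<in> carrier G \<rightarrow>\<^sub>E carrier x. finite (f ` carrier G)}"
  "\<zero>\<^bsub>bfun G x\<^esub> = (\<lambda>a \<in> carrier G. \<zero>\<^bsub>x\<^esub>)"
  "add (bfun G x) = (\<lambda>f f'. \<lambda>a \<in> carrier G. f a \<oplus>\<^bsub>x\<^esub> f' a)"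
  "smult (bfun G x) = (\<lambda>c f. \<lambda>a \<in> carrier G. c \<odot>\<^bsub>x\<^esub> f a)"
  "gact (bfun G x) = (\<lambda>g f. \<lambda>a \<in> carrier G. gact x g (f (inv\<^bsub>G\<^esub> g \<otimes>\<^bsub>G\<^esub> a)))"
  by (simp_all add: bfun_def)

lemma finite_image_comp:
  assumes "finite (f ` A)" "\<And>a. a \<in> A \<Longrightarrow> \<exists>b \<in> A. h a = t (f b)"
  shows "finite (h ` A)"
  by (rule finite_subset[of _ "t ` f ` A"]) (use assms in auto)

lemma finite_image_comp2:
  assumes "finite (f ` A)" "finite (f' ` A)" "\<And>a. a \<in> A \<Longrightarrow> \<exists>b \<in> A. \<exists>c \<in> A. h a = t (f b) (f' c)"
  shows "finite (h ` A)"
  by (rule finite_subset[of _ "(\<lambda>(b, c). t b c) ` (f ` A \<times> f' ` A)"]) (use assms in force)+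

lemma group_module_bfun:
  assumes x: "group_module k G x"
  shows "group_module k G (bfun G x)"
proof -
  interpret x: group_module k G x by fact
  have ic: "inv\<^bsub>G\<^esub> g \<otimes>\<^bsub>G\<^esub> a \<in> carrier G" if "g \<in> carrier G" "a \<in> carrier G" for g a
    using that by simp
  note [simp] = gact_closed[OF x] gact_add[OF x] gact_smult[OF x]
  show ?thesis
  proof (rule group_moduleI)
    fix f assume f: "f \<in> carrier (bfun G x)"
    show "\<exists>h\<in>carrier (bfun G x). h \<oplus>\<^bsub>bfun G x\<^esub> f = \<zero>\<^bsub>bfun G x\<^esub>"
      using f by (intro bexI[of _ "\<lambda>a \<in> carrier G. \<ominus>\<^bsub>x\<^esub> f a"])
        (auto simp: PiE_iff x.M.l_neg intro!: finite_image_comp[of f _ _ "a_inv x"])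
    show "gact (bfun G x) \<one>\<^bsub>G\<^esub> f = f"
      using f by (auto simp: PiE_iff x.gact_one intro!: extensionalityI[of _ "carrier G"])
  next
    fix f h assume "f \<in> carrier (bfun G x)" "h \<in> carrier (bfun G x)"
    then show "f \<oplus>\<^bsub>bfun G x\<^esub> h \<in> carrier (bfun G x)"
      by (auto simp: PiE_iff intro!: finite_image_comp2[of f _ h _ "add x"])
  next
    fix c f assume "c \<in> carrier k" "f \<in> carrier (bfun G x)"
    then show "c \<odot>\<^bsub>bfun G x\<^esub> f \<in> carrier (bfun G x)"
      by (auto simp: PiE_iff intro!: finite_image_comp[of f _ _ "smult x c"])
  next
    fix g f assume "g \<in> carrier G" "f \<in> carrier (bfun G x)"
    then show "gact (bfun G x) g f \<in> carrier (bfun G x)"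
      using ic by (auto simp: PiE_iff intro!: finite_image_comp[of f _ _ "gact x g"])
  next
    fix g h f assume *: "g \<in> carrier G" "h \<in> carrier G" "f \<in> carrier (bfun G x)"
    then have "inv\<^bsub>G\<^esub> h \<otimes>\<^bsub>G\<^esub> (inv\<^bsub>G\<^esub> g \<otimes>\<^bsub>G\<^esub> a) \<in> carrier G" if "a \<in> carrier G" for a
      using that by simp
    with * show "gact (bfun G x) (g \<otimes>\<^bsub>G\<^esub> h) f = gact (bfun G x) g (gact (bfun G x) h f)"
      using ic by (auto simp: fun_eq_iff restrict_def PiE_iff x.inv_mult_group x.m_assoc x.gact_mult)
  next
    show "\<zero>\<^bsub>bfun G x\<^esub> \<in> carrier (bfun G x)"
      using finite_subset[of "(\<lambda>a \<in> carrier G. \<zero>\<^bsub>x\<^esub>) ` carrier G" "{\<zero>\<^bsub>x\<^esub>}"] by auto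
  qed (use x.R.is_cring x.is_group ic in \<open>auto simp: fun_eq_iff PiE_iff restrict_def extensional_def
      x.M.a_assoc x.smult_l_distr x.smult_r_distr x.smult_assoc1 intro: x.M.a_comm\<close>)
qed

lemma gmaps_bfun_const:
  assumes x: "group_module k G x"
  shows "(\<lambda>v \<in> carrier x. \<lambda>a \<in> carrier G. v) \<in> gmaps k G x (bfun G x)"
proof -
  interpret x: group_module k G x by fact
  have "(\<lambda>a \<in> carrier G. v) \<in> carrier (bfun G x)" if "v \<in> carrier x" for v
    using that finite_subset[of "(\<lambda>a \<in> carrier G. v) ` carrier G" "{v}"] by auto
  then show ?thesis
    by (intro gmapsI[OF x]) (auto simp: fun_eq_iff)
qed

lemma gmaps_bfun_map:
  assumes x: "group_module k G x" and y: "group_module k G y" and f: "f \<in> gmaps k G x y"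
  shows "(\<lambda>\<phi> \<in> carrier (bfun G x). \<lambda>a \<in> carrier G. f (\<phi> a)) \<in> gmaps k G (bfun G x) (bfun G y)"
proof -
  interpret x: group_module k G x by fact
  have ic: "inv\<^bsub>G\<^esub> g \<otimes>\<^bsub>G\<^esub> a \<in> carrier G" if "g \<in> carrier G" "a \<in> carrier G" for g a
    using that by simp
  show ?thesis
  proof (rule gmapsI[OF group_module_bfun[OF x]])
    fix \<phi> assume "\<phi> \<in> carrier (bfun G x)"
    then show "(\<lambda>a \<in> carrier G. f (\<phi> a)) \<in> carrier (bfun G y)"
      using gmaps_closed[OF f] by (auto simp: PiE_iff intro!: finite_image_comp[of \<phi> _ _ f])
  qed (use ic in \<open>auto simp: fun_eq_iff restrict_def PiE_iff gmaps_add[OF f] gmaps_smult[OF f] gmaps_act[OF f]\<close>)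
qed

text \<open>One injection for all functions with finitely many values, chosen per group and not per
  module. Thus an element has the same code in \<open>bounded G x\<close> and in
  \<open>bounded G\<close> of a submodule of \<open>x\<close>, and \<open>ker_bmap\<close> can be an
  equality of records.\<close>

definition benc :: "'g monoid \<Rightarrow> ('g \<Rightarrow> 'u) \<Rightarrow> 'u" where
  "benc G = (SOME enc. inj_on enc {f \<in> extensional (carrier G). finite (f ` carrier G)})"

definition bdec :: "'g monoid \<Rightarrow> 'u \<Rightarrow> 'g \<Rightarrow> 'u" where
  "bdec G = inv_into {f \<in> extensional (carrier G). finite (f ` carrier G)} (benc G)"

definition bounded :: "'g monoid \<Rightarrow> ('k, 'u, 'g) gmodule \<Rightarrow> ('k, 'u, 'g) gmodule" where
  "bounded G x = push (benc G) (bdec G) (bfun G x)"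

definition bconst :: "'g monoid \<Rightarrow> ('k, 'u, 'g) gmodule \<Rightarrow> 'u \<Rightarrow> 'u" where
  "bconst G x = (\<lambda>v \<in> carrier x. benc G (\<lambda>a \<in> carrier G. v))"

definition bmap :: "'g monoid \<Rightarrow> ('k, 'u, 'g) gmodule \<Rightarrow> ('u \<Rightarrow> 'u) \<Rightarrow> 'u \<Rightarrow> 'u" where
  "bmap G x f = (\<lambda>b \<in> carrier (bounded G x). benc G (\<lambda>a \<in> carrier G. f (bdec G b a)))"

context group_universe begin

text \<open>A function with finitely many values is determined by the finite set of its values, each
  paired with its fibre. Fibres are subsets of \<open>G\<close>, which is where the bound on
  \<open>Pow (carrier G)\<close> is used.\<close>

lemma bdec_benc:
  assumes "f \<in> extensional (carrier G)" "finite (f ` carrier G)"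
  shows "bdec G (benc G f :: 'u) = f"
proof -
  let ?D = "{f :: 'g \<Rightarrow> 'u. f \<in> extensional (carrier G) \<and> finite (f ` carrier G)}"
  let ?A = "(UNIV :: 'u set) \<times> Pow (carrier G)"
  let ?t = "\<lambda>f a. (f a, {b \<in> carrier G. f b = f a})"
  obtain e :: "('u \<times> 'g set) set \<Rightarrow> 'u" where e: "inj_on e (Fpow ?A)"
    using finite_set_encoding[OF infinite_UNIV, of ?A]
      times_UNIV_lepoll[OF infinite_UNIV lepoll_refl Pow_lepoll] by blast
  have "inj_on (\<lambda>f. e (?t f ` carrier G)) ?D"
  proof (rule inj_onI)
    fix f f' :: "'g \<Rightarrow> 'u"
    assume f: "f \<in> ?D" and f': "f' \<in> ?D" and eq: "e (?t f ` carrier G) = e (?t f' ` carrier G)"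
    have fin: "?t h ` carrier G \<in> Fpow ?A" if "h \<in> ?D" for h :: "'g \<Rightarrow> 'u"
      using that by (auto simp: Fpow_def
          intro!: finite_image_comp[of h _ _ "\<lambda>v. (v, {b \<in> carrier G. h b = v})"])
    have eq': "?t f ` carrier G = ?t f' ` carrier G"
      using inj_onD[OF e eq fin[OF f] fin[OF f']] .
    have "f a = f' a" if "a \<in> carrier G" for a
    proof -
      have "?t f a \<in> ?t f' ` carrier G"
        using eq' that by blast
      then obtain b where b: "f a = f' b" "{c \<in> carrier G. f c = f a} = {c \<in> carrier G. f' c = f' b}"
        by auto
      have "a \<in> {c \<in> carrier G. f c = f a}"
        using that by simp
      then have "a \<in> {c \<in> carrier G. f' c = f' b}"
        by (simp only: b(2))
      then show ?thesis using b(1) by simp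
    qed
    then show "f = f'"
      using f f' by (auto intro: extensionalityI)
  qed
  then have "inj_on (benc G :: _ \<Rightarrow> 'u) ?D"
    unfolding benc_def by (rule someI[where P = "\<lambda>enc. inj_on enc ?D"])
  then show ?thesis
    unfolding bdec_def using assms by (intro inv_into_f_f) auto
qed

lemma bdec_benc_bfun: "f \<in> carrier (bfun G x) \<Longrightarrow> bdec G (benc G f :: 'u) = f"
  by (rule bdec_benc) (auto simp: PiE_iff)

context
  fixes x :: "('k, 'u, 'g) gmodule" assumes x: "group_module k G x"
begin

lemma group_module_bounded: "group_module k G (bounded G x)"
  unfolding bounded_def by (rule group_module_push_inj[OF group_module_bfun[OF x] bdec_benc_bfun])

lemma benc_gmaps: "restrict (benc G) (carrier (bfun G x)) \<in> gmaps k G (bfun G x) (bounded G x)"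
  unfolding bounded_def by (rule push_inj_map[OF group_module_bfun[OF x] bdec_benc_bfun])

lemma bdec_gmaps: "restrict (bdec G) (carrier (bounded G x)) \<in> gmaps k G (bounded G x) (bfun G x)"
  unfolding bounded_def by (rule push_inj_inv[OF group_module_bfun[OF x] bdec_benc_bfun])

lemma bdec_closed: "b \<in> carrier (bounded G x) \<Longrightarrow> bdec G b \<in> carrier (bfun G x)"
  using gmaps_closed[OF bdec_gmaps] by simp

lemma benc_closed: "f \<in> carrier (bfun G x) \<Longrightarrow> benc G f \<in> carrier (bounded G x)"
  by (simp add: bounded_def)

lemma benc_bdec: "b \<in> carrier (bounded G x) \<Longrightarrow> benc G (bdec G b) = b"
  using bdec_benc_bfun[of _ x] by (auto simp: bounded_def simp del: bfun_simps)

lemma bounded_zero: "\<zero>\<^bsub>bounded G x\<^esub> = benc G (\<lambda>a \<in> carrier G. \<zero>\<^bsub>x\<^esub>)"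
  by (simp add: bounded_def)

lemma bconst_gmaps: "bconst G x \<in> gmaps k G x (bounded G x)"
proof -
  have "bconst G x = compose (carrier x) (restrict (benc G) (carrier (bfun G x)))
          (\<lambda>v \<in> carrier x. \<lambda>a \<in> carrier G. v)"
    using gmaps_closed[OF gmaps_bfun_const[OF x]] by (auto simp: bconst_def compose_def fun_eq_iff)
  then show ?thesis
    using gmaps_comp[OF x gmaps_bfun_const[OF x] benc_gmaps] by simp
qed

lemma bdec_bconst: "v \<in> carrier x \<Longrightarrow> bdec G (bconst G x v) = (\<lambda>a \<in> carrier G. v)"
  using gmaps_closed[OF gmaps_bfun_const[OF x], of v] bdec_benc_bfun[of _ x]
  by (simp add: bconst_def)

lemma bconst_inj:
  assumes "v \<in> carrier x" "w \<in> carrier x" "bconst G x v = bconst G x w"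
  shows "v = w"
  using bdec_bconst[OF assms(1)] bdec_bconst[OF assms(2)] assms(3) G.one_closed
  by (metis restrict_apply')

end

lemma
  fixes x :: "('k, 'u, 'g) gmodule"
  assumes x: "group_module k G x" and v: "v \<in> carrier (bounded G x)" and a: "a \<in> carrier G"
  shows bdec_value_closed: "bdec G v a \<in> carrier x"
    and bdec_add: "w \<in> carrier (bounded G x) \<Longrightarrow> bdec G (v \<oplus>\<^bsub>bounded G x\<^esub> w) a = bdec G v a \<oplus>\<^bsub>x\<^esub> bdec G w a"
    and bdec_smult: "t \<in> carrier k \<Longrightarrow> bdec G (t \<odot>\<^bsub>bounded G x\<^esub> v) a = t \<odot>\<^bsub>x\<^esub> bdec G v a"
    and bdec_act: "g \<in> carrier G \<Longrightarrow> bdec G (gact (bounded G x) g v) a = gact x g (bdec G v (inv\<^bsub>G\<^esub> g \<otimes>\<^bsub>G\<^esub> a))"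
proof -
  note gb = group_module_bounded[OF x]
  show "bdec G v a \<in> carrier x"
    using bdec_closed[OF x v] a by (auto simp: PiE_iff)
  show "bdec G (v \<oplus>\<^bsub>bounded G x\<^esub> w) a = bdec G v a \<oplus>\<^bsub>x\<^esub> bdec G w a" if "w \<in> carrier (bounded G x)"
    using fun_cong[OF gmaps_add[OF bdec_gmaps[OF x] v that], of a] a v that
      abelian_groupE(1)[OF group_module_abelian[OF gb] v that] by simp
  show "bdec G (t \<odot>\<^bsub>bounded G x\<^esub> v) a = t \<odot>\<^bsub>x\<^esub> bdec G v a" if "t \<in> carrier k"
    using fun_cong[OF gmaps_smult[OF bdec_gmaps[OF x] v that], of a] a v that
      module.smult_closed[OF group_module_module[OF gb] that v] by simp
  show "bdec G (gact (bounded G x) g v) a = gact x g (bdec G v (inv\<^bsub>G\<^esub> g \<otimes>\<^bsub>G\<^esub> a))" if "g \<in> carrier G"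
    using fun_cong[OF gmaps_act[OF bdec_gmaps[OF x] v that], of a] a v that gact_closed[OF gb that v] by simp
qed

lemma benc_eqI:
  fixes x :: "('k, 'u, 'g) gmodule"
  assumes x: "group_module k G x" and f: "f \<in> carrier (bfun G x)" and w: "w \<in> carrier (bounded G x)"
    and eq: "\<And>a. a \<in> carrier G \<Longrightarrow> f a = bdec G w a"
  shows "benc G f = w"
proof -
  have "f = bdec G w"
    by (rule extensionalityI[of _ "carrier G"]) (use f bdec_closed[OF x w] eq in \<open>auto simp: PiE_iff\<close>)
  then show ?thesis using benc_bdec[OF x w] by simp
qed

lemma bmap_closed:
  fixes x y :: "('k, 'u, 'g) gmodule"
  assumes x: "group_module k G x" and y: "group_module k G y" and f: "f \<in> gmaps k G x y"
    and b: "b \<in> carrier (bounded G x)"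
  shows "(\<lambda>a \<in> carrier G. f (bdec G b a)) \<in> carrier (bfun G y)"
  using gmaps_closed[OF gmaps_bfun_map[OF x y f] bdec_closed[OF x b]] bdec_closed[OF x b] by simp

lemma bmap_gmaps:
  fixes x y :: "('k, 'u, 'g) gmodule"
  assumes x: "group_module k G x" and y: "group_module k G y" and f: "f \<in> gmaps k G x y"
  shows "bmap G x f \<in> gmaps k G (bounded G x) (bounded G y)"
proof -
  note b = group_module_bounded[OF x]
  have "bmap G x f = compose (carrier (bounded G x)) (restrict (benc G) (carrier (bfun G y)))
     (compose (carrier (bounded G x)) (\<lambda>\<phi> \<in> carrier (bfun G x). \<lambda>a \<in> carrier G. f (\<phi> a))
       (restrict (bdec G) (carrier (bounded G x))))"
    using bdec_closed[OF x] bmap_closed[OF x y f]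
    by (auto simp: bmap_def compose_def fun_eq_iff simp del: bfun_simps)
  then show ?thesis
    using gmaps_comp[OF b gmaps_comp[OF b bdec_gmaps[OF x] gmaps_bfun_map[OF x y f]] benc_gmaps[OF y]]
    by simp
qed

lemma bdec_bmap:
  fixes x y :: "('k, 'u, 'g) gmodule"
  assumes "group_module k G x" "group_module k G y" "f \<in> gmaps k G x y" "b \<in> carrier (bounded G x)"
  shows "bdec G (bmap G x f b) = (\<lambda>a \<in> carrier G. f (bdec G b a))"
  using bmap_closed[OF assms] assms(4) bdec_benc_bfun[of _ y] by (simp add: bmap_def del: bfun_simps)

lemma bmap_bconst:
  fixes x y :: "('k, 'u, 'g) gmodule"
  assumes x: "group_module k G x" and y: "group_module k G y" and f: "f \<in> gmaps k G x y"
    and v: "v \<in> carrier x"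
  shows "bmap G x f (bconst G x v) = bconst G y (f v)"
proof -
  have "bdec G (bmap G x f (bconst G x v)) = bdec G (bconst G y (f v))"
    using v gmaps_closed[OF f v] gmaps_closed[OF bconst_gmaps[OF x]]
    by (auto simp: bdec_bmap[OF x y f] bdec_bconst[OF x] bdec_bconst[OF y])
  then show ?thesis
    using benc_bdec[OF y] gmaps_closed[OF bmap_gmaps[OF x y f]] gmaps_closed[OF bconst_gmaps[OF x] v]
      gmaps_closed[OF bconst_gmaps[OF y]] gmaps_closed[OF f v] by metis
qed

text \<open>Right exactness. A preimage is chosen once for each value and not for each point of
  \<open>G\<close>, so the lifted function still takes finitely many values.\<close>

lemma bmap_epis:
  fixes x y :: "('k, 'u, 'g) gmodule"
  assumes x: "group_module k G x" and y: "group_module k G y" and e: "e \<in> epis k G x y"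
  shows "bmap G x e \<in> epis k G (bounded G x) (bounded G y)"
  unfolding epis_iff
proof (intro conjI ballI)
  note e' = epis_gmaps[OF e]
  show "bmap G x e \<in> gmaps k G (bounded G x) (bounded G y)"
    by (rule bmap_gmaps[OF x y e'])
  fix b assume b: "b \<in> carrier (bounded G y)"
  define s where "s w = (SOME v. v \<in> carrier x \<and> e v = w)" for w
  have s: "s w \<in> carrier x" "e (s w) = w" if "w \<in> carrier y" for w
    using someI_ex[of "\<lambda>v. v \<in> carrier x \<and> e v = w"] e that unfolding s_def epis_iff by blast+
  note d = bdec_closed[OF y b]
  have c: "(\<lambda>a \<in> carrier G. s (bdec G b a)) \<in> carrier (bfun G x)"
    using d s by (auto simp: PiE_iff intro!: finite_image_comp[of "bdec G b" _ _ s])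
  have "bmap G x e (benc G (\<lambda>a \<in> carrier G. s (bdec G b a))) = benc G (\<lambda>a \<in> carrier G. e (s (bdec G b a)))"
    using benc_closed[OF x c] bdec_benc_bfun[OF c] by (simp add: bmap_def restrict_def cong: if_cong)
  also have "(\<lambda>a \<in> carrier G. e (s (bdec G b a))) = bdec G b"
    using d s by (intro extensionalityI[of _ "carrier G"]) (auto simp: PiE_iff)
  finally show "\<exists>v\<in>carrier (bounded G x). bmap G x e v = b"
    using benc_closed[OF x c] unfolding benc_bdec[OF y b] by (rule bexI)
qed

text \<open>Left exactness. As an equality and not merely an isomorphism, it allows kernels of
  \<open>bmap\<close> to be rewritten in place when constant maps are restricted to
  syzygies.\<close>

lemma ker_bmap:
  fixes x y :: "('k, 'u, 'g) gmodule"
  assumes x: "group_module k G x" and y: "group_module k G y" and f: "f \<in> gmaps k G x y"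
  shows "ker_module (bounded G x) (bounded G y) (bmap G x f) = bounded G (ker_module x y f)"
proof -
  note kx = group_module_ker[OF x y f]
  have "{b \<in> carrier (bounded G x). bmap G x f b = \<zero>\<^bsub>bounded G y\<^esub>} = carrier (bounded G (ker_module x y f))"
    (is "?L = ?R")
  proof (intro equalityI subsetI)
    fix b assume b: "b \<in> ?L"
    have "bdec G (bmap G x f b) = bdec G (\<zero>\<^bsub>bounded G y\<^esub>)"
      using b by simp
    also have "\<dots> = (\<lambda>a \<in> carrier G. \<zero>\<^bsub>y\<^esub>)"
      using abelian_groupE(2)[OF group_module_abelian[OF group_module_bfun[OF y]]]
        bdec_benc_bfun[of "\<zero>\<^bsub>bfun G y\<^esub>" y] by (simp add: bounded_zero[OF y])
    finally have z: "bdec G (bmap G x f b) = (\<lambda>a \<in> carrier G. \<zero>\<^bsub>y\<^esub>)" .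
    have "f (bdec G b a) = \<zero>\<^bsub>y\<^esub>" if "a \<in> carrier G" for a
      using fun_cong[OF z, of a] fun_cong[OF bdec_bmap[OF x y f, of b], of a] that b by simp
    then have "bdec G b \<in> carrier (bfun G (ker_module x y f))"
      using bdec_closed[OF x, of b] b by (auto simp: PiE_iff)
    then show "b \<in> ?R"
      using benc_closed[OF kx] benc_bdec[OF x, of b] b by fastforce
  next
    fix b assume b: "b \<in> ?R"
    note d = bdec_closed[OF kx b]
    have "bdec G b \<in> carrier (bfun G x)"
      using d by (auto simp: PiE_iff)
    then have bx: "b \<in> carrier (bounded G x)"
      using benc_closed[OF x] benc_bdec[OF kx b] by fastforce
    have "(\<lambda>a \<in> carrier G. f (bdec G b a)) = (\<lambda>a \<in> carrier G. \<zero>\<^bsub>y\<^esub>)"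
      using d by (auto simp: PiE_iff)
    then show "b \<in> ?L"
      using bx by (simp add: bmap_def bounded_zero[OF y])
  qed
  then show ?thesis
    by (simp add: ker_module_def bounded_def push_def bfun_def)
qed

end

section \<open>Projective modules\<close>

lemma projective_group_module: "projective_module k G p \<Longrightarrow> group_module k G p"
  by (simp add: projective_module_def)

lemma projective_lift:
  fixes p x y :: "('k, 'u, 'g) gmodule"
  assumes "projective_module k G p" "group_module k G x" "group_module k G y"
    and "e \<in> epis k G x y" "f \<in> gmaps k G p y"
  shows "\<exists>h \<in> gmaps k G p x. \<forall>v \<in> carrier p. e (h v) = f v"
proof -
  obtain h where h: "h \<in> gmaps k G p x" "compose (carrier p) e h = f"
    using assms unfolding projective_module_def by blast
  have "e (h v) = f v" if "v \<in> carrier p" for v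
    using that compose_eq[of v "carrier p" e h] h(2) by simp
  then show ?thesis using h(1) by blast
qed

text \<open>The module \<open>M\<close> may live on another type, as the free modules
  \<open>ffun\<close> and the modules \<open>bfun\<close> do. Its lifting property is tested only
  against surjections inside the universe, which is exactly what a retract in the universe
  inherits.\<close>

lemma projectiveI_retract:
  fixes M :: "('k, 'v, 'g) gmodule" and p :: "('k, 'u, 'g) gmodule"
  assumes p: "group_module k G p" and M: "group_module k G M"
    and i: "i \<in> gmaps k G p M" and r: "r \<in> gmaps k G M p"
    and ri: "\<And>v. v \<in> carrier p \<Longrightarrow> r (i v) = v"
    and lift: "\<And>(x :: ('k, 'u, 'g) gmodule) (y :: ('k, 'u, 'g) gmodule) e f.
      \<lbrakk>group_module k G x; group_module k G y; e \<in> epis k G x y; f \<in> gmaps k G M y\<rbrakk>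
      \<Longrightarrow> \<exists>h \<in> gmaps k G M x. \<forall>v \<in> carrier M. e (h v) = f v"
  shows "projective_module k G p"
  unfolding projective_module_def
proof (intro conjI allI impI ballI)
  fix x y :: "('k, 'u, 'g) gmodule" and e f
  assume x: "group_module k G x" and y: "group_module k G y" and e: "e \<in> epis k G x y"
    and f: "f \<in> gmaps k G p y"
  obtain h where h: "h \<in> gmaps k G M x" "\<And>v. v \<in> carrier M \<Longrightarrow> e (h v) = compose (carrier M) f r v"
    using lift[OF x y e gmaps_comp[OF M r f]] by blast
  have c: "compose (carrier p) h i \<in> gmaps k G p x"
    by (rule gmaps_comp[OF p i h(1)])
  have "compose (carrier p) e (compose (carrier p) h i) = f"
  proof (rule gmaps_eqI[OF gmaps_comp[OF p c epis_gmaps[OF e]] f])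
    fix v assume v: "v \<in> carrier p"
    then show "compose (carrier p) e (compose (carrier p) h i) v = f v"
      using h(2)[of "i v"] gmaps_closed[OF i v] by (simp add: compose_eq ri)
  qed
  with c show "\<exists>h\<in>gmaps k G p x. compose (carrier p) e h = f"
    by blast
qed (rule p)

lemma projective_retract:
  fixes p q :: "('k, 'u, 'g) gmodule"
  assumes q: "projective_module k G q" and p: "group_module k G p"
    and i: "i \<in> gmaps k G p q" and r: "r \<in> gmaps k G q p"
    and ri: "\<And>v. v \<in> carrier p \<Longrightarrow> r (i v) = v"
  shows "projective_module k G p"
  by (rule projectiveI_retract[OF p projective_group_module[OF q] i r ri projective_lift[OF q]])

section \<open>Free modules\<close>

text \<open>The free kG-module on \<open>X\<close>, with k-basis indexed by
  \<open>carrier G \<times> X\<close>. The basis elements whose group component is the identity form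
  a kG-basis.\<close>

definition ffun :: "'k ring \<Rightarrow> 'g monoid \<Rightarrow> 'u set \<Rightarrow> ('k, 'g \<times> 'u \<Rightarrow> 'k, 'g) gmodule" where
  "ffun k G X = \<lparr>carrier = {\<phi> \<in> carrier G \<times> X \<rightarrow>\<^sub>E carrier k. finite {i \<in> carrier G \<times> X. \<phi> i \<noteq> \<zero>\<^bsub>k\<^esub>}},
     monoid.mult = (\<lambda>\<phi> \<psi>. \<phi>), monoid.one = (\<lambda>i \<in> carrier G \<times> X. \<zero>\<^bsub>k\<^esub>),
     ring.zero = (\<lambda>i \<in> carrier G \<times> X. \<zero>\<^bsub>k\<^esub>), add = (\<lambda>\<phi> \<psi>. \<lambda>i \<in> carrier G \<times> X. \<phi> i \<oplus>\<^bsub>k\<^esub> \<psi> i),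
     smult = (\<lambda>c \<phi>. \<lambda>i \<in> carrier G \<times> X. c \<otimes>\<^bsub>k\<^esub> \<phi> i),
     gact = (\<lambda>g \<phi>. \<lambda>i \<in> carrier G \<times> X. \<phi> (inv\<^bsub>G\<^esub> g \<otimes>\<^bsub>G\<^esub> fst i, snd i))\<rparr>"

lemma ffun_simps [simp]:
  "carrier (ffun k G X) = {\<phi> \<in> carrier G \<times> X \<rightarrow>\<^sub>E carrier k. finite {i \<in> carrier G \<times> X. \<phi> i \<noteq> \<zero>\<^bsub>k\<^esub>}}"
  "\<zero>\<^bsub>ffun k G X\<^esub> = (\<lambda>i \<in> carrier G \<times> X. \<zero>\<^bsub>k\<^esub>)"
  "add (ffun k G X) = (\<lambda>\<phi> \<psi>. \<lambda>i \<in> carrier G \<times> X. \<phi> i \<oplus>\<^bsub>k\<^esub> \<psi> i)"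
  "smult (ffun k G X) = (\<lambda>c \<phi>. \<lambda>i \<in> carrier G \<times> X. c \<otimes>\<^bsub>k\<^esub> \<phi> i)"
  "gact (ffun k G X) = (\<lambda>g \<phi>. \<lambda>i \<in> carrier G \<times> X. \<phi> (inv\<^bsub>G\<^esub> g \<otimes>\<^bsub>G\<^esub> fst i, snd i))"
  by (simp_all add: ffun_def)

definition fdelta :: "'k ring \<Rightarrow> 'g monoid \<Rightarrow> 'u set \<Rightarrow> 'g \<times> 'u \<Rightarrow> 'g \<times> 'u \<Rightarrow> 'k" where
  "fdelta k G X i = (\<lambda>j \<in> carrier G \<times> X. if j = i then \<one>\<^bsub>k\<^esub> else \<zero>\<^bsub>k\<^esub>)"

text \<open>Values are prescribed on the whole k-basis \<open>carrier G \<times> X\<close>.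
  Equivariance is imposed separately in \<open>lin_ext_gmaps\<close>, so that the same formula also
  gives maps that are only k-linear.\<close>

definition lin_ext :: "'k ring \<Rightarrow> 'g monoid \<Rightarrow> 'u set \<Rightarrow> ('k, 'v, 'g) gmodule \<Rightarrow> ('g \<times> 'u \<Rightarrow> 'v)
    \<Rightarrow> ('g \<times> 'u \<Rightarrow> 'k) \<Rightarrow> 'v" where
  "lin_ext k G X y s = (\<lambda>\<phi> \<in> carrier (ffun k G X).
     finsum y (\<lambda>i. \<phi> i \<odot>\<^bsub>y\<^esub> s i) {i \<in> carrier G \<times> X. \<phi> i \<noteq> \<zero>\<^bsub>k\<^esub>})"

lemma ffun_memI:
  assumes "\<And>i. i \<in> carrier G \<times> X \<Longrightarrow> \<phi> i \<in> carrier k" "finite S"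
    "\<And>i. \<lbrakk>i \<in> carrier G \<times> X; i \<notin> S\<rbrakk> \<Longrightarrow> \<phi> i = \<zero>\<^bsub>k\<^esub>"
  shows "restrict \<phi> (carrier G \<times> X) \<in> carrier (ffun k G X)"
proof -
  have "finite {i \<in> carrier G \<times> X. restrict \<phi> (carrier G \<times> X) i \<noteq> \<zero>\<^bsub>k\<^esub>}"
    by (rule finite_subset[OF _ assms(2)]) (use assms(3) in auto)
  then show ?thesis using assms(1) by simp
qed

lemma group_module_ffun:
  fixes k :: "'k ring" and G :: "'g monoid" and X :: "'u set"
  assumes "cring k" "group G"
  shows "group_module k G (ffun k G X)"
proof -
  interpret k: cring k by fact
  interpret group G by fact
  let ?supp = "\<lambda>\<phi>. {i \<in> carrier G \<times> X. \<phi> i \<noteq> \<zero>\<^bsub>k\<^esub>}"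
  show ?thesis
  proof (rule group_moduleI)
    fix \<phi> assume \<phi>: "\<phi> \<in> carrier (ffun k G X)"
    show "\<exists>\<psi>\<in>carrier (ffun k G X). \<psi> \<oplus>\<^bsub>ffun k G X\<^esub> \<phi> = \<zero>\<^bsub>ffun k G X\<^esub>"
    proof (rule bexI)
      show "(\<lambda>i \<in> carrier G \<times> X. \<ominus>\<^bsub>k\<^esub> \<phi> i) \<in> carrier (ffun k G X)"
        by (rule ffun_memI[where S = "?supp \<phi>"]) (use \<phi> in \<open>auto simp: PiE_iff\<close>)
      show "(\<lambda>i \<in> carrier G \<times> X. \<ominus>\<^bsub>k\<^esub> \<phi> i) \<oplus>\<^bsub>ffun k G X\<^esub> \<phi> = \<zero>\<^bsub>ffun k G X\<^esub>"
        using \<phi> by (auto simp: PiE_iff fun_eq_iff k.l_neg restrict_def)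
    qed
    show "gact (ffun k G X) \<one>\<^bsub>G\<^esub> \<phi> = \<phi>"
      using \<phi> by (auto simp: PiE_iff intro!: extensionalityI[of _ "carrier G \<times> X"])
  next
    fix g \<phi> assume g: "g \<in> carrier G" and \<phi>: "\<phi> \<in> carrier (ffun k G X)"
    have "finite ((\<lambda>i. (g \<otimes>\<^bsub>G\<^esub> fst i, snd i)) ` {i \<in> carrier G \<times> X. \<phi> i \<noteq> \<zero>\<^bsub>k\<^esub>})"
      using \<phi> by simp
    moreover have "{i \<in> carrier G \<times> X. \<phi> (inv\<^bsub>G\<^esub> g \<otimes>\<^bsub>G\<^esub> fst i, snd i) \<noteq> \<zero>\<^bsub>k\<^esub>}
        \<subseteq> (\<lambda>i. (g \<otimes>\<^bsub>G\<^esub> fst i, snd i)) ` {i \<in> carrier G \<times> X. \<phi> i \<noteq> \<zero>\<^bsub>k\<^esub>}"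
    proof
      fix i assume "i \<in> {i \<in> carrier G \<times> X. \<phi> (inv\<^bsub>G\<^esub> g \<otimes>\<^bsub>G\<^esub> fst i, snd i) \<noteq> \<zero>\<^bsub>k\<^esub>}"
      then show "i \<in> (\<lambda>i. (g \<otimes>\<^bsub>G\<^esub> fst i, snd i)) ` {i \<in> carrier G \<times> X. \<phi> i \<noteq> \<zero>\<^bsub>k\<^esub>}"
        using g by (intro image_eqI[of _ _ "(inv\<^bsub>G\<^esub> g \<otimes>\<^bsub>G\<^esub> fst i, snd i)"])
          (auto simp: m_assoc[symmetric])
    qed
    ultimately have "finite {i \<in> carrier G \<times> X. \<phi> (inv\<^bsub>G\<^esub> g \<otimes>\<^bsub>G\<^esub> fst i, snd i) \<noteq> \<zero>\<^bsub>k\<^esub>}"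
      by (rule finite_subset[rotated])
    then show "gact (ffun k G X) g \<phi> \<in> carrier (ffun k G X)"
      unfolding ffun_simps(5) by (rule ffun_memI[rotated]) (use g \<phi> in \<open>auto simp: PiE_iff\<close>)
  next
    fix \<phi> \<psi> assume "\<phi> \<in> carrier (ffun k G X)" "\<psi> \<in> carrier (ffun k G X)"
    then show "\<phi> \<oplus>\<^bsub>ffun k G X\<^esub> \<psi> \<in> carrier (ffun k G X)"
      unfolding ffun_simps(3)
      by (intro ffun_memI[where S = "?supp \<phi> \<union> ?supp \<psi>"]) (auto simp: PiE_iff)
  next
    fix c \<phi> assume "c \<in> carrier k" "\<phi> \<in> carrier (ffun k G X)"
    then show "c \<odot>\<^bsub>ffun k G X\<^esub> \<phi> \<in> carrier (ffun k G X)"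
      unfolding ffun_simps(4) by (intro ffun_memI[where S = "?supp \<phi>"]) (auto simp: PiE_iff)
  next
    fix g h \<phi> assume "g \<in> carrier G" "h \<in> carrier G" "\<phi> \<in> carrier (ffun k G X)"
    then show "gact (ffun k G X) (g \<otimes>\<^bsub>G\<^esub> h) \<phi> = gact (ffun k G X) g (gact (ffun k G X) h \<phi>)"
      by (auto simp: fun_eq_iff restrict_def PiE_iff inv_mult_group m_assoc)
  qed (use assms in \<open>auto simp: fun_eq_iff PiE_iff restrict_def extensional_def
      k.a_assoc k.l_distr k.r_distr k.m_assoc intro: k.a_comm\<close>)
qed

lemma fdelta_closed:
  assumes "cring k"
  shows "fdelta k G X i \<in> carrier (ffun k G X)"
proof -
  interpret k: cring k by fact
  have "finite {j \<in> carrier G \<times> X. fdelta k G X i j \<noteq> \<zero>\<^bsub>k\<^esub>}"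
    by (rule finite_subset[of _ "{i}"]) (auto simp: fdelta_def)
  then show ?thesis
    by (auto simp: fdelta_def)
qed

lemma gact_fdelta:
  assumes "group G" "g \<in> carrier G" "a \<in> carrier G" "v \<in> X"
  shows "gact (ffun k G X) g (fdelta k G X (a, v)) = fdelta k G X (g \<otimes>\<^bsub>G\<^esub> a, v)"
proof -
  interpret group G by fact
  have "inv\<^bsub>G\<^esub> g \<otimes>\<^bsub>G\<^esub> b = a \<longleftrightarrow> b = g \<otimes>\<^bsub>G\<^esub> a" if "b \<in> carrier G" for b
    using assms(2,3) that inv_solve_left'[of b g a] by (metis inv_solve_left)
  then show ?thesis
    using assms by (auto simp: fdelta_def fun_eq_iff restrict_def)
qed

lemma linear_maps_ffun_eqI:
  fixes y :: "('k, 'v, 'g) gmodule"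
  assumes "cring k" and y: "group_module k G y"
    and A: "A \<in> linear_maps k (ffun k G X) y" and B: "B \<in> linear_maps k (ffun k G X) y"
    and AB: "\<And>i. i \<in> carrier G \<times> X \<Longrightarrow> A (fdelta k G X i) = B (fdelta k G X i)"
    and \<phi>: "\<phi> \<in> carrier (ffun k G X)"
  shows "A \<phi> = B \<phi>"
proof -
  interpret k: cring k by fact
  interpret y: group_module k G y by fact
  let ?I = "carrier G \<times> X" and ?F = "ffun k G X"
  interpret F: group_module k G "ffun k G X"
    by (rule group_module_ffun[OF k.is_cring y.is_group])
  have A': "A (\<phi> \<oplus>\<^bsub>?F\<^esub> \<psi>) = A \<phi> \<oplus>\<^bsub>y\<^esub> A \<psi>" "A (c \<odot>\<^bsub>?F\<^esub> \<phi>) = c \<odot>\<^bsub>y\<^esub> A \<phi>" "A \<phi> \<in> carrier y"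
    if "\<phi> \<in> carrier ?F" "\<psi> \<in> carrier ?F" "c \<in> carrier k" for \<phi> \<psi> c
    using A that unfolding linear_maps_def by blast+
  have B': "B (\<phi> \<oplus>\<^bsub>?F\<^esub> \<psi>) = B \<phi> \<oplus>\<^bsub>y\<^esub> B \<psi>" "B (c \<odot>\<^bsub>?F\<^esub> \<phi>) = c \<odot>\<^bsub>y\<^esub> B \<phi>" "B \<phi> \<in> carrier y"
    if "\<phi> \<in> carrier ?F" "\<psi> \<in> carrier ?F" "c \<in> carrier k" for \<phi> \<psi> c
    using B that unfolding linear_maps_def by blast+
  have z: "A \<zero>\<^bsub>?F\<^esub> = B \<zero>\<^bsub>?F\<^esub>"
    using A'(2,3)[OF F.M.zero_closed F.M.zero_closed k.zero_closed]
      B'(2,3)[OF F.M.zero_closed F.M.zero_closed k.zero_closed]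
    by (simp del: ffun_simps)
  \<comment> \<open>Induction on a finite set \<open>S\<close> that contains the support;
    \<open>S\<close> need not consist of indices, hence the case distinction on \<open>i\<close>.
    Splitting off the multiple of \<open>fdelta\<close> at \<open>i\<close> shrinks the
    support.\<close>
  have "\<forall>\<phi> \<in> carrier ?F. {i \<in> ?I. \<phi> i \<noteq> \<zero>\<^bsub>k\<^esub>} \<subseteq> S \<longrightarrow> A \<phi> = B \<phi>" if "finite S" for S
    using that
  proof (induction S)
    case empty
    have "\<phi> = \<zero>\<^bsub>?F\<^esub>" if "\<phi> \<in> carrier ?F" "{i \<in> ?I. \<phi> i \<noteq> \<zero>\<^bsub>k\<^esub>} \<subseteq> {}" for \<phi>
      using that by (auto simp: PiE_iff intro!: extensionalityI[of _ ?I])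
    then show ?case using z by blast
  next
    case (insert i S)
    show ?case
    proof (intro ballI impI)
      fix \<phi> assume \<phi>: "\<phi> \<in> carrier ?F" and sub: "{j \<in> ?I. \<phi> j \<noteq> \<zero>\<^bsub>k\<^esub>} \<subseteq> insert i S"
      show "A \<phi> = B \<phi>"
      proof (cases "i \<in> ?I")
        case False
        then have "{j \<in> ?I. \<phi> j \<noteq> \<zero>\<^bsub>k\<^esub>} \<subseteq> S"
          using sub by auto
        then show ?thesis using insert \<phi> by blast
      next
        case True
        define \<psi> where "\<psi> = (\<lambda>j \<in> ?I. if j = i then \<zero>\<^bsub>k\<^esub> else \<phi> j)"
        have \<psi>F: "\<psi> \<in> carrier ?F"
          unfolding \<psi>_def
          by (rule ffun_memI[where S = "{j \<in> ?I. \<phi> j \<noteq> \<zero>\<^bsub>k\<^esub>}"]) (use \<phi> in \<open>auto simp: PiE_iff\<close>)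
        have \<psi>S: "{j \<in> ?I. \<psi> j \<noteq> \<zero>\<^bsub>k\<^esub>} \<subseteq> S"
          using sub by (auto simp: \<psi>_def)
        have c: "\<phi> i \<in> carrier k"
          using \<phi> True by (auto simp: PiE_iff)
        note d = fdelta_closed[OF k.is_cring, of G X i]
        have "\<phi> = \<psi> \<oplus>\<^bsub>?F\<^esub> \<phi> i \<odot>\<^bsub>?F\<^esub> fdelta k G X i"
          using \<phi> c True by (auto simp: \<psi>_def fdelta_def PiE_iff intro!: extensionalityI[of _ ?I])
        moreover have "A \<psi> = B \<psi>"
          using insert.IH \<psi>F \<psi>S by blast
        then have "A (\<psi> \<oplus>\<^bsub>?F\<^esub> \<phi> i \<odot>\<^bsub>?F\<^esub> fdelta k G X i) = B (\<psi> \<oplus>\<^bsub>?F\<^esub> \<phi> i \<odot>\<^bsub>?F\<^esub> fdelta k G X i)"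
          using A'(1)[OF \<psi>F F.smult_closed[OF c d] c] A'(2)[OF d d c]
            B'(1)[OF \<psi>F F.smult_closed[OF c d] c] B'(2)[OF d d c] AB[OF True]
          by (simp del: ffun_simps)
        ultimately show ?thesis by simp
      qed
    qed
  qed
  then show ?thesis using \<phi> by auto
qed

lemma
  fixes y :: "('k, 'v, 'g) gmodule"
  assumes "cring k" and y: "group_module k G y" and s: "\<And>i. i \<in> carrier G \<times> X \<Longrightarrow> s i \<in> carrier y"
  shows lin_ext_linear: "lin_ext k G X y s \<in> linear_maps k (ffun k G X) y"
    and lin_ext_fdelta: "i \<in> carrier G \<times> X \<Longrightarrow> lin_ext k G X y s (fdelta k G X i) = s i"
proof -
  interpret k: cring k by fact
  interpret y: group_module k G y by fact
  let ?I = "carrier G \<times> X" and ?F = "ffun k G X" and ?L = "lin_ext k G X y s"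
  interpret F: group_module k G "ffun k G X"
    by (rule group_module_ffun[OF k.is_cring y.is_group])
  \<comment> \<open>The sum may run over any finite set of indices containing the support, so that
    two functions can be added over the union of their supports.\<close>
  have L: "?L \<phi> = finsum y (\<lambda>i. \<phi> i \<odot>\<^bsub>y\<^esub> s i) S"
    if \<phi>: "\<phi> \<in> carrier ?F" and S: "finite S" "S \<subseteq> ?I" "{i \<in> ?I. \<phi> i \<noteq> \<zero>\<^bsub>k\<^esub>} \<subseteq> S" for \<phi> S
  proof -
    have "finsum y (\<lambda>i. \<phi> i \<odot>\<^bsub>y\<^esub> s i) {i \<in> ?I. \<phi> i \<noteq> \<zero>\<^bsub>k\<^esub>} = finsum y (\<lambda>i. \<phi> i \<odot>\<^bsub>y\<^esub> s i) S"
      by (rule y.M.add.finprod_mono_neutral_cong_left[OF S(1,3)])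
         (use \<phi> S(2) s in \<open>auto simp: PiE_iff subset_iff\<close>)
    then show ?thesis
      using \<phi> by (simp add: lin_ext_def del: ffun_simps)
  qed
  have mem: "(\<lambda>i. \<phi> i \<odot>\<^bsub>y\<^esub> s i) \<in> S \<rightarrow> carrier y" if "\<phi> \<in> carrier ?F" "S \<subseteq> ?I" for \<phi> S
    using that s by (auto simp: PiE_iff subset_iff)
  have fin: "finite {i \<in> ?I. \<phi> i \<noteq> \<zero>\<^bsub>k\<^esub>}" if "\<phi> \<in> carrier ?F" for \<phi>
    using that by simp
  have "?L \<phi> \<in> carrier y" if "\<phi> \<in> carrier ?F" for \<phi>
    using L[OF that fin[OF that]] mem[OF that] y.M.add.finprod_closed by simp
  moreover have "?L (\<phi> \<oplus>\<^bsub>?F\<^esub> \<psi>) = ?L \<phi> \<oplus>\<^bsub>y\<^esub> ?L \<psi>" if \<phi>: "\<phi> \<in> carrier ?F" and \<psi>: "\<psi> \<in> carrier ?F" for \<phi> \<psi>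
  proof -
    let ?S = "{i \<in> ?I. \<phi> i \<noteq> \<zero>\<^bsub>k\<^esub>} \<union> {i \<in> ?I. \<psi> i \<noteq> \<zero>\<^bsub>k\<^esub>}"
    have S: "finite ?S" "?S \<subseteq> ?I"
      using fin[OF \<phi>] fin[OF \<psi>] by auto
    note sm = F.M.a_closed[OF \<phi> \<psi>]
    have "?L (\<phi> \<oplus>\<^bsub>?F\<^esub> \<psi>) = finsum y (\<lambda>i. (\<phi> \<oplus>\<^bsub>?F\<^esub> \<psi>) i \<odot>\<^bsub>y\<^esub> s i) ?S"
      by (rule L[OF sm S]) auto
    also have "\<dots> = finsum y (\<lambda>i. \<phi> i \<odot>\<^bsub>y\<^esub> s i \<oplus>\<^bsub>y\<^esub> \<psi> i \<odot>\<^bsub>y\<^esub> s i) ?S"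
      by (rule y.M.add.finprod_cong')
         (use mem[OF \<phi> S(2)] mem[OF \<psi> S(2)] \<phi> \<psi> s in \<open>auto simp: PiE_iff y.smult_l_distr\<close>)
    also have "\<dots> = finsum y (\<lambda>i. \<phi> i \<odot>\<^bsub>y\<^esub> s i) ?S \<oplus>\<^bsub>y\<^esub> finsum y (\<lambda>i. \<psi> i \<odot>\<^bsub>y\<^esub> s i) ?S"
      by (rule y.M.add.finprod_multf[OF mem[OF \<phi> S(2)] mem[OF \<psi> S(2)]])
    also have "\<dots> = ?L \<phi> \<oplus>\<^bsub>y\<^esub> ?L \<psi>"
      using L[OF \<phi> S] L[OF \<psi> S] by simp
    finally show ?thesis .
  qed
  moreover have "?L (c \<odot>\<^bsub>?F\<^esub> \<phi>) = c \<odot>\<^bsub>y\<^esub> ?L \<phi>" if c: "c \<in> carrier k" and \<phi>: "\<phi> \<in> carrier ?F" for c \<phi>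
  proof -
    let ?S = "{i \<in> ?I. \<phi> i \<noteq> \<zero>\<^bsub>k\<^esub>}"
    have S: "finite ?S" "?S \<subseteq> ?I"
      using fin[OF \<phi>] by auto
    have "?L (c \<odot>\<^bsub>?F\<^esub> \<phi>) = finsum y (\<lambda>i. (c \<odot>\<^bsub>?F\<^esub> \<phi>) i \<odot>\<^bsub>y\<^esub> s i) ?S"
      by (rule L[OF F.smult_closed[OF c \<phi>] S]) (use c in auto)
    also have "\<dots> = finsum y (\<lambda>i. c \<odot>\<^bsub>y\<^esub> (\<phi> i \<odot>\<^bsub>y\<^esub> s i)) ?S"
      by (rule y.M.add.finprod_cong')
         (use mem[OF \<phi> S(2)] c \<phi> s in \<open>auto simp: PiE_iff y.smult_assoc1\<close>)
    also have "\<dots> = c \<odot>\<^bsub>y\<^esub> finsum y (\<lambda>i. \<phi> i \<odot>\<^bsub>y\<^esub> s i) ?S"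
      using y.finsum_smult_ldistr[OF S(1) c mem[OF \<phi> S(2)]] by simp
    also have "\<dots> = c \<odot>\<^bsub>y\<^esub> ?L \<phi>"
      using L[OF \<phi> S] by simp
    finally show ?thesis .
  qed
  moreover have "?L \<in> extensional (carrier ?F)"
    by (simp add: lin_ext_def)
  ultimately show "?L \<in> linear_maps k ?F y"
    unfolding linear_maps_def PiE_iff by blast
  show "?L (fdelta k G X i) = s i" if "i \<in> ?I"
  proof -
    have "?L (fdelta k G X i) = finsum y (\<lambda>j. fdelta k G X i j \<odot>\<^bsub>y\<^esub> s j) {i}"
      by (rule L[OF fdelta_closed[OF k.is_cring]]) (use that in \<open>auto simp: fdelta_def\<close>)
    also have "\<dots> = s i"
      using that s[OF that] by (simp add: fdelta_def)
    finally show ?thesis .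
  qed
qed

lemma gmaps_linear: "f \<in> gmaps k G x y \<Longrightarrow> f \<in> linear_maps k x y"
  by (simp add: gmaps_def)

lemma lin_ext_gmaps:
  fixes y :: "('k, 'v, 'g) gmodule"
  assumes k: "cring k" and y: "group_module k G y"
    and s: "\<And>i. i \<in> carrier G \<times> X \<Longrightarrow> s i \<in> carrier y"
    and eq: "\<And>g a v. \<lbrakk>g \<in> carrier G; a \<in> carrier G; v \<in> X\<rbrakk> \<Longrightarrow> s (g \<otimes>\<^bsub>G\<^esub> a, v) = gact y g (s (a, v))"
  shows "lin_ext k G X y s \<in> gmaps k G (ffun k G X) y"
proof -
  interpret y: group_module k G y by fact
  let ?I = "carrier G \<times> X" and ?F = "ffun k G X" and ?L = "lin_ext k G X y s"
  have F: "group_module k G ?F"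
    by (rule group_module_ffun[OF k y.is_group])
  interpret F: group_module k G "ffun k G X" by (rule F)
  note lin = lin_ext_linear[of k G y X s, OF k y s]
  have L: "?L (\<phi> \<oplus>\<^bsub>?F\<^esub> \<psi>) = ?L \<phi> \<oplus>\<^bsub>y\<^esub> ?L \<psi>" "?L (c \<odot>\<^bsub>?F\<^esub> \<phi>) = c \<odot>\<^bsub>y\<^esub> ?L \<phi>" "?L \<phi> \<in> carrier y"
    if "\<phi> \<in> carrier ?F" "\<psi> \<in> carrier ?F" "c \<in> carrier k" for \<phi> \<psi> c
    using lin that unfolding linear_maps_def by blast+
  have "?L (gact ?F g \<phi>) = gact y g (?L \<phi>)" if g: "g \<in> carrier G" and \<phi>: "\<phi> \<in> carrier ?F" for g \<phi>
  proof -
    \<comment> \<open>For fixed \<open>g\<close> both sides are k-linear in \<open>\<phi>\<close>,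
      so it suffices to compare them on the basis.\<close>
    let ?A = "\<lambda>\<phi> \<in> carrier ?F. ?L (gact ?F g \<phi>)" and ?B = "\<lambda>\<phi> \<in> carrier ?F. gact y g (?L \<phi>)"
    have c: "\<zero>\<^bsub>k\<^esub> \<in> carrier k" by simp
    have gc: "gact ?F g \<phi> \<in> carrier ?F" if "\<phi> \<in> carrier ?F" for \<phi>
      by (rule gact_closed[OF F g that])
    note simps = gc gact_closed[OF y g] gact_add[OF F g] gact_smult[OF F g] gact_add[OF y g] gact_smult[OF y g]
      L(1)[OF _ _ c] L(2) L(3)[OF _ F.M.zero_closed c] F.M.a_closed F.smult_closed
    have "?A \<in> linear_maps k ?F y"
      unfolding linear_maps_def by (auto simp: simps simp del: ffun_simps)
    moreover have "?B \<in> linear_maps k ?F y"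
      unfolding linear_maps_def by (auto simp: simps simp del: ffun_simps)
    moreover have "?A (fdelta k G X i) = ?B (fdelta k G X i)" if "i \<in> ?I" for i
    proof (cases i)
      case (Pair a v)
      then show ?thesis
        using that g eq[of g a v] fdelta_closed[OF k]
          lin_ext_fdelta[of k G y X s "(a, v)", OF k y s] lin_ext_fdelta[of k G y X s "(g \<otimes>\<^bsub>G\<^esub> a, v)", OF k y s]
        by (simp add: gact_fdelta[OF y.is_group] del: ffun_simps)
    qed
    ultimately have "?A \<phi> = ?B \<phi>"
      by (rule linear_maps_ffun_eqI[OF k y _ _ _ \<phi>])
    then show ?thesis using \<phi> by simp
  qed
  then show ?thesis
    using lin by (simp add: gmaps_def del: ffun_simps)
qed

text \<open>Modules over the trivial subgroup stand for k-modules without leaving the type of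
  \<open>G\<close>: \<open>projective_module k (triv_subgroup G)\<close> expresses
  k-projectivity.\<close>

definition triv_subgroup :: "'g monoid \<Rightarrow> 'g monoid" where
  "triv_subgroup G = G\<lparr>carrier := {\<one>\<^bsub>G\<^esub>}\<rparr>"

lemma group_module_triv:
  assumes "group_module k G x"
  shows "group_module k (triv_subgroup G) x"
  unfolding triv_subgroup_def
  by (rule group_module_subgroup[OF assms]) (use assms in \<open>simp add: group_module_group group.triv_subgroup\<close>)

lemma gmaps_triv:
  assumes "group G" "f \<in> gmaps k G x y"
  shows "f \<in> gmaps k (triv_subgroup G) x y"
  unfolding triv_subgroup_def
  by (rule gmaps_subgroup[OF assms(2)]) (use assms(1) in \<open>simp add: group.is_monoid monoid.one_closed\<close>)

lemma gmaps_triv_iff: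
  assumes "group_module k (triv_subgroup G) x" "group_module k (triv_subgroup G) y"
  shows "f \<in> gmaps k (triv_subgroup G) x y \<longleftrightarrow> f \<in> linear_maps k x y"
proof -
  interpret x: group_module k "triv_subgroup G" x by fact
  interpret y: group_module k "triv_subgroup G" y by fact
  have 1: "gact x \<one>\<^bsub>G\<^esub> v = v" if "v \<in> carrier x" for v
    using x.gact_one[OF that] by (simp add: triv_subgroup_def)
  have 2: "gact y \<one>\<^bsub>G\<^esub> v = v" if "v \<in> carrier y" for v
    using y.gact_one[OF that] by (simp add: triv_subgroup_def)
  show ?thesis
    using 1 2 by (auto simp: gmaps_def triv_subgroup_def linear_maps_def PiE_iff)
qed

lemma ffun_lift:
  fixes x y :: "('k, 'u, 'g) gmodule"
  assumes k: "cring k" and x: "group_module k G x" and y: "group_module k G y"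
    and e: "e \<in> epis k G x y" and f: "f \<in> gmaps k G (ffun k G X) y"
  shows "\<exists>h \<in> gmaps k G (ffun k G X) x. \<forall>v \<in> carrier (ffun k G X). e (h v) = f v"
proof -
  interpret x: group_module k G x by fact
  let ?F = "ffun k G X"
  have F: "group_module k G ?F"
    by (rule group_module_ffun[OF k x.is_group])
  define t where "t w = (SOME v. v \<in> carrier x \<and> e v = w)" for w
  have t: "t w \<in> carrier x" "e (t w) = w" if "w \<in> carrier y" for w
    using someI_ex[of "\<lambda>v. v \<in> carrier x \<and> e v = w"] e that unfolding t_def epis_iff by blast+
  \<comment> \<open>A preimage is chosen at the identity only and then translated, which makes the
    prescribed values equivariant.\<close>
  define s where "s i = gact x (fst i) (t (f (fdelta k G X (\<one>\<^bsub>G\<^esub>, snd i))))" for i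
  have fd: "f (fdelta k G X i) \<in> carrier y" for i
    by (rule gmaps_closed[OF f fdelta_closed[OF k]])
  have s: "s i \<in> carrier x" if "i \<in> carrier G \<times> X" for i
    using that fd t gact_closed[OF x] by (auto simp: s_def)
  have h: "lin_ext k G X x s \<in> gmaps k G ?F x"
    by (rule lin_ext_gmaps[OF k x s]) (use fd t in \<open>auto simp: s_def x.gact_mult\<close>)
  note c = gmaps_comp[OF F h epis_gmaps[OF e]]
  have "compose (carrier ?F) e (lin_ext k G X x s) (fdelta k G X i) = f (fdelta k G X i)"
    if i: "i \<in> carrier G \<times> X" for i
  proof -
    have "compose (carrier ?F) e (lin_ext k G X x s) (fdelta k G X i) = e (s i)"
      using lin_ext_fdelta[of k G x X s, OF k x s i] fdelta_closed[OF k, of G X i]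
      by (simp add: compose_eq del: ffun_simps)
    also have "\<dots> = gact y (fst i) (f (fdelta k G X (\<one>\<^bsub>G\<^esub>, snd i)))"
      using i t fd by (auto simp: s_def gmaps_act[OF epis_gmaps[OF e]])
    also have "\<dots> = f (gact ?F (fst i) (fdelta k G X (\<one>\<^bsub>G\<^esub>, snd i)))"
      using i gmaps_act[OF f fdelta_closed[OF k]] by auto
    also have "\<dots> = f (fdelta k G X i)"
      using i by (auto simp: gact_fdelta[OF x.is_group] simp del: ffun_simps)
    finally show ?thesis .
  qed
  then have "compose (carrier ?F) e (lin_ext k G X x s) \<phi> = f \<phi>" if "\<phi> \<in> carrier ?F" for \<phi>
    by (rule linear_maps_ffun_eqI[OF k y gmaps_linear[OF c] gmaps_linear[OF f] _ that])
  then show ?thesis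
    using h by (auto simp: compose_eq simp del: ffun_simps)
qed

lemma ffun_lift_triv:
  fixes x y :: "('k, 'u, 'g) gmodule"
  assumes k: "cring k" and G: "group G" and x: "group_module k (triv_subgroup G) x"
    and y: "group_module k (triv_subgroup G) y"
    and e: "e \<in> epis k (triv_subgroup G) x y" and f: "f \<in> gmaps k (triv_subgroup G) (ffun k G X) y"
  shows "\<exists>h \<in> gmaps k (triv_subgroup G) (ffun k G X) x. \<forall>v \<in> carrier (ffun k G X). e (h v) = f v"
proof -
  let ?F = "ffun k G X"
  have F: "group_module k (triv_subgroup G) ?F"
    by (rule group_module_triv[OF group_module_ffun[OF k G]])
  text \<open>Linear extension refers to \<open>G\<close>-modules, so \<open>G\<close> is made to act trivially on \<open>x\<close> and \<open>y\<close>.\<close>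
  have tr: "group_module k G (z\<lparr>gact := \<lambda>_ v. v\<rparr>)" if "group_module k (triv_subgroup G) z"
    for z :: "('k, 'u, 'g) gmodule"
  proof -
    interpret z: group_module k "triv_subgroup G" z by fact
    show ?thesis
      by (rule group_moduleI) (use k G z.M.a_assoc z.M.l_neg in \<open>auto simp: z.smult_l_distr
          z.smult_r_distr z.smult_assoc1 intro: z.M.a_comm bexI[of _ "\<ominus>\<^bsub>z\<^esub> _"]\<close>)
  qed
  have lm: "linear_maps k ?F (z\<lparr>gact := \<lambda>_ v. v\<rparr>) = linear_maps k ?F z" for z :: "('k, 'u, 'g) gmodule"
    by (simp add: linear_maps_def)
  \<comment> \<open>Over k the module is free on all of \<open>carrier G \<times> X\<close>, so the
    preimages are chosen independently at every index.\<close>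
  define s where "s i = (SOME v. v \<in> carrier x \<and> e v = f (fdelta k G X i))" for i
  have fd: "f (fdelta k G X i) \<in> carrier y" for i
    by (rule gmaps_closed[OF f fdelta_closed[OF k]])
  have s: "s i \<in> carrier x" "e (s i) = f (fdelta k G X i)" for i
    using someI_ex[of "\<lambda>v. v \<in> carrier x \<and> e v = f (fdelta k G X i)"] e fd
    unfolding s_def epis_iff by blast+
  define h where "h = lin_ext k G X (x\<lparr>gact := \<lambda>_ v. v\<rparr>) s"
  have h: "h \<in> gmaps k (triv_subgroup G) ?F x"
    using lin_ext_linear[of k G "x\<lparr>gact := \<lambda>_ v. v\<rparr>" X s, OF k tr[OF x]] s
    by (simp add: lm gmaps_triv_iff[OF F x] h_def)
  note c = gmaps_comp[OF F h epis_gmaps[OF e]]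
  have hd: "h (fdelta k G X i) = s i" if "i \<in> carrier G \<times> X" for i
    using lin_ext_fdelta[of k G "x\<lparr>gact := \<lambda>_ v. v\<rparr>" X s, OF k tr[OF x] _ that] s by (simp add: h_def)
  have "compose (carrier ?F) e h \<phi> = f \<phi>" if "\<phi> \<in> carrier ?F" for \<phi>
  proof (rule linear_maps_ffun_eqI[OF k tr[OF y] _ _ _ that])
    show "compose (carrier ?F) e h (fdelta k G X i) = f (fdelta k G X i)" if "i \<in> carrier G \<times> X" for i
      using hd[OF that] s fdelta_closed[OF k, of G X i] by (simp add: compose_eq del: ffun_simps)
  qed (use gmaps_linear[OF c] gmaps_linear[OF f] lm in auto)
  then show ?thesis
    using h by (auto simp: compose_eq simp del: ffun_simps)
qed

context group_universe begin

text \<open>What has to be known about free modules is proved here for one cover at once. It then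
  passes to arbitrary projective modules, which are retracts of such covers.\<close>

lemma free_cover:
  fixes y :: "('k, 'u, 'g) gmodule"
  assumes y: "group_module k G y"
  obtains P :: "('k, 'u, 'g) gmodule" and e \<mu> where
    "projective_module k G P" "e \<in> epis k G P y" "projective_module k (triv_subgroup G) P"
    "\<mu> \<in> gmaps k G (bounded G P) P" "\<And>v. v \<in> carrier P \<Longrightarrow> \<mu> (bconst G P v) = v"
proof -
  interpret y: group_module k G y by fact
  define X where "X = carrier y"
  let ?I = "carrier G \<times> X" and ?F = "ffun k G X"
  let ?A = "(carrier G \<times> (UNIV :: 'u set)) \<times> carrier k"
  have F: "group_module k G ?F"
    by (rule group_module_ffun[OF cring group])
  obtain e0 :: "(('g \<times> 'u) \<times> 'k) set \<Rightarrow> 'u" where e0: "inj_on e0 (Fpow ?A)"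
    using finite_set_encoding[OF infinite_UNIV, of ?A] times_UNIV_lepoll[OF infinite_UNIV _ scalars_lepoll]
      times_UNIV_lepoll[OF infinite_UNIV group_lepoll lepoll_refl] by blast
  \<comment> \<open>The graph of \<open>\<phi>\<close> over its support is a finite set of pairs,
    hence codable in the universe.\<close>
  define enc where "enc \<phi> = e0 ((\<lambda>i. (i, \<phi> i)) ` {i \<in> ?I. \<phi> i \<noteq> \<zero>\<^bsub>k\<^esub>})" for \<phi> :: "'g \<times> 'u \<Rightarrow> 'k"
  have inj: "inj_on enc (carrier ?F)"
  proof (rule inj_onI)
    fix \<phi> \<psi> assume \<phi>: "\<phi> \<in> carrier ?F" and \<psi>: "\<psi> \<in> carrier ?F" and eq: "enc \<phi> = enc \<psi>"
    have fin: "(\<lambda>i. (i, \<chi> i)) ` {i \<in> ?I. \<chi> i \<noteq> \<zero>\<^bsub>k\<^esub>} \<in> Fpow ?A" if "\<chi> \<in> carrier ?F" for \<chi>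
      using that by (auto simp: Fpow_def PiE_iff)
    have eq': "(\<lambda>i. (i, \<phi> i)) ` {i \<in> ?I. \<phi> i \<noteq> \<zero>\<^bsub>k\<^esub>} = (\<lambda>i. (i, \<psi> i)) ` {i \<in> ?I. \<psi> i \<noteq> \<zero>\<^bsub>k\<^esub>}"
      using inj_onD[OF e0 _ fin[OF \<phi>] fin[OF \<psi>]] eq by (simp add: enc_def)
    have "\<phi> i = \<psi> i" if "i \<in> ?I" for i
    proof -
      have "\<phi> i \<noteq> \<zero>\<^bsub>k\<^esub> \<Longrightarrow> (i, \<phi> i) \<in> (\<lambda>i. (i, \<psi> i)) ` {i \<in> ?I. \<psi> i \<noteq> \<zero>\<^bsub>k\<^esub>}"
        unfolding eq'[symmetric] using that by blast
      moreover have "\<psi> i \<noteq> \<zero>\<^bsub>k\<^esub> \<Longrightarrow> (i, \<psi> i) \<in> (\<lambda>i. (i, \<phi> i)) ` {i \<in> ?I. \<phi> i \<noteq> \<zero>\<^bsub>k\<^esub>}"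
        unfolding eq' using that by blast
      ultimately show ?thesis by (cases "\<phi> i = \<zero>\<^bsub>k\<^esub>"; cases "\<psi> i = \<zero>\<^bsub>k\<^esub>") auto
    qed
    then show "\<phi> = \<psi>"
      using \<phi> \<psi> by (auto simp: PiE_iff intro!: extensionalityI[of _ ?I])
  qed
  define dec where "dec = inv_into (carrier ?F) enc"
  have de: "dec (enc \<phi>) = \<phi>" if "\<phi> \<in> carrier ?F" for \<phi>
    unfolding dec_def using inv_into_f_f[OF inj that] .
  define P where "P = push enc dec ?F"
  define r where "r = restrict enc (carrier ?F)"
  define i where "i = restrict dec (carrier P)"
  have P: "group_module k G P"
    unfolding P_def by (rule group_module_push_inj[OF F de])
  have r: "r \<in> gmaps k G ?F P"
    unfolding P_def r_def by (rule push_inj_map[OF F de])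
  have i: "i \<in> gmaps k G P ?F"
    unfolding P_def i_def by (rule push_inj_inv[OF F de])
  have ri: "r (i v) = v" if "v \<in> carrier P" for v
    using that de by (auto simp: P_def r_def i_def simp del: ffun_simps)
  have ir: "i (r \<phi>) = \<phi>" if "\<phi> \<in> carrier ?F" for \<phi>
    using that de by (auto simp: P_def r_def i_def simp del: ffun_simps)
  have projP: "projective_module k G P"
    by (rule projectiveI_retract[OF P F i r ri ffun_lift[OF cring]])
  have projP1: "projective_module k (triv_subgroup G) P"
    by (rule projectiveI_retract[OF group_module_triv[OF P] group_module_triv[OF F]
          gmaps_triv[OF group i] gmaps_triv[OF group r] ri ffun_lift_triv[OF cring group]])
  define s where "s j = gact y (fst j) (snd j)" for j
  have s: "s j \<in> carrier y" if "j \<in> ?I" for j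
    using that gact_closed[OF y] by (auto simp: s_def X_def)
  have L: "lin_ext k G X y s \<in> gmaps k G ?F y"
    by (rule lin_ext_gmaps[OF cring y s]) (auto simp: s_def X_def y.gact_mult)
  define e where "e = compose (carrier P) (lin_ext k G X y s) i"
  have "e \<in> epis k G P y"
    unfolding epis_iff
  proof (intro conjI ballI)
    show "e \<in> gmaps k G P y"
      unfolding e_def by (rule gmaps_comp[OF P i L])
    fix w assume w: "w \<in> carrier y"
    have d: "fdelta k G X (\<one>\<^bsub>G\<^esub>, w) \<in> carrier ?F"
      by (rule fdelta_closed[OF cring])
    have "e (r (fdelta k G X (\<one>\<^bsub>G\<^esub>, w))) = lin_ext k G X y s (fdelta k G X (\<one>\<^bsub>G\<^esub>, w))"
      using gmaps_closed[OF r d] ir[OF d] by (simp add: e_def compose_eq)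
    also have "\<dots> = s (\<one>\<^bsub>G\<^esub>, w)"
      by (rule lin_ext_fdelta[OF cring y s]) (use w in \<open>auto simp: X_def\<close>)
    also have "\<dots> = w"
      using w by (simp add: s_def y.gact_one)
    finally show "\<exists>v\<in>carrier P. e v = w"
      using gmaps_closed[OF r d] by blast
  qed
  moreover
  note bP = group_module_bounded[OF P]
  \<comment> \<open>Diagonal evaluation: the value of \<open>b\<close> at \<open>a\<close>, itself a
    function on indices, is read at the indices with first component \<open>a\<close>. Translation
    moves \<open>a\<close> and the index alike, so this is equivariant; on a constant function it
    returns the constant.\<close>
  define m where "m b = (\<lambda>j \<in> ?I. i (bdec G b (fst j)) j)" for b
  have bd: "bdec G b a \<in> carrier P" if "b \<in> carrier (bounded G P)" "a \<in> carrier G" for a b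
    by (rule bdec_value_closed[OF P that])
  have ib: "i v j \<in> carrier k" if "v \<in> carrier P" "j \<in> ?I" for v j
    using gmaps_closed[OF i that(1)] that(2) by (auto simp: PiE_iff)
  have M: "restrict m (carrier (bounded G P)) \<in> gmaps k G (bounded G P) ?F"
  proof (rule gmapsI[OF bP])
    fix b assume b: "b \<in> carrier (bounded G P)"
    \<comment> \<open>The support of \<open>m b\<close> lies in the union of the supports of the
      values of \<open>b\<close>, and there are only finitely many values.\<close>
    have "{j \<in> ?I. m b j \<noteq> \<zero>\<^bsub>k\<^esub>} \<subseteq> (\<Union>v \<in> bdec G b ` carrier G. {j \<in> ?I. i v j \<noteq> \<zero>\<^bsub>k\<^esub>})"
      by (auto simp: m_def)
    moreover have "finite (\<Union>v \<in> bdec G b ` carrier G. {j \<in> ?I. i v j \<noteq> \<zero>\<^bsub>k\<^esub>})"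
    proof (rule finite_UN_I)
      show "finite (bdec G b ` carrier G)"
        using bdec_closed[OF P b] by simp
      show "finite {j \<in> ?I. i v j \<noteq> \<zero>\<^bsub>k\<^esub>}" if v: "v \<in> bdec G b ` carrier G" for v
      proof -
        have "i v \<in> carrier ?F"
          by (rule gmaps_closed[OF i]) (use bd[OF b] v in auto)
        then show ?thesis by simp
      qed
    qed
    ultimately have "finite {j \<in> ?I. m b j \<noteq> \<zero>\<^bsub>k\<^esub>}"
      by (rule finite_subset)
    moreover have "m b \<in> ?I \<rightarrow>\<^sub>E carrier k"
      using ib bd[OF b] by (auto simp: m_def)
    ultimately show "m b \<in> carrier ?F"
      by simp
  next
    fix b c assume b: "b \<in> carrier (bounded G P)" and c: "c \<in> carrier (bounded G P)"
    note bdec_add[OF P b _ c]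
    moreover have "i (v \<oplus>\<^bsub>P\<^esub> w) j = i v j \<oplus>\<^bsub>k\<^esub> i w j" if "v \<in> carrier P" "w \<in> carrier P" "j \<in> ?I" for v w j
      using fun_cong[OF gmaps_add[OF i that(1,2)], of j] that(3) by simp
    ultimately show "m (b \<oplus>\<^bsub>bounded G P\<^esub> c) = m b \<oplus>\<^bsub>?F\<^esub> m c"
      using bd[OF b] bd[OF c] by (auto simp: m_def fun_eq_iff restrict_def)
  next
    fix t b assume t: "t \<in> carrier k" and b: "b \<in> carrier (bounded G P)"
    note bdec_smult[OF P b _ t]
    moreover have "i (t \<odot>\<^bsub>P\<^esub> v) j = t \<otimes>\<^bsub>k\<^esub> i v j" if "v \<in> carrier P" "j \<in> ?I" for v j
      using fun_cong[OF gmaps_smult[OF i that(1) t], of j] that(2) by simp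
    ultimately show "m (t \<odot>\<^bsub>bounded G P\<^esub> b) = t \<odot>\<^bsub>?F\<^esub> m b"
      using bd[OF b] by (auto simp: m_def fun_eq_iff restrict_def)
  next
    fix g b assume g: "g \<in> carrier G" and b: "b \<in> carrier (bounded G P)"
    note bdec_act[OF P b _ g]
    moreover have "i (gact P g v) j = i v (inv\<^bsub>G\<^esub> g \<otimes>\<^bsub>G\<^esub> fst j, snd j)" if "v \<in> carrier P" "j \<in> ?I" for v j
      using fun_cong[OF gmaps_act[OF i that(1) g], of j] that(2) by simp
    moreover have "inv\<^bsub>G\<^esub> g \<otimes>\<^bsub>G\<^esub> a \<in> carrier G" if "a \<in> carrier G" for a
      using g that by simp
    ultimately show "m (gact (bounded G P) g b) = gact ?F g (m b)"
      using bd[OF b] by (auto simp: m_def fun_eq_iff restrict_def)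
  qed
  define \<mu> where "\<mu> = compose (carrier (bounded G P)) r (restrict m (carrier (bounded G P)))"
  have "\<mu> \<in> gmaps k G (bounded G P) P"
    unfolding \<mu>_def by (rule gmaps_comp[OF bP M r])
  moreover have "\<mu> (bconst G P v) = v" if v: "v \<in> carrier P" for v
  proof -
    note b = gmaps_closed[OF bconst_gmaps[OF P] v]
    have "m (bconst G P v) = i v"
      using gmaps_closed[OF i v] by (auto simp: m_def bdec_bconst[OF P v] PiE_iff intro!: extensionalityI[of _ ?I])
    then show ?thesis
      using b ri[OF v] by (simp add: \<mu>_def compose_eq)
  qed
  ultimately show ?thesis
    using that projP projP1 by blast
qed

lemma enough_projectives:
  fixes y :: "('k, 'u, 'g) gmodule"
  assumes "group_module k G y"
  shows "\<exists>p :: ('k, 'u, 'g) gmodule. \<exists>e. projective_module k G p \<and> e \<in> epis k G p y"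
  using free_cover[OF assms] by blast

text \<open>The splitting \<open>s\<close> of the free cover carries both properties from
  \<open>P\<close> to \<open>p\<close>; for the second, naturality of the constant map under
  \<open>bmap\<close> is used.\<close>

lemma
  fixes p :: "('k, 'u, 'g) gmodule"
  assumes p: "projective_module k G p"
  shows projective_triv: "projective_module k (triv_subgroup G) p"
    and projective_bconst_retract:
      "\<exists>\<mu> \<in> gmaps k G (bounded G p) p. \<forall>v \<in> carrier p. \<mu> (bconst G p v) = v"
proof -
  note gp = projective_group_module[OF p]
  obtain P :: "('k, 'u, 'g) gmodule" and e \<mu> where P: "projective_module k G P" and e: "e \<in> epis k G P p"
    and P1: "projective_module k (triv_subgroup G) P" and \<mu>: "\<mu> \<in> gmaps k G (bounded G P) P"
    and \<mu>c: "\<And>v. v \<in> carrier P \<Longrightarrow> \<mu> (bconst G P v) = v"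
    using free_cover[OF gp] by blast
  note gP = projective_group_module[OF P]
  obtain s where s: "s \<in> gmaps k G p P" "\<forall>v \<in> carrier p. e (s v) = v"
    using projective_lift[OF p gP gp e gmaps_id[OF gp]] by auto
  show "projective_module k (triv_subgroup G) p"
    by (rule projective_retract[OF P1 group_module_triv[OF gp] gmaps_triv[OF group s(1)]
          gmaps_triv[OF group epis_gmaps[OF e]]]) (use s in auto)
  note bp = group_module_bounded[OF gp]
  note bm = bmap_gmaps[OF gp gP s(1)]
  let ?m = "compose (carrier (bounded G p)) e (compose (carrier (bounded G p)) \<mu> (bmap G p s))"
  have "?m \<in> gmaps k G (bounded G p) p"
    by (rule gmaps_comp[OF bp gmaps_comp[OF bp bm \<mu>] epis_gmaps[OF e]])
  moreover have "?m (bconst G p v) = v" if v: "v \<in> carrier p" for v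
    using v s(2) gmaps_closed[OF bconst_gmaps[OF gp] v] \<mu>c[OF gmaps_closed[OF s(1) v]]
    by (simp add: compose_eq bmap_bconst[OF gp gP s(1)])
  ultimately show "\<exists>\<mu> \<in> gmaps k G (bounded G p) p. \<forall>v \<in> carrier p. \<mu> (bconst G p v) = v"
    by blast
qed

end

section \<open>Maps that factor through a projective module\<close>

lemma tpI:
  fixes x y p :: "('k, 'u, 'g) gmodule"
  assumes "projective_module k G p" "a \<in> gmaps k G x p" "b \<in> gmaps k G p y" "t \<in> gmaps k G x y"
    and "\<And>v. v \<in> carrier x \<Longrightarrow> t v = b (a v)"
  shows "t \<in> through_projective k G x y"
proof -
  have "t = compose (carrier x) b a"
    using assms(5) gmaps_extensional[OF assms(4)]
    by (intro extensionalityI[of _ "carrier x"]) (auto simp: compose_eq)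
  then show ?thesis
    using assms unfolding through_projective_def by blast
qed

lemma tpE:
  fixes x y :: "('k, 'u, 'g) gmodule"
  assumes "t \<in> through_projective k G x y"
  obtains p :: "('k, 'u, 'g) gmodule" and a b where "projective_module k G p" "a \<in> gmaps k G x p"
    "b \<in> gmaps k G p y" "\<And>v. v \<in> carrier x \<Longrightarrow> t v = b (a v)"
proof -
  obtain p :: "('k, 'u, 'g) gmodule" and a b where *: "projective_module k G p" "a \<in> gmaps k G x p"
    "b \<in> gmaps k G p y" "t = compose (carrier x) b a"
    using assms unfolding through_projective_def by blast
  show ?thesis
    by (rule that[OF *(1,2,3)]) (simp add: *(4) compose_eq)
qed

lemma tp_gmaps:
  assumes "group_module k G x" "t \<in> through_projective k G x y"
  shows "t \<in> gmaps k G x y"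
  using assms gmaps_comp unfolding through_projective_def by blast

lemma tp_left:
  fixes x y z :: "('k, 'u, 'g) gmodule"
  assumes x: "group_module k G x" and t: "t \<in> through_projective k G x y" and g: "g \<in> gmaps k G y z"
    and s: "s \<in> gmaps k G x z" and eq: "\<And>v. v \<in> carrier x \<Longrightarrow> s v = g (t v)"
  shows "s \<in> through_projective k G x z"
proof -
  obtain p :: "('k, 'u, 'g) gmodule" and a b where *: "projective_module k G p" "a \<in> gmaps k G x p"
    "b \<in> gmaps k G p y" "\<And>v. v \<in> carrier x \<Longrightarrow> t v = b (a v)"
    using tpE[OF t] by blast
  show ?thesis
    by (rule tpI[OF *(1,2) gmaps_comp[OF projective_group_module[OF *(1)] *(3) g] s])
       (use eq *(4) gmaps_closed[OF *(2)] in \<open>simp add: compose_eq\<close>)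
qed

lemma tp_right:
  fixes x y w :: "('k, 'u, 'g) gmodule"
  assumes w: "group_module k G w" and t: "t \<in> through_projective k G x y" and f: "f \<in> gmaps k G w x"
    and s: "s \<in> gmaps k G w y" and eq: "\<And>v. v \<in> carrier w \<Longrightarrow> s v = t (f v)"
  shows "s \<in> through_projective k G w y"
proof -
  obtain p :: "('k, 'u, 'g) gmodule" and a b where *: "projective_module k G p" "a \<in> gmaps k G x p"
    "b \<in> gmaps k G p y" "\<And>v. v \<in> carrier x \<Longrightarrow> t v = b (a v)"
    using tpE[OF t] by blast
  show ?thesis
    by (rule tpI[OF *(1) gmaps_comp[OF w f *(2)] *(3) s])
       (use eq *(4) gmaps_closed[OF f] in \<open>simp add: compose_eq\<close>)
qed

lemma tp_to_projective:
  fixes p x :: "('k, 'u, 'g) gmodule"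
  assumes "projective_module k G p" "f \<in> gmaps k G x p"
  shows "f \<in> through_projective k G x p"
  by (rule tpI[OF assms(1) assms(2) gmaps_id[OF projective_group_module[OF assms(1)]] assms(2)])
     (use gmaps_closed[OF assms(2)] in simp)

lemma tp_id_projective:
  fixes x :: "('k, 'u, 'g) gmodule"
  assumes x: "group_module k G x" and t: "(\<lambda>v \<in> carrier x. v) \<in> through_projective k G x x"
  shows "projective_module k G x"
proof -
  obtain p :: "('k, 'u, 'g) gmodule" and a b where *: "projective_module k G p" "a \<in> gmaps k G x p"
    "b \<in> gmaps k G p x" "\<And>v. v \<in> carrier x \<Longrightarrow> (\<lambda>v \<in> carrier x. v) v = b (a v)"
    using tpE[OF t] by blast
  show ?thesis
    by (rule projective_retract[OF *(1) x *(2,3)]) (use *(4) in auto)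
qed

section \<open>Direct sums, and sums of maps that factor through projectives\<close>

definition sum_module :: "('k, 'u, 'g) gmodule \<Rightarrow> ('k, 'v, 'g) gmodule \<Rightarrow> ('k, 'u \<times> 'v, 'g) gmodule" where
  "sum_module p q = \<lparr>carrier = carrier p \<times> carrier q,
     monoid.mult = (\<lambda>a b. a), monoid.one = (\<one>\<^bsub>p\<^esub>, \<one>\<^bsub>q\<^esub>), ring.zero = (\<zero>\<^bsub>p\<^esub>, \<zero>\<^bsub>q\<^esub>),
     add = (\<lambda>a b. (fst a \<oplus>\<^bsub>p\<^esub> fst b, snd a \<oplus>\<^bsub>q\<^esub> snd b)),
     smult = (\<lambda>c a. (c \<odot>\<^bsub>p\<^esub> fst a, c \<odot>\<^bsub>q\<^esub> snd a)),
     gact = (\<lambda>g a. (gact p g (fst a), gact q g (snd a)))\<rparr>"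

lemma sum_module_simps [simp]:
  "carrier (sum_module p q) = carrier p \<times> carrier q" "\<zero>\<^bsub>sum_module p q\<^esub> = (\<zero>\<^bsub>p\<^esub>, \<zero>\<^bsub>q\<^esub>)"
  "add (sum_module p q) = (\<lambda>a b. (fst a \<oplus>\<^bsub>p\<^esub> fst b, snd a \<oplus>\<^bsub>q\<^esub> snd b))"
  "smult (sum_module p q) = (\<lambda>c a. (c \<odot>\<^bsub>p\<^esub> fst a, c \<odot>\<^bsub>q\<^esub> snd a))"
  "gact (sum_module p q) = (\<lambda>g a. (gact p g (fst a), gact q g (snd a)))"
  by (simp_all add: sum_module_def)

lemma group_module_sum:
  assumes p: "group_module k G p" and q: "group_module k G q"
  shows "group_module k G (sum_module p q)"
proof -
  interpret p: group_module k G p by fact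
  interpret q: group_module k G q by fact
  show ?thesis
  proof (rule group_moduleI)
    fix v assume "v \<in> carrier (sum_module p q)"
    then show "\<exists>w\<in>carrier (sum_module p q). w \<oplus>\<^bsub>sum_module p q\<^esub> v = \<zero>\<^bsub>sum_module p q\<^esub>"
      by (intro bexI[of _ "(\<ominus>\<^bsub>p\<^esub> fst v, \<ominus>\<^bsub>q\<^esub> snd v)"]) (auto simp: p.M.l_neg q.M.l_neg)
  qed (use p.R.is_cring p.is_group in \<open>auto simp: p.M.a_assoc q.M.a_assoc p.smult_l_distr q.smult_l_distr
      p.smult_r_distr q.smult_r_distr p.smult_assoc1 q.smult_assoc1 gact_closed[OF p] gact_closed[OF q]
      gact_add[OF p] gact_add[OF q] gact_smult[OF p] gact_smult[OF q] p.gact_one q.gact_one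
      p.gact_mult q.gact_mult intro: p.M.a_comm q.M.a_comm\<close>)
qed

lemma sum_module_copair:
  assumes p: "group_module k G p" and q: "group_module k G q" and x: "group_module k G x"
    and a: "a \<in> gmaps k G p x" and b: "b \<in> gmaps k G q x"
  shows "(\<lambda>w \<in> carrier (sum_module p q). a (fst w) \<oplus>\<^bsub>x\<^esub> b (snd w)) \<in> gmaps k G (sum_module p q) x"
proof -
  interpret x: group_module k G x by fact
  note ac = gmaps_closed[OF a] and bc = gmaps_closed[OF b]
  show ?thesis
    by (rule gmapsI[OF group_module_sum[OF p q]])
       (use ac bc in \<open>auto simp: gmaps_add[OF a] gmaps_add[OF b] gmaps_smult[OF a] gmaps_smult[OF b]
         gmaps_act[OF a] gmaps_act[OF b] gact_add[OF x] x.smult_r_distr x.M.a_ac\<close>)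
qed

lemma sum_module_pair:
  assumes x: "group_module k G x" and a: "a \<in> gmaps k G x p" and b: "b \<in> gmaps k G x q"
  shows "(\<lambda>v \<in> carrier x. (a v, b v)) \<in> gmaps k G x (sum_module p q)"
  by (rule gmapsI[OF x])
     (auto simp: gmaps_closed[OF a] gmaps_closed[OF b] gmaps_add[OF a] gmaps_add[OF b] gmaps_smult[OF a]
       gmaps_smult[OF b] gmaps_act[OF a] gmaps_act[OF b])

lemma
  assumes p: "group_module k G p" and q: "group_module k G q"
  shows sum_module_in1: "(\<lambda>v \<in> carrier p. (v, \<zero>\<^bsub>q\<^esub>)) \<in> gmaps k G p (sum_module p q)"
    and sum_module_in2: "(\<lambda>v \<in> carrier q. (\<zero>\<^bsub>p\<^esub>, v)) \<in> gmaps k G q (sum_module p q)"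
proof -
  interpret p: group_module k G p by fact
  interpret q: group_module k G q by fact
  show "(\<lambda>v \<in> carrier p. (v, \<zero>\<^bsub>q\<^esub>)) \<in> gmaps k G p (sum_module p q)"
    by (rule gmapsI[OF p]) (auto simp: gact_zero[OF q])
  show "(\<lambda>v \<in> carrier q. (\<zero>\<^bsub>p\<^esub>, v)) \<in> gmaps k G q (sum_module p q)"
    by (rule gmapsI[OF q]) (auto simp: gact_zero[OF p])
qed

lemma sum_module_lift:
  fixes p q x y :: "('k, 'u, 'g) gmodule"
  assumes p: "projective_module k G p" and q: "projective_module k G q"
    and x: "group_module k G x" and y: "group_module k G y"
    and e: "e \<in> epis k G x y" and f: "f \<in> gmaps k G (sum_module p q) y"
  shows "\<exists>h \<in> gmaps k G (sum_module p q) x. \<forall>w \<in> carrier (sum_module p q). e (h w) = f w"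
proof -
  interpret p: group_module k G p by (rule projective_group_module[OF p])
  interpret q: group_module k G q by (rule projective_group_module[OF q])
  note gp = projective_group_module[OF p] and gq = projective_group_module[OF q]
  note i1 = gmaps_comp[OF gp sum_module_in1[OF gp gq] f] and i2 = gmaps_comp[OF gq sum_module_in2[OF gp gq] f]
  obtain a where a: "a \<in> gmaps k G p x" "\<forall>v \<in> carrier p. e (a v) = f (v, \<zero>\<^bsub>q\<^esub>)"
    using projective_lift[OF p x y e i1] by (auto simp: compose_eq)
  obtain b where b: "b \<in> gmaps k G q x" "\<forall>v \<in> carrier q. e (b v) = f (\<zero>\<^bsub>p\<^esub>, v)"
    using projective_lift[OF q x y e i2] by (auto simp: compose_eq)
  let ?h = "\<lambda>w \<in> carrier (sum_module p q). a (fst w) \<oplus>\<^bsub>x\<^esub> b (snd w)"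
  have "e (?h w) = f w" if w: "w \<in> carrier (sum_module p q)" for w
  proof (cases w)
    case (Pair v v')
    then have "e (?h w) = f (v, \<zero>\<^bsub>q\<^esub>) \<oplus>\<^bsub>y\<^esub> f (\<zero>\<^bsub>p\<^esub>, v')"
      using w a b gmaps_closed[OF a(1)] gmaps_closed[OF b(1)] by (simp add: gmaps_add[OF epis_gmaps[OF e]])
    also have "\<dots> = f w"
      using gmaps_add[OF f, of "(v, \<zero>\<^bsub>q\<^esub>)" "(\<zero>\<^bsub>p\<^esub>, v')"] w Pair by simp
    finally show ?thesis .
  qed
  then show ?thesis
    using sum_module_copair[OF gp gq x a(1) b(1)] by blast
qed

context group_universe begin

text \<open>The sum factors through the direct sum of the two projective modules. It is coded back
  into the universe because \<open>through_projective\<close> quantifies only over modules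
  there.\<close>

lemma tp_sum:
  fixes x y :: "('k, 'u, 'g) gmodule"
  assumes x: "group_module k G x" and y: "group_module k G y"
    and t: "t \<in> through_projective k G x y" and t': "t' \<in> through_projective k G x y"
  shows "sum_map x y t t' \<in> through_projective k G x y"
proof -
  obtain p :: "('k, 'u, 'g) gmodule" and a b where p: "projective_module k G p" "a \<in> gmaps k G x p"
    "b \<in> gmaps k G p y" "\<And>v. v \<in> carrier x \<Longrightarrow> t v = b (a v)"
    using tpE[OF t] by blast
  obtain q :: "('k, 'u, 'g) gmodule" and a' b' where q: "projective_module k G q" "a' \<in> gmaps k G x q"
    "b' \<in> gmaps k G q y" "\<And>v. v \<in> carrier x \<Longrightarrow> t' v = b' (a' v)"
    using tpE[OF t'] by blast
  note gp = projective_group_module[OF p(1)] and gq = projective_group_module[OF q(1)]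
  let ?S = "sum_module p q"
  have S: "group_module k G ?S"
    by (rule group_module_sum[OF gp gq])
  obtain enc :: "'u \<times> 'u \<Rightarrow> 'u" where "inj enc"
    using times_UNIV_lepoll[OF infinite_UNIV lepoll_refl lepoll_refl] by (auto simp: lepoll_def)
  then have de: "inv_into UNIV enc (enc w) = w" if "w \<in> carrier ?S" for w by simp
  let ?s = "push enc (inv_into UNIV enc) ?S"
  have s: "group_module k G ?s"
    by (rule group_module_push_inj[where \<phi> = enc and \<psi> = "inv_into UNIV enc", OF S de])
  let ?r = "restrict enc (carrier ?S)" and ?i = "restrict (inv_into UNIV enc) (carrier ?s)"
  have r: "?r \<in> gmaps k G ?S ?s"
    by (rule push_inj_map[where \<phi> = enc and \<psi> = "inv_into UNIV enc", OF S de])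
  have i: "?i \<in> gmaps k G ?s ?S"
    by (rule push_inj_inv[where \<phi> = enc and \<psi> = "inv_into UNIV enc", OF S de])
  have proj: "projective_module k G ?s"
    by (rule projectiveI_retract[OF s S i r _ sum_module_lift[OF p(1) q(1)]]) (use de in auto)
  let ?A = "\<lambda>v \<in> carrier x. (a v, a' v)" and ?B = "\<lambda>w \<in> carrier ?S. b (fst w) \<oplus>\<^bsub>y\<^esub> b' (snd w)"
  have A: "?A \<in> gmaps k G x ?S"
    by (rule sum_module_pair[OF x p(2) q(2)])
  have B: "?B \<in> gmaps k G ?S y"
    by (rule sum_module_copair[OF gp gq y p(3) q(3)])
  show ?thesis
  proof (rule tpI[OF proj gmaps_comp[OF x A r] gmaps_comp[OF s i B]])
    show "sum_map x y t t' \<in> gmaps k G x y"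
      by (rule gmaps_sum[OF x y tp_gmaps[OF x t] tp_gmaps[OF x t']])
    fix v assume v: "v \<in> carrier x"
    then show "sum_map x y t t' v = compose (carrier ?s) ?B ?i (compose (carrier x) ?r ?A v)"
      using gmaps_closed[OF p(2) v] gmaps_closed[OF q(2) v] p(4) q(4)
      by (simp add: sum_map_def compose_eq de)
  qed
qed

lemma tp_zero:
  fixes x y :: "('k, 'u, 'g) gmodule"
  assumes x: "group_module k G x" and y: "group_module k G y"
  shows "zero_map x y \<in> through_projective k G x y"
proof -
  obtain p :: "('k, 'u, 'g) gmodule" where p: "projective_module k G p"
    using enough_projectives[OF x] by blast
  note gp = projective_group_module[OF p]
  show ?thesis
    by (rule tpI[OF p gmaps_zero_map[OF x gp] gmaps_zero_map[OF gp y] gmaps_zero_map[OF x y]])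
       (use group_module_abelian[OF gp] in \<open>auto simp: zero_map_def dest: abelian_groupE(2)\<close>)
qed

lemma tp_neg:
  fixes x y :: "('k, 'u, 'g) gmodule"
  assumes x: "group_module k G x" and y: "group_module k G y"
    and t: "t \<in> through_projective k G x y" and s: "s \<in> gmaps k G x y"
    and eq: "\<And>v. v \<in> carrier x \<Longrightarrow> s v = \<ominus>\<^bsub>y\<^esub> t v"
  shows "s \<in> through_projective k G x y"
proof -
  interpret y: group_module k G y by fact
  have "diff_map y y (zero_map y y) (\<lambda>v \<in> carrier y. v) \<in> gmaps k G y y"
    by (rule gmaps_diff[OF y y gmaps_zero_map[OF y y] gmaps_id[OF y]])
  from tp_left[OF x t this s] show ?thesis
    using eq gmaps_closed[OF tp_gmaps[OF x t]] by (simp add: diff_map_def zero_map_def y.minus_eq)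
qed

end

text \<open>Write \<open>f\<close> as \<open>b a\<close> and lift \<open>b\<close> along
  \<open>e'\<close> to \<open>b'\<close>. Then \<open>b' a e\<close> has the same image under
  \<open>e'\<close> as \<open>h\<close> and vanishes on the kernel of \<open>e\<close>; subtracting
  it from \<open>h\<close> gives a map into the kernel of \<open>e'\<close> that is unchanged on the
  kernel of \<open>e\<close>. The extension of constant maps and the effect of \<Omega> on maps
  through projectives both rest on this.\<close>

lemma tp_lift:
  fixes x y q m :: "('k, 'u, 'g) gmodule"
  assumes x: "group_module k G x" and y: "group_module k G y" and q: "group_module k G q"
    and m: "group_module k G m" and e: "e \<in> epis k G q x" and e': "e' \<in> epis k G m y"
    and f: "f \<in> through_projective k G x y" and h: "h \<in> gmaps k G q m"
    and eq: "\<And>v. v \<in> carrier q \<Longrightarrow> e' (h v) = f (e v)"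
  shows "\<exists>s \<in> gmaps k G q (ker_module m y e'). \<forall>v \<in> carrier q. e v = \<zero>\<^bsub>x\<^esub> \<longrightarrow> s v = h v"
proof -
  interpret m: group_module k G m by fact
  obtain p :: "('k, 'u, 'g) gmodule" and a b where p: "projective_module k G p" "a \<in> gmaps k G x p"
    "b \<in> gmaps k G p y" "\<And>v. v \<in> carrier x \<Longrightarrow> f v = b (a v)"
    using tpE[OF f] by blast
  note gp = projective_group_module[OF p(1)]
  obtain b' where b': "b' \<in> gmaps k G p m" "\<forall>v \<in> carrier p. e' (b' v) = b v"
    using projective_lift[OF p(1) m y e' p(3)] by blast
  define t where "t = compose (carrier q) b' (compose (carrier q) a e)"
  have t: "t \<in> gmaps k G q m"
    unfolding t_def by (rule gmaps_comp[OF q gmaps_comp[OF q epis_gmaps[OF e] p(2)] b'(1)])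
  have tv: "t v = b' (a (e v))" if "v \<in> carrier q" for v
    using that by (simp add: t_def compose_eq)
  note ec = gmaps_closed[OF epis_gmaps[OF e]]
  have "diff_map q m h t \<in> gmaps k G q (ker_module m y e')"
  proof (rule gmaps_into_ker[OF gmaps_diff[OF q m h t]])
    fix v assume v: "v \<in> carrier q"
    have "e' (h v \<ominus>\<^bsub>m\<^esub> t v) = e' (h v) \<ominus>\<^bsub>y\<^esub> e' (t v)"
      by (rule gmaps_minus[OF m y epis_gmaps[OF e'] gmaps_closed[OF h v] gmaps_closed[OF t v]])
    also have "\<dots> = \<zero>\<^bsub>y\<^esub>"
      using v ec[OF v] p(4) b'(2) gmaps_closed[OF p(2)] gmaps_closed[OF p(3)]
      by (simp add: eq tv diff_self[OF y])
    finally show "e' (diff_map q m h t v) = \<zero>\<^bsub>y\<^esub>"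
      using v by (simp add: diff_map_def)
  qed
  moreover have "diff_map q m h t v = h v" if "v \<in> carrier q" "e v = \<zero>\<^bsub>x\<^esub>" for v
    using that gmaps_closed[OF h that(1)] 
    by (simp add: diff_map_def tv gmaps_zero[OF x gp p(2)] gmaps_zero[OF gp m b'(1)] diff_zero[OF m])
  ultimately show ?thesis by blast
qed

section \<open>Vanishing of first extension groups\<close>

text \<open>Vanishing of the first Ext in elementary form. Quantifying over all surjections onto
  \<open>x\<close> frees the proofs from the chosen covers; \<open>trivial_Ext_iff\<close> makes the
  link to \<open>Ext\<close>.\<close>

definition ext_vanish :: "'k ring \<Rightarrow> 'g monoid \<Rightarrow> ('k, 'u, 'g) gmodule \<Rightarrow> ('k, 'u, 'g) gmodule \<Rightarrow> bool" where
  "ext_vanish k G x y \<longleftrightarrow> (\<forall>(m :: ('k, 'u, 'g) gmodule) e f. group_module k G m \<longrightarrow> e \<in> epis k G m x \<longrightarrow>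
     f \<in> gmaps k G (ker_module m x e) y \<longrightarrow>
     (\<exists>h \<in> gmaps k G m y. \<forall>v \<in> carrier m. e v = \<zero>\<^bsub>x\<^esub> \<longrightarrow> h v = f v))"

lemma ext_vanishD:
  fixes x y m :: "('k, 'u, 'g) gmodule"
  assumes "ext_vanish k G x y" "group_module k G m" "e \<in> epis k G m x" "f \<in> gmaps k G (ker_module m x e) y"
  shows "\<exists>h \<in> gmaps k G m y. \<forall>v \<in> carrier m. e v = \<zero>\<^bsub>x\<^esub> \<longrightarrow> h v = f v"
  using assms unfolding ext_vanish_def by blast

text \<open>One surjection from a projective module is enough to test, since every other surjection
  onto \<open>x\<close> is a pushout of it.\<close>

lemma ext_vanishI:
  fixes x y q :: "('k, 'u, 'g) gmodule"
  assumes x: "group_module k G x" and y: "group_module k G y" and q: "projective_module k G q"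
    and c: "c \<in> epis k G q x"
    and ext: "\<And>f. f \<in> gmaps k G (ker_module q x c) y \<Longrightarrow>
      \<exists>h \<in> gmaps k G q y. \<forall>v \<in> carrier q. c v = \<zero>\<^bsub>x\<^esub> \<longrightarrow> h v = f v"
  shows "ext_vanish k G x y"
  unfolding ext_vanish_def
proof (intro allI impI)
  fix m :: "('k, 'u, 'g) gmodule" and e f
  assume m: "group_module k G m" and e: "e \<in> epis k G m x" and f: "f \<in> gmaps k G (ker_module m x e) y"
  interpret x: group_module k G x by fact
  interpret y: group_module k G y by fact
  interpret m: group_module k G m by fact
  note gq = projective_group_module[OF q]
  interpret q: group_module k G q by (rule gq)
  note e' = epis_gmaps[OF e] and c' = epis_gmaps[OF c]
  note kc = group_module_ker[OF gq x c'] and ke = group_module_ker[OF m x e']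
  interpret ke: group_module k G "ker_module m x e" by (rule ke)
  obtain h where h: "h \<in> gmaps k G q m" "\<forall>v \<in> carrier q. e (h v) = c v"
    using projective_lift[OF q m x e c'] by blast
  have h': "restrict h (carrier (ker_module q x c)) \<in> gmaps k G (ker_module q x c) (ker_module m x e)"
    by (rule gmaps_ker_ker[OF kc h(1)]) (use h(2) in auto)
  obtain g where g: "g \<in> gmaps k G q y" "\<forall>v \<in> carrier q. c v = \<zero>\<^bsub>x\<^esub> \<longrightarrow> g v = f (h v)"
    using ext[OF gmaps_comp[OF kc h' f]] by (auto simp: compose_eq)
  text \<open>\<open>m\<close> is the quotient of \<open>q \<oplus> ker e\<close> by the antidiagonal copy of \<open>ker c\<close>, so the maps \<open>g\<close> and
    \<open>f\<close> glue.\<close>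
  define K where "K = sum_module q (ker_module m x e)"
  have gK: "group_module k G K"
    unfolding K_def by (rule group_module_sum[OF gq ke])
  have incl: "(\<lambda>v \<in> carrier (ker_module m x e). v) \<in> gmaps k G (ker_module m x e) m"
    by (rule gmaps_ker_incl[OF gmaps_id[OF ke]])
  let ?\<pi> = "\<lambda>w \<in> carrier K. h (fst w) \<oplus>\<^bsub>m\<^esub> (\<lambda>v \<in> carrier (ker_module m x e). v) (snd w)"
  let ?t = "\<lambda>w \<in> carrier K. g (fst w) \<oplus>\<^bsub>y\<^esub> f (snd w)"
  have \<pi>: "?\<pi> \<in> gmaps k G K m"
    unfolding K_def by (rule sum_module_copair[OF gq ke m h(1) incl])
  have t: "?t \<in> gmaps k G K y"
    unfolding K_def by (rule sum_module_copair[OF gq ke y g(1) f])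
  have \<pi>e: "\<exists>w \<in> carrier K. ?\<pi> w = v" if v: "v \<in> carrier m" for v
  proof -
    obtain u where u: "u \<in> carrier q" "c u = e v"
      using epis_surj[OF c gmaps_closed[OF e' v]] by blast
    have hu: "h u \<in> carrier m"
      using gmaps_closed[OF h(1) u(1)] .
    have "e (v \<ominus>\<^bsub>m\<^esub> h u) = \<zero>\<^bsub>x\<^esub>"
      using u v hu h(2) gmaps_closed[OF e' v] by (simp add: gmaps_minus[OF m x e'] diff_self[OF x])
    then have "(u, v \<ominus>\<^bsub>m\<^esub> h u) \<in> carrier K"
      using u v hu by (simp add: K_def)
    moreover have "?\<pi> (u, v \<ominus>\<^bsub>m\<^esub> h u) = v"
      using calculation v hu diff_add[OF m v hu] by (simp add: K_def m.M.a_comm)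
    ultimately show "\<exists>w \<in> carrier K. ?\<pi> w = v" by blast
  qed
  have van: "?t w = \<zero>\<^bsub>y\<^esub>" if w: "w \<in> carrier K" "?\<pi> w = \<zero>\<^bsub>m\<^esub>" for w
  proof -
    obtain u v where uv: "w = (u, v)" "u \<in> carrier q" "v \<in> carrier m" "e v = \<zero>\<^bsub>x\<^esub>"
      using w(1) by (auto simp: K_def)
    have hu: "h u \<in> carrier m"
      using gmaps_closed[OF h(1) uv(2)] .
    have s: "h u \<oplus>\<^bsub>m\<^esub> v = \<zero>\<^bsub>m\<^esub>"
      using w uv by (simp add: K_def)
    then have "e (h u) \<oplus>\<^bsub>x\<^esub> e v = \<zero>\<^bsub>x\<^esub>"
      using gmaps_add[OF e' hu uv(3)] gmaps_zero[OF m x e'] by simp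
    then have cu: "c u = \<zero>\<^bsub>x\<^esub>"
      using uv h(2) gmaps_closed[OF c' uv(2)] by simp
    have huk: "h u \<in> carrier (ker_module m x e)" "v \<in> carrier (ker_module m x e)"
      using hu h(2) uv cu by auto
    have "f (h u) \<oplus>\<^bsub>y\<^esub> f v = \<zero>\<^bsub>y\<^esub>"
      using gmaps_add[OF f huk] s gmaps_zero[OF ke y f] by simp
    then show ?thesis
      using w(1) uv g(2) cu by simp
  qed
  obtain F where F: "F \<in> gmaps k G m y" "\<And>w. w \<in> carrier K \<Longrightarrow> F (?\<pi> w) = ?t w"
    using gmaps_descend[OF gK m y \<pi> \<pi>e t van] by blast
  have "F v = f v" if v: "v \<in> carrier m" "e v = \<zero>\<^bsub>x\<^esub>" for v
  proof -
    have w: "(\<zero>\<^bsub>q\<^esub>, v) \<in> carrier K"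
      using v by (simp add: K_def)
    have "?\<pi> (\<zero>\<^bsub>q\<^esub>, v) = v"
      using v w by (simp add: gmaps_zero[OF gq m h(1)])
    moreover have "?t (\<zero>\<^bsub>q\<^esub>, v) = f v"
      using v w gmaps_closed[OF f, of v] by (simp add: gmaps_zero[OF gq y g(1)])
    ultimately show ?thesis
      using F(2)[OF w] by simp
  qed
  then show "\<exists>h \<in> gmaps k G m y. \<forall>v \<in> carrier m. e v = \<zero>\<^bsub>x\<^esub> \<longrightarrow> h v = f v"
    using F(1) by blast
qed

text \<open>\<Omega> of a map through a projective module factors through the cover
  \<open>q\<close>, by the extension from \<open>tp_lift\<close>. The module \<open>m\<close> is
  left arbitrary because it is \<open>bounded G q\<close> when constant maps are treated.\<close>

lemma tp_syzygy:
  fixes x y q m :: "('k, 'u, 'g) gmodule"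
  assumes x: "group_module k G x" and y: "group_module k G y" and q: "projective_module k G q"
    and m: "group_module k G m" and e: "e \<in> epis k G q x" and e': "e' \<in> epis k G m y"
    and f: "f \<in> through_projective k G x y" and h: "h \<in> gmaps k G q m"
    and eq: "\<And>v. v \<in> carrier q \<Longrightarrow> e' (h v) = f (e v)"
    and t: "t \<in> gmaps k G (ker_module q x e) (ker_module m y e')"
    and th: "\<And>v. \<lbrakk>v \<in> carrier q; e v = \<zero>\<^bsub>x\<^esub>\<rbrakk> \<Longrightarrow> t v = h v"
  shows "t \<in> through_projective k G (ker_module q x e) (ker_module m y e')"
proof -
  note gq = projective_group_module[OF q]
  note kq = group_module_ker[OF gq x epis_gmaps[OF e]]
  obtain s where s: "s \<in> gmaps k G q (ker_module m y e')" "\<forall>v \<in> carrier q. e v = \<zero>\<^bsub>x\<^esub> \<longrightarrow> s v = h v"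
    using tp_lift[OF x y gq m e e' f h eq] by blast
  show ?thesis
    by (rule tpI[OF q gmaps_ker_subset[OF kq] s(1) t]) (use s(2) th in auto)
qed

section \<open>Modules with projectively trivial constant map\<close>

definition cofibrant :: "'k ring \<Rightarrow> 'g monoid \<Rightarrow> ('k, 'u, 'g) gmodule \<Rightarrow> bool" where
  "cofibrant k G x \<longleftrightarrow> group_module k G x \<and> bconst G x \<in> through_projective k G x (bounded G x)"

lemma cofibrant_group_module: "cofibrant k G x \<Longrightarrow> group_module k G x"
  by (simp add: cofibrant_def)

context group_universe begin

text \<open>Constant maps are natural, so \<open>bconst G q\<close> lifts \<open>bconst G x\<close>,
  and \<open>tp_lift\<close> applies. Followed by \<open>bmap\<close> of a map and a retraction of
  \<open>bounded G p\<close> onto \<open>p\<close>, the result extends maps from the kernel to a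
  projective \<open>p\<close>.\<close>

lemma cofibrant_ker_extension:
  fixes x q :: "('k, 'u, 'g) gmodule"
  assumes x: "cofibrant k G x" and q: "group_module k G q" and e: "e \<in> epis k G q x"
  shows "\<exists>s \<in> gmaps k G q (bounded G (ker_module q x e)).
    \<forall>v \<in> carrier (ker_module q x e). s v = bconst G (ker_module q x e) v"
proof -
  note gx = cofibrant_group_module[OF x] and e' = epis_gmaps[OF e]
  have eq: "bmap G q e (bconst G q v) = bconst G x (e v)" if "v \<in> carrier q" for v
    by (rule bmap_bconst[OF q gx e' that])
  have "\<exists>s \<in> gmaps k G q (ker_module (bounded G q) (bounded G x) (bmap G q e)).
      \<forall>v \<in> carrier q. e v = \<zero>\<^bsub>x\<^esub> \<longrightarrow> s v = bconst G q v"
    by (rule tp_lift[OF gx group_module_bounded[OF gx] q group_module_bounded[OF q] e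
          bmap_epis[OF q gx e] _ bconst_gmaps[OF q] eq]) (use x in \<open>simp add: cofibrant_def\<close>)
  then show ?thesis
    by (auto simp: ker_bmap[OF q gx e'] bconst_def)
qed

lemma cofibrant_ker:
  fixes x q :: "('k, 'u, 'g) gmodule"
  assumes x: "cofibrant k G x" and q: "projective_module k G q" and e: "e \<in> epis k G q x"
  shows "cofibrant k G (ker_module q x e)"
proof -
  note gq = projective_group_module[OF q]
  note kq = group_module_ker[OF gq cofibrant_group_module[OF x] epis_gmaps[OF e]]
  obtain s where s: "s \<in> gmaps k G q (bounded G (ker_module q x e))"
    "\<forall>v \<in> carrier (ker_module q x e). s v = bconst G (ker_module q x e) v"
    using cofibrant_ker_extension[OF x gq e] by blast
  have "bconst G (ker_module q x e) \<in> through_projective k G (ker_module q x e) (bounded G (ker_module q x e))"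
    by (rule tpI[OF q gmaps_ker_subset[OF kq] s(1) bconst_gmaps[OF kq]]) (use s(2) in auto)
  with kq show ?thesis by (simp add: cofibrant_def)
qed

lemma cofibrant_retract:
  fixes x y :: "('k, 'u, 'g) gmodule"
  assumes y: "cofibrant k G y" and x: "group_module k G x"
    and i: "i \<in> gmaps k G x y" and r: "r \<in> gmaps k G y x" and ri: "\<And>v. v \<in> carrier x \<Longrightarrow> r (i v) = v"
  shows "cofibrant k G x"
proof -
  note gy = cofibrant_group_module[OF y]
  have t: "compose (carrier x) (bconst G y) i \<in> through_projective k G x (bounded G y)"
    by (rule tp_right[OF x _ i gmaps_comp[OF x i bconst_gmaps[OF gy]]])
       (use y in \<open>auto simp: cofibrant_def compose_eq\<close>)
  have "bconst G x \<in> through_projective k G x (bounded G x)"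
    by (rule tp_left[OF x t bmap_gmaps[OF gy x r] bconst_gmaps[OF x]])
       (use gmaps_closed[OF i] ri in \<open>simp add: compose_eq bmap_bconst[OF gy x r]\<close>)
  with x show ?thesis by (simp add: cofibrant_def)
qed

lemma cofibrant_ext_vanish_projective:
  fixes x p :: "('k, 'u, 'g) gmodule"
  assumes x: "cofibrant k G x" and p: "projective_module k G p"
  shows "ext_vanish k G x p"
proof -
  note gx = cofibrant_group_module[OF x] and gp = projective_group_module[OF p]
  obtain q :: "('k, 'u, 'g) gmodule" and c where q: "projective_module k G q" and c: "c \<in> epis k G q x"
    using enough_projectives[OF gx] by blast
  note gq = projective_group_module[OF q]
  note kq = group_module_ker[OF gq gx epis_gmaps[OF c]]
  obtain s where s: "s \<in> gmaps k G q (bounded G (ker_module q x c))"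
    "\<forall>v \<in> carrier (ker_module q x c). s v = bconst G (ker_module q x c) v"
    using cofibrant_ker_extension[OF x gq c] by blast
  obtain \<mu> where \<mu>: "\<mu> \<in> gmaps k G (bounded G p) p" "\<forall>v \<in> carrier p. \<mu> (bconst G p v) = v"
    using projective_bconst_retract[OF p] by blast
  show ?thesis
  proof (rule ext_vanishI[OF gx gp q c])
    fix f assume f: "f \<in> gmaps k G (ker_module q x c) p"
    let ?h = "compose (carrier q) \<mu> (compose (carrier q) (bmap G (ker_module q x c) f) s)"
    have "?h \<in> gmaps k G q p"
      by (rule gmaps_comp[OF gq gmaps_comp[OF gq s(1) bmap_gmaps[OF kq gp f]] \<mu>(1)])
    moreover have "?h v = f v" if "v \<in> carrier q" "c v = \<zero>\<^bsub>x\<^esub>" for v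
      using that s(2) \<mu>(2) gmaps_closed[OF f, of v] bmap_bconst[OF kq gp f, of v] by (simp add: compose_eq)
    ultimately show "\<exists>h \<in> gmaps k G q p. \<forall>v \<in> carrier q. c v = \<zero>\<^bsub>x\<^esub> \<longrightarrow> h v = f v"
      by blast
  qed
qed

text \<open>First lift to the cover \<open>q\<close>. On the kernel of \<open>c\<close> the lift
  takes values in the kernel of \<open>e\<close>; extending this restriction to \<open>q\<close> and
  subtracting it leaves a map that descends to \<open>z\<close>.\<close>

lemma ext_vanish_lift:
  fixes z p y :: "('k, 'u, 'g) gmodule"
  assumes z: "group_module k G z" and p: "group_module k G p" and y: "group_module k G y"
    and e: "e \<in> epis k G p y" and van: "ext_vanish k G z (ker_module p y e)" and f: "f \<in> gmaps k G z y"
  shows "\<exists>h \<in> gmaps k G z p. \<forall>v \<in> carrier z. e (h v) = f v"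
proof -
  obtain q :: "('k, 'u, 'g) gmodule" and c where q: "projective_module k G q" and c: "c \<in> epis k G q z"
    using enough_projectives[OF z] by blast
  note gq = projective_group_module[OF q] and c' = epis_gmaps[OF c] and e' = epis_gmaps[OF e]
  note kq = group_module_ker[OF gq z c']
  obtain g where g: "g \<in> gmaps k G q p" "\<forall>v \<in> carrier q. e (g v) = f (c v)"
    using projective_lift[OF q p y e gmaps_comp[OF gq c' f]] by (auto simp: compose_eq)
  have "restrict g (carrier (ker_module q z c)) \<in> gmaps k G (ker_module q z c) (ker_module p y e)"
    by (rule gmaps_ker_ker[OF kq g(1)]) (use g(2) gmaps_zero[OF z y f] in auto)
  from ext_vanishD[OF van gq c this] obtain h where h: "h \<in> gmaps k G q (ker_module p y e)"
    "\<forall>v \<in> carrier q. c v = \<zero>\<^bsub>z\<^esub> \<longrightarrow> h v = g v"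
    by auto
  note h' = gmaps_ker_incl[OF h(1)]
  note d = gmaps_diff[OF gq p g(1) h']
  obtain F where F: "F \<in> gmaps k G z p" "\<And>v. v \<in> carrier q \<Longrightarrow> F (c v) = diff_map q p g h v"
  proof (rule gmaps_descend[OF gq z p c' _ d])
    show "\<exists>v\<in>carrier q. c v = w" if "w \<in> carrier z" for w
      using epis_surj[OF c that] by blast
    show "diff_map q p g h v = \<zero>\<^bsub>p\<^esub>" if "v \<in> carrier q" "c v = \<zero>\<^bsub>z\<^esub>" for v
      using that h(2) gmaps_closed[OF g(1)] by (simp add: diff_map_def diff_self[OF p])
  qed blast
  have "e (F w) = f w" if w: "w \<in> carrier z" for w
  proof -
    obtain v where v: "v \<in> carrier q" "c v = w"
      using epis_surj[OF c w] by blast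
    have "e (F w) = e (g v \<ominus>\<^bsub>p\<^esub> h v)"
      using F(2)[OF v(1)] v by (simp add: diff_map_def)
    also have "\<dots> = e (g v) \<ominus>\<^bsub>y\<^esub> e (h v)"
      by (rule gmaps_minus[OF p y e' gmaps_closed[OF g(1) v(1)] gmaps_closed[OF h' v(1)]])
    also have "\<dots> = f w"
      using g(2) v gmaps_closed[OF h(1) v(1)] gmaps_closed[OF f w] by (simp add: diff_zero[OF y])
    finally show ?thesis .
  qed
  then show ?thesis using F(1) by blast
qed

text \<open>A map from the syzygy of \<open>x\<close> to \<open>y\<close> lifts to \<open>p\<close>
  by the hypothesis on the kernels, and the lift extends to \<open>q\<close> by the hypothesis on
  \<open>p\<close>. In terms of long exact sequences, Ext^1(x, y) embeds into Ext^2(x, ker e) when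
  Ext^1(x, p) = 0.\<close>

lemma ext_vanish_shift:
  fixes x q y p :: "('k, 'u, 'g) gmodule"
  assumes x: "group_module k G x" and q: "projective_module k G q" and c: "c \<in> epis k G q x"
    and y: "group_module k G y" and p: "group_module k G p" and e: "e \<in> epis k G p y"
    and xp: "ext_vanish k G x p" and ker: "ext_vanish k G (ker_module q x c) (ker_module p y e)"
  shows "ext_vanish k G x y"
proof (rule ext_vanishI[OF x y q c])
  fix f assume f: "f \<in> gmaps k G (ker_module q x c) y"
  note gq = projective_group_module[OF q]
  note kq = group_module_ker[OF gq x epis_gmaps[OF c]]
  obtain g where g: "g \<in> gmaps k G (ker_module q x c) p" "\<forall>v \<in> carrier (ker_module q x c). e (g v) = f v"
    using ext_vanish_lift[OF kq p y e ker f] by blast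
  obtain h where h: "h \<in> gmaps k G q p" "\<forall>v \<in> carrier q. c v = \<zero>\<^bsub>x\<^esub> \<longrightarrow> h v = g v"
    using ext_vanishD[OF xp gq c g(1)] by blast
  show "\<exists>h \<in> gmaps k G q y. \<forall>v \<in> carrier q. c v = \<zero>\<^bsub>x\<^esub> \<longrightarrow> h v = f v"
    by (rule bexI[OF _ gmaps_comp[OF gq h(1) epis_gmaps[OF e]]]) (use h(2) g(2) in \<open>simp add: compose_eq\<close>)
qed

lemma pd_le_group_module: "pd_le k G n y \<Longrightarrow> group_module k G y"
  by (induction rule: pd_le.induct) (auto simp: projective_group_module)

lemma cofibrant_ext_vanish:
  fixes x y :: "('k, 'u, 'g) gmodule"
  assumes "pd_le k G n y" "cofibrant k G x"
  shows "ext_vanish k G x y"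
  using assms
proof (induction arbitrary: x rule: pd_le.induct)
  case (pd_le_0 y)
  then show ?case by (simp add: cofibrant_ext_vanish_projective)
next
  case (pd_le_Suc y p e n)
  note gx = cofibrant_group_module[OF \<open>cofibrant k G x\<close>]
  obtain q :: "('k, 'u, 'g) gmodule" and c where q: "projective_module k G q" and c: "c \<in> epis k G q x"
    using enough_projectives[OF gx] by blast
  show ?case
    by (rule ext_vanish_shift[OF gx q c pd_le_Suc(1) projective_group_module[OF pd_le_Suc(2)] pd_le_Suc(3)
          cofibrant_ext_vanish_projective[OF \<open>cofibrant k G x\<close> pd_le_Suc(2)]
          pd_le_Suc(5)[OF cofibrant_ker[OF \<open>cofibrant k G x\<close> q c]]])
qed

text \<open>The converse of \<open>cofibrant_ext_vanish\<close>. It recognises the members of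
  \<open>PCof\<close> as cofibrant, and also the cokernels in
  \<open>cofibrant_cosyzygy\<close>.\<close>

lemma cofibrantI:
  fixes x :: "('k, 'u, 'g) gmodule"
  assumes x: "group_module k G x" and pd: "finite_pd k G (bounded G x)"
    and van: "\<And>y :: ('k, 'u, 'g) gmodule. finite_pd k G y \<Longrightarrow> ext_vanish k G x y"
  shows "cofibrant k G x"
proof -
  obtain n where "pd_le k G n (bounded G x)"
    using pd by (auto simp: finite_pd_def)
  then have "bconst G x \<in> through_projective k G x (bounded G x)"
  proof cases
    case pd_le_0
    then show ?thesis
      using tp_to_projective bconst_gmaps[OF x] by blast
  next
    case (pd_le_Suc p e m)
    note gp = projective_group_module[OF pd_le_Suc(3)]
    have "finite_pd k G (ker_module p (bounded G x) e)"
      using pd_le_Suc by (auto simp: finite_pd_def)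
    then obtain h where h: "h \<in> gmaps k G x p" "\<forall>v \<in> carrier x. e (h v) = bconst G x v"
      using ext_vanish_lift[OF x gp pd_le_Suc(2,4) van bconst_gmaps[OF x]] by blast
    show ?thesis
      by (rule tpI[OF pd_le_Suc(3) h(1) epis_gmaps[OF pd_le_Suc(4)] bconst_gmaps[OF x]]) (use h(2) in auto)
  qed
  with x show ?thesis by (simp add: cofibrant_def)
qed

text \<open>For a cofibrant module \<open>x\<close> the constant map embeds \<open>x\<close> into a projective module; every map from
  \<open>x\<close> to a projective module extends along this embedding.\<close>

lemma cofibrant_cosyzygy:
  fixes x :: "('k, 'u, 'g) gmodule"
  assumes x: "cofibrant k G x" and pd: "\<And>y :: ('k, 'u, 'g) gmodule. group_module k G y \<Longrightarrow> finite_pd k G (bounded G y)"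
  obtains p c :: "('k, 'u, 'g) gmodule" and e a b where "projective_module k G p" "cofibrant k G c"
    "e \<in> epis k G p c" "a \<in> gmaps k G x (ker_module p c e)" "b \<in> gmaps k G (ker_module p c e) x"
    "\<And>v. v \<in> carrier x \<Longrightarrow> b (a v) = v" "\<And>v. v \<in> carrier (ker_module p c e) \<Longrightarrow> a (b v) = v"
proof -
  note gx = cofibrant_group_module[OF x]
  obtain p :: "('k, 'u, 'g) gmodule" and \<alpha> \<beta> where p: "projective_module k G p" "\<alpha> \<in> gmaps k G x p"
    "\<beta> \<in> gmaps k G p (bounded G x)" "\<And>v. v \<in> carrier x \<Longrightarrow> bconst G x v = \<beta> (\<alpha> v)"
    using x tpE unfolding cofibrant_def by blast
  note gp = projective_group_module[OF p(1)]
  \<comment> \<open>The constant map is injective, hence so is its first factor.\<close>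
  have inj: "v = w" if "v \<in> carrier x" "w \<in> carrier x" "\<alpha> v = \<alpha> w" for v w
    using bconst_inj[OF gx that(1,2)] p(4)[OF that(1)] p(4)[OF that(2)] that(3) by simp
  obtain c :: "('k, 'u, 'g) gmodule" and e where c: "group_module k G c" and e: "e \<in> epis k G p c"
    and ker: "carrier (ker_module p c e) = \<alpha> ` carrier x"
    using cokernel_module[OF gx gp p(2)] by blast
  let ?K = "ker_module p c e"
  note gK = group_module_ker[OF gp c epis_gmaps[OF e]]
  have \<alpha>: "\<alpha> \<in> gmaps k G x ?K"
    by (rule gmaps_into_ker[OF p(2)]) (use ker in auto)
  obtain b where b: "b \<in> gmaps k G ?K x" and ba: "\<And>v. v \<in> carrier x \<Longrightarrow> b (\<alpha> v) = v"
    and ab: "\<And>w. w \<in> carrier ?K \<Longrightarrow> \<alpha> (b w) = w"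
    using gmaps_inverse[OF gx gK \<alpha> inj equalityD1[OF ker]] by blast
  have Kc: "cofibrant k G ?K"
    by (rule cofibrant_retract[OF x gK b \<alpha> ab])
  \<comment> \<open>The map \<open>f \<alpha>\<close> from \<open>x\<close> to \<open>y\<close>
    induces one on all of \<open>bounded G x\<close>; composed with \<open>\<beta>\<close> before
    and the retraction \<open>\<mu>\<close> after, it extends \<open>f\<close> to
    \<open>p\<close>.\<close>
  have proj: "ext_vanish k G c y" if y: "projective_module k G y" for y :: "('k, 'u, 'g) gmodule"
  proof (rule ext_vanishI[OF c projective_group_module[OF y] p(1) e])
    note gy = projective_group_module[OF y]
    fix f assume f: "f \<in> gmaps k G ?K y"
    obtain \<mu> where \<mu>: "\<mu> \<in> gmaps k G (bounded G y) y" "\<forall>v \<in> carrier y. \<mu> (bconst G y v) = v"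
      using projective_bconst_retract[OF y] by blast
    note f\<alpha> = gmaps_comp[OF gx \<alpha> f]
    let ?h = "compose (carrier p) \<mu> (compose (carrier p) (bmap G x (compose (carrier x) f \<alpha>)) \<beta>)"
    have "?h \<in> gmaps k G p y"
      by (rule gmaps_comp[OF gp gmaps_comp[OF gp p(3) bmap_gmaps[OF gx gy f\<alpha>]] \<mu>(1)])
    moreover have "?h w = f w" if w: "w \<in> carrier p" "e w = \<zero>\<^bsub>c\<^esub>" for w
    proof -
      obtain v where v: "v \<in> carrier x" "w = \<alpha> v" using ker w by auto
      show ?thesis
        using v w \<mu>(2) gmaps_closed[OF f, of w] bmap_bconst[OF gx gy f\<alpha> v(1)]
        by (simp add: compose_eq p(4)[symmetric])
    qed
    ultimately show "\<exists>h \<in> gmaps k G p y. \<forall>w \<in> carrier p. e w = \<zero>\<^bsub>c\<^esub> \<longrightarrow> h w = f w"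
      by blast
  qed
  \<comment> \<open>A single shift suffices: the syzygy of \<open>c\<close> is a copy of
    \<open>x\<close>, for which all modules of finite projective dimension are already
    covered.\<close>
  have van: "ext_vanish k G c y" if y: "finite_pd k G y" for y :: "('k, 'u, 'g) gmodule"
  proof -
    obtain n where "pd_le k G n y"
      using y by (auto simp: finite_pd_def)
    then show ?thesis
    proof cases
      case pd_le_0
      then show ?thesis by (simp add: proj)
    next
      case (pd_le_Suc q e' m)
      show ?thesis
        by (rule ext_vanish_shift[OF c p(1) e pd_le_Suc(2) projective_group_module[OF pd_le_Suc(3)] pd_le_Suc(4)
              proj[OF pd_le_Suc(3)] cofibrant_ext_vanish[OF pd_le_Suc(5) Kc]])
    qed
  qed
  have "cofibrant k G c"
    by (rule cofibrantI[OF c pd[OF c] van])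
  then show ?thesis
    using that p(1) e \<alpha> b ba ab by blast
qed

section \<open>Syzygies\<close>

lemma
  fixes x :: "('k, 'u, 'g) gmodule"
  assumes "group_module k G x"
  shows cover_projective: "projective_module k G (cover_mod k G x)"
    and cover_epi: "cover_map k G x \<in> epis k G (cover_mod k G x) x"
proof -
  have "\<exists>pe. (\<lambda>(p, e). projective_module k G p \<and> e \<in> epis k G p x) pe"
    using enough_projectives[OF assms] by auto
  then have "(\<lambda>(p, e). projective_module k G p \<and> e \<in> epis k G p x) (proj_cover k G x)"
    unfolding proj_cover_def by (rule someI_ex)
  then show "projective_module k G (cover_mod k G x)" "cover_map k G x \<in> epis k G (cover_mod k G x) x"
    by (auto simp: cover_mod_def cover_map_def case_prod_unfold)
qed

lemma group_module_syzygy: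
  fixes x :: "('k, 'u, 'g) gmodule"
  assumes "group_module k G x"
  shows "group_module k G (syzygy k G x)"
  unfolding syzygy_def
  by (rule group_module_ker[OF projective_group_module[OF cover_projective[OF assms]] assms
        epis_gmaps[OF cover_epi[OF assms]]])

lemma group_module_syzygies:
  fixes x :: "('k, 'u, 'g) gmodule"
  assumes "group_module k G x"
  shows "group_module k G (syzygies k G n x)"
  by (induction n) (simp_all add: assms group_module_syzygy)

lemma cofibrant_syzygies:
  fixes x :: "('k, 'u, 'g) gmodule"
  assumes "cofibrant k G x"
  shows "cofibrant k G (syzygies k G n x)"
proof (induction n)
  case (Suc n)
  note g = cofibrant_group_module[OF Suc]
  show ?case
    using cofibrant_ker[OF Suc cover_projective[OF g] cover_epi[OF g]] by (simp add: syzygy_def)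
qed (simp add: assms)

section \<open>Cofibrancy of high syzygies\<close>

lemma tp_diff_sum:
  fixes x y :: "('k, 'u, 'g) gmodule"
  assumes x: "group_module k G x" and y: "group_module k G y" and f: "f \<in> gmaps k G x y" and g: "g \<in> gmaps k G x y"
    and d: "diff_map x y f g \<in> through_projective k G x y" and gt: "g \<in> through_projective k G x y"
  shows "f \<in> through_projective k G x y"
proof -
  have "f = sum_map x y (diff_map x y f g) g"
    using diff_add[OF y gmaps_closed[OF f] gmaps_closed[OF g]]
    by (intro gmaps_eqI[OF f gmaps_sum[OF x y gmaps_diff[OF x y f g] g]])
       (simp add: sum_map_def diff_map_def)
  then show ?thesis using tp_sum[OF x y d gt] by simp
qed

text \<open>The case of interest is \<open>w = bounded G x\<close> with \<open>\<beta>\<close> the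
  identity. In the induction \<open>w\<close> is replaced by the kernel in its resolution, which
  need not be \<open>bounded G\<close> of the syzygy of \<open>x\<close>. Hence \<open>w\<close> is
  decoupled from \<open>x\<close>, and only a factorisation of the constant map through
  \<open>w\<close>, up to maps through projectives, is carried along.\<close>

lemma cofibrant_syzygies_of_bounded:
  fixes x w :: "('k, 'u, 'g) gmodule"
  assumes "pd_le k G n w" "group_module k G x" "\<alpha> \<in> gmaps k G x w" "\<beta> \<in> gmaps k G w (bounded G x)"
    and "diff_map x (bounded G x) (bconst G x) (compose (carrier x) \<beta> \<alpha>) \<in> through_projective k G x (bounded G x)"
  shows "cofibrant k G (syzygies k G n x)"
  using assms
proof (induction arbitrary: x \<alpha> \<beta> rule: pd_le.induct)
  case (pd_le_0 w)
  note x = pd_le_0(2)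
  note bx = group_module_bounded[OF x]
  have "compose (carrier x) \<beta> \<alpha> \<in> through_projective k G x (bounded G x)"
    by (rule tpI[OF pd_le_0(1,3,4) gmaps_comp[OF x pd_le_0(3,4)]]) (simp add: compose_eq)
  then have "bconst G x \<in> through_projective k G x (bounded G x)"
    using tp_diff_sum[OF x bx bconst_gmaps[OF x] gmaps_comp[OF x pd_le_0(3,4)] pd_le_0(5)] by blast
  then show ?case using x by (simp add: cofibrant_def)
next
  case (pd_le_Suc w p e n)
  note w = pd_le_Suc(1) and p = pd_le_Suc(2) and e = pd_le_Suc(3) and x = pd_le_Suc(6)
    and \<alpha> = pd_le_Suc(7) and \<beta> = pd_le_Suc(8) and d = pd_le_Suc(9)
  define q c where "q = cover_mod k G x" and "c = cover_map k G x"
  have q: "projective_module k G q" and c: "c \<in> epis k G q x"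
    using cover_projective[OF x] cover_epi[OF x] by (simp_all add: q_def c_def)
  note gq = projective_group_module[OF q] and gp = projective_group_module[OF p]
  note c' = epis_gmaps[OF c] and e' = epis_gmaps[OF e]
  let ?K = "ker_module q x c" and ?L = "ker_module p w e"
  note gK = group_module_ker[OF gq x c'] and gL = group_module_ker[OF gp w e']
  note bx = group_module_bounded[OF x] and bq = group_module_bounded[OF gq]
  \<comment> \<open>Both factors lift to the covers: \<open>\<alpha>\<close> because
    \<open>q\<close> is projective, \<open>\<beta>\<close> because \<open>p\<close> is projective
    and \<open>bmap G q c\<close> is onto. Restricted to the kernels, they are the factors for the
    next step.\<close>
  obtain a where a: "a \<in> gmaps k G q p" "\<forall>v \<in> carrier q. e (a v) = \<alpha> (c v)"
    using projective_lift[OF q gp w e gmaps_comp[OF gq c' \<alpha>]] by (auto simp: compose_eq)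
  obtain b where b: "b \<in> gmaps k G p (bounded G q)" "\<forall>v \<in> carrier p. bmap G q c (b v) = \<beta> (e v)"
    using projective_lift[OF p bq bx bmap_epis[OF gq x c] gmaps_comp[OF gp e' \<beta>]] by (auto simp: compose_eq)
  let ?a = "restrict a (carrier ?K)" and ?b = "restrict b (carrier ?L)"
  have aK: "?a \<in> gmaps k G ?K ?L"
    by (rule gmaps_ker_ker[OF gK a(1)]) (use a(2) gmaps_zero[OF x w \<alpha>] in auto)
  have bL: "?b \<in> gmaps k G ?L (bounded G ?K)"
    unfolding ker_bmap[OF gq x c', symmetric]
    by (rule gmaps_ker_ker[OF gL b(1)]) (use b(2) gmaps_zero[OF w bx \<beta>] in auto)
  note ba = gmaps_comp[OF gq a(1) b(1)] and baK = gmaps_comp[OF gK aK bL]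
  let ?h = "diff_map q (bounded G q) (bconst G q) (compose (carrier q) b a)"
  let ?t = "diff_map ?K (bounded G ?K) (bconst G ?K) (compose (carrier ?K) ?b ?a)"
  have h: "?h \<in> gmaps k G q (bounded G q)"
    by (rule gmaps_diff[OF gq bq bconst_gmaps[OF gq] ba])
  have t: "?t \<in> gmaps k G ?K (bounded G ?K)"
    by (rule gmaps_diff[OF gK group_module_bounded[OF gK] bconst_gmaps[OF gK] baK])
  \<comment> \<open>The error of the factorisation upstairs lifts the error downstairs, so that
    \<open>tp_syzygy\<close> applies to it.\<close>
  have lift: "bmap G q c (?h v) = diff_map x (bounded G x) (bconst G x) (compose (carrier x) \<beta> \<alpha>) (c v)"
    if v: "v \<in> carrier q" for v
    using v a(2) b(2) gmaps_closed[OF c' v] gmaps_closed[OF a(1) v]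
      gmaps_minus[OF bq bx bmap_gmaps[OF gq x c'] gmaps_closed[OF bconst_gmaps[OF gq] v] gmaps_closed[OF b(1) gmaps_closed[OF a(1) v]]]
    by (simp add: diff_map_def compose_eq bmap_bconst[OF gq x c'])
  note minus = ker_minus[of k G "bounded G q" "bounded G x" "bmap G q c", unfolded ker_bmap[OF gq x c'],
      OF bq group_module_bounded[OF gK]]
  have "?t \<in> through_projective k G ?K (bounded G ?K)"
    unfolding ker_bmap[OF gq x c', symmetric]
  proof (rule tp_syzygy[OF x bx q bq c bmap_epis[OF gq x c] d h lift])
    show "diff_map ?K (ker_module (bounded G q) (bounded G x) (bmap G q c)) (bconst G ?K) (compose (carrier ?K) ?b ?a)
        \<in> gmaps k G ?K (ker_module (bounded G q) (bounded G x) (bmap G q c))"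
      using t by (simp only: ker_bmap[OF gq x c'])
    fix v assume v: "v \<in> carrier q" "c v = \<zero>\<^bsub>x\<^esub>"
    then have "v \<in> carrier ?K" by simp
    then show "diff_map ?K (ker_module (bounded G q) (bounded G x) (bmap G q c)) (bconst G ?K) (compose (carrier ?K) ?b ?a) v = ?h v"
      unfolding ker_bmap[OF gq x c']
      using v minus gmaps_closed[OF bconst_gmaps[OF gK], of v] gmaps_closed[OF baK, of v] gmaps_closed[OF aK, of v]
      by (simp add: diff_map_def compose_eq bconst_def)
  qed
  then have "cofibrant k G (syzygies k G n ?K)"
    by (rule pd_le_Suc(5)[OF gK aK bL])
  moreover have "?K = syzygy k G x"
    by (simp add: syzygy_def q_def c_def)
  ultimately show ?case
    by (simp add: funpow_swap1)
qed

lemma cofibrant_syzygies_finite_pd: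
  fixes x :: "('k, 'u, 'g) gmodule"
  assumes x: "group_module k G x" and pd: "pd_le k G n (bounded G x)"
  shows "cofibrant k G (syzygies k G n x)"
proof (rule cofibrant_syzygies_of_bounded[OF pd x bconst_gmaps[OF x] gmaps_id[OF group_module_bounded[OF x]]])
  have "diff_map x (bounded G x) (bconst G x) (compose (carrier x) (\<lambda>v \<in> carrier (bounded G x). v) (bconst G x))
      = zero_map x (bounded G x)"
    using gmaps_closed[OF bconst_gmaps[OF x]] diff_self[OF group_module_bounded[OF x]]
    by (auto simp: diff_map_def zero_map_def compose_eq)
  then show "diff_map x (bounded G x) (bconst G x) (compose (carrier x) (\<lambda>v \<in> carrier (bounded G x). v) (bconst G x))
      \<in> through_projective k G x (bounded G x)"
    using tp_zero[OF x group_module_bounded[OF x]] by simp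
qed

end

section \<open>Finite groups\<close>

lemma linear_maps_closed: "\<lbrakk>f \<in> linear_maps k x y; v \<in> carrier x\<rbrakk> \<Longrightarrow> f v \<in> carrier y"
  and linear_maps_add: "\<lbrakk>f \<in> linear_maps k x y; v \<in> carrier x; w \<in> carrier x\<rbrakk> \<Longrightarrow> f (v \<oplus>\<^bsub>x\<^esub> w) = f v \<oplus>\<^bsub>y\<^esub> f w"
  and linear_maps_smult: "\<lbrakk>f \<in> linear_maps k x y; c \<in> carrier k; v \<in> carrier x\<rbrakk> \<Longrightarrow> f (c \<odot>\<^bsub>x\<^esub> v) = c \<odot>\<^bsub>y\<^esub> f v"
  by (auto simp: linear_maps_def)

lemma linear_maps_finsum:
  assumes x: "module k x" and y: "module k y" and f: "f \<in> linear_maps k x y"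
    and A: "finite A" and t: "t \<in> A \<rightarrow> carrier x"
  shows "f (finsum x t A) = finsum y (\<lambda>a. f (t a)) A"
  using A t
proof (induction A)
  interpret x: module k x by fact
  interpret y: module k y by fact
  case empty
  have "f \<zero>\<^bsub>x\<^esub> = \<zero>\<^bsub>y\<^esub>"
    using linear_maps_smult[OF f, of "\<zero>\<^bsub>k\<^esub>" "\<zero>\<^bsub>x\<^esub>"] linear_maps_closed[OF f, of "\<zero>\<^bsub>x\<^esub>"] by simp
  then show ?case by simp
next
  interpret x: module k x by fact
  interpret y: module k y by fact
  case (insert a A)
  have "t a \<in> carrier x" "t \<in> A \<rightarrow> carrier x" "(\<lambda>a. f (t a)) \<in> A \<rightarrow> carrier y" "f (t a) \<in> carrier y"
    using insert.prems linear_maps_closed[OF f] by auto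
  then show ?case
    using insert by (simp add: linear_maps_add[OF f])
qed

definition single :: "'g monoid \<Rightarrow> ('k, 'u, 'g) gmodule \<Rightarrow> 'g \<Rightarrow> 'u \<Rightarrow> 'g \<Rightarrow> 'u" where
  "single G c a v = (\<lambda>b \<in> carrier G. if b = a then v else \<zero>\<^bsub>c\<^esub>)"

lemma single_closed:
  assumes "group_module k G c" "v \<in> carrier c"
  shows "single G c a v \<in> carrier (bfun G c)"
proof -
  interpret group_module k G c by fact
  have "finite (single G c a v ` carrier G)"
    by (rule finite_subset[of _ "{v, \<zero>\<^bsub>c\<^esub>}"]) (auto simp: single_def)
  then show ?thesis using assms(2) by (auto simp: single_def)
qed

text \<open>For finite \<open>G\<close> a function is the sum of its restrictions to single points.
  Evaluation at \<open>b\<close> is linear and leaves only the term at \<open>b\<close>.\<close>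

lemma bfun_decomposition:
  assumes c: "group_module k G c" and fin: "finite (carrier G)" and \<phi>: "\<phi> \<in> carrier (bfun G c)"
  shows "finsum (bfun G c) (\<lambda>a. single G c a (\<phi> a)) (carrier G) = \<phi>"
proof -
  interpret c: group_module k G c by fact
  note gb = group_module_bfun[OF c]
  interpret b: group_module k G "bfun G c" by (rule gb)
  have \<phi>c: "\<phi> a \<in> carrier c" if "a \<in> carrier G" for a
    using \<phi> that by auto
  have t: "(\<lambda>a. single G c a (\<phi> a)) \<in> carrier G \<rightarrow> carrier (bfun G c)"
    using single_closed[OF c \<phi>c] by blast
  have "finsum (bfun G c) (\<lambda>a. single G c a (\<phi> a)) (carrier G) b = \<phi> b" if b: "b \<in> carrier G" for b
  proof -
    let ?ev = "\<lambda>\<psi> \<in> carrier (bfun G c). \<psi> b"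
    have ev: "?ev \<in> linear_maps k (bfun G c) c"
      unfolding linear_maps_def
      using b b.M.a_closed b.smult_closed by (auto simp del: bfun_simps(1)) (auto)
    have S: "finsum (bfun G c) (\<lambda>a. single G c a (\<phi> a)) (carrier G) \<in> carrier (bfun G c)"
      by (rule b.M.finsum_closed[OF t])
    have "finsum (bfun G c) (\<lambda>a. single G c a (\<phi> a)) (carrier G) b
        = finsum c (\<lambda>a. ?ev (single G c a (\<phi> a))) (carrier G)"
      using linear_maps_finsum[OF b.module_axioms c.module_axioms ev fin t] S by simp
    also have "\<dots> = finsum c (\<lambda>a. if b = a then \<phi> a else \<zero>\<^bsub>c\<^esub>) (carrier G)"
      using single_closed[OF c \<phi>c] b \<phi>c
      by (intro c.M.finsum_cong') (auto simp: single_def simp del: bfun_simps)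
    also have "\<dots> = \<phi> b"
      using c.M.add.finprod_singleton[OF b fin, of \<phi>] \<phi>c by auto
    finally show ?thesis .
  qed
  then show ?thesis
    using b.M.finsum_closed[OF t] \<phi>
    by (intro extensionalityI[of _ "carrier G"]) (auto simp: PiE_iff)
qed

lemma gact_single:
  assumes c: "group_module k G c" and a: "a \<in> carrier G" and v: "v \<in> carrier c"
  shows "gact (bfun G c) a (single G c \<one>\<^bsub>G\<^esub> v) = single G c a (gact c a v)"
proof -
  interpret c: group_module k G c by fact
  have "inv\<^bsub>G\<^esub> a \<otimes>\<^bsub>G\<^esub> b = \<one>\<^bsub>G\<^esub> \<longleftrightarrow> b = a" if "b \<in> carrier G" for b
    using a that c.inv_solve_left'[of "\<one>\<^bsub>G\<^esub>" a b] by (metis c.inv_solve_left c.r_one c.one_closed)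
  then show ?thesis
    using a by (auto simp: single_def fun_eq_iff restrict_def gact_zero[OF c a])
qed

lemma gact_linear_map:
  assumes "group_module k G x" "g \<in> carrier G"
  shows "restrict (gact x g) (carrier x) \<in> linear_maps k x x"
proof -
  interpret group_module k G x by fact
  show ?thesis by (rule gact_linear[OF assms(2)])
qed

text \<open>For finite \<open>G\<close> the functions on \<open>G\<close> form the module induced
  from the trivial subgroup, so a k-linear lift on the functions supported at the identity
  determines an equivariant lift.\<close>

lemma bfun_lift_finite:
  fixes c x y :: "('k, 'u, 'g) gmodule"
  assumes fin: "finite (carrier G)" and c: "group_module k G c"
    and proj: "projective_module k (triv_subgroup G) c"
    and x: "group_module k G x" and y: "group_module k G y" and e: "e \<in> epis k G x y"
    and f: "f \<in> gmaps k G (bfun G c) y"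
  shows "\<exists>h \<in> gmaps k G (bfun G c) x. \<forall>\<phi> \<in> carrier (bfun G c). e (h \<phi>) = f \<phi>"
proof -
  interpret c: group_module k G c by fact
  interpret x: group_module k G x by fact
  interpret y: group_module k G y by fact
  let ?B = "bfun G c"
  note gB = group_module_bfun[OF c]
  interpret B: group_module k G ?B by (rule gB)
  note e' = epis_gmaps[OF e]
  have fl: "f \<in> linear_maps k ?B y" and el: "e \<in> linear_maps k x y"
    using f e' by (simp_all add: gmaps_def del: bfun_simps)
  have f1: "(\<lambda>v \<in> carrier c. f (single G c \<one>\<^bsub>G\<^esub> v)) \<in> gmaps k (triv_subgroup G) c y"
    unfolding gmaps_triv_iff[OF group_module_triv[OF c] group_module_triv[OF y]] linear_maps_def
  proof (intro CollectI conjI ballI)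
    show "(\<lambda>v \<in> carrier c. f (single G c \<one>\<^bsub>G\<^esub> v)) \<in> carrier c \<rightarrow>\<^sub>E carrier y"
      using single_closed[OF c] linear_maps_closed[OF fl] by (auto simp del: bfun_simps)
    show "(\<lambda>v \<in> carrier c. f (single G c \<one>\<^bsub>G\<^esub> v)) (v \<oplus>\<^bsub>c\<^esub> w) =
      (\<lambda>v \<in> carrier c. f (single G c \<one>\<^bsub>G\<^esub> v)) v \<oplus>\<^bsub>y\<^esub> (\<lambda>v \<in> carrier c. f (single G c \<one>\<^bsub>G\<^esub> v)) w"
      if "v \<in> carrier c" "w \<in> carrier c" for v w
    proof -
      have "single G c \<one>\<^bsub>G\<^esub> (v \<oplus>\<^bsub>c\<^esub> w) = single G c \<one>\<^bsub>G\<^esub> v \<oplus>\<^bsub>?B\<^esub> single G c \<one>\<^bsub>G\<^esub> w"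
        using that by (auto simp: single_def fun_eq_iff)
      then show ?thesis
        using that single_closed[OF c] linear_maps_add[OF fl] by (simp del: bfun_simps)
    qed
    show "(\<lambda>v \<in> carrier c. f (single G c \<one>\<^bsub>G\<^esub> v)) (t \<odot>\<^bsub>c\<^esub> v) =
      t \<odot>\<^bsub>y\<^esub> (\<lambda>v \<in> carrier c. f (single G c \<one>\<^bsub>G\<^esub> v)) v" if "t \<in> carrier k" "v \<in> carrier c" for t v
    proof -
      have "single G c \<one>\<^bsub>G\<^esub> (t \<odot>\<^bsub>c\<^esub> v) = t \<odot>\<^bsub>?B\<^esub> single G c \<one>\<^bsub>G\<^esub> v"
        using that by (auto simp: single_def fun_eq_iff)
      then show ?thesis
        using that single_closed[OF c] linear_maps_smult[OF fl] by (simp del: bfun_simps)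
    qed
  qed
  have e1: "e \<in> epis k (triv_subgroup G) x y"
    using gmaps_triv[OF c.is_group e'] e by (auto simp: epis_iff)
  obtain s where s1: "s \<in> gmaps k (triv_subgroup G) c x"
    and es: "\<forall>v \<in> carrier c. e (s v) = f (single G c \<one>\<^bsub>G\<^esub> v)"
    using projective_lift[OF proj group_module_triv[OF x] group_module_triv[OF y] e1 f1] by auto
  have s: "s \<in> linear_maps k c x"
    using s1 by (simp add: gmaps_triv_iff[OF group_module_triv[OF c] group_module_triv[OF x]])
  note [simp] = gact_closed[OF c] gact_closed[OF x] linear_maps_closed[OF s]
  \<comment> \<open>The summand at \<open>a\<close>: translate the value by the inverse of
    \<open>a\<close>, lift it by \<open>s\<close>, and translate the result back by
    \<open>a\<close>.\<close>
  define t where "t \<phi> a = gact x a (s (gact c (inv\<^bsub>G\<^esub> a) (\<phi> a)))" for \<phi> a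
  have \<phi>c: "\<phi> a \<in> carrier c" if "\<phi> \<in> carrier ?B" "a \<in> carrier G" for \<phi> a
    using that by auto
  have t: "t \<phi> \<in> carrier G \<rightarrow> carrier x" if "\<phi> \<in> carrier ?B" for \<phi>
    using \<phi>c[OF that] by (auto simp: t_def)
  let ?h = "\<lambda>\<phi> \<in> carrier ?B. finsum x (t \<phi>) (carrier G)"
  have h: "?h \<in> gmaps k G ?B x"
  proof (rule gmapsI[OF gB])
    fix \<phi> assume \<phi>: "\<phi> \<in> carrier ?B"
    show "finsum x (t \<phi>) (carrier G) \<in> carrier x"
      by (rule x.M.finsum_closed[OF t[OF \<phi>]])
    show "finsum x (t (r \<odot>\<^bsub>?B\<^esub> \<phi>)) (carrier G) = r \<odot>\<^bsub>x\<^esub> finsum x (t \<phi>) (carrier G)" if r: "r \<in> carrier k" for r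
    proof -
      have "finsum x (t (r \<odot>\<^bsub>?B\<^esub> \<phi>)) (carrier G) = finsum x (\<lambda>a. r \<odot>\<^bsub>x\<^esub> t \<phi> a) (carrier G)"
        by (rule x.M.finsum_cong')
          (use \<phi>c[OF \<phi>] t[OF \<phi>] r in \<open>auto simp: t_def gact_smult[OF c] gact_smult[OF x] linear_maps_smult[OF s]\<close>)
      then show ?thesis
        using x.finsum_smult_ldistr[OF fin r t[OF \<phi>]] by simp
    qed
    show "finsum x (t (gact ?B g \<phi>)) (carrier G) = gact x g (finsum x (t \<phi>) (carrier G))" if g: "g \<in> carrier G" for g
    proof -
      have tg: "t (gact ?B g \<phi>) \<in> carrier G \<rightarrow> carrier x"
        by (rule t[OF gact_closed[OF gB g \<phi>]])
      have "t (gact ?B g \<phi>) (g \<otimes>\<^bsub>G\<^esub> a) = gact x g (t \<phi> a)" if a: "a \<in> carrier G" for a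
      proof -
        have "gact c (inv\<^bsub>G\<^esub> (g \<otimes>\<^bsub>G\<^esub> a)) (gact c g (\<phi> a)) = gact c (inv\<^bsub>G\<^esub> a) (\<phi> a)"
          using a g \<phi>c[OF \<phi> a] by (simp add: c.gact_mult[symmetric] c.inv_mult_group c.m_assoc)
        moreover have "inv\<^bsub>G\<^esub> g \<otimes>\<^bsub>G\<^esub> (g \<otimes>\<^bsub>G\<^esub> a) = a"
          using a g by (simp add: c.m_assoc[symmetric])
        ultimately show ?thesis
          using a g \<phi>c[OF \<phi> a] by (simp add: t_def x.gact_mult)
      qed
      \<comment> \<open>Reindexing the sum by left translation with \<open>g\<close> gives
        equivariance.\<close>
      then have "finsum x (\<lambda>a. gact x g (t \<phi> a)) (carrier G) = finsum x (\<lambda>a. t (gact ?B g \<phi>) (g \<otimes>\<^bsub>G\<^esub> a)) (carrier G)"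
        by (intro x.M.finsum_cong') (use t[OF \<phi>] g tg in auto)
      also have "\<dots> = finsum x (t (gact ?B g \<phi>)) ((\<lambda>a. g \<otimes>\<^bsub>G\<^esub> a) ` carrier G)"
        by (rule x.M.add.finprod_reindex[symmetric]) (use tg g c.inj_on_cmult[OF g] in auto)
      also have "(\<lambda>a. g \<otimes>\<^bsub>G\<^esub> a) ` carrier G = carrier G"
        by (rule c.surj_const_mult[OF g])
      finally have "finsum x (t (gact ?B g \<phi>)) (carrier G) = finsum x (\<lambda>a. gact x g (t \<phi> a)) (carrier G)" by (rule sym)
      also have "\<dots> = finsum x (\<lambda>a. restrict (gact x g) (carrier x) (t \<phi> a)) (carrier G)"
        by (rule x.M.finsum_cong') (use t[OF \<phi>] g in auto)
      also have "\<dots> = restrict (gact x g) (carrier x) (finsum x (t \<phi>) (carrier G))"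
        by (rule linear_maps_finsum[OF x.module_axioms x.module_axioms gact_linear_map[OF x g] fin t[OF \<phi>], symmetric])
      finally show ?thesis
        using x.M.finsum_closed[OF t[OF \<phi>]] by simp
    qed
    fix \<psi> assume \<psi>: "\<psi> \<in> carrier ?B"
    have "finsum x (t (\<phi> \<oplus>\<^bsub>?B\<^esub> \<psi>)) (carrier G) = finsum x (\<lambda>a. t \<phi> a \<oplus>\<^bsub>x\<^esub> t \<psi> a) (carrier G)"
      by (rule x.M.finsum_cong')
        (use \<phi>c[OF \<phi>] \<phi>c[OF \<psi>] t[OF \<phi>] t[OF \<psi>] in \<open>auto simp: t_def gact_add[OF c] gact_add[OF x] linear_maps_add[OF s]\<close>)
    then show "finsum x (t (\<phi> \<oplus>\<^bsub>?B\<^esub> \<psi>)) (carrier G) = finsum x (t \<phi>) (carrier G) \<oplus>\<^bsub>x\<^esub> finsum x (t \<psi>) (carrier G)"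
      using x.M.finsum_addf[OF t[OF \<phi>] t[OF \<psi>]] by simp
  qed
  moreover have "e (?h \<phi>) = f \<phi>" if \<phi>: "\<phi> \<in> carrier ?B" for \<phi>
  proof -
    have et: "e (t \<phi> a) = f (single G c a (\<phi> a))" if a: "a \<in> carrier G" for a
    proof -
      let ?v = "gact c (inv\<^bsub>G\<^esub> a) (\<phi> a)"
      have v: "?v \<in> carrier c"
        using a \<phi>c[OF \<phi> a] by simp
      have "e (t \<phi> a) = gact y a (f (single G c \<one>\<^bsub>G\<^esub> ?v))"
        using a v es by (simp add: t_def gmaps_act[OF e'])
      also have "\<dots> = f (single G c a (gact c a ?v))"
        unfolding gact_single[OF c a v, symmetric]
        by (rule gmaps_act[OF f single_closed[OF c v] a, symmetric])
      also have "gact c a ?v = \<phi> a"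
        using a \<phi>c[OF \<phi> a] by (simp add: c.gact_mult[symmetric] c.gact_one)
      finally show ?thesis .
    qed
    have sc: "(\<lambda>a. single G c a (\<phi> a)) \<in> carrier G \<rightarrow> carrier ?B"
      using single_closed[OF c \<phi>c[OF \<phi>]] by blast
    have "e (?h \<phi>) = e (finsum x (t \<phi>) (carrier G))"
      using \<phi> by simp
    also have "\<dots> = finsum y (\<lambda>a. e (t \<phi> a)) (carrier G)"
      by (rule linear_maps_finsum[OF x.module_axioms y.module_axioms el fin t[OF \<phi>]])
    also have "\<dots> = finsum y (\<lambda>a. f (single G c a (\<phi> a))) (carrier G)"
      by (rule y.M.finsum_cong') (use et sc linear_maps_closed[OF fl] in \<open>auto simp del: bfun_simps\<close>)
    also have "\<dots> = f (finsum ?B (\<lambda>a. single G c a (\<phi> a)) (carrier G))"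
      by (rule linear_maps_finsum[OF B.module_axioms y.module_axioms fl fin sc, symmetric])
    also have "\<dots> = f \<phi>"
      by (simp only: bfun_decomposition[OF c fin \<phi>])
    finally show ?thesis .
  qed
  ultimately show ?thesis by blast
qed

context group_universe begin

lemma projective_bounded:
  fixes c :: "('k, 'u, 'g) gmodule"
  assumes fin: "finite (carrier G)" and c: "group_module k G c"
    and proj: "projective_module k (triv_subgroup G) c"
  shows "projective_module k G (bounded G c)"
  by (rule projectiveI_retract[OF group_module_bounded[OF c] group_module_bfun[OF c] bdec_gmaps[OF c]
        benc_gmaps[OF c] _ bfun_lift_finite[OF fin c proj]])
     (use bdec_closed[OF c] benc_bdec[OF c] in \<open>simp del: bfun_simps\<close>)

text \<open>The sequence from \<open>c\<close> to \<open>bounded G c\<close> to its cokernel stays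
  among k-projective modules and has a projective middle term. Hence each k-projective module is, up
  to isomorphism, a syzygy of another one, which drives the dimension shifts over finite
  groups.\<close>

lemma bounded_cokernel:
  fixes c :: "('k, 'u, 'g) gmodule"
  assumes fin: "finite (carrier G)" and c: "group_module k G c"
    and proj: "projective_module k (triv_subgroup G) c"
  obtains y :: "('k, 'u, 'g) gmodule" and e where "group_module k G y" "projective_module k (triv_subgroup G) y"
    "e \<in> epis k G (bounded G c) y" "carrier (ker_module (bounded G c) y e) = bconst G c ` carrier c"
proof -
  note gb = group_module_bounded[OF c] and bc = bconst_gmaps[OF c]
  obtain y :: "('k, 'u, 'g) gmodule" and e where y: "group_module k G y" and e: "e \<in> epis k G (bounded G c) y"
    and ker': "carrier (ker_module (bounded G c) y e) = bconst G c ` carrier c"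
    using cokernel_module[OF c gb bc] by blast
  then have ker: "{v \<in> carrier (bounded G c). e v = \<zero>\<^bsub>y\<^esub>} = bconst G c ` carrier c"
    by simp
  note e' = epis_gmaps[OF e]
  text \<open>Subtracting the value at the identity splits the projection \<open>k\<close>-linearly.\<close>
  let ?T = "triv_subgroup G"
  note cT = group_module_triv[OF c] and bT = group_module_triv[OF gb] and yT = group_module_triv[OF y]
  define ev where "ev = (\<lambda>b \<in> carrier (bounded G c). bdec G b \<one>\<^bsub>G\<^esub>)"
  note bfunm = group_module_bfun[OF c]
  have bd: "bdec G b \<one>\<^bsub>G\<^esub> \<in> carrier c" if "b \<in> carrier (bounded G c)" for b
    by (rule bdec_value_closed[OF c that G.one_closed])
  have ev: "ev \<in> gmaps k ?T (bounded G c) c"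
    unfolding gmaps_triv_iff[OF bT cT] linear_maps_def
  proof (intro CollectI conjI ballI)
    show "ev \<in> carrier (bounded G c) \<rightarrow>\<^sub>E carrier c"
      using bd by (auto simp: ev_def)
    show "ev (v \<oplus>\<^bsub>bounded G c\<^esub> w) = ev v \<oplus>\<^bsub>c\<^esub> ev w" if "v \<in> carrier (bounded G c)" "w \<in> carrier (bounded G c)" for v w
      using that bdec_add[OF c that(1) G.one_closed that(2)]
        abelian_groupE(1)[OF group_module_abelian[OF gb] that] by (simp add: ev_def)
    show "ev (t \<odot>\<^bsub>bounded G c\<^esub> v) = t \<odot>\<^bsub>c\<^esub> ev v" if "t \<in> carrier k" "v \<in> carrier (bounded G c)" for t v
      using that bdec_smult[OF c that(2) G.one_closed that(1)]
        module.smult_closed[OF group_module_module[OF gb] that] by (simp add: ev_def)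
  qed
  have evc: "ev (bconst G c v) = v" if "v \<in> carrier c" for v
    using that gmaps_closed[OF bc that] by (simp add: ev_def bdec_bconst[OF c])
  note bcT = gmaps_triv[OF group bc]
  let ?r = "diff_map (bounded G c) (bounded G c) (\<lambda>b \<in> carrier (bounded G c). b)
      (compose (carrier (bounded G c)) (bconst G c) ev)"
  have r: "?r \<in> gmaps k ?T (bounded G c) (bounded G c)"
    by (rule gmaps_diff[OF bT bT gmaps_id[OF bT] gmaps_comp[OF bT ev bcT]])
  have eT: "e \<in> gmaps k ?T (bounded G c) y"
    by (rule gmaps_triv[OF group e'])
  obtain \<sigma> where \<sigma>: "\<sigma> \<in> gmaps k ?T y (bounded G c)" "\<And>b. b \<in> carrier (bounded G c) \<Longrightarrow> \<sigma> (e b) = ?r b"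
  proof (rule gmaps_descend[OF bT yT bT eT _ r])
    show "\<exists>v\<in>carrier (bounded G c). e v = w" if "w \<in> carrier y" for w
      using epis_surj[OF e that] by blast
    show "?r v = \<zero>\<^bsub>bounded G c\<^esub>" if "v \<in> carrier (bounded G c)" "e v = \<zero>\<^bsub>y\<^esub>" for v
    proof -
      have "v \<in> bconst G c ` carrier c"
        unfolding ker[symmetric] using that by simp
      then obtain u where u: "u \<in> carrier c" "v = bconst G c u"
        by blast
      then show ?thesis
        using that gmaps_closed[OF bc u(1)] by (simp add: diff_map_def compose_eq evc diff_self[OF gb])
    qed
  qed blast
  have es: "e (\<sigma> w) = w" if w: "w \<in> carrier y" for w
  proof -
    obtain b where b: "b \<in> carrier (bounded G c)" "e b = w"
      using epis_surj[OF e w] by blast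
    have evb: "ev b \<in> carrier c"
      by (rule gmaps_closed[OF ev b(1)])
    have "bconst G c (ev b) \<in> {v \<in> carrier (bounded G c). e v = \<zero>\<^bsub>y\<^esub>}"
      unfolding ker using evb by blast
    then have "e (\<sigma> w) = e b \<ominus>\<^bsub>y\<^esub> \<zero>\<^bsub>y\<^esub>"
      using \<sigma>(2)[OF b(1)] b gmaps_minus[OF gb y e' b(1), of "bconst G c (ev b)"]
      by (simp add: diff_map_def compose_eq)
    then show ?thesis
      using b w by (simp add: diff_zero[OF y])
  qed
  have "projective_module k ?T y"
    by (rule projective_retract[OF projective_triv[OF projective_bounded[OF fin c proj]] yT \<sigma>(1) eT es])
  then show ?thesis
    using that y e ker by simp
qed

end

section \<open>Benson cofibrant modules\<close>

text \<open>k with trivial action. \<open>bounded_functions k G\<close> has the linear structure of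
  \<open>bfun G\<close> of this module, so that \<open>bfun_decomposition\<close> applies to scalar
  functions.\<close>

definition regular_module :: "'k ring \<Rightarrow> ('k, 'k, 'g) gmodule" where
  "regular_module k = \<lparr>carrier = carrier k, monoid.mult = mult k, monoid.one = \<one>\<^bsub>k\<^esub>, ring.zero = \<zero>\<^bsub>k\<^esub>,
     add = add k, smult = mult k, gact = (\<lambda>g v. v)\<rparr>"

lemma regular_module_simps [simp]:
  "carrier (regular_module k) = carrier k" "\<zero>\<^bsub>regular_module k\<^esub> = \<zero>\<^bsub>k\<^esub>" "add (regular_module k) = add k"
  "smult (regular_module k) = mult k" "gact (regular_module k) = (\<lambda>g v. v)"
  by (simp_all add: regular_module_def)

lemma group_module_regular:
  assumes "cring k" "group G"
  shows "group_module k G (regular_module k)"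
proof -
  interpret k: cring k by fact
  show ?thesis
    by (rule group_moduleI)
       (use assms k.l_neg in \<open>auto simp: k.a_assoc k.m_assoc k.l_distr k.r_distr intro: k.a_comm\<close>)
qed

context group_universe begin

text \<open>The function that stands for the tensor of \<open>b\<close> and \<open>v\<close>, coded
  in the universe.\<close>

definition btensor :: "('k, 'u, 'g) gmodule \<Rightarrow> ('g \<Rightarrow> 'k) \<Rightarrow> 'u \<Rightarrow> 'u" where
  "btensor c b v = benc G (\<lambda>a \<in> carrier G. b a \<odot>\<^bsub>c\<^esub> v)"

context
  fixes c :: "('k, 'u, 'g) gmodule" assumes c: "group_module k G c"
begin

interpretation c: group_module k G c by (rule c)

lemma btensor_fun_closed:
  assumes b: "b \<in> carrier (bounded_functions k G)" and v: "v \<in> carrier c"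
  shows "(\<lambda>a \<in> carrier G. b a \<odot>\<^bsub>c\<^esub> v) \<in> carrier (bfun G c)"
  using b v by (auto simp: bounded_functions_def PiE_iff intro!: finite_image_comp[of b _ _ "\<lambda>t. t \<odot>\<^bsub>c\<^esub> v"])

lemma btensor_bilinear: "bilinear_map k (bounded_functions k G) c (bounded G c) (btensor c)"
proof -
  let ?R = "bounded_functions k G"
  have benc: "benc G (\<phi> \<oplus>\<^bsub>bfun G c\<^esub> \<psi>) = benc G \<phi> \<oplus>\<^bsub>bounded G c\<^esub> benc G \<psi>"
    "benc G (t \<odot>\<^bsub>bfun G c\<^esub> \<phi>) = t \<odot>\<^bsub>bounded G c\<^esub> benc G \<phi>"
    if "\<phi> \<in> carrier (bfun G c)" "\<psi> \<in> carrier (bfun G c)" "t \<in> carrier k" for \<phi> \<psi> t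
    using gmaps_add[OF benc_gmaps[OF c] that(1,2)] gmaps_smult[OF benc_gmaps[OF c] that(1,3)]
      abelian_groupE(1)[OF group_module_abelian[OF group_module_bfun[OF c]] that(1,2)]
      module.smult_closed[OF group_module_module[OF group_module_bfun[OF c]] that(3,1)] that
    by (simp_all del: bfun_simps)
  have k1: "b a \<in> carrier k" if "b \<in> carrier ?R" "a \<in> carrier G" for a b
    using that by (auto simp: bounded_functions_def)
  have cl: "btensor c b v \<in> carrier (bounded G c)" if "b \<in> carrier ?R" "v \<in> carrier c" for b v
    unfolding btensor_def by (rule benc_closed[OF c btensor_fun_closed[OF that]])
  have 1: "btensor c b (v \<oplus>\<^bsub>c\<^esub> w) = btensor c b v \<oplus>\<^bsub>bounded G c\<^esub> btensor c b w"
    if "b \<in> carrier ?R" "v \<in> carrier c" "w \<in> carrier c" for b v w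
  proof -
    have "(\<lambda>a \<in> carrier G. b a \<odot>\<^bsub>c\<^esub> (v \<oplus>\<^bsub>c\<^esub> w))
      = (\<lambda>a \<in> carrier G. b a \<odot>\<^bsub>c\<^esub> v) \<oplus>\<^bsub>bfun G c\<^esub> (\<lambda>a \<in> carrier G. b a \<odot>\<^bsub>c\<^esub> w)"
      using that k1 by (auto simp: fun_eq_iff c.smult_r_distr)
    then show ?thesis
      unfolding btensor_def
      using benc(1)[OF btensor_fun_closed[OF that(1,2)] btensor_fun_closed[OF that(1,3)] k.zero_closed] by simp
  qed
  have 2: "btensor c b (t \<odot>\<^bsub>c\<^esub> v) = t \<odot>\<^bsub>bounded G c\<^esub> btensor c b v"
    if "b \<in> carrier ?R" "v \<in> carrier c" "t \<in> carrier k" for b v t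
  proof -
    have "(\<lambda>a \<in> carrier G. b a \<odot>\<^bsub>c\<^esub> (t \<odot>\<^bsub>c\<^esub> v)) = t \<odot>\<^bsub>bfun G c\<^esub> (\<lambda>a \<in> carrier G. b a \<odot>\<^bsub>c\<^esub> v)"
      using that k1 by (auto simp: fun_eq_iff c.smult_assoc1[symmetric] k.m_comm)
    then show ?thesis
      unfolding btensor_def
      using benc(2)[OF btensor_fun_closed[OF that(1,2)] btensor_fun_closed[OF that(1,2)] that(3)] by simp
  qed
  have 3: "btensor c (b \<oplus>\<^bsub>?R\<^esub> b') v = btensor c b v \<oplus>\<^bsub>bounded G c\<^esub> btensor c b' v"
    if "b \<in> carrier ?R" "b' \<in> carrier ?R" "v \<in> carrier c" for b b' v
  proof -
    have "(\<lambda>a \<in> carrier G. (b \<oplus>\<^bsub>?R\<^esub> b') a \<odot>\<^bsub>c\<^esub> v)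
      = (\<lambda>a \<in> carrier G. b a \<odot>\<^bsub>c\<^esub> v) \<oplus>\<^bsub>bfun G c\<^esub> (\<lambda>a \<in> carrier G. b' a \<odot>\<^bsub>c\<^esub> v)"
      using that k1 by (auto simp: fun_eq_iff c.smult_l_distr bounded_functions_def)
    then show ?thesis
      unfolding btensor_def
      using benc(1)[OF btensor_fun_closed[OF that(1,3)] btensor_fun_closed[OF that(2,3)] k.zero_closed] by simp
  qed
  have 4: "btensor c (t \<odot>\<^bsub>?R\<^esub> b) v = t \<odot>\<^bsub>bounded G c\<^esub> btensor c b v"
    if "b \<in> carrier ?R" "v \<in> carrier c" "t \<in> carrier k" for b v t
  proof -
    have "(\<lambda>a \<in> carrier G. (t \<odot>\<^bsub>?R\<^esub> b) a \<odot>\<^bsub>c\<^esub> v) = t \<odot>\<^bsub>bfun G c\<^esub> (\<lambda>a \<in> carrier G. b a \<odot>\<^bsub>c\<^esub> v)"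
      using that k1 by (auto simp: fun_eq_iff c.smult_assoc1 bounded_functions_def)
    then show ?thesis
      unfolding btensor_def
      using benc(2)[OF btensor_fun_closed[OF that(1,2)] btensor_fun_closed[OF that(1,2)] that(3)] by simp
  qed
  have R: "b \<oplus>\<^bsub>?R\<^esub> b' \<in> carrier ?R" if "b \<in> carrier ?R" "b' \<in> carrier ?R" for b b'
    using that by (auto simp: bounded_functions_def PiE_iff intro!: finite_image_comp2[of b _ b' _ "add k"])
  have R': "t \<odot>\<^bsub>?R\<^esub> b \<in> carrier ?R" if "b \<in> carrier ?R" "t \<in> carrier k" for b t
    using that by (auto simp: bounded_functions_def PiE_iff intro!: finite_image_comp[of b _ _ "mult k t"])
  show ?thesis
    unfolding bilinear_map_def linear_maps_def
    using cl 1 2 3 4 R R' by (auto simp: PiE_iff)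
qed

lemma gact_btensor:
  assumes g: "g \<in> carrier G" and b: "b \<in> carrier (bounded_functions k G)" and v: "v \<in> carrier c"
  shows "gact (bounded G c) g (btensor c b v) = btensor c (gact (bounded_functions k G) g b) (gact c g v)"
proof -
  note \<phi> = btensor_fun_closed[OF b v]
  have k1: "b a \<in> carrier k" if "a \<in> carrier G" for a
    using b that by (auto simp: bounded_functions_def)
  have "gact (bfun G c) g (\<lambda>a \<in> carrier G. b a \<odot>\<^bsub>c\<^esub> v)
      = (\<lambda>a \<in> carrier G. gact (bounded_functions k G) g b a \<odot>\<^bsub>c\<^esub> gact c g v)"
    using g v k1 by (auto simp: fun_eq_iff bounded_functions_def gact_smult[OF c])
  moreover have "gact (bounded G c) g (benc G (\<lambda>a \<in> carrier G. b a \<odot>\<^bsub>c\<^esub> v))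
      = benc G (gact (bfun G c) g (\<lambda>a \<in> carrier G. b a \<odot>\<^bsub>c\<^esub> v))"
    using gmaps_act[OF benc_gmaps[OF c] \<phi> g] gact_closed[OF group_module_bfun[OF c] g \<phi>] \<phi>
    by (simp del: bfun_simps)
  ultimately show ?thesis by (simp add: btensor_def)
qed

text \<open>For finite \<open>G\<close> the indicator functions \<open>d a\<close> form a k-basis of
  the scalar functions. A bilinear \<open>\<beta>\<close> is therefore forced to come from the map
  that sends a function to the sum over \<open>a\<close> of \<open>\<beta>\<close> at
  \<open>d a\<close> and its value at \<open>a\<close>.\<close>

lemma bounded_tensor_product:
  assumes fin: "finite (carrier G)"
  shows "is_tensor_product k (bounded_functions k G) c (bounded G c) (btensor c)"
  unfolding is_tensor_product_def
proof (intro conjI allI impI)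
  let ?R = "bounded_functions k G"
  note gb = group_module_bounded[OF c]
  show mb: "module k (bounded G c)"
    by (rule group_module_module[OF gb])
  show "bilinear_map k ?R c (bounded G c) (btensor c)"
    by (rule btensor_bilinear)
  interpret b: module k "bounded G c" by (rule mb)
  interpret bf: group_module k G "bfun G c" by (rule group_module_bfun[OF c])
  fix z :: "('k, 'u) module" and \<beta>
  assume z: "module k z" and \<beta>: "bilinear_map k ?R c z \<beta>"
  interpret z: module k z by (rule z)
  define d where "d a = (\<lambda>b \<in> carrier G. if b = a then \<one>\<^bsub>k\<^esub> else \<zero>\<^bsub>k\<^esub>)" for a
  have d: "d a \<in> carrier ?R" for a
    using finite_subset[of "d a ` carrier G" "{\<one>\<^bsub>k\<^esub>, \<zero>\<^bsub>k\<^esub>}"] by (auto simp: d_def bounded_functions_def)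
  have \<beta>1: "restrict (\<beta> b) (carrier c) \<in> linear_maps k c z" if "b \<in> carrier ?R" for b
    using \<beta> that by (simp add: bilinear_map_def)
  have \<beta>2: "(\<lambda>b \<in> carrier ?R. \<beta> b v) \<in> linear_maps k ?R z" if "v \<in> carrier c" for v
    using \<beta> that by (simp add: bilinear_map_def)
  have \<beta>c: "\<beta> b v \<in> carrier z" if "b \<in> carrier ?R" "v \<in> carrier c" for b v
    using linear_maps_closed[OF \<beta>1[OF that(1)] that(2)] that(2) by simp
  have \<beta>a: "\<beta> b (v \<oplus>\<^bsub>c\<^esub> w) = \<beta> b v \<oplus>\<^bsub>z\<^esub> \<beta> b w" if "b \<in> carrier ?R" "v \<in> carrier c" "w \<in> carrier c" for b v w
    using linear_maps_add[OF \<beta>1[OF that(1)] that(2,3)] that by simp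
  have \<beta>s: "\<beta> b (t \<odot>\<^bsub>c\<^esub> v) = t \<odot>\<^bsub>z\<^esub> \<beta> b v" if "b \<in> carrier ?R" "v \<in> carrier c" "t \<in> carrier k" for b v t
    using linear_maps_smult[OF \<beta>1[OF that(1)] that(3,2)] that by simp
  have dt: "btensor c (d a) v = benc G (single G c a v)" if "v \<in> carrier c" for a v
  proof -
    have "(\<lambda>b \<in> carrier G. d a b \<odot>\<^bsub>c\<^esub> v) = single G c a v"
      using that by (auto simp: d_def single_def fun_eq_iff)
    then show ?thesis by (simp add: btensor_def)
  qed
  have \<phi>c: "bdec G w a \<in> carrier c" if "w \<in> carrier (bounded G c)" "a \<in> carrier G" for w a
    by (rule bdec_value_closed[OF c that])
  have bl: "restrict (benc G) (carrier (bfun G c)) \<in> linear_maps k (bfun G c) (bounded G c)"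
    by (rule gmaps_linear[OF benc_gmaps[OF c]])
  \<comment> \<open>Every element is a sum of tensors with indicator functions; uniqueness of the
    induced map follows from this.\<close>
  have dec: "finsum (bounded G c) (\<lambda>a. btensor c (d a) (bdec G w a)) (carrier G) = w"
    if w: "w \<in> carrier (bounded G c)" for w
  proof -
    have sc: "(\<lambda>a. single G c a (bdec G w a)) \<in> carrier G \<rightarrow> carrier (bfun G c)"
      using single_closed[OF c \<phi>c[OF w]] by blast
    have "finsum (bounded G c) (\<lambda>a. btensor c (d a) (bdec G w a)) (carrier G)
        = finsum (bounded G c) (\<lambda>a. restrict (benc G) (carrier (bfun G c)) (single G c a (bdec G w a))) (carrier G)"
      by (rule b.M.finsum_cong')
        (use sc \<phi>c[OF w] benc_closed[OF c] dt in \<open>auto simp del: bfun_simps\<close>)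
    also have "\<dots> = restrict (benc G) (carrier (bfun G c)) (finsum (bfun G c) (\<lambda>a. single G c a (bdec G w a)) (carrier G))"
      by (rule linear_maps_finsum[OF bf.module_axioms mb bl fin sc, symmetric])
    also have "\<dots> = w"
      using bdec_closed[OF c w] benc_bdec[OF c w]
      by (simp add: bfun_decomposition[OF c fin bdec_closed[OF c w]] del: bfun_simps)
    finally show ?thesis .
  qed
  define t where "t w a = \<beta> (d a) (bdec G w a)" for w a
  have t: "t w \<in> carrier G \<rightarrow> carrier z" if "w \<in> carrier (bounded G c)" for w
    using \<phi>c[OF that] \<beta>c[OF d] by (auto simp: t_def)
  let ?h = "\<lambda>w \<in> carrier (bounded G c). finsum z (t w) (carrier G)"
  have h: "?h \<in> linear_maps k (bounded G c) z"
    unfolding linear_maps_def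
  proof (intro CollectI conjI ballI)
    show "?h \<in> carrier (bounded G c) \<rightarrow>\<^sub>E carrier z"
      using z.M.finsum_closed[OF t] by auto
    fix w assume w: "w \<in> carrier (bounded G c)"
    show "?h (r \<odot>\<^bsub>bounded G c\<^esub> w) = r \<odot>\<^bsub>z\<^esub> ?h w" if r: "r \<in> carrier k" for r
    proof -
      have "finsum z (t (r \<odot>\<^bsub>bounded G c\<^esub> w)) (carrier G) = finsum z (\<lambda>a. r \<odot>\<^bsub>z\<^esub> t w a) (carrier G)"
        by (intro z.M.finsum_cong') (use t[OF w] \<phi>c[OF w] \<beta>c[OF d] \<beta>s[OF d] r bdec_smult[OF c w _ r] in \<open>auto simp: t_def\<close>)
      then show ?thesis
        using w r z.finsum_smult_ldistr[OF fin r t[OF w]] by simp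
    qed
    fix w' assume w': "w' \<in> carrier (bounded G c)"
    have "finsum z (t (w \<oplus>\<^bsub>bounded G c\<^esub> w')) (carrier G) = finsum z (\<lambda>a. t w a \<oplus>\<^bsub>z\<^esub> t w' a) (carrier G)"
      by (intro z.M.finsum_cong') (use t[OF w] t[OF w'] \<phi>c[OF w] \<phi>c[OF w'] \<beta>c[OF d] \<beta>a[OF d] bdec_add[OF c w _ w'] in \<open>auto simp: t_def\<close>)
    then show "?h (w \<oplus>\<^bsub>bounded G c\<^esub> w') = ?h w \<oplus>\<^bsub>z\<^esub> ?h w'"
      using w w' z.M.finsum_addf[OF t[OF w] t[OF w']] by simp
  qed
  have hb: "?h (btensor c b v) = \<beta> b v" if b: "b \<in> carrier ?R" and v: "v \<in> carrier c" for b v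
  proof -
    have w: "btensor c b v \<in> carrier (bounded G c)"
      unfolding btensor_def by (rule benc_closed[OF c btensor_fun_closed[OF b v]])
    have ba: "b a \<in> carrier k" if "a \<in> carrier G" for a
      using b that by (auto simp: bounded_functions_def)
    have "bdec G (btensor c b v) = (\<lambda>a \<in> carrier G. b a \<odot>\<^bsub>c\<^esub> v)"
      unfolding btensor_def by (rule bdec_benc_bfun[OF btensor_fun_closed[OF b v]])
    then have "?h (btensor c b v) = finsum z (\<lambda>a. \<beta> (d a) (b a \<odot>\<^bsub>c\<^esub> v)) (carrier G)"
      using w t[OF w] ba v \<beta>c[OF d] by (auto simp: t_def intro!: z.M.finsum_cong')
    also have "\<dots> = finsum z (\<lambda>a. b a \<odot>\<^bsub>z\<^esub> \<beta> (d a) v) (carrier G)"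
      by (rule z.M.finsum_cong') (use ba v \<beta>c[OF d] \<beta>s[OF d] in auto)
    also have "\<dots> = finsum z (\<lambda>a. (\<lambda>b \<in> carrier ?R. \<beta> b v) (b a \<odot>\<^bsub>?R\<^esub> d a)) (carrier G)"
    proof (rule z.M.finsum_cong')
      have "(\<lambda>b \<in> carrier ?R. \<beta> b v) (b a \<odot>\<^bsub>?R\<^esub> d a) = b a \<odot>\<^bsub>z\<^esub> \<beta> (d a) v" if "a \<in> carrier G" for a
        using linear_maps_smult[OF \<beta>2[OF v] ba[OF that] d] d by simp
      then show "(\<lambda>a. (\<lambda>b \<in> carrier ?R. \<beta> b v) (b a \<odot>\<^bsub>?R\<^esub> d a)) \<in> carrier G \<rightarrow> carrier z"
        "\<And>a. a \<in> carrier G \<Longrightarrow> b a \<odot>\<^bsub>z\<^esub> \<beta> (d a) v = (\<lambda>b \<in> carrier ?R. \<beta> b v) (b a \<odot>\<^bsub>?R\<^esub> d a)"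
        using ba v \<beta>c[OF d] by auto
    qed simp
    also have "\<dots> = \<beta> b v"
    proof -
      \<comment> \<open>Expanding \<open>b\<close> in indicator functions is
        \<open>bfun_decomposition\<close> for the regular module.\<close>
      let ?k = "regular_module k :: ('k, 'k, 'g) gmodule"
      have gk: "group_module k G ?k"
        by (rule group_module_regular[OF cring group])
      have lm: "(\<lambda>b \<in> carrier ?R. \<beta> b v) \<in> linear_maps k (bfun G ?k) z"
        using \<beta>2[OF v] by (simp add: linear_maps_def bounded_functions_def)
      have bk: "b \<in> carrier (bfun G ?k)"
        using b by (simp add: bounded_functions_def)
      have ds: "b a \<odot>\<^bsub>?R\<^esub> d a = single G ?k a (b a)" if "a \<in> carrier G" for a
        using ba[OF that] by (auto simp: bounded_functions_def d_def single_def fun_eq_iff)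
      have sc: "(\<lambda>a. single G ?k a (b a)) \<in> carrier G \<rightarrow> carrier (bfun G ?k)"
        using single_closed[OF gk] ba by auto
      have "finsum z (\<lambda>a. (\<lambda>b \<in> carrier ?R. \<beta> b v) (b a \<odot>\<^bsub>?R\<^esub> d a)) (carrier G)
          = finsum z (\<lambda>a. (\<lambda>b \<in> carrier ?R. \<beta> b v) (single G ?k a (b a))) (carrier G)"
        by (rule z.M.finsum_cong') (use sc linear_maps_closed[OF lm] ds in \<open>auto simp del: bfun_simps\<close>)
      also have "\<dots> = (\<lambda>b \<in> carrier ?R. \<beta> b v) (finsum (bfun G ?k) (\<lambda>a. single G ?k a (b a)) (carrier G))"
        by (rule linear_maps_finsum[OF group_module_module[OF group_module_bfun[OF gk]] z lm fin sc, symmetric])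
      also have "\<dots> = \<beta> b v"
        using b by (simp add: bfun_decomposition[OF gk fin bk])
      finally show ?thesis .
    qed
    finally show ?thesis .
  qed
  show "\<exists>!h. h \<in> linear_maps k (bounded G c) z \<and> (\<forall>b \<in> carrier ?R. \<forall>v \<in> carrier c. h (btensor c b v) = \<beta> b v)"
  proof (rule ex1I[of _ ?h])
    show "?h \<in> linear_maps k (bounded G c) z \<and> (\<forall>b \<in> carrier ?R. \<forall>v \<in> carrier c. ?h (btensor c b v) = \<beta> b v)"
      using h hb by blast
    fix h' assume h': "h' \<in> linear_maps k (bounded G c) z \<and> (\<forall>b \<in> carrier ?R. \<forall>v \<in> carrier c. h' (btensor c b v) = \<beta> b v)"
    have "h' w = ?h w" if w: "w \<in> carrier (bounded G c)" for w
    proof -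
      have bt: "(\<lambda>a. btensor c (d a) (bdec G w a)) \<in> carrier G \<rightarrow> carrier (bounded G c)"
        using \<phi>c[OF w] benc_closed[OF c single_closed[OF c]] dt by auto
      have "h' w = h' (finsum (bounded G c) (\<lambda>a. btensor c (d a) (bdec G w a)) (carrier G))"
        using dec[OF w] by simp
      also have "\<dots> = finsum z (\<lambda>a. h' (btensor c (d a) (bdec G w a))) (carrier G)"
        by (rule linear_maps_finsum[OF mb z _ fin bt]) (use h' in blast)
      also have "\<dots> = finsum z (t w) (carrier G)"
        by (rule z.M.finsum_cong') (use h' d \<phi>c[OF w] t[OF w] in \<open>auto simp: t_def\<close>)
      finally show ?thesis using w by simp
    qed
    then show "h' = ?h"
      using h h' by (auto simp: linear_maps_def PiE_iff intro!: extensionalityI[of _ "carrier (bounded G c)"])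
  qed
qed

end

end

section \<open>Comparison of \<open>Cof\<close> with the cofibrant modules\<close>

context group_universe begin

text \<open>Provides enough test modules for the orthogonal class over a finite group.\<close>

lemma projective_triv_Cof:
  fixes c :: "('k, 'u, 'g) gmodule"
  assumes fin: "finite (carrier G)" and c: "group_module k G c"
    and proj: "projective_module k (triv_subgroup G) c"
  shows "c \<in> Cof k G"
  unfolding Cof_def
  using c group_module_bounded[OF c] bounded_tensor_product[OF c fin] gact_btensor[OF c]
    projective_bounded[OF fin c proj] by blast

text \<open>Since \<open>t\<close> is projective, it is enough to factor the constant map through
  it: \<open>v\<close> goes to the tensor of the constant function 1 with \<open>v\<close>, and the
  universal property sends this on to the constant function with value \<open>v\<close>.\<close>

lemma Cof_cofibrant:
  fixes c :: "('k, 'u, 'g) gmodule"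
  assumes "c \<in> Cof k G"
  shows "cofibrant k G c"
proof -
  let ?R = "bounded_functions k G"
  obtain t :: "('k, 'u, 'g) gmodule" and \<tau> where c: "group_module k G c" and t: "group_module k G t"
    and tp: "is_tensor_product k ?R c t \<tau>"
    and act: "\<And>g b v. \<lbrakk>g \<in> carrier G; b \<in> carrier ?R; v \<in> carrier c\<rbrakk>
      \<Longrightarrow> gact t g (\<tau> b v) = \<tau> (gact ?R g b) (gact c g v)"
    and proj: "projective_module k G t"
    using assms unfolding Cof_def by blast
  interpret c: group_module k G c by (rule c)
  interpret t: group_module k G t by (rule t)
  note gb = group_module_bounded[OF c]
  interpret b: group_module k G "bounded G c" by (rule gb)
  have bil: "bilinear_map k ?R c t \<tau>"
    using tp by (simp add: is_tensor_product_def)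
  have \<tau>1: "restrict (\<tau> b) (carrier c) \<in> linear_maps k c t" if "b \<in> carrier ?R" for b
    using bil that by (simp add: bilinear_map_def)
  have \<tau>c: "\<tau> b v \<in> carrier t" if "b \<in> carrier ?R" "v \<in> carrier c" for b v
    using linear_maps_closed[OF \<tau>1[OF that(1)] that(2)] that(2) by simp
  \<comment> \<open>The universal property speaks of plain modules, so the action is truncated away,
    and the equivariance of \<open>h\<close> has to be recovered afterwards.\<close>
  let ?z = "module.truncate (bounded G c) :: ('k, 'u) module"
  have zs: "carrier ?z = carrier (bounded G c)" "\<zero>\<^bsub>?z\<^esub> = \<zero>\<^bsub>bounded G c\<^esub>"
    "add ?z = add (bounded G c)" "smult ?z = smult (bounded G c)"
    by (simp_all add: module.truncate_def)
  have zl: "linear_maps k x ?z = linear_maps k x (bounded G c)" for x :: "('k, 'u, 'g) gmodule"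
    by (simp add: linear_maps_def zs)
  have zm: "module k ?z"
  proof (rule moduleI[OF cring abelian_groupI])
    fix v assume "v \<in> carrier ?z"
    then show "\<exists>y\<in>carrier ?z. y \<oplus>\<^bsub>?z\<^esub> v = \<zero>\<^bsub>?z\<^esub>"
      using b.M.l_neg b.M.a_inv_closed unfolding zs by blast
  qed (simp_all add: zs b.M.a_ac b.smult_l_distr b.smult_r_distr b.smult_assoc1)
  have "bilinear_map k ?R c ?z (btensor c)"
    using btensor_bilinear[OF c] by (simp add: bilinear_map_def linear_maps_def zs)
  then have ex1: "\<exists>!h. h \<in> linear_maps k t (bounded G c) \<and>
      (\<forall>b \<in> carrier ?R. \<forall>v \<in> carrier c. h (\<tau> b v) = btensor c b v)"
    using tp zm unfolding is_tensor_product_def zl[symmetric] by blast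
  then obtain h where h: "h \<in> linear_maps k t (bounded G c)"
    "\<And>b v. \<lbrakk>b \<in> carrier ?R; v \<in> carrier c\<rbrakk> \<Longrightarrow> h (\<tau> b v) = btensor c b v" by blast
  have Ract: "gact ?R g b \<in> carrier ?R" if "g \<in> carrier G" "b \<in> carrier ?R" for g b
    using that by (auto simp: bounded_functions_def PiE_iff intro!: finite_image_comp[of b _ _ "\<lambda>x. x"])
  have "h (gact t g w) = gact (bounded G c) g (h w)" if g: "g \<in> carrier G" and w: "w \<in> carrier t" for g w
  proof -
    \<comment> \<open>Conjugating \<open>h\<close> by \<open>g\<close> gives another solution of the
      same universal problem, so uniqueness makes \<open>h\<close> equivariant.\<close>
    let ?h = "\<lambda>w \<in> carrier t. gact (bounded G c) (inv\<^bsub>G\<^esub> g) (h (gact t g w))"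
    note simps = linear_maps_closed[OF h(1)] linear_maps_add[OF h(1)] linear_maps_smult[OF h(1)]
      gact_closed[OF t] gact_closed[OF gb] gact_add[OF t] gact_add[OF gb] gact_smult[OF t] gact_smult[OF gb]
    have "?h \<in> linear_maps k t (bounded G c)"
      unfolding linear_maps_def using g by (auto simp: simps)
    moreover have "?h (\<tau> b v) = btensor c b v" if "b \<in> carrier ?R" "v \<in> carrier c" for b v
    proof -
      have "?h (\<tau> b v) = gact (bounded G c) (inv\<^bsub>G\<^esub> g) (gact (bounded G c) g (btensor c b v))"
        using g that \<tau>c h(2)[OF Ract[OF g that(1)] gact_closed[OF c g that(2)]] gact_btensor[OF c g that]
        by (simp add: act)
      also have "\<dots> = btensor c b v"
        using g linear_maps_closed[OF h(1) \<tau>c[OF that]] h(2)[OF that]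
        by (simp add: b.gact_mult[symmetric] b.gact_one)
      finally show ?thesis .
    qed
    ultimately have "?h = h"
      using ex1 h by blast
    then have "gact (bounded G c) g (?h w) = gact (bounded G c) g (h w)"
      by simp
    then show ?thesis
      using g w by (simp add: b.gact_mult[symmetric] b.gact_one simps)
  qed
  then have hg: "h \<in> gmaps k G t (bounded G c)"
    using h(1) by (simp add: gmaps_def)
  \<comment> \<open>The constant function 1 is fixed by \<open>G\<close>, which makes tensoring with
    it equivariant.\<close>
  define u where "u = (\<lambda>a \<in> carrier G. \<one>\<^bsub>k\<^esub>)"
  have u: "u \<in> carrier ?R"
    using finite_subset[of "u ` carrier G" "{\<one>\<^bsub>k\<^esub>}"] by (auto simp: u_def bounded_functions_def)
  have ug: "gact ?R g u = u" if "g \<in> carrier G" for g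
    using that by (auto simp: u_def bounded_functions_def fun_eq_iff)
  have a: "(\<lambda>v \<in> carrier c. \<tau> u v) \<in> gmaps k G c t"
    by (rule gmapsI[OF c]) (use \<tau>c[OF u] linear_maps_add[OF \<tau>1[OF u]] linear_maps_smult[OF \<tau>1[OF u]] act[OF _ u] ug in
      \<open>auto\<close>)
  have "bconst G c \<in> through_projective k G c (bounded G c)"
  proof (rule tpI[OF proj a hg bconst_gmaps[OF c]])
    fix v assume v: "v \<in> carrier c"
    have "(\<lambda>a \<in> carrier G. u a \<odot>\<^bsub>c\<^esub> v) = (\<lambda>a \<in> carrier G. v)"
      using v by (auto simp: u_def)
    then show "bconst G c v = h ((\<lambda>v \<in> carrier c. \<tau> u v) v)"
      using v h(2)[OF u v] by (simp add: btensor_def bconst_def)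
  qed
  with c show ?thesis by (simp add: cofibrant_def)
qed

section \<open>The group Ext\<close>

lemma comm_group_hom_group:
  fixes x y :: "('k, 'u, 'g) gmodule"
  assumes x: "group_module k G x" and y: "group_module k G y"
  shows "comm_group (hom_group k G x y)"
proof -
  interpret y: group_module k G y by (rule y)
  have mult: "(f \<otimes>\<^bsub>hom_group k G x y\<^esub> g) = sum_map x y f g" for f g
    by (simp add: hom_group_def sum_map_def)
  show ?thesis
  proof (rule comm_groupI)
    fix f g h assume f: "f \<in> carrier (hom_group k G x y)" and g: "g \<in> carrier (hom_group k G x y)"
      and h: "h \<in> carrier (hom_group k G x y)"
    then have f: "f \<in> gmaps k G x y" and g: "g \<in> gmaps k G x y" and h: "h \<in> gmaps k G x y"
      by (simp_all add: hom_group_def)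
    show "f \<otimes>\<^bsub>hom_group k G x y\<^esub> g \<in> carrier (hom_group k G x y)"
      using gmaps_sum[OF x y f g] by (simp add: mult) (simp add: hom_group_def)
    show "f \<otimes>\<^bsub>hom_group k G x y\<^esub> g \<otimes>\<^bsub>hom_group k G x y\<^esub> h = f \<otimes>\<^bsub>hom_group k G x y\<^esub> (g \<otimes>\<^bsub>hom_group k G x y\<^esub> h)"
      using gmaps_closed[OF f] gmaps_closed[OF g] gmaps_closed[OF h]
      by (auto simp: mult sum_map_def fun_eq_iff y.M.a_assoc)
    show "f \<otimes>\<^bsub>hom_group k G x y\<^esub> g = g \<otimes>\<^bsub>hom_group k G x y\<^esub> f"
      using gmaps_closed[OF f] gmaps_closed[OF g] by (auto simp: mult sum_map_def fun_eq_iff y.M.a_comm)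
    show "\<one>\<^bsub>hom_group k G x y\<^esub> \<otimes>\<^bsub>hom_group k G x y\<^esub> f = f"
      using gmaps_closed[OF f] gmaps_extensional[OF f]
      by (auto simp: mult sum_map_def hom_group_def zero_map_def intro!: extensionalityI[of _ "carrier x"])
    show "\<exists>g\<in>carrier (hom_group k G x y). g \<otimes>\<^bsub>hom_group k G x y\<^esub> f = \<one>\<^bsub>hom_group k G x y\<^esub>"
    proof (rule bexI)
      show "diff_map x y (zero_map x y) f \<otimes>\<^bsub>hom_group k G x y\<^esub> f = \<one>\<^bsub>hom_group k G x y\<^esub>"
        using gmaps_closed[OF f] by (auto simp: mult sum_map_def diff_map_def hom_group_def zero_map_def y.minus_eq y.M.l_neg)
      show "diff_map x y (zero_map x y) f \<in> carrier (hom_group k G x y)"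
        using gmaps_diff[OF x y gmaps_zero_map[OF x y] f] by (simp add: hom_group_def)
    qed
  qed (simp_all add: hom_group_def gmaps_zero_map[OF x y])
qed

lemma subgroup_hom_groupI:
  fixes x y :: "('k, 'u, 'g) gmodule"
  assumes x: "group_module k G x" and y: "group_module k G y" and S: "S \<subseteq> gmaps k G x y"
    and zero: "zero_map x y \<in> S" and diff: "\<And>f g. \<lbrakk>f \<in> S; g \<in> S\<rbrakk> \<Longrightarrow> diff_map x y f g \<in> S"
  shows "subgroup S (hom_group k G x y)"
proof -
  interpret y: group_module k G y by (rule y)
  interpret H: comm_group "hom_group k G x y" by (rule comm_group_hom_group[OF x y])
  have inv: "inv\<^bsub>hom_group k G x y\<^esub> f = diff_map x y (zero_map x y) f" if f: "f \<in> gmaps k G x y" for f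
  proof (rule H.inv_equality)
    show "diff_map x y (zero_map x y) f \<otimes>\<^bsub>hom_group k G x y\<^esub> f = \<one>\<^bsub>hom_group k G x y\<^esub>"
      using gmaps_closed[OF f] by (auto simp: diff_map_def hom_group_def zero_map_def y.minus_eq y.M.l_neg)
    show "diff_map x y (zero_map x y) f \<in> carrier (hom_group k G x y)"
      using gmaps_diff[OF x y gmaps_zero_map[OF x y] f] by (simp add: hom_group_def)
  qed (use f in \<open>simp add: hom_group_def\<close>)
  show ?thesis
  proof (rule H.subgroupI)
    show "S \<subseteq> carrier (hom_group k G x y)" "S \<noteq> {}"
      using S zero by (auto simp: hom_group_def)
    show "inv\<^bsub>hom_group k G x y\<^esub> f \<in> S" if "f \<in> S" for f
      using that S diff[OF zero that] by (auto simp: inv)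
    show "f \<otimes>\<^bsub>hom_group k G x y\<^esub> g \<in> S" if "f \<in> S" "g \<in> S" for f g
    proof -
      have fg: "f \<in> gmaps k G x y" "g \<in> gmaps k G x y"
        using that S by auto
      have "f \<otimes>\<^bsub>hom_group k G x y\<^esub> g = diff_map x y f (diff_map x y (zero_map x y) g)"
        using gmaps_closed[OF fg(1)] gmaps_closed[OF fg(2)]
        by (auto simp: hom_group_def diff_map_def zero_map_def y.minus_eq fun_eq_iff)
      then show ?thesis using that diff zero by simp
    qed
  qed
qed

text \<open>A cocycle of degree one vanishes on the kernel of \<open>c1\<close>, so it is a map from
  the syzygy of \<open>x\<close> to \<open>y\<close>; it is a coboundary if that map extends to the
  cover of \<open>x\<close>. Triviality is thus the extension property for one cover, and
  \<open>ext_vanishI\<close> and \<open>ext_vanishD\<close> relate it to all surjections.\<close>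

lemma trivial_Ext_iff:
  fixes x y :: "('k, 'u, 'g) gmodule"
  assumes x: "group_module k G x" and y: "group_module k G y"
  shows "trivial_group (Ext k G 1 x y) \<longleftrightarrow> ext_vanish k G x y"
proof -
  interpret y: group_module k G y by (rule y)
  define p0 c0 where "p0 = cover_mod k G x" and "c0 = cover_map k G x"
  let ?O = "syzygy k G x"
  define p1 c1 where "p1 = cover_mod k G ?O" and "c1 = cover_map k G ?O"
  define p2 c2 where "p2 = cover_mod k G (syzygy k G ?O)" and "c2 = cover_map k G (syzygy k G ?O)"
  have O: "?O = ker_module p0 x c0"
    by (simp add: syzygy_def p0_def c0_def)
  have OO: "syzygy k G ?O = ker_module p1 ?O c1"
    by (simp add: syzygy_def[of k G ?O] p1_def c1_def)
  note gO = group_module_syzygy[OF x] and gOO = group_module_syzygy[OF group_module_syzygy[OF x]]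
  have p0: "projective_module k G p0" and c0: "c0 \<in> epis k G p0 x"
    using cover_projective[OF x] cover_epi[OF x] by (simp_all add: p0_def c0_def)
  have p1: "projective_module k G p1" and c1: "c1 \<in> epis k G p1 ?O"
    using cover_projective[OF gO] cover_epi[OF gO] by (simp_all add: p1_def c1_def)
  have p2: "projective_module k G p2" and c2: "c2 \<in> epis k G p2 (syzygy k G ?O)"
    using cover_projective[OF gOO] cover_epi[OF gOO] by (simp_all add: p2_def c2_def)
  note g0 = projective_group_module[OF p0] and g1 = projective_group_module[OF p1]
    and g2 = projective_group_module[OF p2]
  have c1p0: "c1 \<in> gmaps k G p1 p0"
    using epis_gmaps[OF c1] unfolding O by (rule gmaps_ker_incl)
  have c2p1: "c2 \<in> gmaps k G p2 p1"
    using epis_gmaps[OF c2] unfolding OO by (rule gmaps_ker_incl)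
  have zO: "\<zero>\<^bsub>?O\<^esub> = \<zero>\<^bsub>p0\<^esub>"
    by (simp add: O)
  define Z where "Z = {f \<in> gmaps k G p1 y. \<forall>v \<in> carrier p1. c1 v = \<zero>\<^bsub>p0\<^esub> \<longrightarrow> f v = \<zero>\<^bsub>y\<^esub>}"
  define B where "B = (\<lambda>f. compose (carrier p1) f c1) ` gmaps k G p0 y"
  have cocycles: "Ext_cocycles k G 1 x y = Z"
  proof -
    have "compose (carrier p2) f c2 = zero_map p2 y \<longleftrightarrow> (\<forall>v \<in> carrier p1. c1 v = \<zero>\<^bsub>p0\<^esub> \<longrightarrow> f v = \<zero>\<^bsub>y\<^esub>)"
      (is "?l \<longleftrightarrow> ?r") for f
    proof
      assume l': ?l
      have l: "f (c2 u) = \<zero>\<^bsub>y\<^esub>" if "u \<in> carrier p2" for u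
        using that fun_cong[OF l', of u] by (simp add: compose_eq zero_map_def)
      show ?r
      proof (intro ballI impI)
        fix v assume "v \<in> carrier p1" "c1 v = \<zero>\<^bsub>p0\<^esub>"
        then have "v \<in> carrier (syzygy k G ?O)"
          unfolding OO by (simp add: zO)
        then show "f v = \<zero>\<^bsub>y\<^esub>"
          using epis_surj[OF c2] l by metis
      qed
    next
      assume r: ?r
      have "f (c2 u) = \<zero>\<^bsub>y\<^esub>" if "u \<in> carrier p2" for u
        using r gmaps_closed[OF epis_gmaps[OF c2] that] unfolding OO by (simp add: zO)
      then show ?l
        by (auto simp: compose_def zero_map_def fun_eq_iff)
    qed
    then show ?thesis
      by (simp add: Ext_cocycles_def res_mod_def res_diff_def Z_def p1_def p2_def c2_def)
  qed
  have coboundaries: "Ext_coboundaries k G 1 x y = B"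
    by (simp add: B_def res_mod_def res_diff_def p0_def p1_def c1_def)
  have res1: "res_mod k G x 1 = p1"
    by (simp add: res_mod_def p1_def)
  let ?H = "hom_group k G p1 y"
  interpret H: comm_group ?H by (rule comm_group_hom_group[OF g1 y])
  have Z: "subgroup Z ?H"
    by (rule subgroup_hom_groupI[OF g1 y])
       (use gmaps_diff[OF g1 y] gmaps_zero_map[OF g1 y] in \<open>auto simp: Z_def zero_map_def diff_map_def diff_self[OF y]\<close>)
  have BZ: "B \<subseteq> Z"
    using gmaps_comp[OF g1 c1p0] gmaps_zero[OF g0 y] by (auto simp: B_def Z_def compose_eq)
  have B: "subgroup B ?H"
  proof (rule subgroup_hom_groupI[OF g1 y])
    show "B \<subseteq> gmaps k G p1 y"
      using BZ by (auto simp: Z_def)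
    show "zero_map p1 y \<in> B"
      unfolding B_def
      by (rule image_eqI[OF _ gmaps_zero_map[OF g0 y]])
         (use gmaps_closed[OF c1p0] in \<open>auto simp: zero_map_def compose_def\<close>)
    fix f g assume "f \<in> B" "g \<in> B"
    then obtain f' g' where f': "f' \<in> gmaps k G p0 y" "f = compose (carrier p1) f' c1"
      and g': "g' \<in> gmaps k G p0 y" "g = compose (carrier p1) g' c1"
      by (auto simp: B_def)
    show "diff_map p1 y f g \<in> B"
      unfolding B_def
      by (rule image_eqI[OF _ gmaps_diff[OF g0 y f'(1) g'(1)]])
         (use gmaps_closed[OF c1p0] in \<open>auto simp: f'(2) g'(2) diff_map_def compose_def\<close>)
  qed
  let ?HZ = "?H\<lparr>carrier := Z\<rparr>"
  have E: "Ext k G 1 x y = ?HZ Mod B"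
    by (simp only: Ext_def cocycles coboundaries res1)
  have commZ: "comm_group ?HZ"
    using H.subgroup_imp_group[OF Z] subgroup.subset[OF Z] H.m_comm
    by (intro group.group_comm_groupI) auto
  interpret HZ: comm_group ?HZ by (rule commZ)
  have BHZ: "subgroup B ?HZ"
    using B BZ Z by (simp add: H.subgroup_incl)
  interpret N: normal B ?HZ
    by (rule HZ.subgroup_imp_normal[OF BHZ])
  have "trivial_group (Ext k G 1 x y) \<longleftrightarrow> Z \<subseteq> B"
  proof
    assume t: "trivial_group (Ext k G 1 x y)"
    show "Z \<subseteq> B"
    proof
      fix f assume f: "f \<in> Z"
      have "B #>\<^bsub>?HZ\<^esub> f \<in> carrier (?HZ Mod B)"
        using f by (auto simp: FactGroup_def RCOSETS_def)
      then have "B #>\<^bsub>?HZ\<^esub> f = B"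
        using t unfolding E trivial_group_def by simp
      then show "f \<in> B"
        using HZ.rcos_self[OF _ BHZ, of f] f by simp
    qed
  next
    assume "Z \<subseteq> B"
    then have "Z = B" using BZ by blast
    have "carrier (?HZ Mod B) = {B}"
    proof -
      have "B #>\<^bsub>?HZ\<^esub> f = B" if "f \<in> Z" for f
        using that \<open>Z = B\<close> HZ.coset_join2[OF _ BHZ, of f] by simp
      moreover have "zero_map p1 y \<in> Z"
        using subgroup.one_closed[OF Z] by (simp add: hom_group_def)
      ultimately show ?thesis
        by (auto simp: FactGroup_def RCOSETS_def)
    qed
    then show "trivial_group (Ext k G 1 x y)"
      unfolding E trivial_group_def using N.factorgroup_is_group by simp
  qed
  also have "\<dots> \<longleftrightarrow> ext_vanish k G x y"
  proof
    assume ZB: "Z \<subseteq> B"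
    show "ext_vanish k G x y"
    proof (rule ext_vanishI[OF x y p0 c0])
      fix f assume f: "f \<in> gmaps k G (ker_module p0 x c0) y"
      then have f': "f \<in> gmaps k G ?O y" by (simp only: O)
      have "compose (carrier p1) f c1 \<in> Z"
        using gmaps_comp[OF g1 epis_gmaps[OF c1] f'] gmaps_zero[OF gO y f'] by (auto simp: Z_def compose_eq zO)
      then obtain g where g: "g \<in> gmaps k G p0 y" "compose (carrier p1) f c1 = compose (carrier p1) g c1"
        using ZB by (auto simp: B_def)
      have "g v = f v" if v: "v \<in> carrier p0" "c0 v = \<zero>\<^bsub>x\<^esub>" for v
      proof -
        have "v \<in> carrier ?O" using v by (simp add: O)
        then obtain u where u: "u \<in> carrier p1" "c1 u = v"
          using epis_surj[OF c1] by blast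
        then show ?thesis
          using fun_cong[OF g(2), of u] by (simp add: compose_eq)
      qed
      then show "\<exists>h \<in> gmaps k G p0 y. \<forall>v \<in> carrier p0. c0 v = \<zero>\<^bsub>x\<^esub> \<longrightarrow> h v = f v"
        using g(1) by blast
    qed
  next
    assume van: "ext_vanish k G x y"
    show "Z \<subseteq> B"
    proof
      fix z assume z: "z \<in> Z"
      then have zg: "z \<in> gmaps k G p1 y" by (simp add: Z_def)
      obtain f where f: "f \<in> gmaps k G ?O y" "\<And>v. v \<in> carrier p1 \<Longrightarrow> f (c1 v) = z v"
      proof (rule gmaps_descend[OF g1 gO y epis_gmaps[OF c1] _ zg])
        show "\<exists>v\<in>carrier p1. c1 v = w" if "w \<in> carrier ?O" for w
          using epis_surj[OF c1 that] by blast
        show "z v = \<zero>\<^bsub>y\<^esub>" if "v \<in> carrier p1" "c1 v = \<zero>\<^bsub>?O\<^esub>" for v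
          using that z by (simp add: Z_def zO)
      qed blast
      obtain g where g: "g \<in> gmaps k G p0 y" "\<forall>v \<in> carrier p0. c0 v = \<zero>\<^bsub>x\<^esub> \<longrightarrow> g v = f v"
        using ext_vanishD[OF van g0 c0] f(1) unfolding O by blast
      have "z = compose (carrier p1) g c1"
      proof (rule gmaps_eqI[OF zg gmaps_comp[OF g1 c1p0 g(1)]])
        fix v assume v: "v \<in> carrier p1"
        have "c1 v \<in> carrier ?O" by (rule gmaps_closed[OF epis_gmaps[OF c1] v])
        then show "z v = compose (carrier p1) g c1 v"
          using f(2)[OF v] g(2) v unfolding O by (simp add: compose_eq)
      qed
      then show "z \<in> B" using g(1) by (auto simp: B_def)
    qed
  qed
  finally show ?thesis .
qed

section \<open>Modules of finite projective dimension\<close>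

lemma bconst_inverse:
  fixes c K :: "('k, 'u, 'g) gmodule"
  assumes c: "group_module k G c" and K: "group_module k G (ker_module (bounded G c) d e)"
    and ker: "carrier (ker_module (bounded G c) d e) = bconst G c ` carrier c"
  obtains i where "i \<in> gmaps k G (ker_module (bounded G c) d e) c" "\<And>v. v \<in> carrier c \<Longrightarrow> i (bconst G c v) = v"
proof -
  have "bconst G c \<in> gmaps k G c (ker_module (bounded G c) d e)"
    by (rule gmaps_into_ker[OF bconst_gmaps[OF c]]) (use ker in auto)
  from gmaps_inverse[OF c K this bconst_inj[OF c] equalityD1[OF ker]] show ?thesis
    using that by blast
qed

text \<open>Takes the place of Schanuel's lemma: the bound on \<open>w\<close> comes with some
  resolution, but the n-th kernel of a prescribed one must be shown projective. As in
  \<open>cofibrant_syzygies_of_bounded\<close>, \<open>w\<close> is decoupled from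
  \<open>X 0\<close>, whose identity need only factor through \<open>w\<close> up to maps through
  projectives.\<close>

lemma pd_le_resolution:
  fixes w :: "('k, 'u, 'g) gmodule" and X :: "nat \<Rightarrow> ('k, 'u, 'g) gmodule"
  assumes "pd_le k G n w" "group_module k G (X 0)" "a \<in> gmaps k G (X 0) w" "b \<in> gmaps k G w (X 0)"
    and "diff_map (X 0) (X 0) (\<lambda>v \<in> carrier (X 0). v) (compose (carrier (X 0)) b a) \<in> through_projective k G (X 0) (X 0)"
    and "\<And>i. i < n \<Longrightarrow> \<exists>q e. projective_module k G q \<and> e \<in> epis k G q (X i) \<and> X (Suc i) = ker_module q (X i) e"
  shows "projective_module k G (X n)"
  using assms
proof (induction arbitrary: X a b rule: pd_le.induct)
  case (pd_le_0 w)
  note x = pd_le_0(2)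
  have "compose (carrier (X 0)) b a \<in> through_projective k G (X 0) (X 0)"
    by (rule tpI[OF pd_le_0(1,3,4) gmaps_comp[OF x pd_le_0(3,4)]]) (simp add: compose_eq)
  then show ?case
    using tp_id_projective[OF x] tp_diff_sum[OF x x gmaps_id[OF x] gmaps_comp[OF x pd_le_0(3,4)] pd_le_0(5)] by blast
next
  case (pd_le_Suc w p e n)
  note w = pd_le_Suc(1) and p = pd_le_Suc(2) and e = pd_le_Suc(3) and x = pd_le_Suc(6)
    and \<alpha> = pd_le_Suc(7) and \<beta> = pd_le_Suc(8) and d = pd_le_Suc(9)
  obtain q c where q: "projective_module k G q" and c: "c \<in> epis k G q (X 0)" and X1: "X (Suc 0) = ker_module q (X 0) c"
    using pd_le_Suc(10)[of 0] by auto
  note gq = projective_group_module[OF q] and gp = projective_group_module[OF p]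
  note c' = epis_gmaps[OF c] and e' = epis_gmaps[OF e]
  let ?K = "ker_module q (X 0) c" and ?L = "ker_module p w e"
  note gK = group_module_ker[OF gq x c'] and gL = group_module_ker[OF gp w e']
  obtain f where f: "f \<in> gmaps k G q p" "\<forall>v \<in> carrier q. e (f v) = a (c v)"
    using projective_lift[OF q gp w e gmaps_comp[OF gq c' \<alpha>]] by (auto simp: compose_eq)
  obtain g where g: "g \<in> gmaps k G p q" "\<forall>v \<in> carrier p. c (g v) = b (e v)"
    using projective_lift[OF p gq x c gmaps_comp[OF gp e' \<beta>]] by (auto simp: compose_eq)
  let ?f = "restrict f (carrier ?K)" and ?g = "restrict g (carrier ?L)"
  have fK: "?f \<in> gmaps k G ?K ?L"
    by (rule gmaps_ker_ker[OF gK f(1)]) (use f(2) gmaps_zero[OF x w \<alpha>] in auto)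
  have gL': "?g \<in> gmaps k G ?L ?K"
    by (rule gmaps_ker_ker[OF gL g(1)]) (use g(2) gmaps_zero[OF w x \<beta>] in auto)
  note gf = gmaps_comp[OF gq f(1) g(1)] and gfK = gmaps_comp[OF gK fK gL']
  let ?h = "diff_map q q (\<lambda>v \<in> carrier q. v) (compose (carrier q) g f)"
  let ?t = "diff_map ?K ?K (\<lambda>v \<in> carrier ?K. v) (compose (carrier ?K) ?g ?f)"
  have h: "?h \<in> gmaps k G q q"
    by (rule gmaps_diff[OF gq gq gmaps_id[OF gq] gf])
  have t: "?t \<in> gmaps k G ?K ?K"
    by (rule gmaps_diff[OF gK gK gmaps_id[OF gK] gfK])
  have lift: "c (?h v) = diff_map (X 0) (X 0) (\<lambda>v \<in> carrier (X 0). v) (compose (carrier (X 0)) b a) (c v)"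
    if v: "v \<in> carrier q" for v
    using v f(2) g(2) gmaps_closed[OF c' v] gmaps_closed[OF f(1) v]
      gmaps_minus[OF gq x c' v gmaps_closed[OF g(1) gmaps_closed[OF f(1) v]]]
    by (simp add: diff_map_def compose_eq)
  note minus = ker_minus[OF gq gK]
  have th: "?t v = ?h v" if "v \<in> carrier q" "c v = \<zero>\<^bsub>X 0\<^esub>" for v
  proof -
    have v: "v \<in> carrier ?K" using that by simp
    have "compose (carrier ?K) ?g ?f v = g (f v)"
      using v gmaps_closed[OF fK v] by (simp add: compose_eq)
    then show ?thesis
      using that(1) v minus[OF v gmaps_closed[OF gfK v]]
      by (simp add: diff_map_def compose_eq del: carrier_ker_module)
  qed
  have "?t \<in> through_projective k G ?K ?K"
    by (rule tp_syzygy[OF x x q gq c c d h lift t th])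
  note tt = this
  have "projective_module k G ((\<lambda>i. X (Suc i)) n)"
  proof (rule pd_le_Suc(5)[where X = "\<lambda>i. X (Suc i)" and a = ?f and b = ?g])
    show "\<exists>q e. projective_module k G q \<and> e \<in> epis k G q (X (Suc i)) \<and> X (Suc (Suc i)) = ker_module q (X (Suc i)) e"
      if "i < n" for i
      using pd_le_Suc(10)[of "Suc i"] that by simp
  qed (simp_all only: X1 gK fK gL' tt)
  then show ?case by simp
qed

lemma pd_le_syzygies:
  fixes x :: "('k, 'u, 'g) gmodule"
  assumes "group_module k G x" "projective_module k G (syzygies k G n x)"
  shows "pd_le k G n x"
  using assms
proof (induction n arbitrary: x)
  case 0
  then show ?case by (simp add: pd_le.pd_le_0)
next
  case (Suc n)
  have "pd_le k G n (syzygy k G x)"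
    using Suc.IH[OF group_module_syzygy[OF Suc.prems(1)]] Suc.prems(2) by (simp add: funpow_swap1)
  then show ?case
    using pd_le.pd_le_Suc[OF Suc.prems(1) cover_projective[OF Suc.prems(1)] cover_epi[OF Suc.prems(1)]]
    by (simp add: syzygy_def)
qed

text \<open>The retraction of \<open>bounded G y\<close> onto \<open>y\<close> is passed down the
  syzygies, where it survives up to maps through projectives. The n-th syzygy is k-projective, so
  \<open>bounded G\<close> of it is projective and its identity factors through projectives.\<close>

lemma bounded_retract_finite_pd:
  fixes y :: "('k, 'u, 'g) gmodule"
  assumes fin: "finite (carrier G)" and y: "group_module k G y"
    and r: "r \<in> gmaps k G (bounded G y) y" and rc: "\<And>v. v \<in> carrier y \<Longrightarrow> r (bconst G y v) = v"
    and proj: "projective_module k (triv_subgroup G) (syzygies k G n y)"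
  shows "pd_le k G n y"
proof (rule pd_le_syzygies[OF y])
  let ?S = "\<lambda>i. syzygies k G i y"
  let ?id = "\<lambda>i. \<lambda>v \<in> carrier (?S i). v"
  note gS = group_module_syzygies[OF y]
  have "\<exists>r \<in> gmaps k G (bounded G (?S i)) (?S i).
      diff_map (?S i) (?S i) (?id i) (compose (carrier (?S i)) r (bconst G (?S i))) \<in> through_projective k G (?S i) (?S i)"
    for i
  proof (induction i)
    case 0
    have "diff_map y y (\<lambda>v \<in> carrier y. v) (compose (carrier y) r (bconst G y)) = zero_map y y"
      by (auto simp: diff_map_def zero_map_def compose_eq rc diff_self[OF y])
    then show ?case
      using r tp_zero[OF y y] by (intro bexI[of _ r]) (simp_all only: funpow_0)
  next
    case (Suc i)
    define x where "x = ?S i"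
    have x: "group_module k G x"
      unfolding x_def by (rule gS)
    note gb = group_module_bounded[OF x]
    obtain s where s: "s \<in> gmaps k G (bounded G x) x"
      "diff_map x x (\<lambda>v \<in> carrier x. v) (compose (carrier x) s (bconst G x)) \<in> through_projective k G x x"
      using Suc unfolding x_def by blast
    define q c where "q = cover_mod k G x" and "c = cover_map k G x"
    have q: "projective_module k G q" and c: "c \<in> epis k G q x"
      using cover_projective[OF x] cover_epi[OF x] by (simp_all add: q_def c_def)
    note gq = projective_group_module[OF q] and c' = epis_gmaps[OF c]
    note bq = group_module_bounded[OF gq]
    let ?K = "ker_module q x c"
    note gK = group_module_ker[OF gq x c']
    \<comment> \<open>Projectivity of \<open>bounded G q\<close>, which rests on the finiteness of
      \<open>G\<close>, allows the retraction to be lifted along \<open>c\<close>.\<close>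
    have pb: "projective_module k G (bounded G q)"
      by (rule projective_bounded[OF fin gq projective_triv[OF q]])
    obtain t where t: "t \<in> gmaps k G (bounded G q) q" "\<forall>b \<in> carrier (bounded G q). c (t b) = s (bmap G q c b)"
      using projective_lift[OF pb gq x c gmaps_comp[OF bq bmap_gmaps[OF gq x c'] s(1)]] by (auto simp: compose_eq)
    let ?t = "restrict t (carrier (bounded G ?K))"
    have kb: "ker_module (bounded G q) (bounded G x) (bmap G q c) = bounded G ?K"
      by (rule ker_bmap[OF gq x c'])
    have gk: "group_module k G (ker_module (bounded G q) (bounded G x) (bmap G q c))"
      unfolding kb by (rule group_module_bounded[OF gK])
    have tK: "?t \<in> gmaps k G (bounded G ?K) ?K"
      unfolding kb[symmetric]
      by (rule gmaps_ker_ker[OF gk t(1)]) (use t(2) gmaps_zero[OF gb x s(1)] in auto)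
    have bK: "bconst G ?K v = bconst G q v" if "v \<in> carrier ?K" for v
      using that by (simp add: bconst_def)
    note tc = gmaps_comp[OF gq bconst_gmaps[OF gq] t(1)] and tcK = gmaps_comp[OF gK bconst_gmaps[OF gK] tK]
    let ?h = "diff_map q q (\<lambda>v \<in> carrier q. v) (compose (carrier q) t (bconst G q))"
    let ?d = "diff_map ?K ?K (\<lambda>v \<in> carrier ?K. v) (compose (carrier ?K) ?t (bconst G ?K))"
    have h: "?h \<in> gmaps k G q q"
      by (rule gmaps_diff[OF gq gq gmaps_id[OF gq] tc])
    have d: "?d \<in> gmaps k G ?K ?K"
      by (rule gmaps_diff[OF gK gK gmaps_id[OF gK] tcK])
    have lift: "c (?h v) = diff_map x x (\<lambda>v \<in> carrier x. v) (compose (carrier x) s (bconst G x)) (c v)"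
      if v: "v \<in> carrier q" for v
      using v t(2) gmaps_closed[OF c' v] gmaps_closed[OF bconst_gmaps[OF gq] v]
        gmaps_minus[OF gq x c' v gmaps_closed[OF t(1) gmaps_closed[OF bconst_gmaps[OF gq] v]]]
      by (simp add: diff_map_def compose_eq bmap_bconst[OF gq x c'])
    note minus = ker_minus[OF gq gK]
    have dh: "?d v = ?h v" if "v \<in> carrier q" "c v = \<zero>\<^bsub>x\<^esub>" for v
    proof -
      have v: "v \<in> carrier ?K" using that by simp
      have "compose (carrier ?K) ?t (bconst G ?K) v = t (bconst G q v)"
        using v gmaps_closed[OF bconst_gmaps[OF gK] v] bK[OF v] by (simp add: compose_eq)
      then show ?thesis
        using that(1) v minus[OF v gmaps_closed[OF tcK v]]
        by (simp add: diff_map_def compose_eq del: carrier_ker_module)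
    qed
    have "?d \<in> through_projective k G ?K ?K"
      by (rule tp_syzygy[OF x x q gq c c s(2) h lift d dh])
    moreover have "?S (Suc i) = ?K"
      by (simp add: syzygy_def x_def q_def c_def)
    ultimately show ?case
      using tK by (intro bexI[of _ ?t]) (simp_all only:)
  qed
  then obtain s where s: "s \<in> gmaps k G (bounded G (?S n)) (?S n)"
    "diff_map (?S n) (?S n) (?id n) (compose (carrier (?S n)) s (bconst G (?S n))) \<in> through_projective k G (?S n) (?S n)"
    by blast
  note sc = gmaps_comp[OF gS bconst_gmaps[OF gS] s(1)]
  have "compose (carrier (?S n)) s (bconst G (?S n)) \<in> through_projective k G (?S n) (?S n)"
    by (rule tpI[OF projective_bounded[OF fin gS proj] bconst_gmaps[OF gS] s(1) sc]) (simp add: compose_eq)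
  then show "projective_module k G (?S n)"
    by (intro tp_id_projective[OF gS] tp_diff_sum[OF gS gS gmaps_id[OF gS] sc s(2)])
qed

text \<open>As Ext^1(c, p) = 0 for the cover \<open>p\<close> of \<open>y\<close>, it remains to
  lift maps from \<open>c\<close> to \<open>y\<close> along that cover. Such a map extends to
  \<open>bounded G c\<close>, because the cokernel of the constant map is again a k-projective test
  module, and from the projective module \<open>bounded G c\<close> it lifts.\<close>

lemma ext_vanish_syzygy:
  fixes y :: "('k, 'u, 'g) gmodule"
  assumes fin: "finite (carrier G)" and y: "group_module k G y"
    and van: "\<And>c :: ('k, 'u, 'g) gmodule. \<lbrakk>group_module k G c; projective_module k (triv_subgroup G) c\<rbrakk> \<Longrightarrow> ext_vanish k G c y"
    and c: "group_module k G c" and proj: "projective_module k (triv_subgroup G) c"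
  shows "ext_vanish k G c (syzygy k G y)"
proof -
  define p e where "p = cover_mod k G y" and "e = cover_map k G y"
  have p: "projective_module k G p" and e: "e \<in> epis k G p y" and S: "syzygy k G y = ker_module p y e"
    using cover_projective[OF y] cover_epi[OF y] by (simp_all add: p_def e_def syzygy_def)
  obtain q :: "('k, 'u, 'g) gmodule" and \<pi> where q: "projective_module k G q" and \<pi>: "\<pi> \<in> epis k G q c"
    using enough_projectives[OF c] by blast
  note gp = projective_group_module[OF p] and gq = projective_group_module[OF q]
    and \<pi>' = epis_gmaps[OF \<pi>] and e' = epis_gmaps[OF e]
  note gK = group_module_ker[OF gq c \<pi>']
  note gb = group_module_bounded[OF c]
  have cof: "cofibrant k G c"
    by (rule Cof_cofibrant[OF projective_triv_Cof[OF fin c proj]])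
  obtain d :: "('k, 'u, 'g) gmodule" and \<rho> where d: "group_module k G d" "projective_module k (triv_subgroup G) d"
    "\<rho> \<in> epis k G (bounded G c) d" and ker: "carrier (ker_module (bounded G c) d \<rho>) = bconst G c ` carrier c"
    using bounded_cokernel[OF fin c proj] by blast
  show ?thesis
  proof (rule ext_vanishI[OF c group_module_syzygy[OF y] q \<pi>])
    fix f assume f: "f \<in> gmaps k G (ker_module q c \<pi>) (syzygy k G y)"
    then have fp: "f \<in> gmaps k G (ker_module q c \<pi>) p"
      unfolding S by (rule gmaps_ker_incl)
    obtain g where g: "g \<in> gmaps k G q p" "\<forall>v \<in> carrier q. \<pi> v = \<zero>\<^bsub>c\<^esub> \<longrightarrow> g v = f v"
      using ext_vanishD[OF cofibrant_ext_vanish_projective[OF cof p] gq \<pi> fp] by blast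
    have eg: "e (g v) = \<zero>\<^bsub>y\<^esub>" if "v \<in> carrier q" "\<pi> v = \<zero>\<^bsub>c\<^esub>" for v
      using gmaps_closed[OF f, of v] that g(2) by (simp add: S)
    \<comment> \<open>\<open>g\<close> extends \<open>f\<close> with values in \<open>p\<close>.
      What keeps its values out of the kernel of \<open>e\<close> is this induced map on
      \<open>c\<close>.\<close>
    obtain g' where g': "g' \<in> gmaps k G c y" "\<And>v. v \<in> carrier q \<Longrightarrow> g' (\<pi> v) = e (g v)"
    proof (rule gmaps_descend[OF gq c y \<pi>' _ gmaps_comp[OF gq g(1) e']])
      show "\<exists>v\<in>carrier q. \<pi> v = w" if "w \<in> carrier c" for w
        using epis_surj[OF \<pi> that] by blast
      show "compose (carrier q) e g v = \<zero>\<^bsub>y\<^esub>" if "v \<in> carrier q" "\<pi> v = \<zero>\<^bsub>c\<^esub>" for v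
        using that eg by (simp add: compose_eq)
    qed (simp add: compose_eq)
    obtain i where i: "i \<in> gmaps k G (ker_module (bounded G c) d \<rho>) c" "\<And>v. v \<in> carrier c \<Longrightarrow> i (bconst G c v) = v"
      using bconst_inverse[OF c group_module_ker[OF gb d(1) epis_gmaps[OF d(3)]] ker] by blast
    note gi = gmaps_comp[OF group_module_ker[OF gb d(1) epis_gmaps[OF d(3)]] i(1) g'(1)]
    obtain h where h: "h \<in> gmaps k G (bounded G c) y"
      "\<forall>v \<in> carrier (bounded G c). \<rho> v = \<zero>\<^bsub>d\<^esub> \<longrightarrow> h v = compose (carrier (ker_module (bounded G c) d \<rho>)) g' i v"
      using ext_vanishD[OF van[OF d(1,2)] gb d(3) gi] by blast
    have hb: "h (bconst G c v) = g' v" if v: "v \<in> carrier c" for v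
    proof -
      have "bconst G c v \<in> carrier (ker_module (bounded G c) d \<rho>)"
        unfolding ker using v by blast
      then show ?thesis
        using h(2) i(2)[OF v] by (simp add: compose_eq)
    qed
    obtain t where t: "t \<in> gmaps k G (bounded G c) p" "\<forall>v \<in> carrier (bounded G c). e (t v) = h v"
      using projective_lift[OF projective_bounded[OF fin c proj] gp y e h(1)] by blast
    \<comment> \<open>The correction term factors over \<open>c\<close>, so it vanishes on the
      kernel of \<open>\<pi>\<close>, and it agrees with \<open>g\<close> after
      \<open>e\<close>.\<close>
    let ?s = "compose (carrier q) t (compose (carrier q) (bconst G c) \<pi>)"
    have s: "?s \<in> gmaps k G q p"
      by (rule gmaps_comp[OF gq gmaps_comp[OF gq \<pi>' bconst_gmaps[OF c]] t(1)])
    have sv: "?s v = t (bconst G c (\<pi> v))" if "v \<in> carrier q" for v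
      using that by (simp add: compose_eq)
    have bc: "bconst G c (\<pi> v) \<in> carrier (bounded G c)" if "v \<in> carrier q" for v
      by (rule gmaps_closed[OF bconst_gmaps[OF c] gmaps_closed[OF \<pi>' that]])
    have "diff_map q p g ?s \<in> gmaps k G q (ker_module p y e)"
    proof (rule gmaps_into_ker[OF gmaps_diff[OF gq gp g(1) s]])
      fix v assume v: "v \<in> carrier q"
      have "e (g v \<ominus>\<^bsub>p\<^esub> ?s v) = e (g v) \<ominus>\<^bsub>y\<^esub> e (?s v)"
        by (rule gmaps_minus[OF gp y e' gmaps_closed[OF g(1) v] gmaps_closed[OF s v]])
      also have "e (?s v) = e (g v)"
        unfolding sv[OF v] using t(2) bc[OF v] hb[OF gmaps_closed[OF \<pi>' v]] g'(2)[OF v] by simp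
      finally show "e (diff_map q p g ?s v) = \<zero>\<^bsub>y\<^esub>"
        using v gmaps_closed[OF e' gmaps_closed[OF g(1) v]] by (simp add: diff_map_def diff_self[OF y])
    qed
    moreover have "diff_map q p g ?s v = f v" if v: "v \<in> carrier q" "\<pi> v = \<zero>\<^bsub>c\<^esub>" for v
    proof -
      have "?s v = \<zero>\<^bsub>p\<^esub>"
        unfolding sv[OF v(1)] v(2) by (simp add: gmaps_zero[OF c gb bconst_gmaps[OF c]] gmaps_zero[OF gb gp t(1)])
      then show ?thesis
        using v g(2) gmaps_closed[OF g(1) v(1)] by (simp add: diff_map_def diff_zero[OF gp])
    qed
    ultimately show "\<exists>h \<in> gmaps k G q (syzygy k G y). \<forall>v \<in> carrier q. \<pi> v = \<zero>\<^bsub>c\<^esub> \<longrightarrow> h v = f v"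
      unfolding S by blast
  qed
qed

text \<open>Shift from \<open>y\<close> to its n-th syzygy \<open>x\<close>, which is k-projective.
  Orthogonality to the cokernel of \<open>x\<close> in \<open>bounded G x\<close> splits this
  embedding, so \<open>x\<close> is a retract of a projective module.\<close>

lemma ext_vanish_finite_pd:
  fixes y :: "('k, 'u, 'g) gmodule"
  assumes fin: "finite (carrier G)" and y: "group_module k G y"
    and van: "\<And>c :: ('k, 'u, 'g) gmodule. \<lbrakk>group_module k G c; projective_module k (triv_subgroup G) c\<rbrakk> \<Longrightarrow> ext_vanish k G c y"
    and proj: "projective_module k (triv_subgroup G) (syzygies k G n y)"
  shows "pd_le k G n y"
proof (rule pd_le_syzygies[OF y])
  define x where "x = syzygies k G n y"
  have x: "group_module k G x" and px: "projective_module k (triv_subgroup G) x"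
    using group_module_syzygies[OF y] proj by (simp_all add: x_def)
  have vanx: "ext_vanish k G c x" if "group_module k G c" "projective_module k (triv_subgroup G) c"
    for c :: "('k, 'u, 'g) gmodule"
  proof -
    have "\<forall>c :: ('k, 'u, 'g) gmodule. group_module k G c \<longrightarrow> projective_module k (triv_subgroup G) c \<longrightarrow>
        ext_vanish k G c (syzygies k G i y)" for i
    proof (induction i)
      case (Suc i)
      then show ?case
        using ext_vanish_syzygy[OF fin group_module_syzygies[OF y, of i]] by simp
    qed (simp add: van)
    then show ?thesis using that by (simp add: x_def)
  qed
  note gb = group_module_bounded[OF x]
  obtain d :: "('k, 'u, 'g) gmodule" and \<rho> where d: "group_module k G d" "projective_module k (triv_subgroup G) d"
    "\<rho> \<in> epis k G (bounded G x) d" and ker: "carrier (ker_module (bounded G x) d \<rho>) = bconst G x ` carrier x"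
    using bounded_cokernel[OF fin x px] by blast
  obtain i where i: "i \<in> gmaps k G (ker_module (bounded G x) d \<rho>) x" "\<And>v. v \<in> carrier x \<Longrightarrow> i (bconst G x v) = v"
    using bconst_inverse[OF x group_module_ker[OF gb d(1) epis_gmaps[OF d(3)]] ker] by blast
  obtain h where h: "h \<in> gmaps k G (bounded G x) x" "\<forall>v \<in> carrier (bounded G x). \<rho> v = \<zero>\<^bsub>d\<^esub> \<longrightarrow> h v = i v"
    using ext_vanishD[OF vanx[OF d(1,2)] gb d(3) i(1)] by blast
  have "h (bconst G x v) = v" if v: "v \<in> carrier x" for v
  proof -
    have "bconst G x v \<in> carrier (ker_module (bounded G x) d \<rho>)"
      unfolding ker using v by blast
    then show ?thesis using h(2) i(2)[OF v] by simp
  qed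
  then show "projective_module k G (syzygies k G n y)"
    unfolding x_def[symmetric]
    by (rule projective_retract[OF projective_bounded[OF fin x px] x bconst_gmaps[OF x] h(1)])
qed

end

section \<open>Global dimension\<close>

text \<open>Changes the type of the acting group: global dimension is stated over the one-element
  group of type \<open>unit\<close>, whereas syzygies are restricted to the trivial subgroup of
  \<open>G\<close>.\<close>

definition trivial_action :: "('k, 'u, 'a) gmodule \<Rightarrow> ('k, 'u, 'b) gmodule" where
  "trivial_action x = \<lparr>carrier = carrier x, monoid.mult = mult x, monoid.one = \<one>\<^bsub>x\<^esub>, ring.zero = \<zero>\<^bsub>x\<^esub>,
     add = add x, smult = smult x, gact = (\<lambda>g v. v)\<rparr>"

lemma trivial_action_simps [simp]:
  "carrier (trivial_action x) = carrier x" "\<zero>\<^bsub>trivial_action x\<^esub> = \<zero>\<^bsub>x\<^esub>" "add (trivial_action x) = add x"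
  "smult (trivial_action x) = smult x" "gact (trivial_action x) = (\<lambda>g v. v)"
  by (simp_all add: trivial_action_def)

lemma group_module_trivial_action:
  fixes x :: "('k, 'u, 'a) gmodule" and L :: "'b monoid"
  assumes x: "group_module k H x" and L: "group L"
  shows "group_module k L (trivial_action x)"
proof -
  interpret x: group_module k H x by (rule x)
  show ?thesis
  proof (rule group_moduleI)
    fix v assume "v \<in> carrier (trivial_action x :: ('k, 'u, 'b) gmodule)"
    then show "\<exists>w\<in>carrier (trivial_action x :: ('k, 'u, 'b) gmodule). w \<oplus>\<^bsub>trivial_action x\<^esub> v = \<zero>\<^bsub>trivial_action x\<^esub>"
      by (intro bexI[of _ "\<ominus>\<^bsub>x\<^esub> v"]) (auto simp: x.M.l_neg)
  qed (use x.R.is_cring L in \<open>auto simp: x.M.a_assoc x.smult_l_distr x.smult_r_distr x.smult_assoc1 intro: x.M.a_comm\<close>)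
qed

lemma gmaps_trivial_group:
  assumes H: "carrier H = {\<one>\<^bsub>H\<^esub>}" and x: "group_module k H x" and y: "group_module k H y"
  shows "gmaps k H x y = linear_maps k x y"
proof -
  interpret x: group_module k H x by (rule x)
  interpret y: group_module k H y by (rule y)
  show ?thesis
    using H x.gact_one y.gact_one by (auto simp: gmaps_def linear_maps_def PiE_iff)
qed

text \<open>A relation instead of an equality, because the two records differ in the type of the
  acting group.\<close>

definition same_linear :: "('k, 'u, 'a) gmodule \<Rightarrow> ('k, 'u, 'b) gmodule \<Rightarrow> bool" where
  "same_linear x y \<longleftrightarrow> carrier x = carrier y \<and> \<zero>\<^bsub>x\<^esub> = \<zero>\<^bsub>y\<^esub> \<and> add x = add y \<and> smult x = smult y"

lemma same_linear_maps:
  assumes "same_linear x x'" "same_linear y y'"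
  shows "linear_maps k x y = linear_maps k x' y'"
  using assms by (simp add: same_linear_def linear_maps_def)

text \<open>Over a one-element group every linear map is equivariant, so a lifting problem moves
  from one such group to another by giving the modules the trivial action.\<close>

lemma projective_trivial_group:
  fixes H :: "'a monoid" and L :: "'b monoid" and p :: "('k, 'u, 'a) gmodule" and q :: "('k, 'u, 'b) gmodule"
  assumes H: "group H" "carrier H = {\<one>\<^bsub>H\<^esub>}" and L: "carrier L = {\<one>\<^bsub>L\<^esub>}"
    and p: "projective_module k H p" and q: "group_module k L q" and pq: "same_linear p q"
  shows "projective_module k L q"
  unfolding projective_module_def
proof (intro conjI allI impI ballI)
  fix x y :: "('k, 'u, 'b) gmodule" and e f
  assume x: "group_module k L x" and y: "group_module k L y" and e: "e \<in> epis k L x y" and f: "f \<in> gmaps k L q y"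
  let ?x = "trivial_action x :: ('k, 'u, 'a) gmodule" and ?y = "trivial_action y :: ('k, 'u, 'a) gmodule"
  have xs: "same_linear x ?x" and ys: "same_linear y ?y"
    and xs': "same_linear ?x x" and ys': "same_linear ?y y"
    by (simp_all add: same_linear_def)
  have gx: "group_module k H ?x" and gy: "group_module k H ?y"
    using group_module_trivial_action x y H(1) by blast+
  note gp = projective_group_module[OF p]
  have e': "e \<in> epis k H ?x ?y"
    using e same_linear_maps[OF xs ys]
    by (simp add: epis_iff gmaps_trivial_group[OF H(2) gx gy] gmaps_trivial_group[OF L x y])
  have f': "f \<in> gmaps k H p ?y"
    using f same_linear_maps[OF pq ys', of k]
    by (simp add: gmaps_trivial_group[OF H(2) gp gy] gmaps_trivial_group[OF L q y])
  obtain h where h: "h \<in> gmaps k H p ?x" "\<forall>v \<in> carrier p. e (h v) = f v"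
    using projective_lift[OF p gx gy e' f'] by blast
  have hq: "h \<in> gmaps k L q x"
    using h(1) same_linear_maps[OF pq xs', of k]
    by (simp add: gmaps_trivial_group[OF H(2) gp gx] gmaps_trivial_group[OF L q x])
  have "compose (carrier q) e h = f"
    by (rule gmaps_eqI[OF gmaps_comp[OF q hq epis_gmaps[OF e]] f])
       (use h(2) pq in \<open>simp add: compose_eq same_linear_def\<close>)
  then show "\<exists>h\<in>gmaps k L q x. compose (carrier q) e h = f"
    using hq by blast
qed (rule q)

lemma pd_le_trivial_group:
  fixes H :: "'a monoid" and L :: "'b monoid" and x :: "('k, 'u, 'a) gmodule" and y :: "('k, 'u, 'b) gmodule"
  assumes H: "group H" "carrier H = {\<one>\<^bsub>H\<^esub>}" and L: "group L" "carrier L = {\<one>\<^bsub>L\<^esub>}"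
  shows "\<lbrakk>pd_le k H n x; group_module k L y; same_linear x y\<rbrakk> \<Longrightarrow> pd_le k L n y"
proof (induction arbitrary: y rule: pd_le.induct)
  case (pd_le_0 x)
  then show ?case
    using projective_trivial_group[OF H L(2)] pd_le.pd_le_0 by blast
next
  case (pd_le_Suc x p e n)
  let ?p = "trivial_action p :: ('k, 'u, 'b) gmodule"
  note gp = projective_group_module[OF pd_le_Suc(2)] and x = pd_le_Suc(1) and y = pd_le_Suc(6)
  have ps: "same_linear p ?p"
    by (simp add: same_linear_def)
  have gp': "group_module k L ?p"
    by (rule group_module_trivial_action[OF gp L(1)])
  have p': "projective_module k L ?p"
    by (rule projective_trivial_group[OF H L(2) pd_le_Suc(2) gp' ps])
  have e': "e \<in> epis k L ?p y"
    using pd_le_Suc(3,7) same_linear_maps[OF ps pd_le_Suc(7)]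
    by (simp add: epis_iff gmaps_trivial_group[OF H(2) gp x] gmaps_trivial_group[OF L(2) gp' y] same_linear_def)
  have "same_linear (ker_module p x e) (ker_module ?p y e)"
    using pd_le_Suc(7) by (simp add: same_linear_def)
  then have "pd_le k L n (ker_module ?p y e)"
    using pd_le_Suc(5) group_module_ker[OF gp' y epis_gmaps[OF e']] by blast
  then show ?case
    by (rule pd_le.pd_le_Suc[OF y p' e'])
qed

context group_universe begin

lemma group_universe_triv: "group_universe k (triv_subgroup G) u"
  unfolding triv_subgroup_def by (rule group_universe_subgroup[OF G.triv_subgroup])

text \<open>Projective kG-modules are k-projective, so the kG-syzygies of \<open>y\<close> come from
  a resolution over k, and \<open>pd_le_resolution\<close> applies to it with the bound from the
  global dimension.\<close>

lemma syzygies_projective_triv: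
  fixes y :: "('k, 'u, 'g) gmodule"
  assumes gd: "finite_global_dimension u k" and y: "group_module k G y"
  shows "\<exists>n. projective_module k (triv_subgroup G) (syzygies k G n y)"
proof -
  let ?T = "triv_subgroup G"
  interpret T: group_universe k ?T u by (rule group_universe_triv)
  let ?S = "singleton_group () :: unit monoid"
  have S: "group ?S" "carrier ?S = {\<one>\<^bsub>?S\<^esub>}"
    by (simp_all add: singleton_group_def group_def monoid_def group_axioms_def Units_def)
  have T: "group ?T" "carrier ?T = {\<one>\<^bsub>?T\<^esub>}"
    using T.group by (simp_all add: triv_subgroup_def)
  obtain n where n: "\<And>x :: ('k, 'u, unit) gmodule. group_module k ?S x \<Longrightarrow> pd_le k ?S n x"
    using gd unfolding finite_global_dimension_def by blast
  note yT = group_module_triv[OF y]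
  have pd: "pd_le k ?T n y"
  proof (rule pd_le_trivial_group[OF S T])
    show "pd_le k ?S n (trivial_action y)"
      by (rule n[OF group_module_trivial_action[OF yT S(1)]])
  qed (use yT in \<open>simp_all add: same_linear_def\<close>)
  let ?X = "\<lambda>i. syzygies k G i y"
  note id = gmaps_id[OF yT]
  have zero: "diff_map y y (\<lambda>v \<in> carrier y. v) (compose (carrier y) (\<lambda>v \<in> carrier y. v) (\<lambda>v \<in> carrier y. v)) = zero_map y y"
    by (auto simp: diff_map_def zero_map_def compose_eq diff_self[OF y])
  have "projective_module k ?T (?X n)"
  proof (rule T.pd_le_resolution[where X = ?X, OF pd, unfolded funpow_0, OF yT id id])
    show "diff_map y y (\<lambda>v \<in> carrier y. v) (compose (carrier y) (\<lambda>v \<in> carrier y. v) (\<lambda>v \<in> carrier y. v))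
        \<in> through_projective k ?T y y"
      unfolding zero by (rule T.tp_zero[OF yT yT])
    show "\<exists>q e. projective_module k ?T q \<and> e \<in> epis k ?T q (?X i) \<and> ?X (Suc i) = ker_module q (?X i) e" for i
    proof -
      note g = group_module_syzygies[OF y, of i]
      have "cover_map k G (?X i) \<in> epis k ?T (cover_mod k G (?X i)) (?X i)"
        using cover_epi[OF g] gmaps_triv[OF group] by (auto simp: epis_iff)
      then show ?thesis
        using projective_triv[OF cover_projective[OF g]] by (auto simp: syzygy_def)
    qed
  qed
  then show ?thesis by blast
qed

text \<open>One inclusion tests \<open>y\<close> on the k-projective modules, all of which lie in
  \<open>Cof\<close>; the other uses that modules in \<open>Cof\<close> are cofibrant.\<close>

lemma right_perp_Cof_finite_group:
  fixes y :: "('k, 'u, 'g) gmodule"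
  assumes gd: "finite_global_dimension u k" and fin: "finite (carrier G)"
  shows "y \<in> right_perp k G (Cof k G) \<longleftrightarrow> group_module k G y \<and> finite_pd k G y"
proof
  assume "y \<in> right_perp k G (Cof k G)"
  then have y: "group_module k G y" and tr: "\<And>x. x \<in> Cof k G \<Longrightarrow> trivial_group (Ext k G 1 x y)"
    by (auto simp: right_perp_def)
  have van: "ext_vanish k G c y" if c: "group_module k G c" "projective_module k (triv_subgroup G) c"
    for c :: "('k, 'u, 'g) gmodule"
    using tr[OF projective_triv_Cof[OF fin c]] trivial_Ext_iff[OF c(1) y] by blast
  obtain n where "projective_module k (triv_subgroup G) (syzygies k G n y)"
    using syzygies_projective_triv[OF gd y] by blast
  then have "pd_le k G n y"
    using ext_vanish_finite_pd[OF fin y van] by blast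
  then show "group_module k G y \<and> finite_pd k G y"
    using y by (auto simp: finite_pd_def)
next
  assume *: "group_module k G y \<and> finite_pd k G y"
  then obtain n where y: "group_module k G y" and n: "pd_le k G n y"
    by (auto simp: finite_pd_def)
  have "trivial_group (Ext k G 1 x y)" if "x \<in> Cof k G" for x
    using cofibrant_ext_vanish[OF n Cof_cofibrant[OF that]]
      trivial_Ext_iff[OF cofibrant_group_module[OF Cof_cofibrant[OF that]] y] by blast
  then show "y \<in> right_perp k G (Cof k G)"
    using y by (simp add: right_perp_def)
qed

text \<open>With one element chosen from each right coset of \<open>F\<close>,
  \<open>\<sigma> a\<close> is the factor in \<open>F\<close> that carries the chosen element of the
  coset to \<open>a\<close>.\<close>

lemma equivariant_section:
  assumes F: "subgroup F G"
  obtains \<sigma> where "\<And>a. a \<in> carrier G \<Longrightarrow> \<sigma> a \<in> F"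
    "\<And>h a. \<lbrakk>h \<in> F; a \<in> carrier G\<rbrakk> \<Longrightarrow> \<sigma> (h \<otimes>\<^bsub>G\<^esub> a) = h \<otimes>\<^bsub>G\<^esub> \<sigma> a"
proof -
  have sub: "F \<subseteq> carrier G"
    by (rule subgroup.subset[OF F])
  define t where "t a = (SOME t. t \<in> F #>\<^bsub>G\<^esub> a)" for a
  define \<sigma> where "\<sigma> a = a \<otimes>\<^bsub>G\<^esub> inv\<^bsub>G\<^esub> t a" for a
  have t: "t a \<in> F #>\<^bsub>G\<^esub> a" if "a \<in> carrier G" for a
    unfolding t_def by (rule someI[of _ a]) (rule G.rcos_self[OF that F])
  have "\<sigma> a \<in> F" if a: "a \<in> carrier G" for a
  proof -
    obtain h where h: "h \<in> F" "t a = h \<otimes>\<^bsub>G\<^esub> a"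
      using t[OF a] by (auto simp: r_coset_def)
    then have "\<sigma> a = inv\<^bsub>G\<^esub> h"
      using a sub by (auto simp: \<sigma>_def G.inv_mult_group G.m_assoc[symmetric])
    then show ?thesis using subgroup.m_inv_closed[OF F h(1)] by simp
  qed
  moreover have "\<sigma> (h \<otimes>\<^bsub>G\<^esub> a) = h \<otimes>\<^bsub>G\<^esub> \<sigma> a" if h: "h \<in> F" and a: "a \<in> carrier G" for h a
  proof -
    have "F #>\<^bsub>G\<^esub> (h \<otimes>\<^bsub>G\<^esub> a) = F #>\<^bsub>G\<^esub> a"
      using G.coset_mult_assoc[OF sub _ a, of h] G.coset_join2[OF _ F h] h sub by auto
    then have "t (h \<otimes>\<^bsub>G\<^esub> a) = t a" by (simp add: t_def)
    moreover have "t a \<in> carrier G"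
      using t[OF a] G.r_coset_subset_G[OF sub a] by blast
    ultimately show ?thesis
      using h a sub by (auto simp: \<sigma>_def G.m_assoc)
  qed
  ultimately show ?thesis using that by blast
qed

text \<open>A function on \<open>F\<close> whose values are functions on \<open>G\<close> is
  evaluated at \<open>\<sigma> a\<close> and then at \<open>a\<close>; a constant function returns
  its value. Finiteness of \<open>F\<close> keeps the number of values finite, and equivariance of
  \<open>\<sigma>\<close> makes the retraction \<open>F\<close>-equivariant.\<close>

lemma bounded_restriction_retract:
  fixes z :: "('k, 'u, 'g) gmodule"
  assumes F: "subgroup F G" and fin: "finite F" and z: "group_module k G z"
  shows "\<exists>r \<in> gmaps k (G\<lparr>carrier := F\<rparr>) (bounded (G\<lparr>carrier := F\<rparr>) (bounded G z)) (bounded G z).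
    \<forall>v \<in> carrier (bounded G z). r (bconst (G\<lparr>carrier := F\<rparr>) (bounded G z) v) = v"
proof -
  let ?H = "G\<lparr>carrier := F\<rparr>" and ?y = "bounded G z"
  interpret H: group_universe k ?H u by (rule group_universe_subgroup[OF F])
  have sub: "F \<subseteq> carrier G"
    by (rule subgroup.subset[OF F])
  note y = group_module_bounded[OF z]
  have yH: "group_module k ?H ?y"
    by (rule group_module_subgroup[OF y F])
  note b = H.group_module_bounded[OF yH]
  interpret b: group_module k ?H "bounded ?H ?y" by (rule b)
  interpret y: group_module k G ?y by (rule y)
  have iH: "inv\<^bsub>?H\<^esub> h = inv\<^bsub>G\<^esub> h" if "h \<in> F" for h
    by (rule G.m_inv_consistent[OF F that])
  obtain \<sigma> where \<sigma>: "\<And>a. a \<in> carrier G \<Longrightarrow> \<sigma> a \<in> F"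
    "\<And>h a. \<lbrakk>h \<in> F; a \<in> carrier G\<rbrakk> \<Longrightarrow> \<sigma> (h \<otimes>\<^bsub>G\<^esub> a) = h \<otimes>\<^bsub>G\<^esub> \<sigma> a"
    using equivariant_section[OF F] by blast
  define m where "m \<beta> = (\<lambda>a \<in> carrier G. bdec G (bdec ?H \<beta> (\<sigma> a)) a)" for \<beta> :: 'u
  have mv: "m \<beta> a = bdec G (bdec ?H \<beta> (\<sigma> a)) a" if "a \<in> carrier G" for \<beta> a
    using that by (simp add: m_def)
  have vy: "bdec ?H \<beta> h \<in> carrier ?y" if "\<beta> \<in> carrier (bounded ?H ?y)" "h \<in> F" for \<beta> h
    using H.bdec_value_closed[OF yH that(1)] that(2) by simp
  have mc: "m \<beta> \<in> carrier (bfun G z)" if \<beta>: "\<beta> \<in> carrier (bounded ?H ?y)" for \<beta>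
  proof -
    have "m \<beta> ` carrier G \<subseteq> (\<Union>v \<in> bdec ?H \<beta> ` F. bdec G v ` carrier G)"
      using \<sigma>(1) by (auto simp: m_def)
    moreover have "finite (\<Union>v \<in> bdec ?H \<beta> ` F. bdec G v ` carrier G)"
      using fin bdec_closed[OF z vy[OF \<beta>]] by auto
    ultimately have "finite (m \<beta> ` carrier G)"
      by (rule finite_subset)
    then show ?thesis
      using bdec_value_closed[OF z vy[OF \<beta> \<sigma>(1)]] by (auto simp: m_def)
  qed
  have "restrict (\<lambda>\<beta>. benc G (m \<beta>)) (carrier (bounded ?H ?y)) \<in> gmaps k ?H (bounded ?H ?y) ?y"
  proof (rule gmapsI[OF b])
    fix \<beta> assume \<beta>: "\<beta> \<in> carrier (bounded ?H ?y)"
    have bm: "benc G (m \<beta>) \<in> carrier ?y"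
      by (rule benc_closed[OF z mc[OF \<beta>]])
    then show "benc G (m \<beta>) \<in> carrier ?y" .
    have bdm: "bdec G (benc G (m \<beta>)) a = bdec G (bdec ?H \<beta> (\<sigma> a)) a" if "a \<in> carrier G" for a
      using that by (simp add: bdec_benc_bfun[OF mc[OF \<beta>]] mv)
    show "benc G (m (t \<odot>\<^bsub>bounded ?H ?y\<^esub> \<beta>)) = t \<odot>\<^bsub>?y\<^esub> benc G (m \<beta>)" if t: "t \<in> carrier k" for t
    proof (rule benc_eqI[OF z mc])
      fix a assume a: "a \<in> carrier G"
      show "m (t \<odot>\<^bsub>bounded ?H ?y\<^esub> \<beta>) a = bdec G (t \<odot>\<^bsub>?y\<^esub> benc G (m \<beta>)) a"
        using a t \<sigma>(1)[OF a] bdm[OF a] vy[OF \<beta> \<sigma>(1)[OF a]]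
        by (simp add: mv H.bdec_smult[OF yH \<beta>] bdec_smult[OF z bm a] bdec_smult[OF z _ a])
    qed (use \<beta> t bm in auto)
    show "benc G (m (gact (bounded ?H ?y) h \<beta>)) = gact ?y h (benc G (m \<beta>))" if h: "h \<in> carrier ?H" for h
    proof (rule benc_eqI[OF z mc])
      have hF: "h \<in> F" and hG: "h \<in> carrier G" using h sub by auto
      show "gact (bounded ?H ?y) h \<beta> \<in> carrier (bounded ?H ?y)"
        by (rule gact_closed[OF b h \<beta>])
      show "gact ?y h (benc G (m \<beta>)) \<in> carrier ?y"
        by (rule gact_closed[OF y hG bm])
      fix a assume a: "a \<in> carrier G"
      have ia: "inv\<^bsub>G\<^esub> h \<otimes>\<^bsub>G\<^esub> a \<in> carrier G" using hG a by simp
      have si: "\<sigma> (inv\<^bsub>G\<^esub> h \<otimes>\<^bsub>G\<^esub> a) = inv\<^bsub>G\<^esub> h \<otimes>\<^bsub>G\<^esub> \<sigma> a"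
        by (rule \<sigma>(2)[OF subgroup.m_inv_closed[OF F hF] a])
      have "m (gact (bounded ?H ?y) h \<beta>) a = bdec G (gact ?y h (bdec ?H \<beta> (\<sigma> (inv\<^bsub>G\<^esub> h \<otimes>\<^bsub>G\<^esub> a)))) a"
        using a \<sigma>(1)[OF a] H.bdec_act[OF yH \<beta>, of "\<sigma> a" h] hF by (simp add: mv iH si)
      also have "\<dots> = gact z h (bdec G (bdec ?H \<beta> (\<sigma> (inv\<^bsub>G\<^esub> h \<otimes>\<^bsub>G\<^esub> a))) (inv\<^bsub>G\<^esub> h \<otimes>\<^bsub>G\<^esub> a))"
        by (rule bdec_act[OF z vy[OF \<beta> \<sigma>(1)[OF ia]] a hG])
      also have "\<dots> = bdec G (gact ?y h (benc G (m \<beta>))) a"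
        by (simp add: bdec_act[OF z bm a hG] bdm[OF ia])
      finally show "m (gact (bounded ?H ?y) h \<beta>) a = bdec G (gact ?y h (benc G (m \<beta>))) a" .
    qed
    fix \<gamma> assume \<gamma>: "\<gamma> \<in> carrier (bounded ?H ?y)"
    have bm': "benc G (m \<gamma>) \<in> carrier ?y"
      by (rule benc_closed[OF z mc[OF \<gamma>]])
    have bdm': "bdec G (benc G (m \<gamma>)) a = bdec G (bdec ?H \<gamma> (\<sigma> a)) a" if "a \<in> carrier G" for a
      using that by (simp add: bdec_benc_bfun[OF mc[OF \<gamma>]] mv)
    show "benc G (m (\<beta> \<oplus>\<^bsub>bounded ?H ?y\<^esub> \<gamma>)) = benc G (m \<beta>) \<oplus>\<^bsub>?y\<^esub> benc G (m \<gamma>)"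
    proof (rule benc_eqI[OF z mc])
      fix a assume a: "a \<in> carrier G"
      show "m (\<beta> \<oplus>\<^bsub>bounded ?H ?y\<^esub> \<gamma>) a = bdec G (benc G (m \<beta>) \<oplus>\<^bsub>?y\<^esub> benc G (m \<gamma>)) a"
        using a \<sigma>(1)[OF a] bdm[OF a] bdm'[OF a] vy[OF \<beta> \<sigma>(1)[OF a]] vy[OF \<gamma> \<sigma>(1)[OF a]]
        by (simp add: mv H.bdec_add[OF yH \<beta> _ \<gamma>] bdec_add[OF z bm a bm'] bdec_add[OF z _ a])
    qed (use \<beta> \<gamma> bm bm' in auto)
  qed
  moreover have "restrict (\<lambda>\<beta>. benc G (m \<beta>)) (carrier (bounded ?H ?y)) (bconst ?H ?y v) = v" if v: "v \<in> carrier ?y" for v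
  proof -
    note c = gmaps_closed[OF H.bconst_gmaps[OF yH] v]
    have "benc G (m (bconst ?H ?y v)) = v"
      by (rule benc_eqI[OF z mc[OF c] v]) (use \<sigma>(1) H.bdec_bconst[OF yH v] in \<open>simp add: mv\<close>)
    then show ?thesis using c by simp
  qed
  ultimately show ?thesis by blast
qed

end

section \<open>Groups of type Phi\<close>

locale phi_universe = group_universe k G u
  for k :: "'k ring" and G :: "'g monoid" and u :: "'u itself" +
  assumes gldim: "finite_global_dimension u k" and phi: "type_Phi u k G"
begin

lemma finite_pd_iff:
  fixes x :: "('k, 'u, 'g) gmodule"
  assumes "group_module k G x"
  shows "finite_pd k G x \<longleftrightarrow> (\<forall>F. subgroup F G \<and> finite F \<longrightarrow> finite_pd k (G\<lparr>carrier := F\<rparr>) x)"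
  using phi assms unfolding type_Phi_def by blast

lemma finite_pd_bounded:
  fixes x :: "('k, 'u, 'g) gmodule"
  assumes x: "group_module k G x"
  shows "finite_pd k G (bounded G x)"
  unfolding finite_pd_iff[OF group_module_bounded[OF x]]
proof (intro allI impI)
  fix F assume F: "subgroup F G \<and> finite F"
  let ?H = "G\<lparr>carrier := F\<rparr>"
  interpret H: group_universe k ?H u by (rule group_universe_subgroup) (use F in blast)
  have yH: "group_module k ?H (bounded G x)"
    by (rule group_module_subgroup[OF group_module_bounded[OF x]]) (use F in blast)
  obtain r where r: "r \<in> gmaps k ?H (bounded ?H (bounded G x)) (bounded G x)"
    "\<And>v. v \<in> carrier (bounded G x) \<Longrightarrow> r (bconst ?H (bounded G x) v) = v"
    using bounded_restriction_retract[OF _ _ x] F by blast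
  obtain n where "projective_module k (triv_subgroup ?H) (syzygies k ?H n (bounded G x))"
    using H.syzygies_projective_triv[OF gldim yH] by blast
  then have "pd_le k ?H n (bounded G x)"
    using H.bounded_retract_finite_pd[OF _ yH r] F by simp
  then show "finite_pd k ?H (bounded G x)"
    by (auto simp: finite_pd_def)
qed

lemma W_class_iff:
  fixes x :: "('k, 'u, 'g) gmodule"
  shows "x \<in> W_class k G \<longleftrightarrow> group_module k G x \<and> finite_pd k G x"
proof -
  have "x \<in> right_perp k (G\<lparr>carrier := F\<rparr>) (Cof k (G\<lparr>carrier := F\<rparr>)) \<longleftrightarrow> finite_pd k (G\<lparr>carrier := F\<rparr>) x"
    if x: "group_module k G x" and F: "subgroup F G" "finite F" for F
  proof -
    interpret H: group_universe k "G\<lparr>carrier := F\<rparr>" u by (rule group_universe_subgroup[OF F(1)])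
    show ?thesis
      using H.right_perp_Cof_finite_group[OF gldim, of x] F(2) group_module_subgroup[OF x F(1)] by simp
  qed
  then show ?thesis
    unfolding W_class_def using finite_pd_iff by blast
qed

lemma PCof_iff:
  fixes x :: "('k, 'u, 'g) gmodule"
  shows "x \<in> PCof k G \<longleftrightarrow> cofibrant k G x"
proof
  assume "x \<in> PCof k G"
  then have x: "group_module k G x" and tr: "\<And>y. y \<in> W_class k G \<Longrightarrow> trivial_group (Ext k G 1 x y)"
    by (auto simp: PCof_def left_perp_def)
  show "cofibrant k G x"
  proof (rule cofibrantI[OF x finite_pd_bounded[OF x]])
    fix y :: "('k, 'u, 'g) gmodule" assume y: "finite_pd k G y"
    then have gy: "group_module k G y"
      using pd_le_group_module by (auto simp: finite_pd_def)
    show "ext_vanish k G x y"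
      using tr[of y] trivial_Ext_iff[OF x gy] gy y by (simp add: W_class_iff)
  qed
next
  assume c: "cofibrant k G x"
  note x = cofibrant_group_module[OF c]
  have "trivial_group (Ext k G 1 x y)" if y: "y \<in> W_class k G" for y
  proof -
    obtain n where "pd_le k G n y" and gy: "group_module k G y"
      using y by (auto simp: W_class_iff finite_pd_def)
    then show ?thesis
      using cofibrant_ext_vanish[OF _ c] trivial_Ext_iff[OF x gy] by blast
  qed
  then show "x \<in> PCof k G"
    using x by (simp add: PCof_def left_perp_def)
qed

end

section \<open>Equivalences of categories\<close>

lemma isomorphism_inI:
  assumes "f \<in> Hom C x y" "g \<in> Hom C y x" "Comp C x y x g f = Ident C x" "Comp C y x y f g = Ident C y"
  shows "isomorphism_in C x y f"
  using assms unfolding isomorphism_in_def by blast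

lemma (in category) isomorphism_in_comp:
  assumes ob: "x \<in> Ob C" "y \<in> Ob C" "z \<in> Ob C"
    and f: "isomorphism_in C x y f" and g: "isomorphism_in C y z g"
  shows "isomorphism_in C x z (Comp C x y z g f)"
proof -
  obtain f' where f': "f \<in> Hom C x y" "f' \<in> Hom C y x" "Comp C x y x f' f = Ident C x" "Comp C y x y f f' = Ident C y"
    using f unfolding isomorphism_in_def by blast
  obtain g' where g': "g \<in> Hom C y z" "g' \<in> Hom C z y" "Comp C y z y g' g = Ident C y" "Comp C z y z g g' = Ident C z"
    using g unfolding isomorphism_in_def by blast
  note gf = Comp_in_Hom[OF ob f'(1) g'(1)] and fg' = Comp_in_Hom[OF ob(3,2,1) g'(2) f'(2)]
  show ?thesis
  proof (rule isomorphism_inI[OF gf fg'])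
    have "Comp C x z x (Comp C z y x f' g') (Comp C x y z g f) = Comp C x y x f' (Comp C x z y g' (Comp C x y z g f))"
      using Comp_assoc[OF ob(1,3,2,1) gf g'(2) f'(2)] by simp
    also have "Comp C x z y g' (Comp C x y z g f) = f"
      using Comp_assoc[OF ob(1,2,3,2) f'(1) g'(1,2)] g'(3) Ident_Comp[OF ob(1,2) f'(1)] by simp
    finally show "Comp C x z x (Comp C z y x f' g') (Comp C x y z g f) = Ident C x"
      using f'(3) by simp
    have "Comp C z x z (Comp C x y z g f) (Comp C z y x f' g') = Comp C z y z g (Comp C z x y f (Comp C z y x f' g'))"
      using Comp_assoc[OF ob(3,1,2,3) fg' f'(1) g'(1)] by simp
    also have "Comp C z x y f (Comp C z y x f' g') = g'"
      using Comp_assoc[OF ob(3,2,1,2) g'(2) f'(2,1)] f'(4) Ident_Comp[OF ob(3,2) g'(2)] by simp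
    finally show "Comp C z x z (Comp C x y z g f) (Comp C z y x f' g') = Ident C z"
      using g'(4) by simp
  qed
qed

lemma isomorphism_in_inverse:
  assumes "isomorphism_in C x y f"
  obtains g where "isomorphism_in C y x g"
  using assms unfolding isomorphism_in_def by blast

lemma (in category_functor) isomorphism_in_image:
  assumes ob: "x \<in> Ob C" "y \<in> Ob C" and f: "isomorphism_in C x y f"
  shows "isomorphism_in D (Fo x) (Fo y) (Fm x y f)"
proof -
  obtain g where g: "f \<in> Hom C x y" "g \<in> Hom C y x" "Comp C x y x g f = Ident C x" "Comp C y x y f g = Ident C y"
    using f unfolding isomorphism_in_def by blast
  show ?thesis
    by (rule isomorphism_inI[OF Fm_in_Hom[OF ob g(1)] Fm_in_Hom[OF ob(2,1) g(2)]])
       (use Fm_Comp[OF ob(1,2,1) g(1,2)] Fm_Comp[OF ob(2,1,2) g(2,1)] g(3,4) Fm_Ident[OF ob(1)] Fm_Ident[OF ob(2)] in simp_all)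
qed

text \<open>A fully faithful and essentially surjective functor is an equivalence. It points from
  \<open>D\<close> to \<open>C\<close>, as the inclusion of \<open>PCof\<close> into all modules
  does.\<close>

lemma equivalent_categoriesI:
  assumes "category_functor D C Io Im"
    and bij: "\<And>x y. \<lbrakk>x \<in> Ob D; y \<in> Ob D\<rbrakk> \<Longrightarrow> bij_betw (Im x y) (Hom D x y) (Hom C (Io x) (Io y))"
    and ess: "\<And>x. x \<in> Ob C \<Longrightarrow> \<exists>y \<in> Ob D. \<exists>f. isomorphism_in C x (Io y) f"
  shows "equivalent_categories C D"
proof -
  interpret C: category C by (rule category_functor.axioms(2)[OF assms(1)])
  interpret D: category D by (rule category_functor.axioms(1)[OF assms(1)])
  interpret I: category_functor D C Io Im by fact
  \<comment> \<open>The object, the isomorphism to its image and the inverse are chosen together as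
    a triple, so that they match.\<close>
  have "\<forall>x. \<exists>yfg. x \<in> Ob C \<longrightarrow> fst yfg \<in> Ob D \<and> fst (snd yfg) \<in> Hom C x (Io (fst yfg)) \<and>
      snd (snd yfg) \<in> Hom C (Io (fst yfg)) x \<and>
      Comp C x (Io (fst yfg)) x (snd (snd yfg)) (fst (snd yfg)) = Ident C x \<and>
      Comp C (Io (fst yfg)) x (Io (fst yfg)) (fst (snd yfg)) (snd (snd yfg)) = Ident C (Io (fst yfg))"
    (is "\<forall>x. \<exists>yfg. ?P x yfg")
  proof
    fix x
    show "\<exists>yfg. ?P x yfg"
    proof (cases "x \<in> Ob C")
      case True
      then obtain y f where y: "y \<in> Ob D" and "isomorphism_in C x (Io y) f"
        using ess by blast
      then obtain g where "f \<in> Hom C x (Io y)" "g \<in> Hom C (Io y) x" "Comp C x (Io y) x g f = Ident C x"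
        "Comp C (Io y) x (Io y) f g = Ident C (Io y)"
        unfolding isomorphism_in_def by blast
      then show ?thesis using y by (intro exI[of _ "(y, f, g)"]) simp
    qed simp
  qed
  then obtain choice where ch: "\<And>x. ?P x (choice x)" by metis
  define Fo where "Fo x = fst (choice x)" for x
  define \<eta> where "\<eta> x = fst (snd (choice x))" for x
  define \<theta> where "\<theta> x = snd (snd (choice x))" for x
  have Fo: "Fo x \<in> Ob D" and \<eta>: "\<eta> x \<in> Hom C x (Io (Fo x))" and \<theta>: "\<theta> x \<in> Hom C (Io (Fo x)) x"
    and \<theta>\<eta>: "Comp C x (Io (Fo x)) x (\<theta> x) (\<eta> x) = Ident C x"
    and \<eta>\<theta>: "Comp C (Io (Fo x)) x (Io (Fo x)) (\<eta> x) (\<theta> x) = Ident C (Io (Fo x))" if "x \<in> Ob C" for x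
    using ch[of x] that by (simp_all add: Fo_def \<eta>_def \<theta>_def)
  have IFo: "Io (Fo x) \<in> Ob C" if "x \<in> Ob C" for x
    by (rule I.Fo_in_Ob[OF Fo[OF that]])
  \<comment> \<open>\<open>f\<close> transported along the chosen isomorphisms; the inverse functor
    takes its unique preimage under \<open>Im\<close>.\<close>
  define conj where "conj x y f = Comp C (Io (Fo x)) x (Io (Fo y)) (Comp C x y (Io (Fo y)) (\<eta> y) f) (\<theta> x)" for x y f
  define Fm where "Fm x y f = inv_into (Hom D (Fo x) (Fo y)) (Im (Fo x) (Fo y)) (conj x y f)" for x y f
  have conj: "conj x y f \<in> Hom C (Io (Fo x)) (Io (Fo y))" if "x \<in> Ob C" "y \<in> Ob C" "f \<in> Hom C x y" for x y f
    unfolding conj_def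
    by (rule C.Comp_in_Hom[OF IFo[OF that(1)] that(1) IFo[OF that(2)] \<theta>[OF that(1)]
          C.Comp_in_Hom[OF that(1,2) IFo[OF that(2)] that(3) \<eta>[OF that(2)]]])
  have Fm: "Fm x y f \<in> Hom D (Fo x) (Fo y)" and IFm: "Im (Fo x) (Fo y) (Fm x y f) = conj x y f"
    if "x \<in> Ob C" "y \<in> Ob C" "f \<in> Hom C x y" for x y f
  proof -
    have "conj x y f \<in> Im (Fo x) (Fo y) ` Hom D (Fo x) (Fo y)"
      using conj[OF that] bij[OF Fo[OF that(1)] Fo[OF that(2)]] by (simp add: bij_betw_def)
    then show "Fm x y f \<in> Hom D (Fo x) (Fo y)" "Im (Fo x) (Fo y) (Fm x y f) = conj x y f"
      unfolding Fm_def by (rule inv_into_into, rule f_inv_into_f)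
  qed
  \<comment> \<open>Equations in \<open>D\<close> are verified in \<open>C\<close>, by
    faithfulness.\<close>
  have inj: "f = g" if "x \<in> Ob D" "y \<in> Ob D" "f \<in> Hom D x y" "g \<in> Hom D x y" "Im x y f = Im x y g" for x y f g
    using bij[OF that(1,2)] that(3-5) by (auto simp: bij_betw_def dest: inj_onD)
  have conj_\<eta>: "Comp C x (Io (Fo x)) (Io (Fo y)) (conj x y f) (\<eta> x) = Comp C x y (Io (Fo y)) (\<eta> y) f"
    if x: "x \<in> Ob C" and y: "y \<in> Ob C" and f: "f \<in> Hom C x y" for x y f
  proof -
    note h = C.Comp_in_Hom[OF x y IFo[OF y] f \<eta>[OF y]]
    show ?thesis
      unfolding conj_def
      using C.Comp_assoc[OF x IFo[OF x] x IFo[OF y] \<eta>[OF x] \<theta>[OF x] h] \<theta>\<eta>[OF x] C.Comp_Ident[OF x IFo[OF y] h]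
      by simp
  qed
  have \<theta>_conj: "Comp C (Io (Fo x)) (Io (Fo y)) y (\<theta> y) (conj x y f) = Comp C (Io (Fo x)) x y f (\<theta> x)"
    if x: "x \<in> Ob C" and y: "y \<in> Ob C" and f: "f \<in> Hom C x y" for x y f
  proof -
    note h = C.Comp_in_Hom[OF x y IFo[OF y] f \<eta>[OF y]]
    have "Comp C (Io (Fo x)) (Io (Fo y)) y (\<theta> y) (conj x y f)
        = Comp C (Io (Fo x)) x y (Comp C x (Io (Fo y)) y (\<theta> y) (Comp C x y (Io (Fo y)) (\<eta> y) f)) (\<theta> x)"
      unfolding conj_def by (rule C.Comp_assoc[OF IFo[OF x] x IFo[OF y] y \<theta>[OF x] h \<theta>[OF y]])
    also have "Comp C x (Io (Fo y)) y (\<theta> y) (Comp C x y (Io (Fo y)) (\<eta> y) f) = f"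
      using C.Comp_assoc[OF x y IFo[OF y] y f \<eta>[OF y] \<theta>[OF y]] \<theta>\<eta>[OF y] C.Ident_Comp[OF x y f] by simp
    finally show ?thesis .
  qed
  have F: "category_functor C D Fo Fm"
  proof (unfold_locales)
    fix x assume x: "x \<in> Ob C"
    then show "Fo x \<in> Ob D" by (rule Fo)
    have "Im (Fo x) (Fo x) (Fm x x (Ident C x)) = Im (Fo x) (Fo x) (Ident D (Fo x))"
      using IFm[OF x x C.Ident_in_Hom[OF x]] I.Fm_Ident[OF Fo[OF x]] \<eta>\<theta>[OF x] C.Comp_Ident[OF x IFo[OF x] \<eta>[OF x]]
      by (simp add: conj_def)
    then show "Fm x x (Ident C x) = Ident D (Fo x)"
      by (rule inj[OF Fo[OF x] Fo[OF x] Fm[OF x x C.Ident_in_Hom[OF x]] D.Ident_in_Hom[OF Fo[OF x]]])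
  next
    fix x y f assume "x \<in> Ob C" "y \<in> Ob C" "f \<in> Hom C x y"
    then show "Fm x y f \<in> Hom D (Fo x) (Fo y)" by (rule Fm)
  next
    fix x y z f g
    assume x: "x \<in> Ob C" and y: "y \<in> Ob C" and z: "z \<in> Ob C" and f: "f \<in> Hom C x y" and g: "g \<in> Hom C y z"
    note gf = C.Comp_in_Hom[OF x y z f g]
    have "Comp C (Io (Fo x)) (Io (Fo y)) (Io (Fo z)) (conj y z g) (conj x y f)
        = Comp C (Io (Fo x)) y (Io (Fo z)) (Comp C y z (Io (Fo z)) (\<eta> z) g) (Comp C (Io (Fo x)) (Io (Fo y)) y (\<theta> y) (conj x y f))"
      unfolding conj_def[of y z]
      by (rule C.Comp_assoc[OF IFo[OF x] IFo[OF y] y IFo[OF z] conj[OF x y f] \<theta>[OF y]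
            C.Comp_in_Hom[OF y z IFo[OF z] g \<eta>[OF z]], symmetric])
    also have "\<dots> = Comp C (Io (Fo x)) y (Io (Fo z)) (Comp C y z (Io (Fo z)) (\<eta> z) g) (Comp C (Io (Fo x)) x y f (\<theta> x))"
      by (simp only: \<theta>_conj[OF x y f])
    also have "\<dots> = Comp C (Io (Fo x)) x (Io (Fo z)) (Comp C x y (Io (Fo z)) (Comp C y z (Io (Fo z)) (\<eta> z) g) f) (\<theta> x)"
      by (rule C.Comp_assoc[OF IFo[OF x] x y IFo[OF z] \<theta>[OF x] f C.Comp_in_Hom[OF y z IFo[OF z] g \<eta>[OF z]]])
    also have "Comp C x y (Io (Fo z)) (Comp C y z (Io (Fo z)) (\<eta> z) g) f = Comp C x z (Io (Fo z)) (\<eta> z) (Comp C x y z g f)"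
      by (rule C.Comp_assoc[OF x y z IFo[OF z] f g \<eta>[OF z], symmetric])
    finally have "Im (Fo x) (Fo z) (Fm x z (Comp C x y z g f)) = Im (Fo x) (Fo z) (Comp D (Fo x) (Fo y) (Fo z) (Fm y z g) (Fm x y f))"
      using I.Fm_Comp[OF Fo[OF x] Fo[OF y] Fo[OF z] Fm[OF x y f] Fm[OF y z g]] IFm[OF x y f] IFm[OF y z g] IFm[OF x z gf]
      by (simp add: conj_def[of x z])
    then show "Fm x z (Comp C x y z g f) = Comp D (Fo x) (Fo y) (Fo z) (Fm y z g) (Fm x y f)"
      by (rule inj[OF Fo[OF x] Fo[OF z] Fm[OF x z gf] D.Comp_in_Hom[OF Fo[OF x] Fo[OF y] Fo[OF z] Fm[OF x y f] Fm[OF y z g]]])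
  qed
  have nat1: "natural_isomorphism C C (\<lambda>x. x) (\<lambda>x y f. f) (\<lambda>x. Io (Fo x)) (\<lambda>x y f. Im (Fo x) (Fo y) (Fm x y f)) \<eta>"
    unfolding natural_isomorphism_def
    using isomorphism_inI[OF \<eta> \<theta> \<theta>\<eta> \<eta>\<theta>] IFm conj_\<eta> by simp
  \<comment> \<open>The counit and its inverse are the preimages of the chosen isomorphisms at
    \<open>Io d\<close>.\<close>
  define \<epsilon> where "\<epsilon> d = inv_into (Hom D (Fo (Io d)) d) (Im (Fo (Io d)) d) (\<theta> (Io d))" for d
  define \<delta> where "\<delta> d = inv_into (Hom D d (Fo (Io d))) (Im d (Fo (Io d))) (\<eta> (Io d))" for d
  have I: "Io d \<in> Ob C" if "d \<in> Ob D" for d by (rule I.Fo_in_Ob[OF that])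
  have \<epsilon>: "\<epsilon> d \<in> Hom D (Fo (Io d)) d" and I\<epsilon>: "Im (Fo (Io d)) d (\<epsilon> d) = \<theta> (Io d)" if d: "d \<in> Ob D" for d
  proof -
    have "\<theta> (Io d) \<in> Im (Fo (Io d)) d ` Hom D (Fo (Io d)) d"
      using \<theta>[OF I[OF d]] bij[OF Fo[OF I[OF d]] d] by (simp add: bij_betw_def)
    then show "\<epsilon> d \<in> Hom D (Fo (Io d)) d" "Im (Fo (Io d)) d (\<epsilon> d) = \<theta> (Io d)"
      unfolding \<epsilon>_def by (rule inv_into_into, rule f_inv_into_f)
  qed
  have \<delta>: "\<delta> d \<in> Hom D d (Fo (Io d))" and I\<delta>: "Im d (Fo (Io d)) (\<delta> d) = \<eta> (Io d)" if d: "d \<in> Ob D" for d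
  proof -
    have "\<eta> (Io d) \<in> Im d (Fo (Io d)) ` Hom D d (Fo (Io d))"
      using \<eta>[OF I[OF d]] bij[OF d Fo[OF I[OF d]]] by (simp add: bij_betw_def)
    then show "\<delta> d \<in> Hom D d (Fo (Io d))" "Im d (Fo (Io d)) (\<delta> d) = \<eta> (Io d)"
      unfolding \<delta>_def by (rule inv_into_into, rule f_inv_into_f)
  qed
  have nat2: "natural_isomorphism D D (\<lambda>x. Fo (Io x)) (\<lambda>x y f. Fm (Io x) (Io y) (Im x y f)) (\<lambda>x. x) (\<lambda>x y f. f) \<epsilon>"
    unfolding natural_isomorphism_def
  proof (intro conjI ballI)
    fix d assume d: "d \<in> Ob D"
    note F = Fo[OF I[OF d]]
    show "isomorphism_in D (Fo (Io d)) d (\<epsilon> d)"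
    proof (rule isomorphism_inI[OF \<epsilon>[OF d] \<delta>[OF d]])
      show "Comp D (Fo (Io d)) d (Fo (Io d)) (\<delta> d) (\<epsilon> d) = Ident D (Fo (Io d))"
        by (rule inj[OF F F D.Comp_in_Hom[OF F d F \<epsilon>[OF d] \<delta>[OF d]] D.Ident_in_Hom[OF F]])
           (simp add: I.Fm_Comp[OF F d F \<epsilon>[OF d] \<delta>[OF d]] I.Fm_Ident[OF F] I\<epsilon>[OF d] I\<delta>[OF d] \<eta>\<theta>[OF I[OF d]])
      show "Comp D d (Fo (Io d)) d (\<epsilon> d) (\<delta> d) = Ident D d"
        by (rule inj[OF d d D.Comp_in_Hom[OF d F d \<delta>[OF d] \<epsilon>[OF d]] D.Ident_in_Hom[OF d]])
           (simp add: I.Fm_Comp[OF d F d \<delta>[OF d] \<epsilon>[OF d]] I.Fm_Ident[OF d] I\<epsilon>[OF d] I\<delta>[OF d] \<theta>\<eta>[OF I[OF d]])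
    qed
    fix d' f assume d': "d' \<in> Ob D" and f: "f \<in> Hom D d d'"
    note F' = Fo[OF I[OF d']]
    note If = I.Fm_in_Hom[OF d d' f]
    note Ff = Fm[OF I[OF d] I[OF d'] If]
    show "Comp D (Fo (Io d)) (Fo (Io d')) d' (\<epsilon> d') (Fm (Io d) (Io d') (Im d d' f)) = Comp D (Fo (Io d)) d d' f (\<epsilon> d)"
      by (rule inj[OF F d' D.Comp_in_Hom[OF F F' d' Ff \<epsilon>[OF d']] D.Comp_in_Hom[OF F d d' \<epsilon>[OF d] f]])
         (simp add: I.Fm_Comp[OF F F' d' Ff \<epsilon>[OF d']] I.Fm_Comp[OF F d d' \<epsilon>[OF d] f] I\<epsilon>[OF d] I\<epsilon>[OF d']
           IFm[OF I[OF d] I[OF d'] If] \<theta>_conj[OF I[OF d] I[OF d'] If])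
  qed
  show ?thesis
    unfolding equivalent_categories_def
    using F I.category_functor_axioms nat1 nat2 by blast
qed

section \<open>The stable category\<close>

text \<open>The common ground of the two categories: \<open>proper_StMod\<close> is a full
  subcategory of it, and the Mazza-Symonds category arises from it by the direct limit along
  \<Omega>.\<close>

definition stable_category :: "'k ring \<Rightarrow> 'g monoid \<Rightarrow> (('k, 'u, 'g) gmodule, ('u \<Rightarrow> 'u) set) category_data" where
  "stable_category k G = \<lparr>Ob = {x. group_module k G x}, Hom = stable_hom k G, Comp = stable_comp k G,
     Ident = stable_id k G\<rparr>"

lemma stable_category_simps [simp]:
  "Ob (stable_category k G) = {x. group_module k G x}" "Hom (stable_category k G) = stable_hom k G"
  "Comp (stable_category k G) = stable_comp k G" "Ident (stable_category k G) = stable_id k G"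
  by (simp_all add: stable_category_def)

definition stably_equal :: "'k ring \<Rightarrow> 'g monoid \<Rightarrow> ('k, 'u, 'g) gmodule \<Rightarrow> ('k, 'u, 'g) gmodule
    \<Rightarrow> ('u \<Rightarrow> 'u) \<Rightarrow> ('u \<Rightarrow> 'u) \<Rightarrow> bool" where
  "stably_equal k G x y f g \<longleftrightarrow> f \<in> gmaps k G x y \<and> g \<in> gmaps k G x y \<and>
     diff_map x y f g \<in> through_projective k G x y"

lemma tp_cong:
  assumes "t \<in> through_projective k G x y" "group_module k G x" "s \<in> gmaps k G x y"
    "\<And>v. v \<in> carrier x \<Longrightarrow> s v = t v"
  shows "s \<in> through_projective k G x y"
  using gmaps_eqI[OF assms(3) tp_gmaps[OF assms(2,1)] assms(4)] assms(1) by simp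

context group_universe begin

context
  fixes x y :: "('k, 'u, 'g) gmodule"
  assumes x: "group_module k G x" and y: "group_module k G y"
begin

lemma stably_equal_refl:
  assumes f: "f \<in> gmaps k G x y"
  shows "stably_equal k G x y f f"
proof -
  have "diff_map x y f f = zero_map x y"
    using gmaps_closed[OF f] by (auto simp: diff_map_def zero_map_def diff_self[OF y])
  then show ?thesis
    using f tp_zero[OF x y] by (simp add: stably_equal_def)
qed

lemma stably_equal_sym:
  assumes fg: "stably_equal k G x y f g"
  shows "stably_equal k G x y g f"
proof -
  have f: "f \<in> gmaps k G x y" and g: "g \<in> gmaps k G x y" and t: "diff_map x y f g \<in> through_projective k G x y"
    using fg by (simp_all add: stably_equal_def)
  have "diff_map x y g f \<in> through_projective k G x y"
    by (rule tp_neg[OF x y t gmaps_diff[OF x y g f]])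
       (use gmaps_closed[OF f] gmaps_closed[OF g] in \<open>simp add: diff_map_def neg_diff[OF y]\<close>)
  then show ?thesis
    using f g by (simp add: stably_equal_def)
qed

lemma stably_equal_trans:
  assumes fg: "stably_equal k G x y f g" and gh: "stably_equal k G x y g h"
  shows "stably_equal k G x y f h"
proof -
  have f: "f \<in> gmaps k G x y" and g: "g \<in> gmaps k G x y" and h: "h \<in> gmaps k G x y"
    and t: "diff_map x y f g \<in> through_projective k G x y" "diff_map x y g h \<in> through_projective k G x y"
    using fg gh by (simp_all add: stably_equal_def)
  have "diff_map x y f h \<in> through_projective k G x y"
    by (rule tp_cong[OF tp_sum[OF x y t] x gmaps_diff[OF x y f h]])
       (use gmaps_closed[OF f] gmaps_closed[OF g] gmaps_closed[OF h] in
         \<open>simp add: diff_map_def sum_map_def diff_triangle[OF y]\<close>)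
  then show ?thesis
    using f h by (simp add: stably_equal_def)
qed

lemma stable_class_mem:
  assumes f: "f \<in> gmaps k G x y"
  shows "g \<in> stable_class k G x y f \<longleftrightarrow> stably_equal k G x y g f"
proof -
  interpret y: group_module k G y by (rule y)
  have mem: "stable_class k G x y f = (\<lambda>t. sum_map x y t f) ` through_projective k G x y"
    by (auto simp: stable_class_def r_coset_def hom_group_def sum_map_def)
  show ?thesis
  proof
    assume "g \<in> stable_class k G x y f"
    then obtain t where t: "t \<in> through_projective k G x y" "g = sum_map x y t f"
      unfolding mem by blast
    note tg = tp_gmaps[OF x t(1)]
    have g: "g \<in> gmaps k G x y"
      unfolding t(2) by (rule gmaps_sum[OF x y tg f])
    have "diff_map x y g f \<in> through_projective k G x y"
      by (rule tp_cong[OF t(1) x gmaps_diff[OF x y g f]])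
         (use gmaps_closed[OF tg] gmaps_closed[OF f] in \<open>simp add: t(2) diff_map_def sum_map_def y.minus_eq y.M.a_assoc y.M.r_neg\<close>)
    then show "stably_equal k G x y g f"
      using f g by (simp add: stably_equal_def)
  next
    assume s: "stably_equal k G x y g f"
    then have g: "g \<in> gmaps k G x y" by (simp add: stably_equal_def)
    have "g = sum_map x y (diff_map x y g f) f"
      by (rule gmaps_eqI[OF g gmaps_sum[OF x y gmaps_diff[OF x y g f] f]])
         (use gmaps_closed[OF g] gmaps_closed[OF f] in \<open>simp add: diff_map_def sum_map_def diff_add[OF y]\<close>)
    then show "g \<in> stable_class k G x y f"
      unfolding mem using s by (auto simp: stably_equal_def)
  qed
qed

lemma stable_class_eq_iff:
  assumes f: "f \<in> gmaps k G x y" and g: "g \<in> gmaps k G x y"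
  shows "stable_class k G x y f = stable_class k G x y g \<longleftrightarrow> stably_equal k G x y f g"
proof
  assume "stable_class k G x y f = stable_class k G x y g"
  then show "stably_equal k G x y f g"
    using stable_class_mem[OF f, of f] stable_class_mem[OF g, of f] stably_equal_refl[OF f] by blast
next
  assume "stably_equal k G x y f g"
  then show "stable_class k G x y f = stable_class k G x y g"
    using stable_class_mem[OF f] stable_class_mem[OF g] stably_equal_sym stably_equal_trans by blast
qed

lemma stable_hom_iff: "\<phi> \<in> stable_hom k G x y \<longleftrightarrow> (\<exists>f \<in> gmaps k G x y. \<phi> = stable_class k G x y f)"
  by (auto simp: stable_hom_def FactGroup_def RCOSETS_def stable_class_def hom_group_def)

lemma stable_class_in_hom: "f \<in> gmaps k G x y \<Longrightarrow> stable_class k G x y f \<in> stable_hom k G x y"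
  by (auto simp: stable_hom_iff)

lemma stable_class_self: "f \<in> gmaps k G x y \<Longrightarrow> f \<in> stable_class k G x y f"
  using stable_class_mem stably_equal_refl by blast

end

lemma stable_comp_class:
  fixes x y z :: "('k, 'u, 'g) gmodule"
  assumes x: "group_module k G x" and y: "group_module k G y" and z: "group_module k G z"
    and f: "f \<in> gmaps k G x y" and g: "g \<in> gmaps k G y z"
  shows "stable_comp k G x y z (stable_class k G y z g) (stable_class k G x y f)
    = stable_class k G x z (compose (carrier x) g f)"
proof -
  interpret z: group_module k G z by (rule z)
  have "stable_class k G x z (compose (carrier x) g' f') = stable_class k G x z (compose (carrier x) g f)"
    if "stably_equal k G y z g' g" "stably_equal k G x y f' f" for g' f'
  proof -
    have f': "f' \<in> gmaps k G x y" and g': "g' \<in> gmaps k G y z"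
      and tf: "diff_map x y f' f \<in> through_projective k G x y"
      and tg: "diff_map y z g' g \<in> through_projective k G y z"
      using that by (simp_all add: stably_equal_def)
    note c' = gmaps_comp[OF x f' g'] and c = gmaps_comp[OF x f g]
    note m = gmaps_comp[OF x f' g]
    \<comment> \<open>The difference of the composites is split as (g' - g) f' + g (f' - f).\<close>
    have 1: "diff_map x z (compose (carrier x) g' f') (compose (carrier x) g f') \<in> through_projective k G x z"
      by (rule tp_right[OF x tg f' gmaps_diff[OF x z c' m]])
         (use gmaps_closed[OF f'] in \<open>simp add: diff_map_def compose_eq\<close>)
    have 2: "diff_map x z (compose (carrier x) g f') (compose (carrier x) g f) \<in> through_projective k G x z"
      by (rule tp_left[OF x tf g gmaps_diff[OF x z m c]])
         (use gmaps_closed[OF f'] gmaps_closed[OF f] in \<open>simp add: diff_map_def compose_eq gmaps_minus[OF y z g]\<close>)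
    have "stably_equal k G x z (compose (carrier x) g' f') (compose (carrier x) g f)"
      by (rule stably_equal_trans[OF x z, of _ "compose (carrier x) g f'"])
         (use 1 2 c c' m in \<open>simp_all add: stably_equal_def\<close>)
    then show ?thesis
      using stable_class_eq_iff[OF x z c' c] by blast
  qed
  then show ?thesis
    unfolding stable_comp_def
    using stable_class_mem[OF x y f] stable_class_mem[OF y z g] stably_equal_refl[OF x y f] stably_equal_refl[OF y z g]
    by blast
qed

lemma stable_category: "category (stable_category k G :: (('k, 'u, 'g) gmodule, ('u \<Rightarrow> 'u) set) category_data)"
proof
  fix x :: "('k, 'u, 'g) gmodule" assume "x \<in> Ob (stable_category k G)"
  then show "Ident (stable_category k G) x \<in> Hom (stable_category k G) x x"
    using stable_class_in_hom[of x x "\<lambda>v \<in> carrier x. v"] gmaps_id[of k G x] by (simp add: stable_id_def)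
next
  fix x y z :: "('k, 'u, 'g) gmodule" and \<phi> \<psi>
  assume "x \<in> Ob (stable_category k G)" "y \<in> Ob (stable_category k G)" "z \<in> Ob (stable_category k G)"
    "\<phi> \<in> Hom (stable_category k G) x y" "\<psi> \<in> Hom (stable_category k G) y z"
  then obtain f g where x: "group_module k G x" and y: "group_module k G y" and z: "group_module k G z"
    and f: "f \<in> gmaps k G x y" "\<phi> = stable_class k G x y f" and g: "g \<in> gmaps k G y z" "\<psi> = stable_class k G y z g"
    by (auto simp: stable_hom_iff)
  then show "Comp (stable_category k G) x y z \<psi> \<phi> \<in> Hom (stable_category k G) x z"
    using stable_class_in_hom[OF x z gmaps_comp[OF x f(1) g(1)]] by (simp add: stable_comp_class)
next
  fix x y :: "('k, 'u, 'g) gmodule" and \<phi>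
  assume "x \<in> Ob (stable_category k G)" "y \<in> Ob (stable_category k G)" "\<phi> \<in> Hom (stable_category k G) x y"
  then obtain f where x: "group_module k G x" and y: "group_module k G y" and f: "f \<in> gmaps k G x y"
    and \<phi>: "\<phi> = stable_class k G x y f"
    by (auto simp: stable_hom_iff)
  have "compose (carrier x) f (\<lambda>v \<in> carrier x. v) = f"
    by (rule gmaps_eqI[OF gmaps_comp[OF x gmaps_id[OF x] f] f]) (simp add: compose_eq)
  then show "Comp (stable_category k G) x x y \<phi> (Ident (stable_category k G) x) = \<phi>"
    using stable_comp_class[OF x x y gmaps_id[OF x] f] by (simp add: stable_id_def \<phi>)
  have "compose (carrier x) (\<lambda>v \<in> carrier y. v) f = f"
    by (rule gmaps_eqI[OF gmaps_comp[OF x f gmaps_id[OF y]] f]) (use gmaps_closed[OF f] in \<open>simp add: compose_eq\<close>)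
  then show "Comp (stable_category k G) x y y (Ident (stable_category k G) y) \<phi> = \<phi>"
    using stable_comp_class[OF x y y f gmaps_id[OF y]] by (simp add: stable_id_def \<phi>)
next
  fix w x y z :: "('k, 'u, 'g) gmodule" and \<phi> \<psi> \<chi>
  assume "w \<in> Ob (stable_category k G)" "x \<in> Ob (stable_category k G)" "y \<in> Ob (stable_category k G)"
    "z \<in> Ob (stable_category k G)" "\<phi> \<in> Hom (stable_category k G) w x" "\<psi> \<in> Hom (stable_category k G) x y"
    "\<chi> \<in> Hom (stable_category k G) y z"
  then obtain f g h where w: "group_module k G w" and x: "group_module k G x" and y: "group_module k G y"
    and z: "group_module k G z" and f: "f \<in> gmaps k G w x" "\<phi> = stable_class k G w x f"
    and g: "g \<in> gmaps k G x y" "\<psi> = stable_class k G x y g" and h: "h \<in> gmaps k G y z" "\<chi> = stable_class k G y z h"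
    by (auto simp: stable_hom_iff)
  have "compose (carrier w) h (compose (carrier w) g f) = compose (carrier w) (compose (carrier x) h g) f"
    using gmaps_closed[OF f(1)] by (auto simp: compose_def fun_eq_iff)
  then show "Comp (stable_category k G) w y z \<chi> (Comp (stable_category k G) w x y \<psi> \<phi>)
      = Comp (stable_category k G) w x z (Comp (stable_category k G) x y z \<chi> \<psi>) \<phi>"
    by (simp add: f(2) g(2) h(2) stable_comp_class[OF w x y f(1) g(1)] stable_comp_class[OF x y z g(1) h(1)]
        stable_comp_class[OF w y z gmaps_comp[OF w f(1) g(1)] h(1)]
        stable_comp_class[OF w x z f(1) gmaps_comp[OF x g(1) h(1)]])
qed

end

section \<open>The syzygy functor\<close>

context group_universe begin

lemma syzygy_lift:
  fixes x y :: "('k, 'u, 'g) gmodule"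
  assumes x: "group_module k G x" and y: "group_module k G y" and f: "f \<in> gmaps k G x y"
  shows "\<exists>h \<in> gmaps k G (cover_mod k G x) (cover_mod k G y).
    \<forall>v \<in> carrier (cover_mod k G x). cover_map k G y (h v) = f (cover_map k G x v)"
proof -
  note c = gmaps_comp[OF projective_group_module[OF cover_projective[OF x]] epis_gmaps[OF cover_epi[OF x]] f]
  show ?thesis
    using projective_lift[OF cover_projective[OF x] projective_group_module[OF cover_projective[OF y]] y cover_epi[OF y] c]
    by (simp add: compose_eq)
qed

lemma syzygy_restrict:
  fixes x y :: "('k, 'u, 'g) gmodule"
  assumes x: "group_module k G x" and y: "group_module k G y" and f: "f \<in> gmaps k G x y"
    and h: "h \<in> gmaps k G (cover_mod k G x) (cover_mod k G y)"
    and hf: "\<And>v. v \<in> carrier (cover_mod k G x) \<Longrightarrow> cover_map k G y (h v) = f (cover_map k G x v)"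
  shows "restrict h (carrier (syzygy k G x)) \<in> gmaps k G (syzygy k G x) (syzygy k G y)"
  unfolding syzygy_def
  by (rule gmaps_ker_ker[OF group_module_syzygy[OF x, unfolded syzygy_def] h]) (use hf gmaps_zero[OF x y f] in auto)

text \<open>Lifts of two stably equal maps differ by a lift of a map through projectives, so by
  \<open>tp_syzygy\<close> the union in \<open>syzygy_map\<close> is over a single class.\<close>

lemma syzygy_map_class:
  fixes x y :: "('k, 'u, 'g) gmodule"
  assumes x: "group_module k G x" and y: "group_module k G y" and f: "f \<in> gmaps k G x y"
    and h: "h \<in> gmaps k G (cover_mod k G x) (cover_mod k G y)"
    and hf: "\<And>v. v \<in> carrier (cover_mod k G x) \<Longrightarrow> cover_map k G y (h v) = f (cover_map k G x v)"
  shows "syzygy_map k G x y (stable_class k G x y f)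
    = stable_class k G (syzygy k G x) (syzygy k G y) (restrict h (carrier (syzygy k G x)))"
proof -
  let ?X = "syzygy k G x" and ?Y = "syzygy k G y"
  let ?P = "cover_mod k G x" and ?Q = "cover_mod k G y" and ?c = "cover_map k G x" and ?d = "cover_map k G y"
  note P = cover_projective[OF x] and Q = cover_projective[OF y] and c = cover_epi[OF x] and d = cover_epi[OF y]
  note gP = projective_group_module[OF P] and gQ = projective_group_module[OF Q]
  note gX = group_module_syzygy[OF x] and gY = group_module_syzygy[OF y]
  note hX = syzygy_restrict[OF x y f h hf]
  have eq: "stable_class k G ?X ?Y (restrict h' (carrier ?X)) = stable_class k G ?X ?Y (restrict h (carrier ?X))"
    if f'f: "stably_equal k G x y f' f" and h': "h' \<in> gmaps k G ?P ?Q"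
      and hf': "\<And>v. v \<in> carrier ?P \<Longrightarrow> ?d (h' v) = f' (?c v)" for f' h'
  proof -
    have f': "f' \<in> gmaps k G x y" and t: "diff_map x y f' f \<in> through_projective k G x y"
      using f'f by (simp_all add: stably_equal_def)
    note hX' = syzygy_restrict[OF x y f' h' hf']
    note dX = gmaps_diff[OF gX gY hX' hX]
    have "diff_map ?X ?Y (restrict h' (carrier ?X)) (restrict h (carrier ?X)) \<in> through_projective k G ?X ?Y"
      unfolding syzygy_def
    proof (rule tp_syzygy[OF x y P gQ c d t gmaps_diff[OF gP gQ h' h]])
      fix v assume v: "v \<in> carrier ?P"
      show "?d (diff_map ?P ?Q h' h v) = diff_map x y f' f (?c v)"
        using v gmaps_closed[OF epis_gmaps[OF c] v]
          gmaps_minus[OF gQ y epis_gmaps[OF d] gmaps_closed[OF h' v] gmaps_closed[OF h v]]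
        by (simp add: diff_map_def hf hf')
    next
      show "diff_map (ker_module ?P x ?c) (ker_module ?Q y ?d) (restrict h' (carrier (ker_module ?P x ?c)))
          (restrict h (carrier (ker_module ?P x ?c))) \<in> gmaps k G (ker_module ?P x ?c) (ker_module ?Q y ?d)"
        using dX by (simp only: syzygy_def)
      fix v assume v: "v \<in> carrier ?P" "?c v = \<zero>\<^bsub>x\<^esub>"
      then have vX: "v \<in> carrier (ker_module ?P x ?c)" by simp
      show "diff_map (ker_module ?P x ?c) (ker_module ?Q y ?d) (restrict h' (carrier (ker_module ?P x ?c)))
          (restrict h (carrier (ker_module ?P x ?c))) v = diff_map ?P ?Q h' h v"
        using v(1) vX ker_minus[OF gQ gY[unfolded syzygy_def], of "h' v" "h v"]
          gmaps_closed[OF hX'[unfolded syzygy_def] vX] gmaps_closed[OF hX[unfolded syzygy_def] vX]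
        by (simp add: diff_map_def del: carrier_ker_module)
    qed
    then have "stably_equal k G ?X ?Y (restrict h' (carrier ?X)) (restrict h (carrier ?X))"
      using hX hX' by (simp add: stably_equal_def)
    then show ?thesis
      using stable_class_eq_iff[OF gX gY hX' hX] by blast
  qed
  have lift_iff: "compose (carrier ?P) ?d h' = compose (carrier ?P) f' ?c \<longleftrightarrow> (\<forall>v \<in> carrier ?P. ?d (h' v) = f' (?c v))" for f' h'
    by (auto simp: compose_def fun_eq_iff restrict_def)
  have "{stable_class k G ?X ?Y (restrict h' (carrier ?X)) | f' h'. f' \<in> stable_class k G x y f \<and> h' \<in> gmaps k G ?P ?Q \<and>
      compose (carrier ?P) ?d h' = compose (carrier ?P) f' ?c} = {stable_class k G ?X ?Y (restrict h (carrier ?X))}"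
  proof (intro equalityI subsetI)
    fix S assume "S \<in> {stable_class k G ?X ?Y (restrict h' (carrier ?X)) | f' h'. f' \<in> stable_class k G x y f \<and> h' \<in> gmaps k G ?P ?Q \<and>
      compose (carrier ?P) ?d h' = compose (carrier ?P) f' ?c}"
    then obtain f' h' where "S = stable_class k G ?X ?Y (restrict h' (carrier ?X))" "f' \<in> stable_class k G x y f"
      "h' \<in> gmaps k G ?P ?Q" "compose (carrier ?P) ?d h' = compose (carrier ?P) f' ?c" by blast
    then show "S \<in> {stable_class k G ?X ?Y (restrict h (carrier ?X))}"
      using eq[of f' h'] stable_class_mem[OF x y f, of f'] by (simp add: lift_iff)
  next
    fix S assume "S \<in> {stable_class k G ?X ?Y (restrict h (carrier ?X))}"
    then show "S \<in> {stable_class k G ?X ?Y (restrict h' (carrier ?X)) | f' h'. f' \<in> stable_class k G x y f \<and> h' \<in> gmaps k G ?P ?Q \<and>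
      compose (carrier ?P) ?d h' = compose (carrier ?P) f' ?c}"
      unfolding lift_iff using h hf stable_class_self[OF x y f] by blast
  qed
  then show ?thesis
    unfolding syzygy_map_def by simp
qed

lemma syzygy_functor:
  "category_functor (stable_category k G) (stable_category k G :: (('k, 'u, 'g) gmodule, ('u \<Rightarrow> 'u) set) category_data)
     (syzygy k G) (syzygy_map k G)"
proof -
  interpret S: category "stable_category k G :: (('k, 'u, 'g) gmodule, ('u \<Rightarrow> 'u) set) category_data"
    by (rule stable_category)
  show ?thesis
  proof
    fix x :: "('k, 'u, 'g) gmodule" assume "x \<in> Ob (stable_category k G)"
    then have x: "group_module k G x" by simp
    note gP = projective_group_module[OF cover_projective[OF x]]
    show "syzygy k G x \<in> Ob (stable_category k G)"
      using group_module_syzygy[OF x] by simp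
    have "syzygy_map k G x x (stable_class k G x x (\<lambda>v \<in> carrier x. v))
        = stable_class k G (syzygy k G x) (syzygy k G x) (restrict (\<lambda>v \<in> carrier (cover_mod k G x). v) (carrier (syzygy k G x)))"
      by (rule syzygy_map_class[OF x x gmaps_id[OF x] gmaps_id[OF gP]])
         (use gmaps_closed[OF epis_gmaps[OF cover_epi[OF x]]] in simp)
    moreover have "restrict (\<lambda>v \<in> carrier (cover_mod k G x). v) (carrier (syzygy k G x)) = (\<lambda>v \<in> carrier (syzygy k G x). v)"
      by (auto simp: syzygy_def)
    ultimately show "syzygy_map k G x x (Ident (stable_category k G) x) = Ident (stable_category k G) (syzygy k G x)"
      by (simp add: stable_id_def)
  next
    fix x y :: "('k, 'u, 'g) gmodule" and \<phi>
    assume "x \<in> Ob (stable_category k G)" "y \<in> Ob (stable_category k G)" "\<phi> \<in> Hom (stable_category k G) x y"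
    then obtain f where x: "group_module k G x" and y: "group_module k G y" and f: "f \<in> gmaps k G x y"
      and \<phi>: "\<phi> = stable_class k G x y f"
      by (auto simp: stable_hom_iff)
    obtain h where h: "h \<in> gmaps k G (cover_mod k G x) (cover_mod k G y)"
      "\<And>v. v \<in> carrier (cover_mod k G x) \<Longrightarrow> cover_map k G y (h v) = f (cover_map k G x v)"
      using syzygy_lift[OF x y f] by blast
    show "syzygy_map k G x y \<phi> \<in> Hom (stable_category k G) (syzygy k G x) (syzygy k G y)"
      using stable_class_in_hom[OF group_module_syzygy[OF x] group_module_syzygy[OF y] syzygy_restrict[OF x y f h]]
      by (simp add: \<phi> syzygy_map_class[OF x y f h])
  next
    fix x y z :: "('k, 'u, 'g) gmodule" and \<phi> \<psi>
    assume "x \<in> Ob (stable_category k G)" "y \<in> Ob (stable_category k G)" "z \<in> Ob (stable_category k G)"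
      "\<phi> \<in> Hom (stable_category k G) x y" "\<psi> \<in> Hom (stable_category k G) y z"
    then obtain f g where x: "group_module k G x" and y: "group_module k G y" and z: "group_module k G z"
      and f: "f \<in> gmaps k G x y" "\<phi> = stable_class k G x y f" and g: "g \<in> gmaps k G y z" "\<psi> = stable_class k G y z g"
      by (auto simp: stable_hom_iff)
    obtain h where h: "h \<in> gmaps k G (cover_mod k G x) (cover_mod k G y)"
      "\<And>v. v \<in> carrier (cover_mod k G x) \<Longrightarrow> cover_map k G y (h v) = f (cover_map k G x v)"
      using syzygy_lift[OF x y f(1)] by blast
    obtain i where i: "i \<in> gmaps k G (cover_mod k G y) (cover_mod k G z)"
      "\<And>v. v \<in> carrier (cover_mod k G y) \<Longrightarrow> cover_map k G z (i v) = g (cover_map k G y v)"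
      using syzygy_lift[OF y z g(1)] by blast
    note gP = projective_group_module[OF cover_projective[OF x]]
    note gX = group_module_syzygy[OF x] and gY = group_module_syzygy[OF y] and gZ = group_module_syzygy[OF z]
    note hX = syzygy_restrict[OF x y f(1) h] and iY = syzygy_restrict[OF y z g(1) i]
    have "syzygy_map k G x z (stable_class k G x z (compose (carrier x) g f))
      = stable_class k G (syzygy k G x) (syzygy k G z) (restrict (compose (carrier (cover_mod k G x)) i h) (carrier (syzygy k G x)))"
      by (rule syzygy_map_class[OF x z gmaps_comp[OF x f(1) g(1)] gmaps_comp[OF gP h(1) i(1)]])
         (use gmaps_closed[OF h(1)] gmaps_closed[OF epis_gmaps[OF cover_epi[OF x]]] in \<open>simp add: compose_eq h i\<close>)
    also have "restrict (compose (carrier (cover_mod k G x)) i h) (carrier (syzygy k G x))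
      = compose (carrier (syzygy k G x)) (restrict i (carrier (syzygy k G y))) (restrict h (carrier (syzygy k G x)))"
    proof (rule extensionalityI[of _ "carrier (syzygy k G x)"])
      fix v assume v: "v \<in> carrier (syzygy k G x)"
      then have "v \<in> carrier (cover_mod k G x)" by (simp add: syzygy_def)
      then show "restrict (compose (carrier (cover_mod k G x)) i h) (carrier (syzygy k G x)) v
          = (compose (carrier (syzygy k G x)) (restrict i (carrier (syzygy k G y))) (restrict h (carrier (syzygy k G x)))) v"
        using v gmaps_closed[OF hX v] by (simp add: compose_eq)
    qed simp_all
    finally show "syzygy_map k G x z (Comp (stable_category k G) x y z \<psi> \<phi>)
      = Comp (stable_category k G) (syzygy k G x) (syzygy k G y) (syzygy k G z) (syzygy_map k G y z \<psi>) (syzygy_map k G x y \<phi>)"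
      by (simp add: f(2) g(2) stable_comp_class[OF x y z f(1) g(1)] syzygy_map_class[OF x y f(1) h]
          syzygy_map_class[OF y z g(1) i] stable_comp_class[OF gX gY gZ hX iY])
  qed
qed

text \<open>Cofibrancy enters through the vanishing of Ext^1 from \<open>x\<close> to projective
  modules: maps from the syzygy of \<open>x\<close> into projective modules extend to the cover of
  \<open>x\<close>.\<close>

lemma syzygy_map_bij:
  fixes x y :: "('k, 'u, 'g) gmodule"
  assumes cof: "cofibrant k G x" and y: "group_module k G y"
  shows "bij_betw (syzygy_map k G x y) (stable_hom k G x y) (stable_hom k G (syzygy k G x) (syzygy k G y))"
proof -
  note x = cofibrant_group_module[OF cof]
  let ?X = "syzygy k G x" and ?Y = "syzygy k G y"
  let ?P = "cover_mod k G x" and ?Q = "cover_mod k G y" and ?c = "cover_map k G x" and ?d = "cover_map k G y"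
  note P = cover_projective[OF x] and Q = cover_projective[OF y] and c = cover_epi[OF x] and d = cover_epi[OF y]
  note gP = projective_group_module[OF P] and gQ = projective_group_module[OF Q]
  note gX = group_module_syzygy[OF x] and gY = group_module_syzygy[OF y]
  note c' = epis_gmaps[OF c] and d' = epis_gmaps[OF d]
  have csurj: "\<exists>v \<in> carrier ?P. ?c v = w" if "w \<in> carrier x" for w
    using epis_surj[OF c that] by blast
  interpret Om: category_functor "stable_category k G" "stable_category k G :: (('k, 'u, 'g) gmodule, ('u \<Rightarrow> 'u) set) category_data"
    "syzygy k G" "syzygy_map k G" by (rule syzygy_functor)
  have "\<phi> = \<psi>" if pq: "\<phi> \<in> stable_hom k G x y" "\<psi> \<in> stable_hom k G x y" "syzygy_map k G x y \<phi> = syzygy_map k G x y \<psi>" for \<phi> \<psi>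
  proof -
    obtain f g where f: "f \<in> gmaps k G x y" "\<phi> = stable_class k G x y f" and g: "g \<in> gmaps k G x y" "\<psi> = stable_class k G x y g"
      using pq(1,2) unfolding stable_hom_iff[OF x y] by blast
    obtain h where h: "h \<in> gmaps k G ?P ?Q" "\<And>v. v \<in> carrier ?P \<Longrightarrow> ?d (h v) = f (?c v)"
      using syzygy_lift[OF x y f(1)] by blast
    obtain i where i: "i \<in> gmaps k G ?P ?Q" "\<And>v. v \<in> carrier ?P \<Longrightarrow> ?d (i v) = g (?c v)"
      using syzygy_lift[OF x y g(1)] by blast
    note hX = syzygy_restrict[OF x y f(1) h] and iX = syzygy_restrict[OF x y g(1) i]
    have "stably_equal k G ?X ?Y (restrict h (carrier ?X)) (restrict i (carrier ?X))"
      using pq(3) stable_class_eq_iff[OF gX gY hX iX]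
      by (simp add: f(2) g(2) syzygy_map_class[OF x y f(1) h] syzygy_map_class[OF x y g(1) i])
    then have "diff_map ?X ?Y (restrict h (carrier ?X)) (restrict i (carrier ?X)) \<in> through_projective k G ?X ?Y"
      by (simp add: stably_equal_def)
    then obtain p :: "('k, 'u, 'g) gmodule" and a b where p: "projective_module k G p" "a \<in> gmaps k G ?X p"
      "b \<in> gmaps k G p ?Y" "\<And>v. v \<in> carrier ?X \<Longrightarrow> diff_map ?X ?Y (restrict h (carrier ?X)) (restrict i (carrier ?X)) v = b (a v)"
      using tpE by blast
    \<comment> \<open>With the first factor extended to the cover, the difference of the lifts can
      be corrected so that it vanishes on the syzygy and descends to \<open>x\<close>. The descended
      map \<open>F\<close> then factors \<open>f - g\<close> through the cover of
      \<open>y\<close>.\<close>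
    obtain a' where a': "a' \<in> gmaps k G ?P p" "\<forall>v \<in> carrier ?P. ?c v = \<zero>\<^bsub>x\<^esub> \<longrightarrow> a' v = a v"
      using ext_vanishD[OF cofibrant_ext_vanish_projective[OF cof p(1)] gP c] p(2) unfolding syzygy_def by blast
    have bQ: "b \<in> gmaps k G p ?Q"
      using p(3) unfolding syzygy_def by (rule gmaps_ker_incl)
    have db: "?d (b w) = \<zero>\<^bsub>y\<^esub>" if "w \<in> carrier p" for w
      using gmaps_closed[OF p(3) that] by (simp add: syzygy_def)
    note ba = gmaps_comp[OF gP a'(1) bQ] and hi = gmaps_diff[OF gP gQ h(1) i(1)]
    let ?k = "diff_map ?P ?Q (diff_map ?P ?Q h i) (compose (carrier ?P) b a')"
    note kg = gmaps_diff[OF gP gQ hi ba]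
    obtain F where F: "F \<in> gmaps k G x ?Q" "\<And>v. v \<in> carrier ?P \<Longrightarrow> F (?c v) = ?k v"
    proof (rule gmaps_descend[OF gP x gQ c' csurj kg])
      fix v assume v: "v \<in> carrier ?P" "?c v = \<zero>\<^bsub>x\<^esub>"
      then have vX: "v \<in> carrier ?X" by (simp add: syzygy_def)
      have "h v \<ominus>\<^bsub>?Q\<^esub> i v = b (a v)"
        using p(4)[OF vX] vX gmaps_closed[OF hX vX] gmaps_closed[OF iX vX]
          ker_minus[OF gQ gY[unfolded syzygy_def], of "h v" "i v"]
        by (simp add: diff_map_def syzygy_def)
      then show "?k v = \<zero>\<^bsub>?Q\<^esub>"
        using v a'(2) gmaps_closed[OF bQ gmaps_closed[OF p(2) vX]] by (simp add: diff_map_def compose_eq diff_self[OF gQ])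
    qed blast+
    have "diff_map x y f g \<in> through_projective k G x y"
    proof (rule tpI[OF Q F(1) d' gmaps_diff[OF x y f(1) g(1)]])
      fix w assume w: "w \<in> carrier x"
      obtain v where v: "v \<in> carrier ?P" "?c v = w" using csurj[OF w] by blast
      have "?d (F w) = ?d (diff_map ?P ?Q h i v) \<ominus>\<^bsub>y\<^esub> ?d (b (a' v))"
        using F(2)[OF v(1)] v gmaps_minus[OF gQ y d' gmaps_closed[OF hi v(1)] gmaps_closed[OF bQ gmaps_closed[OF a'(1) v(1)]]]
        by (simp add: diff_map_def[of _ _ "diff_map _ _ _ _"] compose_eq)
      also have "\<dots> = f w \<ominus>\<^bsub>y\<^esub> g w"
        using v h(2)[OF v(1)] i(2)[OF v(1)] db[OF gmaps_closed[OF a'(1) v(1)]]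
          gmaps_minus[OF gQ y d' gmaps_closed[OF h(1) v(1)] gmaps_closed[OF i(1) v(1)]]
          diff_zero[OF y diff_closed[OF y gmaps_closed[OF f(1) w] gmaps_closed[OF g(1) w]]]
        by (simp add: diff_map_def)
      finally show "diff_map x y f g w = ?d (F w)"
        using w by (simp add: diff_map_def)
    qed
    then show ?thesis
      using stable_class_eq_iff[OF x y f(1) g(1)] f g by (simp add: stably_equal_def)
  qed
  moreover have "\<exists>\<phi> \<in> stable_hom k G x y. syzygy_map k G x y \<phi> = \<psi>" if psi: "\<psi> \<in> stable_hom k G ?X ?Y" for \<psi>
  proof -
    obtain g where g: "g \<in> gmaps k G ?X ?Y" "\<psi> = stable_class k G ?X ?Y g"
      using psi unfolding stable_hom_iff[OF gX gY] by blast
    have gQ': "g \<in> gmaps k G (ker_module ?P x ?c) ?Q"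
      using g(1) unfolding syzygy_def by (rule gmaps_ker_incl)
    \<comment> \<open>A map of syzygies, regarded as a map into the cover of \<open>y\<close>,
      extends to the cover of \<open>x\<close> and so induces a map from \<open>x\<close> to
      \<open>y\<close>.\<close>
    obtain h where h: "h \<in> gmaps k G ?P ?Q" "\<forall>v \<in> carrier ?P. ?c v = \<zero>\<^bsub>x\<^esub> \<longrightarrow> h v = g v"
      using ext_vanishD[OF cofibrant_ext_vanish_projective[OF cof Q] gP c gQ'] by blast
    obtain f where f: "f \<in> gmaps k G x y" "\<And>v. v \<in> carrier ?P \<Longrightarrow> f (?c v) = compose (carrier ?P) ?d h v"
    proof (rule gmaps_descend[OF gP x y c' csurj gmaps_comp[OF gP h(1) d']])
      fix v assume v: "v \<in> carrier ?P" "?c v = \<zero>\<^bsub>x\<^esub>"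
      then have "g v \<in> carrier ?Y"
        by (intro gmaps_closed[OF g(1)]) (simp add: syzygy_def)
      then show "compose (carrier ?P) ?d h v = \<zero>\<^bsub>y\<^esub>"
        using v h(2) by (simp add: compose_eq syzygy_def)
    qed blast+
    have fh: "?d (h v) = f (?c v)" if "v \<in> carrier ?P" for v
      using f(2)[OF that] that by (simp add: compose_eq)
    have "restrict h (carrier ?X) = g"
      by (rule gmaps_eqI[OF syzygy_restrict[OF x y f(1) h(1) fh] g(1)]) (use h(2) in \<open>simp_all add: syzygy_def\<close>)
    then have "syzygy_map k G x y (stable_class k G x y f) = \<psi>"
      using syzygy_map_class[OF x y f(1) h(1) fh] g(2) by simp
    then show ?thesis
      using stable_class_in_hom[OF x y f(1)] by blast
  qed
  moreover have "syzygy_map k G x y \<phi> \<in> stable_hom k G ?X ?Y" if "\<phi> \<in> stable_hom k G x y" for \<phi>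
    using Om.Fm_in_Hom[of x y \<phi>] x y that by simp
  ultimately show ?thesis
    unfolding bij_betw_def inj_on_def by blast
qed

section \<open>Stable isomorphisms\<close>

lemma stable_isomorphismI:
  fixes x y :: "('k, 'u, 'g) gmodule"
  assumes x: "group_module k G x" and y: "group_module k G y" and a: "a \<in> gmaps k G x y" and b: "b \<in> gmaps k G y x"
    and ba: "stably_equal k G x x (compose (carrier x) b a) (\<lambda>v \<in> carrier x. v)"
    and ab: "stably_equal k G y y (compose (carrier y) a b) (\<lambda>v \<in> carrier y. v)"
  shows "isomorphism_in (stable_category k G) x y (stable_class k G x y a)"
proof (rule isomorphism_inI)
  show "stable_class k G x y a \<in> Hom (stable_category k G) x y" "stable_class k G y x b \<in> Hom (stable_category k G) y x"
    using stable_class_in_hom[OF x y a] stable_class_in_hom[OF y x b] by simp_all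
  show "Comp (stable_category k G) x y x (stable_class k G y x b) (stable_class k G x y a) = Ident (stable_category k G) x"
    using stable_comp_class[OF x y x a b] stable_class_eq_iff[OF x x gmaps_comp[OF x a b] gmaps_id[OF x]] ba
    by (simp add: stable_id_def)
  show "Comp (stable_category k G) y x y (stable_class k G x y a) (stable_class k G y x b) = Ident (stable_category k G) y"
    using stable_comp_class[OF y x y b a] stable_class_eq_iff[OF y y gmaps_comp[OF y b a] gmaps_id[OF y]] ab
    by (simp add: stable_id_def)
qed

text \<open>\<open>h\<close> lifts the identity of \<open>c\<close>, so \<open>h\<close> minus the
  identity lifts zero and \<open>tp_syzygy\<close> applies.\<close>

lemma ker_stably_equal_id:
  fixes c p :: "('k, 'u, 'g) gmodule"
  assumes c: "group_module k G c" and p: "projective_module k G p" and e: "e \<in> epis k G p c"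
    and h: "h \<in> gmaps k G p p" and eh: "\<And>v. v \<in> carrier p \<Longrightarrow> e (h v) = e v"
    and t: "t \<in> gmaps k G (ker_module p c e) (ker_module p c e)" and th: "\<And>v. v \<in> carrier (ker_module p c e) \<Longrightarrow> t v = h v"
  shows "stably_equal k G (ker_module p c e) (ker_module p c e) t (\<lambda>v \<in> carrier (ker_module p c e). v)"
proof -
  let ?K = "ker_module p c e"
  note gp = projective_group_module[OF p]
  note gK = group_module_ker[OF gp c epis_gmaps[OF e]]
  have d: "diff_map ?K ?K t (\<lambda>v \<in> carrier ?K. v) \<in> through_projective k G ?K ?K"
  proof (rule tp_syzygy[OF c c p gp e e tp_zero[OF c c] gmaps_diff[OF gp gp h gmaps_id[OF gp]] _
        gmaps_diff[OF gK gK t gmaps_id[OF gK]]])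
    fix v assume v: "v \<in> carrier p"
    show "e (diff_map p p h (\<lambda>v \<in> carrier p. v) v) = zero_map c c (e v)"
      using v gmaps_minus[OF gp c epis_gmaps[OF e] gmaps_closed[OF h v] v] eh[OF v] gmaps_closed[OF epis_gmaps[OF e] v]
      by (simp add: diff_map_def zero_map_def diff_self[OF c])
    assume "e v = \<zero>\<^bsub>c\<^esub>"
    then have vK: "v \<in> carrier ?K" using v by simp
    show "diff_map ?K ?K t (\<lambda>v \<in> carrier ?K. v) v = diff_map p p h (\<lambda>v \<in> carrier p. v) v"
      using v vK ker_minus[OF gp gK gmaps_closed[OF t vK] vK] th[OF vK] by (simp add: diff_map_def del: carrier_ker_module)
  qed
  then show ?thesis
    using t gmaps_id[OF gK] by (simp add: stably_equal_def)
qed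

text \<open>Schanuel's lemma in stable form: lifts of the identity of \<open>c\<close> in both
  directions are stably inverse to each other on the kernels.\<close>

lemma ker_stable_isomorphism:
  fixes c p q :: "('k, 'u, 'g) gmodule"
  assumes c: "group_module k G c" and p: "projective_module k G p" and e: "e \<in> epis k G p c"
    and q: "projective_module k G q" and d: "d \<in> epis k G q c"
  shows "\<exists>\<phi>. isomorphism_in (stable_category k G) (ker_module p c e) (ker_module q c d) \<phi>"
proof -
  let ?K = "ker_module p c e" and ?L = "ker_module q c d"
  note gp = projective_group_module[OF p] and gq = projective_group_module[OF q]
  note gK = group_module_ker[OF gp c epis_gmaps[OF e]] and gL = group_module_ker[OF gq c epis_gmaps[OF d]]
  obtain a where a: "a \<in> gmaps k G p q" "\<forall>v \<in> carrier p. d (a v) = e v"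
    using projective_lift[OF p gq c d epis_gmaps[OF e]] by blast
  obtain b where b: "b \<in> gmaps k G q p" "\<forall>v \<in> carrier q. e (b v) = d v"
    using projective_lift[OF q gp c e epis_gmaps[OF d]] by blast
  let ?a = "restrict a (carrier ?K)" and ?b = "restrict b (carrier ?L)"
  have aK: "?a \<in> gmaps k G ?K ?L"
    by (rule gmaps_ker_ker[OF gK a(1)]) (use a(2) in auto)
  have bL: "?b \<in> gmaps k G ?L ?K"
    by (rule gmaps_ker_ker[OF gL b(1)]) (use b(2) in auto)
  have "stably_equal k G ?K ?K (compose (carrier ?K) ?b ?a) (\<lambda>v \<in> carrier ?K. v)"
    by (rule ker_stably_equal_id[OF c p e gmaps_comp[OF gp a(1) b(1)] _ gmaps_comp[OF gK aK bL]])
       (use a(2) b(2) gmaps_closed[OF a(1)] in \<open>simp_all add: compose_eq\<close>)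
  moreover have "stably_equal k G ?L ?L (compose (carrier ?L) ?a ?b) (\<lambda>v \<in> carrier ?L. v)"
    by (rule ker_stably_equal_id[OF c q d gmaps_comp[OF gq b(1) a(1)] _ gmaps_comp[OF gL bL aK]])
       (use a(2) b(2) gmaps_closed[OF b(1)] in \<open>simp_all add: compose_eq\<close>)
  ultimately show ?thesis
    using stable_isomorphismI[OF gK gL aK bL] by blast
qed

section \<open>Complete cohomology in degree zero\<close>

interpretation Om: category_functor "stable_category k G" "stable_category k G :: (('k, 'u, 'g) gmodule, ('u \<Rightarrow> 'u) set) category_data"
  "syzygy k G" "syzygy_map k G"
  by (rule syzygy_functor)

lemma syzygy_shift_add:
  "syzygy_shift k G x y n (j + i) \<phi> = syzygy_shift k G x y (n + j) i (syzygy_shift k G x y n j \<phi>)"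
  by (induction i) (simp_all add: add.assoc)

lemma syzygy_shift_commute:
  assumes "n + i = m + j" "syzygy_shift k G x y n i \<phi> = syzygy_shift k G x y m j \<psi>"
  shows "syzygy_shift k G x y n (i + l) \<phi> = syzygy_shift k G x y m (j + l) \<psi>"
  using assms by (simp add: syzygy_shift_add)

lemma complete_rel_iff:
  fixes x y :: "('k, 'u, 'g) gmodule"
  shows
  "((n, \<phi>), (m, \<psi>)) \<in> complete_rel k G x y \<longleftrightarrow>
     \<phi> \<in> stable_hom k G (syzygies k G n x) (syzygies k G n y) \<and>
     \<psi> \<in> stable_hom k G (syzygies k G m x) (syzygies k G m y) \<and>
     (\<exists>i j. n + i = m + j \<and> syzygy_shift k G x y n i \<phi> = syzygy_shift k G x y m j \<psi>)"
  by (auto simp: complete_rel_def complete_cochains_def)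

context
  fixes x y :: "('k, 'u, 'g) gmodule"
  assumes x: "group_module k G x" and y: "group_module k G y"
begin

lemma syzygy_shift_closed:
  assumes "\<phi> \<in> stable_hom k G (syzygies k G n x) (syzygies k G n y)"
  shows "syzygy_shift k G x y n j \<phi> \<in> stable_hom k G (syzygies k G (n + j) x) (syzygies k G (n + j) y)"
proof (induction j)
  case (Suc j)
  then show ?case
    using Om.Fm_in_Hom[of "syzygies k G (n + j) x" "syzygies k G (n + j) y"]
      group_module_syzygies[OF x] group_module_syzygies[OF y] by simp
qed (use assms in simp)

lemma complete_rel_equiv: "equiv (complete_cochains k G x y) (complete_rel k G x y)"
proof (rule equivI)
  show "complete_rel k G x y \<subseteq> complete_cochains k G x y \<times> complete_cochains k G x y"
    by (auto simp: complete_rel_def)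
  show "refl_on (complete_cochains k G x y) (complete_rel k G x y)"
    by (auto simp: refl_on_def complete_rel_iff complete_cochains_def)
  show "sym (complete_rel k G x y)"
  proof (rule symI)
    fix a b assume ab: "(a, b) \<in> complete_rel k G x y"
    obtain n \<phi> m \<psi> where e: "a = (n, \<phi>)" "b = (m, \<psi>)"
      by (cases a; cases b) blast
    obtain i j where "n + i = m + j" "syzygy_shift k G x y n i \<phi> = syzygy_shift k G x y m j \<psi>"
      using ab unfolding e complete_rel_iff by blast
    then have "m + j = n + i" "syzygy_shift k G x y m j \<psi> = syzygy_shift k G x y n i \<phi>"
      by simp_all
    then show "(b, a) \<in> complete_rel k G x y"
      using ab unfolding e complete_rel_iff by blast
  qed
  show "trans (complete_rel k G x y)"
  proof (rule transI)
    fix a b c assume ab: "(a, b) \<in> complete_rel k G x y" and bc: "(b, c) \<in> complete_rel k G x y"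
    obtain n \<phi> m \<psi> l \<chi> where abc: "a = (n, \<phi>)" "b = (m, \<psi>)" "c = (l, \<chi>)"
      by (cases a; cases b; cases c) blast
    obtain i j where ij: "n + i = m + j" "syzygy_shift k G x y n i \<phi> = syzygy_shift k G x y m j \<psi>"
      using ab unfolding abc complete_rel_iff by blast
    obtain i' j' where ij': "m + i' = l + j'" "syzygy_shift k G x y m i' \<psi> = syzygy_shift k G x y l j' \<chi>"
      using bc unfolding abc complete_rel_iff by blast
    have "syzygy_shift k G x y n (i + i') \<phi> = syzygy_shift k G x y m (j + i') \<psi>"
      by (rule syzygy_shift_commute[OF ij])
    also have "\<dots> = syzygy_shift k G x y l (j' + j) \<chi>"
      using syzygy_shift_commute[OF ij', of j] by (simp add: add.commute)
    finally have "syzygy_shift k G x y n (i + i') \<phi> = syzygy_shift k G x y l (j' + j) \<chi>" .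
    moreover have "n + (i + i') = l + (j' + j)"
      using ij(1) ij'(1) by simp
    ultimately show "(a, c) \<in> complete_rel k G x y"
      using ab bc unfolding abc complete_rel_iff by blast
  qed
qed

end

definition complete_class :: "('k, 'u, 'g) gmodule \<Rightarrow> ('k, 'u, 'g) gmodule \<Rightarrow> nat \<Rightarrow> ('u \<Rightarrow> 'u) set
    \<Rightarrow> (nat \<times> ('u \<Rightarrow> 'u) set) set" where
  "complete_class x y n \<phi> = complete_rel k G x y `` {(n, \<phi>)}"

lemma complete_class_mem:
  fixes x y :: "('k, 'u, 'g) gmodule"
  shows
  "(m, \<psi>) \<in> complete_class x y n \<phi> \<longleftrightarrow>
     \<phi> \<in> stable_hom k G (syzygies k G n x) (syzygies k G n y) \<and>
     \<psi> \<in> stable_hom k G (syzygies k G m x) (syzygies k G m y) \<and>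
     (\<exists>i j. n + i = m + j \<and> syzygy_shift k G x y n i \<phi> = syzygy_shift k G x y m j \<psi>)"
  by (simp add: complete_class_def complete_rel_iff)

context
  fixes x y :: "('k, 'u, 'g) gmodule"
  assumes x: "group_module k G x" and y: "group_module k G y"
begin

lemma complete_class_eq_iff:
  assumes "\<phi> \<in> stable_hom k G (syzygies k G n x) (syzygies k G n y)"
    "\<psi> \<in> stable_hom k G (syzygies k G m x) (syzygies k G m y)"
  shows "complete_class x y n \<phi> = complete_class x y m \<psi> \<longleftrightarrow>
    (\<exists>i j. n + i = m + j \<and> syzygy_shift k G x y n i \<phi> = syzygy_shift k G x y m j \<psi>)"
proof -
  have "complete_class x y n \<phi> = complete_class x y m \<psi> \<longleftrightarrow> ((n, \<phi>), (m, \<psi>)) \<in> complete_rel k G x y"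
    unfolding complete_class_def
    by (rule eq_equiv_class_iff[OF complete_rel_equiv[OF x y]]) (use assms in \<open>auto simp: complete_cochains_def\<close>)
  then show ?thesis
    using assms by (simp add: complete_rel_iff)
qed

lemma complete_class_shift:
  assumes \<phi>: "\<phi> \<in> stable_hom k G (syzygies k G n x) (syzygies k G n y)"
  shows "complete_class x y (n + j) (syzygy_shift k G x y n j \<phi>) = complete_class x y n \<phi>"
  unfolding complete_class_eq_iff[OF syzygy_shift_closed[OF x y \<phi>] \<phi>]
  by (rule exI[of _ 0], rule exI[of _ j]) simp

lemma complete_Ext0_class:
  assumes "\<phi> \<in> stable_hom k G (syzygies k G n x) (syzygies k G n y)"
  shows "complete_class x y n \<phi> \<in> complete_Ext0 k G x y"
  using assms unfolding complete_Ext0_def complete_class_def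
  by (intro quotientI) (simp add: complete_cochains_def)

text \<open>Representatives are offered in all large degrees, so that finitely many classes can be
  put in one common degree.\<close>

lemma complete_Ext0E:
  assumes "a \<in> complete_Ext0 k G x y"
  obtains n where "\<And>N. n \<le> N \<Longrightarrow> \<exists>\<phi> \<in> stable_hom k G (syzygies k G N x) (syzygies k G N y). a = complete_class x y N \<phi>"
proof -
  obtain n \<phi> where \<phi>: "\<phi> \<in> stable_hom k G (syzygies k G n x) (syzygies k G n y)" "a = complete_class x y n \<phi>"
    using assms unfolding complete_Ext0_def complete_class_def quotient_def
    by (auto simp: complete_cochains_def)
  show ?thesis
  proof
    fix N assume "n \<le> N"
    then obtain j where j: "N = n + j" using le_Suc_ex by blast
    show "\<exists>\<phi> \<in> stable_hom k G (syzygies k G N x) (syzygies k G N y). a = complete_class x y N \<phi>"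
      unfolding j using syzygy_shift_closed[OF x y \<phi>(1), of j] complete_class_shift[OF \<phi>(1), of j] \<phi>(2) by metis
  qed
qed

end

lemma syzygy_shift_id:
  fixes x :: "('k, 'u, 'g) gmodule"
  assumes x: "group_module k G x"
  shows "syzygy_shift k G x x n j (stable_id k G (syzygies k G n x)) = stable_id k G (syzygies k G (n + j) x)"
proof (induction j)
  case (Suc j)
  then show ?case
    using Om.Fm_Ident[of "syzygies k G (n + j) x"] group_module_syzygies[OF x] by simp
qed simp

lemma stable_id_in_hom:
  fixes x :: "('k, 'u, 'g) gmodule"
  assumes "group_module k G x"
  shows "stable_id k G x \<in> stable_hom k G x x"
  using category.Ident_in_Hom[OF stable_category, of x] assms by simp

lemma stable_comp_in_hom:
  fixes x y z :: "('k, 'u, 'g) gmodule"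
  assumes "group_module k G x" "group_module k G y" "group_module k G z"
    "\<phi> \<in> stable_hom k G x y" "\<psi> \<in> stable_hom k G y z"
  shows "stable_comp k G x y z \<psi> \<phi> \<in> stable_hom k G x z"
  using category.Comp_in_Hom[OF stable_category, of x y z \<phi> \<psi>] assms by simp

context
  fixes x y z :: "('k, 'u, 'g) gmodule"
  assumes x: "group_module k G x" and y: "group_module k G y" and z: "group_module k G z"
begin

lemma syzygy_shift_comp:
  assumes "\<phi> \<in> stable_hom k G (syzygies k G n x) (syzygies k G n y)"
    "\<psi> \<in> stable_hom k G (syzygies k G n y) (syzygies k G n z)"
  shows "syzygy_shift k G x z n j (stable_comp k G (syzygies k G n x) (syzygies k G n y) (syzygies k G n z) \<psi> \<phi>)
    = stable_comp k G (syzygies k G (n + j) x) (syzygies k G (n + j) y) (syzygies k G (n + j) z)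
        (syzygy_shift k G y z n j \<psi>) (syzygy_shift k G x y n j \<phi>)"
proof (induction j)
  case (Suc j)
  then show ?case
    using Om.Fm_Comp[of "syzygies k G (n + j) x" "syzygies k G (n + j) y" "syzygies k G (n + j) z"
        "syzygy_shift k G x y n j \<phi>" "syzygy_shift k G y z n j \<psi>"]
      group_module_syzygies[OF x] group_module_syzygies[OF y] group_module_syzygies[OF z]
      syzygy_shift_closed[OF x y assms(1)] syzygy_shift_closed[OF y z assms(2)] by simp
qed simp

lemma complete_comp_class:
  assumes \<phi>: "\<phi> \<in> stable_hom k G (syzygies k G n x) (syzygies k G n y)"
    and \<psi>: "\<psi> \<in> stable_hom k G (syzygies k G n y) (syzygies k G n z)"
  shows "complete_comp k G x y z (complete_class y z n \<psi>) (complete_class x y n \<phi>)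
    = complete_class x z n (stable_comp k G (syzygies k G n x) (syzygies k G n y) (syzygies k G n z) \<psi> \<phi>)"
    (is "_ = ?C")
proof -
  let ?X = "\<lambda>n. syzygies k G n x" and ?Y = "\<lambda>n. syzygies k G n y" and ?Z = "\<lambda>n. syzygies k G n z"
  note gX = group_module_syzygies[OF x] and gY = group_module_syzygies[OF y] and gZ = group_module_syzygies[OF z]
  have "complete_class x z m (stable_comp k G (?X m) (?Y m) (?Z m) \<psi>' \<phi>') = ?C"
    if m: "(m, \<phi>') \<in> complete_class x y n \<phi>" "(m, \<psi>') \<in> complete_class y z n \<psi>" for m \<phi>' \<psi>'
  proof -
    obtain i j where \<phi>': "\<phi>' \<in> stable_hom k G (?X m) (?Y m)" and ij: "n + i = m + j"
      "syzygy_shift k G x y n i \<phi> = syzygy_shift k G x y m j \<phi>'"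
      using m(1) complete_class_mem by blast
    obtain i' j' where \<psi>': "\<psi>' \<in> stable_hom k G (?Y m) (?Z m)" and ij': "n + i' = m + j'"
      "syzygy_shift k G y z n i' \<psi> = syzygy_shift k G y z m j' \<psi>'"
      using m(2) complete_class_mem by blast
    \<comment> \<open>The two factors agree with their representatives after shifts of possibly
      different length; shifting further brings both comparisons to one degree.\<close>
    have J: "j' + i = j + i'" and N: "n + (i + i') = m + (j + i')" using ij(1) ij'(1) by simp_all
    have 1: "syzygy_shift k G x y n (i + i') \<phi> = syzygy_shift k G x y m (j + i') \<phi>'"
      by (rule syzygy_shift_commute[OF ij])
    have 2: "syzygy_shift k G y z n (i + i') \<psi> = syzygy_shift k G y z m (j + i') \<psi>'"
      using syzygy_shift_commute[OF ij', of i] J by (simp add: add.commute)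
    have "syzygy_shift k G x z m (j + i') (stable_comp k G (?X m) (?Y m) (?Z m) \<psi>' \<phi>')
        = syzygy_shift k G x z n (i + i') (stable_comp k G (?X n) (?Y n) (?Z n) \<psi> \<phi>)"
      by (simp only: syzygy_shift_comp[OF \<phi> \<psi>] syzygy_shift_comp[OF \<phi>' \<psi>'] 1 2 N)
    then show ?thesis
      using complete_class_eq_iff[OF x z stable_comp_in_hom[OF gX gY gZ \<phi>' \<psi>'] stable_comp_in_hom[OF gX gY gZ \<phi> \<psi>]] N
      by metis
  qed
  moreover have "(n, \<phi>) \<in> complete_class x y n \<phi>" "(n, \<psi>) \<in> complete_class y z n \<psi>"
    using complete_class_mem complete_class_mem \<phi> \<psi> by blast+
  ultimately have "{complete_rel k G x z `` {(n', stable_comp k G (?X n') (?Y n') (?Z n') \<psi>' \<phi>')} | n' \<phi>' \<psi>'.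
      (n', \<phi>') \<in> complete_class x y n \<phi> \<and> (n', \<psi>') \<in> complete_class y z n \<psi>} = {?C}"
    unfolding complete_class_def[of x z, symmetric] by blast
  then show ?thesis
    unfolding complete_comp_def by simp
qed

end

lemma Mazza_Symonds_simps [simp]:
  "Ob (Mazza_Symonds_StMod k G :: (('k, 'u, 'g) gmodule, (nat \<times> ('u \<Rightarrow> 'u) set) set) category_data) = {x. group_module k G x}"
  "Hom (Mazza_Symonds_StMod k G :: (('k, 'u, 'g) gmodule, (nat \<times> ('u \<Rightarrow> 'u) set) set) category_data) = complete_Ext0 k G"
  "Comp (Mazza_Symonds_StMod k G :: (('k, 'u, 'g) gmodule, (nat \<times> ('u \<Rightarrow> 'u) set) set) category_data) = complete_comp k G"
  "Ident (Mazza_Symonds_StMod k G :: (('k, 'u, 'g) gmodule, (nat \<times> ('u \<Rightarrow> 'u) set) set) category_data) x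
     = complete_class x x 0 (stable_id k G x)"
  by (simp_all add: Mazza_Symonds_StMod_def complete_class_def)

lemma complete_class_id:
  fixes x :: "('k, 'u, 'g) gmodule"
  assumes x: "group_module k G x"
  shows "complete_class x x n (stable_id k G (syzygies k G n x)) = complete_class x x 0 (stable_id k G x)"
  using complete_class_shift[OF x x, of "stable_id k G x" 0 n] syzygy_shift_id[OF x, of 0 n] stable_id_in_hom[OF x] by simp

lemma Mazza_Symonds_category:
  "category (Mazza_Symonds_StMod k G :: (('k, 'u, 'g) gmodule, (nat \<times> ('u \<Rightarrow> 'u) set) set) category_data)"
proof -
  let ?M = "Mazza_Symonds_StMod k G :: (('k, 'u, 'g) gmodule, (nat \<times> ('u \<Rightarrow> 'u) set) set) category_data"
  note gs = group_module_syzygies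
  show ?thesis
  proof
    fix x assume "x \<in> Ob ?M"
    then show "Ident ?M x \<in> Hom ?M x x"
      using complete_Ext0_class[of x x "stable_id k G x" 0] stable_id_in_hom[of x] by simp
  next
    fix x y z a b assume "x \<in> Ob ?M" "y \<in> Ob ?M" "z \<in> Ob ?M" and a: "a \<in> Hom ?M x y" and b: "b \<in> Hom ?M y z"
    then have x: "group_module k G x" and y: "group_module k G y" and z: "group_module k G z" by simp_all
    obtain n where n: "\<And>N. n \<le> N \<Longrightarrow> \<exists>\<phi> \<in> stable_hom k G (syzygies k G N x) (syzygies k G N y). a = complete_class x y N \<phi>"
      using complete_Ext0E[OF x y] a by auto
    obtain m where m: "\<And>N. m \<le> N \<Longrightarrow> \<exists>\<psi> \<in> stable_hom k G (syzygies k G N y) (syzygies k G N z). b = complete_class y z N \<psi>"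
      using complete_Ext0E[OF y z] b by auto
    obtain \<phi> \<psi> where "\<phi> \<in> stable_hom k G (syzygies k G (n + m) x) (syzygies k G (n + m) y)" "a = complete_class x y (n + m) \<phi>"
      "\<psi> \<in> stable_hom k G (syzygies k G (n + m) y) (syzygies k G (n + m) z)" "b = complete_class y z (n + m) \<psi>"
      using n[of "n + m"] m[of "n + m"] by auto
    then show "Comp ?M x y z b a \<in> Hom ?M x z"
      using complete_Ext0_class[OF x z stable_comp_in_hom[OF gs[OF x] gs[OF y] gs[OF z]]] complete_comp_class[OF x y z]
      by simp
  next
    fix x y a assume "x \<in> Ob ?M" "y \<in> Ob ?M" and a: "a \<in> Hom ?M x y"
    then have x: "group_module k G x" and y: "group_module k G y" by simp_all
    obtain n where n: "\<And>N. n \<le> N \<Longrightarrow> \<exists>\<phi> \<in> stable_hom k G (syzygies k G N x) (syzygies k G N y). a = complete_class x y N \<phi>"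
      using complete_Ext0E[OF x y] a by auto
    obtain \<phi> where \<phi>: "\<phi> \<in> stable_hom k G (syzygies k G n x) (syzygies k G n y)" "a = complete_class x y n \<phi>"
      using n[of n] by auto
    show "Comp ?M x x y a (Ident ?M x) = a"
      using complete_comp_class[OF x x y stable_id_in_hom[OF gs[OF x]] \<phi>(1)] complete_class_id[OF x, of n] \<phi>(2)
        Om.source.Comp_Ident[of "syzygies k G n x" "syzygies k G n y" \<phi>] \<phi>(1) gs[OF x] gs[OF y] by simp
    show "Comp ?M x y y (Ident ?M y) a = a"
      using complete_comp_class[OF x y y \<phi>(1) stable_id_in_hom[OF gs[OF y]]] complete_class_id[OF y, of n] \<phi>(2)
        Om.source.Ident_Comp[of "syzygies k G n x" "syzygies k G n y" \<phi>] \<phi>(1) gs[OF x] gs[OF y] by simp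
  next
    fix w x y z a b c assume "w \<in> Ob ?M" "x \<in> Ob ?M" "y \<in> Ob ?M" "z \<in> Ob ?M"
      and a: "a \<in> Hom ?M w x" and b: "b \<in> Hom ?M x y" and c: "c \<in> Hom ?M y z"
    then have w: "group_module k G w" and x: "group_module k G x" and y: "group_module k G y" and z: "group_module k G z"
      by simp_all
    let ?N = "\<lambda>n. syzygies k G n"
    obtain n where n: "\<And>N. n \<le> N \<Longrightarrow> \<exists>\<phi> \<in> stable_hom k G (?N N w) (?N N x). a = complete_class w x N \<phi>"
      using complete_Ext0E[OF w x] a by auto
    obtain m where m: "\<And>N. m \<le> N \<Longrightarrow> \<exists>\<phi> \<in> stable_hom k G (?N N x) (?N N y). b = complete_class x y N \<phi>"
      using complete_Ext0E[OF x y] b by auto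
    obtain l where l: "\<And>N. l \<le> N \<Longrightarrow> \<exists>\<phi> \<in> stable_hom k G (?N N y) (?N N z). c = complete_class y z N \<phi>"
      using complete_Ext0E[OF y z] c by auto
    define N where "N = n + m + l"
    obtain \<phi> \<psi> \<chi> where \<phi>: "\<phi> \<in> stable_hom k G (?N N w) (?N N x)" "a = complete_class w x N \<phi>"
      and \<psi>: "\<psi> \<in> stable_hom k G (?N N x) (?N N y)" "b = complete_class x y N \<psi>"
      and \<chi>: "\<chi> \<in> stable_hom k G (?N N y) (?N N z)" "c = complete_class y z N \<chi>"
      using n[of N] m[of N] l[of N] by (auto simp: N_def)
    note gw = gs[OF w, of N] and gx = gs[OF x, of N] and gy = gs[OF y, of N] and gz = gs[OF z, of N]
    show "Comp ?M w y z c (Comp ?M w x y b a) = Comp ?M w x z (Comp ?M x y z c b) a"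
      using Om.source.Comp_assoc[of "?N N w" "?N N x" "?N N y" "?N N z" \<phi> \<psi> \<chi>] \<phi>(1) \<psi>(1) \<chi>(1) gw gx gy gz
      by (simp add: \<phi>(2) \<psi>(2) \<chi>(2) complete_comp_class[OF w x y \<phi>(1) \<psi>(1)] complete_comp_class[OF x y z \<psi>(1) \<chi>(1)]
          complete_comp_class[OF w y z stable_comp_in_hom[OF gw gx gy \<phi>(1) \<psi>(1)] \<chi>(1)]
          complete_comp_class[OF w x z \<phi>(1) stable_comp_in_hom[OF gx gy gz \<psi>(1) \<chi>(1)]])
  qed
qed

text \<open>Morphisms in the limit may be represented in degree \<open>n\<close>, so an isomorphism
  between n-th syzygies is enough.\<close>

lemma Mazza_Symonds_isomorphism:
  fixes x y :: "('k, 'u, 'g) gmodule"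
  assumes x: "group_module k G x" and y: "group_module k G y"
    and iso: "isomorphism_in (stable_category k G) (syzygies k G n x) (syzygies k G n y) \<phi>"
  shows "isomorphism_in (Mazza_Symonds_StMod k G) x y (complete_class x y n \<phi>)"
proof -
  obtain \<psi> where \<phi>: "\<phi> \<in> stable_hom k G (syzygies k G n x) (syzygies k G n y)"
    and \<psi>: "\<psi> \<in> stable_hom k G (syzygies k G n y) (syzygies k G n x)"
    and eq: "stable_comp k G (syzygies k G n x) (syzygies k G n y) (syzygies k G n x) \<psi> \<phi> = stable_id k G (syzygies k G n x)"
      "stable_comp k G (syzygies k G n y) (syzygies k G n x) (syzygies k G n y) \<phi> \<psi> = stable_id k G (syzygies k G n y)"
    using iso by (auto simp: isomorphism_in_def)
  show ?thesis
    by (rule isomorphism_inI[of _ _ _ _ "complete_class y x n \<psi>"])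
       (simp_all add: complete_Ext0_class[OF x y \<phi>] complete_Ext0_class[OF y x \<psi>] complete_comp_class[OF x y x \<phi> \<psi>]
         complete_comp_class[OF y x y \<psi> \<phi>] eq complete_class_id[OF x] complete_class_id[OF y])
qed

lemma syzygy_shift_bij:
  fixes x y :: "('k, 'u, 'g) gmodule"
  assumes cx: "cofibrant k G x" and y: "group_module k G y"
  shows "bij_betw (syzygy_shift k G x y n j) (stable_hom k G (syzygies k G n x) (syzygies k G n y))
    (stable_hom k G (syzygies k G (n + j) x) (syzygies k G (n + j) y))"
proof (induction j)
  case 0
  show ?case by (auto simp: bij_betw_def inj_on_def)
next
  case (Suc j)
  show ?case
    using bij_betw_trans[OF Suc syzygy_map_bij[OF cofibrant_syzygies[OF cx, of "n + j"] group_module_syzygies[OF y, of "n + j"]]]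
    by (simp add: o_def)
qed

text \<open>For a cofibrant source all transition maps are bijective, so the direct limit is its
  term in degree zero. This is full faithfulness of the inclusion of \<open>PCof\<close>.\<close>

lemma complete_class_bij:
  fixes x y :: "('k, 'u, 'g) gmodule"
  assumes cx: "cofibrant k G x" and y: "group_module k G y"
  shows "bij_betw (complete_class x y 0) (stable_hom k G x y) (complete_Ext0 k G x y)"
proof -
  note x = cofibrant_group_module[OF cx]
  have b: "bij_betw (syzygy_shift k G x y 0 n) (stable_hom k G x y) (stable_hom k G (syzygies k G n x) (syzygies k G n y))" for n
    using syzygy_shift_bij[OF cx y, of 0 n] by simp
  have "inj_on (complete_class x y 0) (stable_hom k G x y)"
  proof (rule inj_onI)
    fix \<phi> \<psi> assume "\<phi> \<in> stable_hom k G x y" "\<psi> \<in> stable_hom k G x y" "complete_class x y 0 \<phi> = complete_class x y 0 \<psi>"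
    then show "\<phi> = \<psi>"
      using complete_class_eq_iff[OF x y, of \<phi> 0 \<psi> 0] b by (auto simp: bij_betw_def dest: inj_onD)
  qed
  moreover have "a \<in> complete_class x y 0 ` stable_hom k G x y" if a: "a \<in> complete_Ext0 k G x y" for a
  proof -
    obtain n where "\<And>N. n \<le> N \<Longrightarrow> \<exists>\<phi> \<in> stable_hom k G (syzygies k G N x) (syzygies k G N y). a = complete_class x y N \<phi>"
      using complete_Ext0E[OF x y a] by blast
    then obtain \<phi> where \<phi>: "\<phi> \<in> stable_hom k G (syzygies k G n x) (syzygies k G n y)" "a = complete_class x y n \<phi>"
      by blast
    then obtain \<psi> where \<psi>: "\<psi> \<in> stable_hom k G x y" "\<phi> = syzygy_shift k G x y 0 n \<psi>"
      using b[of n] by (auto simp: bij_betw_def)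
    then have "a = complete_class x y 0 \<psi>"
      using complete_class_shift[OF x y, of \<psi> 0 n] \<phi>(2) by simp
    then show ?thesis using \<psi>(1) by blast
  qed
  moreover have "complete_class x y 0 \<phi> \<in> complete_Ext0 k G x y" if "\<phi> \<in> stable_hom k G x y" for \<phi>
    using complete_Ext0_class[OF x y, of \<phi> 0] that by simp
  ultimately show ?thesis
    unfolding bij_betw_def by blast
qed

end

section \<open>Comparison of the two stable categories\<close>

context phi_universe begin

lemma proper_StMod_simps [simp]:
  "Ob (proper_StMod k G :: (('k, 'u, 'g) gmodule, ('u \<Rightarrow> 'u) set) category_data) = {x. cofibrant k G x}"
  "Hom (proper_StMod k G :: (('k, 'u, 'g) gmodule, ('u \<Rightarrow> 'u) set) category_data) = stable_hom k G"
  "Comp (proper_StMod k G :: (('k, 'u, 'g) gmodule, ('u \<Rightarrow> 'u) set) category_data) = stable_comp k G"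
  "Ident (proper_StMod k G :: (('k, 'u, 'g) gmodule, ('u \<Rightarrow> 'u) set) category_data) = stable_id k G"
  using PCof_iff by (auto simp: proper_StMod_def)

lemma proper_StMod_category: "category (proper_StMod k G :: (('k, 'u, 'g) gmodule, ('u \<Rightarrow> 'u) set) category_data)"
proof -
  interpret S: category "stable_category k G :: (('k, 'u, 'g) gmodule, ('u \<Rightarrow> 'u) set) category_data"
    by (rule stable_category)
  have g: "x \<in> Ob (stable_category k G)" if "cofibrant k G x" for x :: "('k, 'u, 'g) gmodule"
    using cofibrant_group_module[OF that] by simp
  show ?thesis
    by unfold_locales
       (use g S.Ident_in_Hom S.Comp_in_Hom S.Comp_Ident S.Ident_Comp S.Comp_assoc in \<open>simp_all add: cofibrant_group_module\<close>)
qed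

text \<open>The cokernel given by \<open>cofibrant_cosyzygy\<close> is cofibrant again, so the
  construction can be iterated; each step is undone by one syzygy up to stable isomorphism.\<close>

lemma iterated_cosyzygy:
  fixes x :: "('k, 'u, 'g) gmodule"
  assumes "cofibrant k G x"
  shows "\<exists>y :: ('k, 'u, 'g) gmodule. \<exists>\<phi>. cofibrant k G y \<and> isomorphism_in (stable_category k G) (syzygies k G n y) x \<phi>"
  using assms
proof (induction n arbitrary: x)
  case 0
  note x = cofibrant_group_module[OF 0]
  have c: "compose (carrier x) (\<lambda>v \<in> carrier x. v) (\<lambda>v \<in> carrier x. v) = (\<lambda>v \<in> carrier x. v)"
    by (auto simp: compose_def)
  have "isomorphism_in (stable_category k G) x x (stable_class k G x x (\<lambda>v \<in> carrier x. v))"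
    by (rule stable_isomorphismI[OF x x gmaps_id[OF x] gmaps_id[OF x]])
       (simp_all add: c stably_equal_refl[OF x x gmaps_id[OF x]])
  then show ?case
    using 0 by auto
next
  case (Suc n)
  note x = cofibrant_group_module[OF Suc.prems]
  interpret S: category "stable_category k G :: (('k, 'u, 'g) gmodule, ('u \<Rightarrow> 'u) set) category_data"
    by (rule stable_category)
  interpret Om: category_functor "stable_category k G" "stable_category k G :: (('k, 'u, 'g) gmodule, ('u \<Rightarrow> 'u) set) category_data"
    "syzygy k G" "syzygy_map k G"
    by (rule syzygy_functor)
  obtain p c :: "('k, 'u, 'g) gmodule" and e a b where p: "projective_module k G p" and c: "cofibrant k G c"
    and e: "e \<in> epis k G p c" and a: "a \<in> gmaps k G x (ker_module p c e)" and b: "b \<in> gmaps k G (ker_module p c e) x"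
    and ba: "\<And>v. v \<in> carrier x \<Longrightarrow> b (a v) = v" and ab: "\<And>v. v \<in> carrier (ker_module p c e) \<Longrightarrow> a (b v) = v"
    using cofibrant_cosyzygy[OF Suc.prems finite_pd_bounded] by blast
  note gc = cofibrant_group_module[OF c]
  let ?K = "ker_module p c e"
  note gK = group_module_ker[OF projective_group_module[OF p] gc epis_gmaps[OF e]]
  obtain y :: "('k, 'u, 'g) gmodule" and \<phi> where y: "cofibrant k G y"
    and \<phi>: "isomorphism_in (stable_category k G) (syzygies k G n y) c \<phi>"
    using Suc.IH[OF c] by blast
  note gy = cofibrant_group_module[OF y]
  note gn = group_module_syzygies[OF gy, of n]
  have 1: "isomorphism_in (stable_category k G) (syzygy k G (syzygies k G n y)) (syzygy k G c)
      (syzygy_map k G (syzygies k G n y) c \<phi>)"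
    by (rule Om.isomorphism_in_image) (use gn gc \<phi> in simp_all)
  obtain \<psi> where 2: "isomorphism_in (stable_category k G) (syzygy k G c) ?K \<psi>"
    using ker_stable_isomorphism[OF gc cover_projective[OF gc] cover_epi[OF gc] p e] unfolding syzygy_def by blast
  have "compose (carrier ?K) a b = (\<lambda>v \<in> carrier ?K. v)" "compose (carrier x) b a = (\<lambda>v \<in> carrier x. v)"
    using ab ba by (auto simp: compose_def fun_eq_iff)
  then have 3: "isomorphism_in (stable_category k G) ?K x (stable_class k G ?K x b)"
    by (intro stable_isomorphismI[OF gK x b a])
       (simp_all add: stably_equal_refl[OF x x gmaps_id[OF x]] stably_equal_refl[OF gK gK gmaps_id[OF gK], simplified])
  note gs = group_module_syzygy[OF gn] and gsc = group_module_syzygy[OF gc]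
  \<comment> \<open>The composite of \<Omega> of the inductive isomorphism, the stable comparison of
    two kernels over \<open>c\<close>, and the identification of the kernel with
    \<open>x\<close>.\<close>
  have "isomorphism_in (stable_category k G) (syzygy k G (syzygies k G n y)) x
      (Comp (stable_category k G) (syzygy k G (syzygies k G n y)) ?K x (stable_class k G ?K x b)
        (Comp (stable_category k G) (syzygy k G (syzygies k G n y)) (syzygy k G c) ?K \<psi> (syzygy_map k G (syzygies k G n y) c \<phi>)))"
    by (rule S.isomorphism_in_comp[OF _ _ _ S.isomorphism_in_comp[OF _ _ _ 1 2] 3]) (use gs gsc gK x in simp_all)
  then show ?case
    using y by auto
qed

lemma Mazza_Symonds_equivalent_proper:
  "equivalent_categories
     (Mazza_Symonds_StMod k G :: (('k, 'u, 'g) gmodule, (nat \<times> ('u \<Rightarrow> 'u) set) set) category_data)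
     (proper_StMod k G :: (('k, 'u, 'g) gmodule, ('u \<Rightarrow> 'u) set) category_data)"
proof (rule equivalent_categoriesI)
  let ?M = "Mazza_Symonds_StMod k G :: (('k, 'u, 'g) gmodule, (nat \<times> ('u \<Rightarrow> 'u) set) set) category_data"
  let ?P = "proper_StMod k G :: (('k, 'u, 'g) gmodule, ('u \<Rightarrow> 'u) set) category_data"
  show "category_functor ?P ?M (\<lambda>x. x) (\<lambda>x y. complete_class x y 0)"
  proof (rule category_functor.intro[OF proper_StMod_category Mazza_Symonds_category], unfold_locales)
    fix x y z \<phi> \<psi>
    assume *: "x \<in> Ob ?P" "y \<in> Ob ?P" "z \<in> Ob ?P" "\<phi> \<in> Hom ?P x y" "\<psi> \<in> Hom ?P y z"
    then have "group_module k G x" "group_module k G y" "group_module k G z"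
      by (simp_all add: cofibrant_group_module)
    then show "complete_class x z 0 (Comp ?P x y z \<psi> \<phi>) = Comp ?M x y z (complete_class y z 0 \<psi>) (complete_class x y 0 \<phi>)"
      using complete_comp_class[of x y z \<phi> 0 \<psi>] * by simp
  next
    fix x y \<phi> assume "x \<in> Ob ?P" "y \<in> Ob ?P" "\<phi> \<in> Hom ?P x y"
    then show "complete_class x y 0 \<phi> \<in> Hom ?M x y"
      using complete_Ext0_class[of x y \<phi> 0] by (simp add: cofibrant_group_module)
  qed (simp_all add: cofibrant_group_module)
  show "bij_betw (complete_class x y 0) (Hom ?P x y) (Hom ?M x y)" if "x \<in> Ob ?P" "y \<in> Ob ?P" for x y
    using complete_class_bij[of x y] that by (simp add: cofibrant_group_module)
  show "\<exists>y \<in> Ob ?P. \<exists>f. isomorphism_in ?M x y f" if "x \<in> Ob ?M" for x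
  proof -
    have x: "group_module k G x" using that by simp
    \<comment> \<open>The same \<open>n\<close> takes \<open>x\<close> down to a cofibrant syzygy
      and that syzygy back up to \<open>y\<close>.\<close>
    obtain n where n: "pd_le k G n (bounded G x)"
      using finite_pd_bounded[OF x] by (auto simp: finite_pd_def)
    obtain y :: "('k, 'u, 'g) gmodule" and \<phi> where y: "cofibrant k G y"
      and iso: "isomorphism_in (stable_category k G) (syzygies k G n y) (syzygies k G n x) \<phi>"
      using iterated_cosyzygy[OF cofibrant_syzygies_finite_pd[OF x n], of n] by blast
    obtain \<psi> where "isomorphism_in (stable_category k G) (syzygies k G n x) (syzygies k G n y) \<psi>"
      by (rule isomorphism_in_inverse[OF iso])
    then show ?thesis
      using Mazza_Symonds_isomorphism[OF x cofibrant_group_module[OF y]] y by auto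
  qed
qed

end

theorem corollary7p17:
  fixes k :: "'k ring" and G :: "'g monoid"
  assumes "admissible_universe TYPE('u) k G"
    and "cring k" and "group G"
    and "finite_global_dimension TYPE('u) k"
    and "type_Phi TYPE('u) k G"
  shows "equivalent_categories
           (Mazza_Symonds_StMod k G :: (('k, 'u, 'g) gmodule, (nat \<times> ('u \<Rightarrow> 'u) set) set) category_data)
           (proper_StMod k G :: (('k, 'u, 'g) gmodule, ('u \<Rightarrow> 'u) set) category_data)"
proof -
  interpret phi_universe k G "TYPE('u)"
    by (intro phi_universe.intro group_universe.intro phi_universe_axioms.intro assms)
  show ?thesis
    by (rule Mazza_Symonds_equivalent_proper)
qed

end
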